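(* Let $S$ be a Damek--Ricci space with parameters $m,k$, dimension $n=m+k+1$ and $Q=\frac m2+k$. The dual Abel transform $\mathcal{A}^*$ is a topological isomorphism between $C^\infty(\mathbb{R})_{\mathrm{even}}$ and $C^\infty(S)^\sharp\equiv C^\infty(\mathbb{R})_{\mathrm{even}}$. Explicitly, for $f\in C^\infty(\mathbb{R})_{\mathrm{even}}$ and $r>0$, $$\mathcal{A}^*f(r)=\tfrac{c_2}2\bigl(\sinh\tfrac r2\bigr)^{-m}(\sinh r)^{-(k-1)}\;\mathcal{R}^{1}_{k/2}\Bigl\{\bigl(\cosh\tfrac{\cdot}2\bigr)^{-1}\,\mathcal{R}^{1/2}_{m/2}\bigl[\bigl(\sinh\tfrac{\cdot}2\bigr)^{-1}f\bigr]\Bigr\}(r)$$ and $$(\mathcal{A}^* )^{-1}f(r)=\tfrac1{c_2}\,\tfrac d{dr}\bigl(\mathcal{R}^{1/2}_{-m/2}\circ\mathcal{R}^{1}_{-k/2+1}\bigr)\Bigl\{\bigl(\sinh\tfrac{\cdot}2\bigr)^{m}(\sinh\cdot)^{k-1}f\Bigr\}(r),$$ where $$c_2=\frac{2^{\frac{n-1}2}\,\Gamma(\frac n2)}{\sqrt\pi}=\frac{(n-1)!}{2^{\frac{n-1}2}\,\Gamma(\frac{n+1}2)}.$$ More precisely, $$(\mathcal{A}^* )^{-1}f(r)=\tfrac1{c_2}\,\tfrac d{dr}\Bigl(\tfrac d{d(\cosh\frac r2)}\Bigr)^{\frac m2}\Bigl(\tfrac d{d(\cosh r)}\Bigr)^{\frac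 k2-1}\Bigl\{\bigl(\sinh\tfrac r2\bigr)^m(\sinh r)^{k-1}f(r)\Bigr\}$$ if $n$ is odd, i.e. $k$ is even, and $$(\mathcal{A}^* )^{-1}f(r)=\tfrac1{c_2\sqrt\pi}\,\tfrac d{dr}\Bigl(\tfrac d{d(\cosh\frac r2)}\Bigr)^{\frac m2}\Bigl(\tfrac d{d(\cosh r)}\Bigr)^{\frac{k-1}2}\int_0^r\frac{\bigl(\sinh\frac s2\bigr)^m(\sinh s)^k f(s)}{\sqrt{\cosh r-\cosh s}}\,ds$$ if $n$ is even, i.e. $k$ is odd.
   Context: Damek--Ricci space: let $m\ge0$ be an even integer and $k\ge1$ an integer, and let $[\cdot,\cdot]:\mathbb{R}^m\times\mathbb{R}^m\to\mathbb{R}^k$ be a skew-symmetric bilinear map of Heisenberg type, i.e. for every $Y\in\mathbb{R}^k$ the endomorphism $J_Y$ of $\mathbb{R}^m$ defined by $\langle J_YX,X'\rangle=\langle Y,[X,X']\rangle$ satisfies $J_Y^2=-|Y|^2\,\mathrm{Id}$ (the degenerate case $m=0$ gives real hyperbolic space). $S=\mathbb{R}^m\times\mathbb{R}^k\times\mathbb{R}$ is the Lie group with multiplication $$(X,Y,z)\cdot(X',Y',z')=\bigl(X+e^{z/2}X',\;Y+e^{z}Y'+\tfrac12e^{z/2}[X,X'],\;z+z'\bigr),$$ identity $e=(0,0,0)$, equipped with the left-invariant Riemannian metric which at $e$ is the standard Euclidean inner product $\langle X,X'\rangle+\langle Y,Y'\rangle+zz'$. Radial functions: $C^\infty(S)^\sharp$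 is the space of smooth functions on $S$ depending only on the Riemannian distance $r=d(x,e)$; it is identified with the space $C^\infty(\mathbb{R})_{\mathrm{even}}$ of smooth even functions on $\mathbb{R}$ via $f(x)=f(d(x,e))$. Both carry their usual Fréchet topologies. For $F\in C^\infty(S)$, $F^\sharp(r)=\frac1{\delta(r)}\int_{S(e,r)}F(x)\,dx$ is the mean of $F$ over the geodesic sphere $S(e,r)$ for the Riemannian surface measure, of total mass $\delta(r)=2^{m+1}\pi^{n/2}\Gamma(\frac n2)^{-1}(\sinh\frac r2)^m(\sinh r)^k$. Dual Abel transform: for $f\in C^\infty(\mathbb{R})_{\mathrm{even}}$, $\mathcal{A}^*f(r)=(\widetilde f\,)^\sharp(r)$, where $\widetilde f(X,Y,z)=e^{\frac Q2z}f(z)$. Riemann--Liouville transforms: for $\tau>0$, $\mu\in\mathbb{C}$ and $M\in\mathbb{N}=\{0,1,\dots\}$ with $\operatorname{Re}\mu>-M$, $$\mathcal{R}^\tau_\mu f(r)=\tfrac1{\Gamma(\mu+M)}\int_0^r d(\cosh\tau s)\,(\cosh\tau r-\cosh\tau s)^{\mu+M-1}\Bigl(\tfrac d{d(\cosh\tau s)}\Bigr)^Mf(s),$$ where $d(\cosh\tau s)=\tau\sinh(\tau s)\,ds$ and $\frac d{d(\cosh\tau s)}=\frac1{\tau\sinh\tau s}\frac d{ds}$. Here $M$ is taken to be the smallest admissible integer, and $\mathcal{R}^\tau_0$ is the identity. *)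

theory Defs
  imports "HOL-Analysis.Analysis"
begin

fun iter_deriv :: "'a::real_normed_vector list \<Rightarrow> ('a \<Rightarrow> 'b::real_normed_vector) \<Rightarrow> 'a \<Rightarrow> 'b" where
  "iter_deriv [] f = f"
| "iter_deriv (v # vs) f = (\<lambda>x. frechet_derivative (iter_deriv vs f) (at x) v)"

text \<open>Only meant for open sets: all iterated directional derivatives exist and are
  (Frechet) differentiable, hence continuous, at every point of the set.\<close>

definition smooth_on :: "'a::real_normed_vector set \<Rightarrow> ('a \<Rightarrow> 'b::real_normed_vector) \<Rightarrow> bool" where
  "smooth_on U f \<longleftrightarrow> (\<forall>vs. \<forall>x\<in>U. iter_deriv vs f differentiable (at x))"

definition smooth_nbhd ::
    "('a::euclidean_space \<Rightarrow> complex) \<Rightarrow> 'a set \<Rightarrow> nat \<Rightarrow> real \<Rightarrow> ('a \<Rightarrow> complex) set" where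
  "smooth_nbhd f K N \<epsilon> =
     {g. smooth_on UNIV g \<and>
         (\<forall>bs. set bs \<subseteq> Basis \<and> length bs \<le> N \<longrightarrow>
            (\<forall>x\<in>K. norm (iter_deriv bs g x - iter_deriv bs f x) < \<epsilon>))}"

text \<open>Uniform convergence on compact sets of all partial derivatives.\<close>

definition smooth_topology :: "('a::euclidean_space \<Rightarrow> complex) topology" where
  "smooth_topology = topology_generated_by
     {smooth_nbhd f K N \<epsilon> | f K N \<epsilon>. smooth_on UNIV f \<and> compact K \<and> 0 < \<epsilon>}"

definition even_smooth :: "(real \<Rightarrow> complex) set" where
  "even_smooth = {f. smooth_on UNIV f \<and> (\<forall>x. f (- x) = f x)}"

definition topological_isomorphism ::
    "('a \<Rightarrow> complex) topology \<Rightarrow> ('b \<Rightarrow> complex) topology \<Rightarrow>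
     (('a \<Rightarrow> complex) \<Rightarrow> ('b \<Rightarrow> complex)) \<Rightarrow> bool" where
  "topological_isomorphism X Y T \<longleftrightarrow>
     homeomorphic_map X Y T \<and>
     (\<forall>f\<in>topspace X. \<forall>g\<in>topspace X. T (\<lambda>x. f x + g x) = (\<lambda>y. T f y + T g y)) \<and>
     (\<forall>c. \<forall>f\<in>topspace X. T (\<lambda>x. c * f x) = (\<lambda>y. c * T f y))"

text \<open>A Riemannian metric on a vector space \<open>'s\<close> is given as a function \<open>g\<close>, where \<open>g p u w\<close> is
  the inner product at the point \<open>p\<close> of the tangent vectors \<open>u\<close> and \<open>w\<close>.\<close>

definition curve_length ::
    "('s::real_normed_vector \<Rightarrow> 's \<Rightarrow> 's \<Rightarrow> real) \<Rightarrow> (real \<Rightarrow> 's) \<Rightarrow> real" where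
  "curve_length g \<gamma> = integral {0..1}
     (\<lambda>t. sqrt (g (\<gamma> t) (vector_derivative \<gamma> (at t)) (vector_derivative \<gamma> (at t))))"

text \<open>The library's piecewise C1 curves may have non-integrable speed at a break point, for which
  \<open>integral\<close> would return \<open>0\<close>; hence C1 curves, which give the same infimum.\<close>

definition riemannian_dist ::
    "('s::real_normed_vector \<Rightarrow> 's \<Rightarrow> 's \<Rightarrow> real) \<Rightarrow> 's \<Rightarrow> 's \<Rightarrow> real" where
  "riemannian_dist g p q =
     Inf {curve_length g \<gamma> | \<gamma>. \<gamma> C1_differentiable_on {0..1} \<and> \<gamma> 0 = p \<and> \<gamma> 1 = q}"

definition local_param ::
    "'s::real_normed_vector set \<Rightarrow> (real^'i) set \<Rightarrow> (real^'i \<Rightarrow> 's) \<Rightarrow> bool" where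
  "local_param \<Sigma> U \<phi> \<longleftrightarrow>
     open U \<and> \<phi> ` U \<subseteq> \<Sigma> \<and> openin (top_of_set \<Sigma>) (\<phi> ` U) \<and>
     (\<exists>\<psi>. homeomorphism U (\<phi> ` U) \<phi> \<psi>) \<and>
     smooth_on U \<phi> \<and> (\<forall>u\<in>U. inj (frechet_derivative \<phi> (at u)))"

definition gram_matrix ::
    "('s::real_normed_vector \<Rightarrow> 's \<Rightarrow> 's \<Rightarrow> real) \<Rightarrow> (real^'i \<Rightarrow> 's) \<Rightarrow> real^'i \<Rightarrow> real^'i^'i" where
  "gram_matrix g \<phi> u =
     (\<chi> a b. g (\<phi> u) (frechet_derivative \<phi> (at u) (axis a 1)) (frechet_derivative \<phi> (at u) (axis b 1)))"

text \<open>The ambient space is \<open>real^'i \<times> real\<close>, so that hypersurfaces are parametrised by open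
  subsets of \<open>real^'i\<close>.  For an embedded hypersurface there is exactly one such measure.\<close>

definition is_surface_measure ::
    "((real^'i) \<times> real \<Rightarrow> (real^'i) \<times> real \<Rightarrow> (real^'i) \<times> real \<Rightarrow> real) \<Rightarrow>
     ((real^'i) \<times> real) set \<Rightarrow> ((real^'i) \<times> real) measure \<Rightarrow> bool" where
  "is_surface_measure g \<Sigma> \<mu> \<longleftrightarrow>
     sets \<mu> = sets borel \<and> emeasure \<mu> (- \<Sigma>) = 0 \<and>
     (\<forall>U (\<phi> :: real^'i \<Rightarrow> (real^'i) \<times> real) A.
        local_param \<Sigma> U \<phi> \<and> A \<in> sets borel \<and> A \<subseteq> U \<longrightarrow>
        emeasure \<mu> (\<phi> ` A) = (\<integral>\<^sup>+ u\<in>A. ennreal (sqrt (det (gram_matrix g \<phi> u))) \<partial>lborel))"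

definition surface_measure ::
    "((real^'i) \<times> real \<Rightarrow> (real^'i) \<times> real \<Rightarrow> (real^'i) \<times> real \<Rightarrow> real) \<Rightarrow>
     ((real^'i) \<times> real) set \<Rightarrow> ((real^'i) \<times> real) measure" where
  "surface_measure g \<Sigma> = (THE \<mu>. is_surface_measure g \<Sigma> \<mu>)"

text \<open>Since the case \<open>m = 0\<close> has to be included and every type \<open>real^'m\<close> has positive dimension,
  the product of the Euclidean spaces of dimensions \<open>m \<ge> 0\<close> and \<open>k \<ge> 1\<close> is encoded as a single
  space \<open>real^'i\<close> with \<open>CARD('i) = m + k\<close>, together with the set \<open>I\<close> of those \<open>m\<close> indices that
  are coordinates of the first factor; the \<open>k\<close> indices outside \<open>I\<close> are coordinates of the second
  factor.  So a vector of the first factor is one supported on \<open>I\<close>, a vector of the second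
  factor is one supported on \<open>- I\<close>, a pair \<open>(X, Y)\<close> is written \<open>X + Y\<close>, and the inner product
  of \<open>real^'i\<close> is the sum of the two standard ones.  A point \<open>(X, Y, z)\<close> of the group is
  \<open>(X + Y, z)\<close>, of type \<open>real^'i \<times> real\<close>, and the identity is \<open>0\<close>.\<close>

definition supported :: "'i::finite set \<Rightarrow> (real^'i) set" where
  "supported I = {w. \<forall>i. i \<notin> I \<longrightarrow> w $ i = 0}"

definition restr :: "'i::finite set \<Rightarrow> real^'i \<Rightarrow> real^'i" where
  "restr I w = (\<chi> i. if i \<in> I then w $ i else 0)"

text \<open>Only the values of the bracket on \<open>supported I\<close> are ever used.  A bilinear map on
  \<open>supported I\<close> always extends to a bilinear map on \<open>real^'i\<close>, so taking the bracket
  to be defined everywhere is no restriction.\<close>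

definition heisenberg_type :: "'i::finite set \<Rightarrow> (real^'i \<Rightarrow> real^'i \<Rightarrow> real^'i) \<Rightarrow> bool" where
  "heisenberg_type I br \<longleftrightarrow>
     bilinear br \<and>
     (\<forall>X\<in>supported I. \<forall>X'\<in>supported I. br X X' \<in> supported (- I) \<and> br X' X = - br X X') \<and>
     (\<forall>Y\<in>supported (- I). \<exists>J. linear J \<and> J ` supported I \<subseteq> supported I \<and>
        (\<forall>X\<in>supported I. \<forall>X'\<in>supported I. J X \<bullet> X' = Y \<bullet> br X X') \<and>
        (\<forall>X\<in>supported I. J (J X) = - ((norm Y)\<^sup>2 *\<^sub>R X)))"

definition dr_mult ::
    "'i::finite set \<Rightarrow> (real^'i \<Rightarrow> real^'i \<Rightarrow> real^'i) \<Rightarrow>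
     (real^'i) \<times> real \<Rightarrow> (real^'i) \<times> real \<Rightarrow> (real^'i) \<times> real" where
  "dr_mult I br p q =
     (let X = restr I (fst p); Y = restr (- I) (fst p); z = snd p;
          X' = restr I (fst q); Y' = restr (- I) (fst q); z' = snd q
      in ((X + exp (z / 2) *\<^sub>R X') + (Y + exp z *\<^sub>R Y' + (1 / 2 * exp (z / 2)) *\<^sub>R br X X'), z + z'))"

text \<open>Left-invariant metric: the differential at the identity of left translation by \<open>p\<close> is an
  isometry onto the tangent space at \<open>p\<close>.\<close>

definition dr_metric ::
    "'i::finite set \<Rightarrow> (real^'i \<Rightarrow> real^'i \<Rightarrow> real^'i) \<Rightarrow>
     (real^'i) \<times> real \<Rightarrow> (real^'i) \<times> real \<Rightarrow> (real^'i) \<times> real \<Rightarrow> real" where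
  "dr_metric I br p u w =
     (let D = frechet_derivative (dr_mult I br p) (at 0) in inv D u \<bullet> inv D w)"

definition dr_dist ::
    "'i::finite set \<Rightarrow> (real^'i \<Rightarrow> real^'i \<Rightarrow> real^'i) \<Rightarrow>
     (real^'i) \<times> real \<Rightarrow> (real^'i) \<times> real \<Rightarrow> real" where
  "dr_dist I br = riemannian_dist (dr_metric I br)"

definition dr_sphere ::
    "'i::finite set \<Rightarrow> (real^'i \<Rightarrow> real^'i \<Rightarrow> real^'i) \<Rightarrow> real \<Rightarrow> ((real^'i) \<times> real) set" where
  "dr_sphere I br r = {x. dr_dist I br x 0 = r}"

definition radial_smooth ::
    "'i::finite set \<Rightarrow> (real^'i \<Rightarrow> real^'i \<Rightarrow> real^'i) \<Rightarrow> ((real^'i) \<times> real \<Rightarrow> complex) set" where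
  "radial_smooth I br =
     {F. smooth_on UNIV F \<and> (\<forall>x y. dr_dist I br x 0 = dr_dist I br y 0 \<longrightarrow> F x = F y)}"

definition sphere_area :: "nat \<Rightarrow> nat \<Rightarrow> real \<Rightarrow> real" where
  "sphere_area m k r =
     2 ^ (m + 1) * pi powr (real (m + k + 1) / 2) / Gamma (real (m + k + 1) / 2) *
     sinh (r / 2) ^ m * sinh r ^ k"

text \<open>The spherical mean, extended to \<open>r = 0\<close> by the value at the identity (the sphere of
  radius \<open>0\<close>) and to \<open>r < 0\<close> as an even function.\<close>

definition spherical_mean ::
    "'i::finite set \<Rightarrow> (real^'i \<Rightarrow> real^'i \<Rightarrow> real^'i) \<Rightarrow> ((real^'i) \<times> real \<Rightarrow> complex) \<Rightarrow> real \<Rightarrow> complex" where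
  "spherical_mean I br F r =
     (if r = 0 then F 0
      else (1 / sphere_area (card I) (card (- I)) \<bar>r\<bar>) *\<^sub>R
        (LINT x : dr_sphere I br \<bar>r\<bar> | surface_measure (dr_metric I br) (dr_sphere I br \<bar>r\<bar>). F x))"

definition dual_abel ::
    "'i::finite set \<Rightarrow> (real^'i \<Rightarrow> real^'i \<Rightarrow> real^'i) \<Rightarrow> (real \<Rightarrow> complex) \<Rightarrow> real \<Rightarrow> complex" where
  "dual_abel I br f =
     (let Q = real (card I) / 2 + real (card (- I))
      in spherical_mean I br (\<lambda>p. of_real (exp (Q / 2 * snd p)) * f (snd p)))"

definition cosh_deriv :: "real \<Rightarrow> (real \<Rightarrow> complex) \<Rightarrow> real \<Rightarrow> complex" where
  "cosh_deriv \<tau> f s = of_real (1 / (\<tau> * sinh (\<tau> * s))) * vector_derivative f (at s)"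

text \<open>For \<open>\<mu> = 0\<close> the least admissible \<open>M\<close> would be \<open>1\<close> and the integral would give \<open>f r - f 0\<close>;
  the transform is the identity there by convention.\<close>

definition riemann_liouville :: "real \<Rightarrow> complex \<Rightarrow> (real \<Rightarrow> complex) \<Rightarrow> real \<Rightarrow> complex" where
  "riemann_liouville \<tau> \<mu> f r =
     (if \<mu> = 0 then f r
      else let M = (LEAST M :: nat. Re \<mu> > - real M)
           in 1 / Gamma (\<mu> + of_nat M) *
              integral {0..r} (\<lambda>s. of_real (\<tau> * sinh (\<tau> * s)) *
                of_real (cosh (\<tau> * r) - cosh (\<tau> * s)) powr (\<mu> + of_nat M - 1) *
                (cosh_deriv \<tau> ^^ M) f s))"

definition c2 :: "nat \<Rightarrow> real" where
  "c2 n = 2 powr ((real n - 1) / 2) * Gamma (real n / 2) / sqrt pi"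

end

theory Submission
  imports Defs "HOL-Analysis.Analysis"
begin

text \<open>Write \<open>C\<close> for the squared hyperbolic cosine of half the distance to the identity. It is an explicit function of
  \<open>(X, Y, z)\<close>, so a geodesic sphere is \<open>{C = const}\<close>: a round sphere in the coordinates \<open>(X, Y, 1 + e\<^sup>z + |X|\<^sup>2/4)\<close>, and a union of two
  graphs over the \<open>(X, Y)\<close> plane. Integrating \<open>e\<^bsup>Qz/2\<^esup> f(z)\<close> over the graphs in polar coordinates of \<open>X\<close> and \<open>Y\<close> gives two nested
  integrals with kernels \<open>(cosh r - cosh s)\<^bsup>k/2-1\<^esup>\<close> and \<open>(cosh (s/2) - cosh (z/2))\<^bsup>m/2-1\<^esup>\<close>, that is, the Riemann-Liouville transforms.
  After the substitution \<open>x = sinh (\<tau> s/2)\<close> these become Erdelyi-Kober operators, averages of dilates, which act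
  on even smooth functions and are inverted there by differential operators.\<close>

section \<open>Smooth functions\<close>

text \<open>The distance is an infimum over curves, so the formula for \<open>C\<close> has two
  halves: \<open>|grad C|^2 = C^2 - C\<close>, a consequence of the Heisenberg condition, bounds all
  lengths from below, and an explicit curve attains the bound. The surface measure is a definite
  description, so a candidate built from one stereographic chart is shown to be the only measure
  with the required values in all charts. The kernels are singular and the orders half-integral.
  Therefore functions are kept in the form \<open>x^(j - 1) * G x\<close>: a transform of order
  \<open>d / 2\<close> raises \<open>j\<close> by \<open>d\<close> and averages the dilates of
  \<open>G\<close> over an angle, with a continuous weight. Two such half steps are inverted by an
  Euler operator, one half step by adding another. The inversion formulas end in a single
  \<open>d/dr\<close> because the outer inversion stops at total order one. Integrating
  \<open>h / cosh (r / 2)\<close> against \<open>d (cosh r)\<close> is, up to a constant,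
  integrating \<open>h\<close> against \<open>d (cosh (r / 2))\<close>, so this last order passes
  from the outer scale to the inner one and survives the inner inversion as a primitive.\<close>

lemma frechet_derivative_cong_open:
  assumes "open U" "x \<in> U" "\<And>y. y \<in> U \<Longrightarrow> f y = g y"
  shows "frechet_derivative f (at x) = frechet_derivative g (at x)"
proof -
  have "(f has_derivative D) (at x) \<longleftrightarrow> (g has_derivative D) (at x)" for D
    using has_derivative_transform_within_open[of f D x UNIV U g]
      has_derivative_transform_within_open[of g D x UNIV U f] assms by auto
  then show ?thesis by (simp add: frechet_derivative_def)
qed

lemma differentiable_cong_open:
  assumes "open U" "x \<in> U" "\<And>y. y \<in> U \<Longrightarrow> f y = g y" "f differentiable at x"
  shows "g differentiable at x"
  using assms has_derivative_transform_within_open[of f _ x UNIV U g]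
  unfolding differentiable_def by blast

lemma iter_deriv_append: "iter_deriv (us @ vs) f = iter_deriv us (iter_deriv vs f)"
  by (induction us) auto

text \<open>By induction on the list of directions, every iterated derivative agrees on
  \<open>U\<close> with a member of \<open>P\<close>. Closure properties of smooth functions thus
  reduce to finding a class that is stable under one differentiation. Agreement is asked on
  \<open>U\<close> only, because nothing is known about derivatives elsewhere.\<close>

lemma smooth_on_coinduct:
  assumes U: "open U" and "P f"
    and step: "\<And>f. P f \<Longrightarrow> (\<forall>x\<in>U. f differentiable at x) \<and>
      (\<forall>v. \<exists>g. P g \<and> (\<forall>x\<in>U. g x = frechet_derivative f (at x) v))"
  shows "smooth_on U f"
proof -
  have *: "\<exists>g. P g \<and> (\<forall>x\<in>U. g x = iter_deriv vs f x)" for vs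
  proof (induction vs)
    case Nil
    then show ?case using \<open>P f\<close> by auto
  next
    case (Cons v vs)
    then obtain g where g: "P g" "\<And>x. x \<in> U \<Longrightarrow> g x = iter_deriv vs f x" by auto
    from step[OF g(1)] obtain h where h: "P h" "\<forall>x\<in>U. h x = frechet_derivative g (at x) v" by blast
    have "h x = iter_deriv (v # vs) f x" if "x \<in> U" for x
      using h(2) that frechet_derivative_cong_open[OF U that g(2)] by simp
    then show ?case using h(1) by blast
  qed
  show ?thesis
    unfolding smooth_on_def
  proof (intro allI ballI)
    fix vs x assume x: "x \<in> U"
    obtain g where "P g" "\<forall>x\<in>U. g x = iter_deriv vs f x" using * by blast
    then show "iter_deriv vs f differentiable at x"
      using step[of g] differentiable_cong_open[OF U x, of g "iter_deriv vs f"] x by simp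
  qed
qed

lemma derivative_stepI:
  assumes d: "\<And>x. x \<in> U \<Longrightarrow> (f has_derivative D x) (at x)"
    and "\<And>v. \<exists>g. P g \<and> (\<forall>x\<in>U. g x = D x v)"
  shows "(\<forall>x\<in>U. f differentiable at x) \<and>
    (\<forall>v. \<exists>g. P g \<and> (\<forall>x\<in>U. g x = frechet_derivative f (at x) v))"
proof -
  have "D x = frechet_derivative f (at x)" if "x \<in> U" for x
    using frechet_derivative_at[OF d[OF that]] .
  then show ?thesis using assms unfolding differentiable_def by fastforce
qed

lemma smooth_on_imp_differentiable: "smooth_on U f \<Longrightarrow> x \<in> U \<Longrightarrow> f differentiable at x"
  unfolding smooth_on_def using iter_deriv.simps(1)[of f] by metis

lemma smooth_on_iter_deriv: "smooth_on U f \<Longrightarrow> smooth_on U (iter_deriv vs f)"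
  unfolding smooth_on_def by (metis iter_deriv_append)

lemma smooth_on_frechet: "smooth_on U f \<Longrightarrow> smooth_on U (\<lambda>x. frechet_derivative f (at x) v)"
  using smooth_on_iter_deriv[of U f "[v]"] by simp

lemma smooth_on_has_derivative:
  "smooth_on U f \<Longrightarrow> x \<in> U \<Longrightarrow> (f has_derivative frechet_derivative f (at x)) (at x)"
  using smooth_on_imp_differentiable frechet_derivative_works by blast

lemma smooth_on_continuous_on: "smooth_on U f \<Longrightarrow> continuous_on U f"
  by (metis continuous_at_imp_continuous_on differentiable_imp_continuous_within
      smooth_on_imp_differentiable)

lemma smooth_on_cong:
  assumes "open U" "smooth_on U f" "\<And>x. x \<in> U \<Longrightarrow> g x = f x"
  shows "smooth_on U g"
proof (rule smooth_on_coinduct[where P = "\<lambda>h. \<exists>k. smooth_on U k \<and> (\<forall>x\<in>U. h x = k x)", OF assms(1)])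
  show "\<exists>k. smooth_on U k \<and> (\<forall>x\<in>U. g x = k x)" using assms by blast
  fix h :: "'a \<Rightarrow> 'b" assume "\<exists>k. smooth_on U k \<and> (\<forall>x\<in>U. h x = k x)"
  then obtain k where k: "smooth_on U k" "\<And>x. x \<in> U \<Longrightarrow> k x = h x" by auto
  show "(\<forall>x\<in>U. h differentiable at x) \<and> (\<forall>v. \<exists>g. (\<exists>k. smooth_on U k \<and> (\<forall>x\<in>U. g x = k x)) \<and>
      (\<forall>x\<in>U. g x = frechet_derivative h (at x) v))"
  proof (intro conjI allI ballI)
    show "h differentiable at x" if "x \<in> U" for x
      using differentiable_cong_open[OF assms(1) that k(2), of "\<lambda>x. x"] smooth_on_imp_differentiable[OF k(1) that] by blast
    fix v
    show "\<exists>g. (\<exists>k. smooth_on U k \<and> (\<forall>x\<in>U. g x = k x)) \<and>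
      (\<forall>x\<in>U. g x = frechet_derivative h (at x) v)"
      by (rule exI[of _ "\<lambda>x. frechet_derivative h (at x) v"])
        (use smooth_on_frechet[OF k(1)] frechet_derivative_cong_open[OF assms(1) _ k(2)] in fastforce)
  qed
qed

section \<open>Closure properties of smooth functions\<close>

lemma smooth_on_const: "open U \<Longrightarrow> smooth_on U (\<lambda>_. c)"
  by (rule smooth_on_coinduct[where P = "\<lambda>g. \<exists>c. g = (\<lambda>_. c)"])
    (auto simp: frechet_derivative_const)

lemma smooth_on_bounded_linear:
  assumes "open U" "bounded_linear L" shows "smooth_on U L"
proof (rule smooth_on_coinduct[where P = "\<lambda>g. g = L \<or> (\<exists>c. g = (\<lambda>_. c))"])
  have "frechet_derivative L (at x) = L" for x
    using assms(2) bounded_linear_imp_has_derivative frechet_derivative_at by metis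
  then show "(\<forall>x\<in>U. f differentiable at x) \<and>
      (\<forall>v. \<exists>g. (g = L \<or> (\<exists>c. g = (\<lambda>_. c))) \<and> (\<forall>x\<in>U. g x = frechet_derivative f (at x) v))"
    if "f = L \<or> (\<exists>c. f = (\<lambda>_. c))" for f
    using that assms(2) bounded_linear_imp_differentiable
    by (auto simp: frechet_derivative_const)
qed (use assms in auto)

text \<open>The Leibniz rule turns one product into a sum of two, so the class stable under
  differentiation is that of finite sums of products.\<close>

inductive bilinear_sums :: "('a::real_normed_vector \<Rightarrow> 'b::real_normed_vector \<Rightarrow> 'c::real_normed_vector) \<Rightarrow>
    'd::real_normed_vector set \<Rightarrow> ('d \<Rightarrow> 'c) \<Rightarrow> bool" for pr U where
  "smooth_on U f \<Longrightarrow> smooth_on U g \<Longrightarrow> bilinear_sums pr U (\<lambda>x. pr (f x) (g x))"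
| "bilinear_sums pr U f \<Longrightarrow> bilinear_sums pr U g \<Longrightarrow> bilinear_sums pr U (\<lambda>x. f x + g x)"

lemma bilinear_sums_smooth:
  assumes U: "open U" and pr: "bounded_bilinear pr" and "bilinear_sums pr U f"
  shows "smooth_on U f"
proof (rule smooth_on_coinduct[where P = "bilinear_sums pr U"])
  fix f assume "bilinear_sums pr U f"
  then show "(\<forall>x\<in>U. f differentiable at x) \<and>
      (\<forall>v. \<exists>g. bilinear_sums pr U g \<and> (\<forall>x\<in>U. g x = frechet_derivative f (at x) v))"
  proof (induction)
    case (1 f g)
    have d: "((\<lambda>x. pr (f x) (g x)) has_derivative
        (\<lambda>v. pr (f x) (frechet_derivative g (at x) v) + pr (frechet_derivative f (at x) v) (g x))) (at x)"
      if "x \<in> U" for x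
      by (rule bounded_bilinear.FDERIV[OF pr smooth_on_has_derivative[OF 1(1) that] smooth_on_has_derivative[OF 1(2) that]])
    have "bilinear_sums pr U (\<lambda>x. pr (f x) (frechet_derivative g (at x) v) + pr (frechet_derivative f (at x) v) (g x))" for v
      by (intro bilinear_sums.intros 1 smooth_on_frechet)
    moreover have "frechet_derivative (\<lambda>x. pr (f x) (g x)) (at x) v =
        pr (f x) (frechet_derivative g (at x) v) + pr (frechet_derivative f (at x) v) (g x)" if "x \<in> U" for x v
      using fun_cong[OF frechet_derivative_at[OF d[OF that]], of v] by simp
    ultimately show ?case by (intro derivative_stepI[OF d]) auto
  next
    case (2 f g)
    have d: "((\<lambda>x. f x + g x) has_derivative
        (\<lambda>v. frechet_derivative f (at x) v + frechet_derivative g (at x) v)) (at x)" if "x \<in> U" for x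
      using 2 that by (intro has_derivative_add) (auto simp: frechet_derivative_works)
    have *: "frechet_derivative (\<lambda>x. f x + g x) (at x) v =
        frechet_derivative f (at x) v + frechet_derivative g (at x) v" if "x \<in> U" for x v
      using fun_cong[OF frechet_derivative_at[OF d[OF that]], of v] by simp
    show ?case
    proof (intro conjI allI ballI)
      show "(\<lambda>x. f x + g x) differentiable at x" if "x \<in> U" for x
        using d[OF that] differentiable_def by blast
      fix v
      obtain f' g' where "bilinear_sums pr U f'" "\<forall>x\<in>U. f' x = frechet_derivative f (at x) v"
        "bilinear_sums pr U g'" "\<forall>x\<in>U. g' x = frechet_derivative g (at x) v"
        using 2 by blast
      then show "\<exists>h. bilinear_sums pr U h \<and> (\<forall>x\<in>U. h x = frechet_derivative (\<lambda>x. f x + g x) (at x) v)"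
        using bilinear_sums.intros(2)[of pr U f' g'] * by (intro exI[of _ "\<lambda>x. f' x + g' x"]) auto
    qed
  qed
qed (use assms in auto)

lemma smooth_on_bilinear:
  "open U \<Longrightarrow> bounded_bilinear pr \<Longrightarrow> smooth_on U f \<Longrightarrow> smooth_on U g \<Longrightarrow> smooth_on U (\<lambda>x. pr (f x) (g x))"
  by (rule bilinear_sums_smooth) (auto intro: bilinear_sums.intros)

lemmas smooth_on_scaleR = smooth_on_bilinear[OF _ bounded_bilinear_scaleR]
lemmas smooth_on_mult = smooth_on_bilinear[OF _ bounded_bilinear_mult]

lemma smooth_on_add:
  assumes "open U" "smooth_on U f" "smooth_on U g" shows "smooth_on U (\<lambda>x. f x + g x)"
proof -
  have "bilinear_sums (*\<^sub>R) U (\<lambda>x. 1 *\<^sub>R f x + 1 *\<^sub>R g x)"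
    by (intro bilinear_sums.intros smooth_on_const assms)
  then show ?thesis
    using bilinear_sums_smooth[OF assms(1) bounded_bilinear_scaleR] by fastforce
qed

lemma smooth_on_linear_comp:
  assumes U: "open U" and L: "bounded_linear L" and f: "smooth_on U f"
  shows "smooth_on U (\<lambda>x. L (f x))"
proof (rule smooth_on_coinduct[where P = "\<lambda>g. \<exists>f. smooth_on U f \<and> g = (\<lambda>x. L (f x))", OF U])
  fix g assume "\<exists>f. smooth_on U f \<and> g = (\<lambda>x. L (f x))"
  then obtain f where f: "smooth_on U f" "g = (\<lambda>x. L (f x))" by blast
  have d: "(g has_derivative (\<lambda>v. L (frechet_derivative f (at x) v))) (at x)" if "x \<in> U" for x
    unfolding f using bounded_linear.has_derivative[OF L smooth_on_has_derivative[OF f(1) that]] .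
  have *: "frechet_derivative g (at x) v = L (frechet_derivative f (at x) v)" if "x \<in> U" for x v
    using fun_cong[OF frechet_derivative_at[OF d[OF that]], of v] by simp
  show "(\<forall>x\<in>U. g differentiable at x) \<and> (\<forall>v. \<exists>h. (\<exists>f. smooth_on U f \<and> h = (\<lambda>x. L (f x))) \<and>
      (\<forall>x\<in>U. h x = frechet_derivative g (at x) v))"
    by (rule derivative_stepI[OF d]) (use smooth_on_frechet[OF f(1)] in blast)+
qed (use f in blast)

lemma smooth_on_minus: "open U \<Longrightarrow> smooth_on U f \<Longrightarrow> smooth_on U (\<lambda>x. - f x)"
  by (rule smooth_on_linear_comp) (auto intro: bounded_linear_minus bounded_linear_ident)

lemma smooth_on_diff:
  "open U \<Longrightarrow> smooth_on U f \<Longrightarrow> smooth_on U g \<Longrightarrow> smooth_on U (\<lambda>x. f x - g x)"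
  using smooth_on_add[of U f "\<lambda>x. - g x"] smooth_on_minus[of U g] by simp

lemma smooth_on_power:
  fixes f :: "'a::real_normed_vector \<Rightarrow> 'b::real_normed_algebra_1"
  assumes "open U" "smooth_on U f" shows "smooth_on U (\<lambda>x. f x ^ n)"
  by (induction n) (auto intro: assms smooth_on_const smooth_on_mult)

lemma smooth_on_Pair:
  assumes "open U" "smooth_on U f" "smooth_on U g" shows "smooth_on U (\<lambda>x. (f x, g x))"
proof -
  have "smooth_on U (\<lambda>x. (f x, 0) + (0, g x))"
    using smooth_on_linear_comp[OF assms(1) _ assms(2), of "\<lambda>y. (y, 0)"]
      smooth_on_linear_comp[OF assms(1) _ assms(3), of "\<lambda>y. (0, y)"]
    by (intro smooth_on_add assms) (auto simp: bounded_linear_Pair bounded_linear_ident bounded_linear_zero)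
  then show ?thesis by simp
qed

lemma frechet_derivative_real:
  "f differentiable at (x::real) \<Longrightarrow> frechet_derivative f (at x) v = v *\<^sub>R frechet_derivative f (at x) 1"
  using linear_frechet_derivative[of f "at x"] linear_cmul[of "frechet_derivative f (at x)" v 1] by simp

lemma has_vector_derivative_frechet:
  "f differentiable at (x::real) \<Longrightarrow> (f has_vector_derivative frechet_derivative f (at x) 1) (at x)"
  unfolding has_vector_derivative_def
  by (rule has_derivative_eq_rhs[OF iffD1[OF frechet_derivative_works]])
    (auto intro!: ext frechet_derivative_real)

lemma vector_derivative_frechet:
  assumes "(f has_vector_derivative d) (at (x::real))"
  shows "frechet_derivative f (at x) v = v *\<^sub>R d"
  using fun_cong[OF frechet_derivative_at[OF assms[unfolded has_vector_derivative_def]], of v] by simp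

text \<open>The chain rule produces \<open>h' (f x)\<close> with a new smooth scalar coefficient,
  hence the coefficients \<open>k\<close> and the sums. As \<open>h\<close> has a real argument, its
  derivative is again a function of the same type, so the class closes up.\<close>

inductive comp_sums :: "real set \<Rightarrow> 'a::real_normed_vector set \<Rightarrow> ('a \<Rightarrow> real) \<Rightarrow> ('a \<Rightarrow> 'b::real_normed_vector) \<Rightarrow> bool"
  for V U f where
  "smooth_on U k \<Longrightarrow> smooth_on V h \<Longrightarrow> comp_sums V U f (\<lambda>x. k x *\<^sub>R h (f x))"
| "comp_sums V U f g \<Longrightarrow> comp_sums V U f h \<Longrightarrow> comp_sums V U f (\<lambda>x. g x + h x)"

lemma smooth_on_compose_real:
  fixes h :: "real \<Rightarrow> 'b::real_normed_vector" and f :: "'a::real_normed_vector \<Rightarrow> real"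
  assumes U: "open U" and V: "open V" and h: "smooth_on V h" and f: "smooth_on U f" and fU: "f ` U \<subseteq> V"
  shows "smooth_on U (\<lambda>x. h (f x))"
proof -
  have "smooth_on U (\<lambda>x. 1 *\<^sub>R h (f x))"
  proof (rule smooth_on_coinduct[where P = "comp_sums V U f", OF U])
    show "comp_sums V U f (\<lambda>x. 1 *\<^sub>R h (f x))"
      by (intro comp_sums.intros h smooth_on_const U)
    fix g :: "'a \<Rightarrow> 'b" assume "comp_sums V U f g"
    then show "(\<forall>x\<in>U. g differentiable at x) \<and>
      (\<forall>v. \<exists>h. comp_sums V U f h \<and> (\<forall>x\<in>U. h x = frechet_derivative g (at x) v))"
    proof induction
      case (1 k h)
      let ?h' = "\<lambda>x. frechet_derivative h (at x) 1"
      have d: "((\<lambda>x. k x *\<^sub>R h (f x)) has_derivative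
          (\<lambda>v. k x *\<^sub>R (frechet_derivative f (at x) v *\<^sub>R ?h' (f x)) + frechet_derivative k (at x) v *\<^sub>R h (f x))) (at x)"
        if x: "x \<in> U" for x
      proof -
        have "((h \<circ> f) has_derivative (\<lambda>v. frechet_derivative f (at x) v *\<^sub>R ?h' (f x))) (at x)"
          using diff_chain_at[OF smooth_on_has_derivative[OF f x], of h "\<lambda>t. t *\<^sub>R ?h' (f x)"]
            has_vector_derivative_frechet[of h "f x"] smooth_on_imp_differentiable[OF 1(2), of "f x"] fU x
          unfolding has_vector_derivative_def o_def by auto
        then show ?thesis
          using bounded_bilinear.FDERIV[OF bounded_bilinear_scaleR smooth_on_has_derivative[OF 1(1) x]]
          unfolding o_def by blast
      qed
      have *: "frechet_derivative (\<lambda>x. k x *\<^sub>R h (f x)) (at x) v =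
          (k x * frechet_derivative f (at x) v) *\<^sub>R ?h' (f x) + frechet_derivative k (at x) v *\<^sub>R h (f x)"
        if "x \<in> U" for x v
        using fun_cong[OF frechet_derivative_at[OF d[OF that]], of v] by simp
      have "comp_sums V U f (\<lambda>x. (k x * frechet_derivative f (at x) v) *\<^sub>R ?h' (f x) + frechet_derivative k (at x) v *\<^sub>R h (f x))" for v
        by (intro comp_sums.intros 1 smooth_on_frechet smooth_on_mult f U)
      then show ?case by (intro derivative_stepI[OF d]) auto
    next
      case (2 g h)
      have d: "((\<lambda>x. g x + h x) has_derivative
          (\<lambda>v. frechet_derivative g (at x) v + frechet_derivative h (at x) v)) (at x)" if "x \<in> U" for x
        using 2 that by (intro has_derivative_add) (auto simp: frechet_derivative_works)
      have *: "frechet_derivative (\<lambda>x. g x + h x) (at x) v =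
          frechet_derivative g (at x) v + frechet_derivative h (at x) v" if "x \<in> U" for x v
        using fun_cong[OF frechet_derivative_at[OF d[OF that]], of v] by simp
      show ?case
      proof (intro conjI allI ballI)
        show "(\<lambda>x. g x + h x) differentiable at x" if "x \<in> U" for x
          using d[OF that] differentiable_def by blast
        fix v
        obtain g' h' where "comp_sums V U f g'" "\<forall>x\<in>U. g' x = frechet_derivative g (at x) v"
          "comp_sums V U f h'" "\<forall>x\<in>U. h' x = frechet_derivative h (at x) v"
          using 2 by blast
        then show "\<exists>k. comp_sums V U f k \<and> (\<forall>x\<in>U. k x = frechet_derivative (\<lambda>x. g x + h x) (at x) v)"
          using comp_sums.intros(2)[of V U f g' h'] * by (intro exI[of _ "\<lambda>x. g' x + h' x"]) auto
      qed
    qed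
  qed
  then show ?thesis by simp
qed

text \<open>On the line a direction \<open>v\<close> contributes only a scalar factor, so the
  multiples \<open>c *\<^sub>R F j\<close> of a sequence of successive derivatives form a stable
  class.\<close>

lemma smooth_on_seq:
  assumes U: "open U" and d: "\<And>j x. x \<in> U \<Longrightarrow> (F j has_vector_derivative F (Suc j) x) (at x)"
  shows "smooth_on U (F 0)" and "x \<in> U \<Longrightarrow> iter_deriv (replicate j (1::real)) (F 0) x = F j x"
proof -
  have fr: "frechet_derivative (F j) (at x) v = v *\<^sub>R F (Suc j) x" if "x \<in> U" for x v j
    using vector_derivative_frechet[OF d[OF that]] .
  have "smooth_on U (\<lambda>x. 1 *\<^sub>R F 0 x)"
  proof (rule smooth_on_coinduct[where P = "\<lambda>g. \<exists>c j. g = (\<lambda>x. c *\<^sub>R F j x)", OF U])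
    fix g assume "\<exists>c j. g = (\<lambda>x. c *\<^sub>R F j x)"
    then obtain c j where g: "g = (\<lambda>x. c *\<^sub>R F j x)" by blast
    have "(g has_vector_derivative c *\<^sub>R F (Suc j) x) (at x)" if "x \<in> U" for x
      unfolding g using d[OF that, of j] by (auto intro!: derivative_eq_intros)
    then show "(\<forall>x\<in>U. g differentiable at x) \<and>
      (\<forall>v. \<exists>h. (\<exists>c j. h = (\<lambda>x. c *\<^sub>R F j x)) \<and> (\<forall>x\<in>U. h x = frechet_derivative g (at x) v))"
    proof (intro conjI allI ballI)
      assume *: "\<And>x. x \<in> U \<Longrightarrow> (g has_vector_derivative c *\<^sub>R F (Suc j) x) (at x)"
      show "g differentiable at x" if "x \<in> U" for x
        using *[OF that] unfolding has_vector_derivative_def differentiable_def by blast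
      show "\<exists>h. (\<exists>c j. h = (\<lambda>x. c *\<^sub>R F j x)) \<and> (\<forall>x\<in>U. h x = frechet_derivative g (at x) v)" for v
        by (rule exI[of _ "\<lambda>x. (v * c) *\<^sub>R F (Suc j) x"])
          (use vector_derivative_frechet[OF *] in auto)
    qed
  qed blast
  then show "smooth_on U (F 0)" by simp
  show "x \<in> U \<Longrightarrow> iter_deriv (replicate j (1::real)) (F 0) x = F j x"
  proof (induction j arbitrary: x)
    case (Suc j)
    have "frechet_derivative (iter_deriv (replicate j (1::real)) (F 0)) (at x) = frechet_derivative (F j) (at x)"
      by (rule frechet_derivative_cong_open[OF U Suc.prems Suc.IH])
    then show ?case using fr[OF Suc.prems] by simp
  qed simp
qed

lemma has_vector_derivative_iter:
  assumes "smooth_on U f" "x \<in> U"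
  shows "(iter_deriv (replicate j (1::real)) f has_vector_derivative iter_deriv (replicate (Suc j) 1) f x) (at x)"
  using has_vector_derivative_frechet[of "iter_deriv (replicate j 1) f" x] assms
  by (simp add: smooth_on_def)

lemma set_Basis_real: "set bs \<subseteq> Basis \<Longrightarrow> bs = replicate (length bs) (1::real)"
  by (induction bs) auto

lemma smooth_on_exp: "smooth_on UNIV (exp :: real \<Rightarrow> real)"
  using smooth_on_seq(1)[of UNIV "\<lambda>_. exp :: real \<Rightarrow> real"]
  by (simp add: has_real_derivative_iff_has_vector_derivative[symmetric])

lemma smooth_on_inverse: "smooth_on {0<..} (inverse :: real \<Rightarrow> real)"
proof -
  have "smooth_on {0<..} ((\<lambda>j x. (- 1) ^ j * fact j * inverse x ^ Suc j) 0 :: real \<Rightarrow> real)"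
  proof (rule smooth_on_seq(1))
    fix j :: nat and x :: real assume "x \<in> {0<..}"
    then have "((\<lambda>x. (- 1) ^ j * fact j * inverse x ^ Suc j) has_real_derivative
        (- 1) ^ j * fact j * ((1 + real j) * (- (inverse x ^ Suc (Suc 0)) * inverse x ^ j))) (at x)"
      by (intro DERIV_cmult DERIV_power_Suc DERIV_inverse) auto
    then show "((\<lambda>x. (- 1) ^ j * fact j * inverse x ^ Suc j) has_vector_derivative
      (- 1) ^ Suc j * fact (Suc j) * inverse x ^ Suc (Suc j)) (at x)"
      unfolding has_real_derivative_iff_has_vector_derivative[symmetric]
      by (simp add: algebra_simps)
  qed auto
  then show ?thesis by simp
qed

text \<open>Only the zeroth derivative is new, all others are derivatives of \<open>h'\<close>. This
  reaches \<open>ln\<close> and \<open>arsinh\<close>, whose derivatives are built from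
  \<open>inverse\<close> and \<open>sqrt\<close>.\<close>

lemma smooth_on_deriv1:
  assumes V: "open V" and d: "\<And>x. x \<in> V \<Longrightarrow> (h has_vector_derivative h' x) (at (x::real))" and h': "smooth_on V h'"
  shows "smooth_on V h"
proof (rule smooth_on_coinduct[where P = "\<lambda>g. smooth_on V g \<or> g = h", OF V])
  fix g assume "smooth_on V g \<or> g = h"
  then show "(\<forall>x\<in>V. g differentiable at x) \<and>
      (\<forall>v. \<exists>k. (smooth_on V k \<or> k = h) \<and> (\<forall>x\<in>V. k x = frechet_derivative g (at x) v))"
  proof
    assume "smooth_on V g"
    then show ?thesis using smooth_on_frechet smooth_on_imp_differentiable by blast
  next
    assume g: "g = h"
    have "\<exists>k. (smooth_on V k \<or> k = h) \<and> (\<forall>x\<in>V. k x = frechet_derivative h (at x) v)" for v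
      using vector_derivative_frechet[OF d] smooth_on_scaleR[OF V smooth_on_const[OF V] h', of v]
      by (intro exI[of _ "\<lambda>x. v *\<^sub>R h' x"]) auto
    then show ?thesis unfolding g using d has_vector_derivative_def differentiable_def by blast
  qed
qed simp

lemma smooth_on_ln: "smooth_on {0<..} (ln :: real \<Rightarrow> real)"
  by (rule smooth_on_deriv1[OF _ _ smooth_on_inverse])
    (auto intro!: derivative_eq_intros simp: has_real_derivative_iff_has_vector_derivative[symmetric] divide_inverse)

lemma smooth_on_sqrt: "smooth_on {0<..} (sqrt :: real \<Rightarrow> real)"
proof (rule smooth_on_cong)
  show "smooth_on {0<..} (\<lambda>x::real. exp ((1 / 2) * ln x))"
    by (intro smooth_on_compose_real[OF _ open_UNIV smooth_on_exp] smooth_on_mult smooth_on_const smooth_on_ln) auto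
  show "sqrt x = exp (1 / 2 * ln x)" if "x \<in> {0<..}" for x :: real
    using that by (simp add: powr_half_sqrt[symmetric] powr_def)
qed auto

section \<open>Operators on spaces of smooth functions\<close>

text \<open>The standard seminorm of order \<open>N\<close> on \<open>K\<close> is at most
  \<open>c\<close>. Stated as a bound instead of a supremum, it makes sense for every function; for
  empty \<open>K\<close> it holds with any \<open>c\<close>, even a negative one.\<close>

definition deriv_bound :: "nat \<Rightarrow> 'a::euclidean_space set \<Rightarrow> real \<Rightarrow> ('a \<Rightarrow> complex) \<Rightarrow> bool" where
  "deriv_bound N K c f \<longleftrightarrow>
     (\<forall>bs. set bs \<subseteq> Basis \<and> length bs \<le> N \<longrightarrow> (\<forall>x\<in>K. norm (iter_deriv bs f x) \<le> c))"

definition fs_subspace :: "('a::euclidean_space \<Rightarrow> complex) set \<Rightarrow> bool" where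
  "fs_subspace E \<longleftrightarrow> (\<forall>f\<in>E. smooth_on UNIV f) \<and> (\<forall>f\<in>E. \<forall>g\<in>E. (\<lambda>x. f x + g x) \<in> E) \<and>
     (\<forall>c. \<forall>f\<in>E. (\<lambda>x. c * f x) \<in> E)"

text \<open>The continuity estimate for linear maps of Frechet spaces: each seminorm of the image is
  controlled by a single seminorm of the argument. The order and the compact set may grow, as some
  inverses cost derivatives.\<close>

definition fs_bounded :: "('a::euclidean_space \<Rightarrow> complex) set \<Rightarrow> (('a \<Rightarrow> complex) \<Rightarrow> ('b::euclidean_space \<Rightarrow> complex)) \<Rightarrow> bool" where
  "fs_bounded E T \<longleftrightarrow> (\<forall>N K. compact K \<longrightarrow> (\<exists>N' K' B. compact K' \<and> 0 \<le> B \<and>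
     (\<forall>f\<in>E. \<forall>c. deriv_bound N' K' c f \<longrightarrow> deriv_bound N K (B * c) (T f))))"

definition fs_op :: "('a::euclidean_space \<Rightarrow> complex) set \<Rightarrow> ('b::euclidean_space \<Rightarrow> complex) set \<Rightarrow>
    (('a \<Rightarrow> complex) \<Rightarrow> ('b \<Rightarrow> complex)) \<Rightarrow> bool" where
  "fs_op E F T \<longleftrightarrow> (\<forall>f\<in>E. T f \<in> F) \<and>
     (\<forall>f\<in>E. \<forall>g\<in>E. T (\<lambda>x. f x + g x) = (\<lambda>y. T f y + T g y)) \<and>
     (\<forall>c. \<forall>f\<in>E. T (\<lambda>x. c * f x) = (\<lambda>y. c * T f y)) \<and> fs_bounded E T"

text \<open>The inverse has to satisfy seminorm estimates too, so that continuity in both directions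
  is carried through compositions.\<close>

definition fs_iso :: "('a::euclidean_space \<Rightarrow> complex) set \<Rightarrow> ('b::euclidean_space \<Rightarrow> complex) set \<Rightarrow>
    (('a \<Rightarrow> complex) \<Rightarrow> ('b \<Rightarrow> complex)) \<Rightarrow> bool" where
  "fs_iso E F T \<longleftrightarrow> fs_op E F T \<and>
     (\<exists>T'. fs_op F E T' \<and> (\<forall>f\<in>E. T' (T f) = f) \<and> (\<forall>g\<in>F. T (T' g) = g))"

lemma fs_op_bound:
  assumes "fs_op E F T" "compact K"
  obtains N' K' B where "compact K'" "0 \<le> B"
    "\<And>f c. f \<in> E \<Longrightarrow> deriv_bound N' K' c f \<Longrightarrow> deriv_bound N K (B * c) (T f)"
proof -
  have "fs_bounded E T" using assms(1) by (simp add: fs_op_def)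
  then show ?thesis using assms(2) that unfolding fs_bounded_def by metis
qed

lemma fs_subspaceD:
  assumes "fs_subspace E" "f \<in> E"
  shows "smooth_on UNIV f" "g \<in> E \<Longrightarrow> (\<lambda>x. f x + g x) \<in> E" "(\<lambda>x. c * f x) \<in> E"
  using assms unfolding fs_subspace_def by blast+

lemma fs_opD:
  assumes "fs_op E F T" "f \<in> E"
  shows "T f \<in> F" "g \<in> E \<Longrightarrow> T (\<lambda>x. f x + g x) = (\<lambda>y. T f y + T g y)" "T (\<lambda>x. c * f x) = (\<lambda>y. c * T f y)"
proof -
  show "T f \<in> F" using assms by (simp add: fs_op_def)
  have "\<forall>f\<in>E. \<forall>g\<in>E. T (\<lambda>x. f x + g x) = (\<lambda>y. T f y + T g y)" using assms by (simp add: fs_op_def)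
  then show "g \<in> E \<Longrightarrow> T (\<lambda>x. f x + g x) = (\<lambda>y. T f y + T g y)" using assms(2) by simp
  have "\<forall>c. \<forall>f\<in>E. T (\<lambda>x. c * f x) = (\<lambda>y. c * T f y)" using assms by (simp add: fs_op_def)
  then show "T (\<lambda>x. c * f x) = (\<lambda>y. c * T f y)" using assms(2) by simp
qed

lemma fs_op_comp:
  assumes "fs_op E F T" "fs_op F G S" shows "fs_op E G (\<lambda>f. S (T f))"
proof -
  have "\<exists>N' K' B. compact K' \<and> 0 \<le> B \<and>
        (\<forall>f\<in>E. \<forall>c. deriv_bound N' K' c f \<longrightarrow> deriv_bound N K (B * c) (S (T f)))" if K: "compact K" for N K
  proof -
    obtain N1 K1 B1 where 1: "compact K1" "0 \<le> B1"
      "\<And>f c. f \<in> F \<Longrightarrow> deriv_bound N1 K1 c f \<Longrightarrow> deriv_bound N K (B1 * c) (S f)"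
      using fs_op_bound[OF assms(2) K] by metis
    obtain N2 K2 B2 where 2: "compact K2" "0 \<le> B2"
      "\<And>f c. f \<in> E \<Longrightarrow> deriv_bound N2 K2 c f \<Longrightarrow> deriv_bound N1 K1 (B2 * c) (T f)"
      using fs_op_bound[OF assms(1) 1(1)] by metis
    have "T f \<in> F" if "f \<in> E" for f using assms(1) that by (auto simp: fs_op_def)
    then show ?thesis
      using 1 2 by (intro exI[of _ N2] exI[of _ K2] exI[of _ "B1 * B2"]) (auto simp: mult.assoc)
  qed
  then have "fs_bounded E (\<lambda>f. S (T f))" unfolding fs_bounded_def by simp
  then show ?thesis
    using fs_opD[OF assms(1)] fs_opD[OF assms(2)] unfolding fs_op_def by simp
qed

lemma fs_iso_comp:
  assumes "fs_iso E F T" "fs_iso F G S" shows "fs_iso E G (\<lambda>f. S (T f))"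
proof -
  obtain T' S' where *: "fs_op F E T'" "\<And>f. f \<in> E \<Longrightarrow> T' (T f) = f" "\<And>g. g \<in> F \<Longrightarrow> T (T' g) = g"
    "fs_op G F S'" "\<And>f. f \<in> F \<Longrightarrow> S' (S f) = f" "\<And>g. g \<in> G \<Longrightarrow> S (S' g) = g"
    using assms unfolding fs_iso_def by metis
  have "\<And>f. f \<in> E \<Longrightarrow> T f \<in> F" "\<And>g. g \<in> G \<Longrightarrow> S' g \<in> F"
    using assms(1) *(4) by (auto simp: fs_op_def fs_iso_def)
  then show ?thesis
    unfolding fs_iso_def using assms * fs_op_comp[of E F T G S] fs_op_comp[of G F S' E T']
    by (auto simp: fs_iso_def intro!: exI[of _ "\<lambda>g. T' (S' g)"])
qed

lemma fs_op_cong: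
  assumes "fs_op E F T" "fs_subspace E" "\<And>f. f \<in> E \<Longrightarrow> S f = T f" shows "fs_op E F S"
proof -
  have "fs_bounded E S" using assms(1,3) unfolding fs_op_def fs_bounded_def by simp
  then show ?thesis
    using fs_opD[OF assms(1)] fs_subspaceD[OF assms(2)] assms(3) unfolding fs_op_def by simp
qed

lemma fs_iso_cong:
  assumes "fs_iso E F T" "fs_subspace E" "\<And>f. f \<in> E \<Longrightarrow> S f = T f" shows "fs_iso E F S"
proof -
  obtain T' where T': "fs_op F E T'" "\<And>f. f \<in> E \<Longrightarrow> T' (T f) = f" "\<And>g. g \<in> F \<Longrightarrow> T (T' g) = g"
    using assms(1) unfolding fs_iso_def by metis
  moreover have "S (T' g) = g" if "g \<in> F" for g
    using T' that assms(3) by (auto simp: fs_op_def)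
  ultimately show ?thesis
    using fs_op_cong[OF _ assms(2,3)] assms unfolding fs_iso_def by (intro conjI exI[of _ T']) auto
qed

lemma fs_iso_bij_betw:
  assumes "fs_iso E F T" shows "bij_betw T E F"
proof -
  obtain T' where T': "fs_op F E T'" "\<And>f. f \<in> E \<Longrightarrow> T' (T f) = f" "\<And>g. g \<in> F \<Longrightarrow> T (T' g) = g"
    using assms unfolding fs_iso_def by metis
  then show ?thesis using assms by (intro bij_betwI[of _ _ _ T']) (auto simp: fs_op_def fs_iso_def)
qed

section \<open>From seminorm estimates to the topology\<close>

lemma topspace_smooth_topology: "topspace smooth_topology = {f :: 'a::euclidean_space \<Rightarrow> complex. smooth_on UNIV f}"
proof -
  have "(f :: 'a \<Rightarrow> complex) \<in> smooth_nbhd f {} 0 1" if "smooth_on UNIV f" for f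
    using that by (simp add: smooth_nbhd_def)
  then show ?thesis
    unfolding smooth_topology_def topology_generated_by_topspace
    by (auto simp: smooth_nbhd_def) (use compact_empty zero_less_one in blast)
qed

lemma openin_smooth_nbhd:
  "smooth_on UNIV f \<Longrightarrow> compact K \<Longrightarrow> 0 < j \<Longrightarrow> openin smooth_topology (smooth_nbhd f K N j)"
  unfolding smooth_topology_def by (rule topology_generated_by_Basis) blast

lemma iter_deriv_linear:
  assumes "smooth_on UNIV f" "smooth_on UNIV g"
  shows "iter_deriv bs (\<lambda>x. f x + c * g x) = (\<lambda>x. iter_deriv bs f x + c * iter_deriv bs (g :: _ \<Rightarrow> complex) x)"
proof (induction bs)
  case (Cons v bs)
  have "((\<lambda>x. iter_deriv bs f x + c * iter_deriv bs g x) has_derivative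
      (\<lambda>v. frechet_derivative (iter_deriv bs f) (at x) v + c * frechet_derivative (iter_deriv bs g) (at x) v)) (at x)" for x
    by (intro has_derivative_add has_derivative_mult_right smooth_on_has_derivative[of UNIV]
        smooth_on_iter_deriv assms) auto
  from frechet_derivative_at[OF this] show ?case
    unfolding iter_deriv.simps Cons.IH by metis
qed simp

lemma finite_Basis_lists: "finite {bs. set bs \<subseteq> (Basis :: 'a::euclidean_space set) \<and> length bs \<le> N}"
  by (rule finite_lists_length_le) simp

text \<open>The maximum over the compact set is below \<open>j\<close>, hence there is room for a small ball around \<open>T f\<close>.\<close>

lemma smooth_nbhd_gap:
  fixes f g :: "'a::euclidean_space \<Rightarrow> complex"
  assumes "f \<in> smooth_nbhd g K N j" "smooth_on UNIV g" "compact K" "0 < j"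
  obtains \<eta> where "0 < \<eta>"
    "\<And>h. smooth_on UNIV h \<Longrightarrow> deriv_bound N K \<eta> (\<lambda>x. h x + (-1) * f x) \<Longrightarrow> h \<in> smooth_nbhd g K N j"
proof -
  let ?L = "{bs. set bs \<subseteq> (Basis :: 'a set) \<and> length bs \<le> N}"
  have f: "smooth_on UNIV f" using assms(1) by (simp add: smooth_nbhd_def)
  have "\<exists>e>0. \<forall>x\<in>K. norm (iter_deriv bs f x - iter_deriv bs g x) + e < j" if "bs \<in> ?L" for bs
  proof (cases "K = {}")
    case False
    have "continuous_on K (\<lambda>x. norm (iter_deriv bs f x - iter_deriv bs g x))"
      by (intro continuous_intros continuous_on_subset[OF smooth_on_continuous_on[OF smooth_on_iter_deriv[OF f]]]
          continuous_on_subset[OF smooth_on_continuous_on[OF smooth_on_iter_deriv[OF assms(2)]]]) auto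
    then obtain x0 where x0: "x0 \<in> K"
      "\<And>x. x \<in> K \<Longrightarrow> norm (iter_deriv bs f x - iter_deriv bs g x) \<le> norm (iter_deriv bs f x0 - iter_deriv bs g x0)"
      using continuous_attains_sup[OF assms(3) False] by blast
    have lt: "norm (iter_deriv bs f x0 - iter_deriv bs g x0) < j"
      using assms(1) x0(1) that by (auto simp: smooth_nbhd_def)
    have gap: "norm (iter_deriv bs f x - iter_deriv bs g x) +
        (j - norm (iter_deriv bs f x0 - iter_deriv bs g x0)) / 2 < j"
      if "x \<in> K" for x
      proof -
        have "a + (j - b) / 2 < j" if "a \<le> b" "b < j" for a b :: real using that by (simp add: field_simps)
        from this[OF x0(2)[OF that] lt] show ?thesis .
      qed
    show ?thesis
      by (rule exI[of _ "(j - norm (iter_deriv bs f x0 - iter_deriv bs g x0)) / 2"])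
        (use gap lt in simp)
  qed (simp add: exI[of _ "1::real"])
  then have "\<forall>bs\<in>?L. \<exists>e. 0 < e \<and> (\<forall>x\<in>K. norm (iter_deriv bs f x - iter_deriv bs g x) + e < j)"
    by (rule ballI)
  from bchoice[OF this] obtain e
    where e': "\<forall>bs\<in>?L. 0 < e bs \<and> (\<forall>x\<in>K. norm (iter_deriv bs f x - iter_deriv bs g x) + e bs < j)"
    by (rule exE)
  have e: "0 < e bs" "x \<in> K \<Longrightarrow> norm (iter_deriv bs f x - iter_deriv bs g x) + e bs < j"
    if "bs \<in> ?L" for bs x
    using bspec[OF e' that] by simp_all
  define \<eta> where "\<eta> = Min (insert 1 (e ` ?L))"
  have \<eta>: "0 < \<eta>" "\<And>bs. bs \<in> ?L \<Longrightarrow> \<eta> \<le> e bs"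
    using finite_Basis_lists[where 'a = 'a] e(1) unfolding \<eta>_def by auto
  show ?thesis
  proof (rule that[OF \<eta>(1)])
    fix h assume h: "smooth_on UNIV h" "deriv_bound N K \<eta> (\<lambda>x. h x + (-1) * f x)"
    have "norm (iter_deriv bs h x - iter_deriv bs g x) < j" if "bs \<in> ?L" "x \<in> K" for bs x
    proof -
      have "norm (iter_deriv bs h x - iter_deriv bs f x) \<le> \<eta>"
        using h(2) that unfolding deriv_bound_def iter_deriv_linear[OF h(1) f] by auto
      then show ?thesis
        using e(2)[OF that] \<eta>(2)[OF that(1)]
          norm_triangle_ineq[of "iter_deriv bs h x - iter_deriv bs f x" "iter_deriv bs f x - iter_deriv bs g x"]
        by simp
    qed
    then show "h \<in> smooth_nbhd g K N j" using h(1) by (simp add: smooth_nbhd_def)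
  qed
qed

text \<open>Subbasic neighbourhoods are centred at arbitrary \<open>g\<close>, not at the image
  point. \<open>smooth_nbhd_gap\<close> provides a smaller ball around \<open>T f\<close>, and the
  seminorm estimate, applied to the difference \<open>h - f\<close>, keeps \<open>T h\<close> inside
  it.\<close>

lemma fs_op_continuous_map:
  fixes T :: "('a::euclidean_space \<Rightarrow> complex) \<Rightarrow> ('b::euclidean_space \<Rightarrow> complex)"
  assumes T: "fs_op E F T" and E: "fs_subspace E" and F: "fs_subspace F"
  shows "continuous_map (subtopology smooth_topology E) (subtopology smooth_topology F) T"
proof -
  have TE: "T f \<in> F" "smooth_on UNIV (T f)" if "f \<in> E" for f
    using T F that by (auto simp: fs_op_def fs_subspace_def)
  have top: "topspace (subtopology smooth_topology E) = E"
    using E by (auto simp: topspace_smooth_topology fs_subspace_def)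
  have "continuous_map (subtopology smooth_topology E) smooth_topology T"
    unfolding smooth_topology_def[where 'a = 'b]
  proof (rule continuous_on_generated_topo)
    fix U :: "('b \<Rightarrow> complex) set"
    assume "U \<in> {smooth_nbhd f K N j |f K N j. smooth_on UNIV f \<and> compact K \<and> 0 < j}"
    then obtain g K N j where U: "U = smooth_nbhd g K N j" and g: "smooth_on UNIV g" "compact K" "0 < j"
      by blast
    show "openin (subtopology smooth_topology E) (T -` U \<inter> topspace (subtopology smooth_topology E))"
    proof (subst openin_subopen, intro ballI)
      fix f assume "f \<in> T -` U \<inter> topspace (subtopology smooth_topology E)"
      then have f: "f \<in> E" "T f \<in> smooth_nbhd g K N j" unfolding top U by auto
      then have sf: "smooth_on UNIV f" using E by (auto simp: fs_subspace_def)
      obtain \<eta> where \<eta>: "0 < \<eta>"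
        "\<And>h. smooth_on UNIV h \<Longrightarrow> deriv_bound N K \<eta> (\<lambda>x. h x + (-1) * T f x) \<Longrightarrow> h \<in> smooth_nbhd g K N j"
        using smooth_nbhd_gap[OF f(2) g] by blast
      obtain N' K' B where B: "compact K'" "0 \<le> B"
        "\<And>f c. f \<in> E \<Longrightarrow> deriv_bound N' K' c f \<Longrightarrow> deriv_bound N K (B * c) (T f)"
        using fs_op_bound[OF T g(2)] by metis
      \<comment> \<open>\<open>B + 1\<close> instead of \<open>B\<close>, because \<open>B\<close>
        may be zero.\<close>
      define \<delta> where "\<delta> = \<eta> / (B + 1)"
      have \<delta>: "0 < \<delta>" "B * \<delta> \<le> \<eta>" using \<eta>(1) B(2) by (auto simp: \<delta>_def field_simps)
      let ?V = "smooth_nbhd f K' N' \<delta> \<inter> E"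
      have "T h \<in> U" if h: "h \<in> ?V" for h
      proof -
        have hE: "h \<in> E" "smooth_on UNIV h" using h E by (auto simp: fs_subspace_def)
        have mf: "(\<lambda>x. (-1) * f x) \<in> E" by (rule fs_subspaceD(3)[OF E f(1)])
        have hf: "(\<lambda>x. h x + (-1) * f x) \<in> E" by (rule fs_subspaceD(2)[OF E hE(1) mf])
        have "deriv_bound N' K' \<delta> (\<lambda>x. h x + (-1) * f x)"
          using h unfolding deriv_bound_def iter_deriv_linear[OF hE(2) sf]
          by (auto simp: smooth_nbhd_def less_imp_le)
        from B(3)[OF hf this] have "deriv_bound N K (B * \<delta>) (T (\<lambda>x. h x + (-1) * f x))" .
        moreover have "T (\<lambda>x. h x + (-1) * f x) = (\<lambda>y. T h y + (-1) * T f y)"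
          using fs_opD(2)[OF T hE(1) mf] fs_opD(3)[OF T f(1), of "-1"] by simp
        ultimately have "deriv_bound N K \<eta> (\<lambda>y. T h y + (-1) * T f y)"
          using \<delta>(2) unfolding deriv_bound_def by (metis order_trans)
        then show ?thesis using \<eta>(2) TE(2)[OF hE(1)] U by blast
      qed
      moreover have "openin (subtopology smooth_topology E) ?V"
        unfolding openin_subtopology using openin_smooth_nbhd[OF sf B(1) \<delta>(1)] by blast
      moreover have "f \<in> ?V" using f(1) sf \<delta>(1) by (simp add: smooth_nbhd_def)
      ultimately show "\<exists>V. openin (subtopology smooth_topology E) V \<and> f \<in> V \<and>
          V \<subseteq> T -` U \<inter> topspace (subtopology smooth_topology E)"
        unfolding top by (intro exI[of _ ?V]) auto
    qed
  next
    have "T f \<in> smooth_nbhd (T f) {} 0 1" if "f \<in> E" for f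
      using TE(2)[OF that] by (simp add: smooth_nbhd_def)
    then show "T ` topspace (subtopology smooth_topology E) \<subseteq>
        \<Union> {smooth_nbhd f K N j |f K N j. smooth_on UNIV f \<and> compact K \<and> 0 < j}"
      unfolding top using TE(2) by (fastforce intro: compact_empty zero_less_one)
  qed
  then show ?thesis
    unfolding continuous_map_in_subtopology using TE(1) top by blast
qed

lemma fs_iso_topological_isomorphism:
  assumes T: "fs_iso E F T" and E: "fs_subspace E" and F: "fs_subspace F"
  shows "topological_isomorphism (subtopology smooth_topology E) (subtopology smooth_topology F) T"
proof -
  have top: "topspace (subtopology smooth_topology E) = E" "topspace (subtopology smooth_topology F) = F"
    using E F by (auto simp: topspace_smooth_topology fs_subspace_def)
  obtain T' where T': "fs_op F E T'" "\<forall>f\<in>E. T' (T f) = f" "\<forall>g\<in>F. T (T' g) = g"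
    using T unfolding fs_iso_def by blast
  have "homeomorphic_maps (subtopology smooth_topology E) (subtopology smooth_topology F) T T'"
    unfolding homeomorphic_maps_def top
    using fs_op_continuous_map[OF _ E F, of T] fs_op_continuous_map[OF T'(1) F E] T T'(2,3)
    unfolding fs_iso_def by blast
  then have "homeomorphic_map (subtopology smooth_topology E) (subtopology smooth_topology F) T"
    using homeomorphic_maps_map by blast
  then show ?thesis
    using T fs_opD[of E F T] unfolding topological_isomorphism_def top fs_iso_def by blast
qed

section \<open>Seminorm estimates for multiplication and substitution\<close>

abbreviation nth_deriv :: "nat \<Rightarrow> (real \<Rightarrow> complex) \<Rightarrow> real \<Rightarrow> complex" where
  "nth_deriv j f \<equiv> iter_deriv (replicate j (1::real)) f"

abbreviation smooth_fns :: "('a::euclidean_space \<Rightarrow> complex) set" where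
  "smooth_fns \<equiv> {f. smooth_on UNIV f}"

lemma replicate_Suc_snoc: "replicate (Suc j) x = replicate j x @ [x]"
  by (simp add: replicate_append_same)

lemma nth_deriv_Suc: "nth_deriv (Suc j) f = nth_deriv j (nth_deriv 1 f)"
  unfolding replicate_Suc_snoc[of j] iter_deriv_append by simp

lemma even_smooth_subspace: "fs_subspace even_smooth"
  by (auto simp: fs_subspace_def even_smooth_def intro!: smooth_on_add smooth_on_mult smooth_on_const)

lemma fs_bounded_subset: "fs_bounded F T \<Longrightarrow> E \<subseteq> F \<Longrightarrow> fs_bounded E T"
  unfolding fs_bounded_def by (meson subset_iff)

lemma deriv_bound_mono: "deriv_bound N K c f \<Longrightarrow> M \<le> N \<Longrightarrow> c \<le> c' \<Longrightarrow> L \<subseteq> K \<Longrightarrow> deriv_bound M L c' f"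
  unfolding deriv_bound_def by (meson order_trans subsetD)

text \<open>\<open>iter_deriv\<close> applies the last list entry first, so splitting lists at the
  end peels off the innermost derivative. Inductions on the order can then pass from
  \<open>f\<close> to its first partial derivatives.\<close>

lemma deriv_bound_Suc_iff:
  "deriv_bound (Suc N) K c f \<longleftrightarrow> (\<forall>x\<in>K. norm (f x) \<le> c) \<and>
     (\<forall>v\<in>Basis. deriv_bound N K c (\<lambda>x. frechet_derivative f (at x) v))" (is "?L \<longleftrightarrow> ?R")
proof
  assume L: ?L
  show ?R
  proof (intro conjI ballI)
    fix x assume "x \<in> K"
    then show "norm (f x) \<le> c" using L unfolding deriv_bound_def by (auto dest: spec[of _ "[]"])
  next
    fix v :: 'a assume v: "v \<in> Basis"
    show "deriv_bound N K c (\<lambda>x. frechet_derivative f (at x) v)"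
      unfolding deriv_bound_def
    proof (intro allI impI ballI)
      fix bs x assume "set bs \<subseteq> (Basis :: 'a set) \<and> length bs \<le> N" "x \<in> K"
      then show "norm (iter_deriv bs (\<lambda>x. frechet_derivative f (at x) v) x) \<le> c"
        using L[unfolded deriv_bound_def, rule_format, of "bs @ [v]" x] v by (simp add: iter_deriv_append)
    qed
  qed
next
  assume R: ?R
  show ?L
    unfolding deriv_bound_def
  proof (intro allI impI ballI)
    fix bs x assume bs: "set bs \<subseteq> (Basis :: 'a set) \<and> length bs \<le> Suc N" and x: "x \<in> K"
    show "norm (iter_deriv bs f x) \<le> c"
    proof (cases bs rule: rev_cases)
      case Nil
      then show ?thesis using R x by simp
    next
      case (snoc vs v)
      then have "deriv_bound N K c (\<lambda>x. frechet_derivative f (at x) v)" "set vs \<subseteq> Basis" "length vs \<le> N"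
        using R bs by auto
      then show ?thesis using x unfolding snoc iter_deriv_append deriv_bound_def by simp
    qed
  qed
qed

lemma deriv_bound_0_iff: "deriv_bound 0 K c f \<longleftrightarrow> (\<forall>x\<in>K. norm (f x) \<le> c)"
  by (auto simp: deriv_bound_def)

lemma deriv_bound_le: "deriv_bound N K c f \<Longrightarrow> x \<in> K \<Longrightarrow> norm (f x) \<le> c"
  unfolding deriv_bound_def by (auto dest: spec[of _ "[]"])

lemma deriv_bound_nonneg: "deriv_bound N K c f \<Longrightarrow> K \<noteq> {} \<Longrightarrow> 0 \<le> c"
  using deriv_bound_le norm_ge_zero order_trans by (metis all_not_in_conv)

lemma deriv_bound_empty: "deriv_bound N {} c f"
  by (simp add: deriv_bound_def)

lemma deriv_bound_add:
  assumes "smooth_on UNIV f" "smooth_on UNIV g" "deriv_bound N K c f" "deriv_bound N K d g"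
  shows "deriv_bound N K (c + d) (\<lambda>x. f x + g x)"
proof -
  have "norm (iter_deriv bs (\<lambda>x. f x + 1 * g x) x) \<le> c + d"
    if "set bs \<subseteq> Basis \<and> length bs \<le> N" "x \<in> K" for bs x
    unfolding iter_deriv_linear[OF assms(1,2)]
    using norm_triangle_mono[of "iter_deriv bs f x" c "iter_deriv bs g x" d] assms(3,4) that
    by (auto simp: deriv_bound_def)
  then show ?thesis unfolding deriv_bound_def by simp
qed

lemma frechet_derivative_mult:
  fixes f g :: "'a::real_normed_vector \<Rightarrow> complex"
  assumes "f differentiable at x" "g differentiable at x"
  shows "frechet_derivative (\<lambda>x. f x * g x) (at x) v =
    frechet_derivative f (at x) v * g x + f x * frechet_derivative g (at x) v"
  using fun_cong[OF frechet_derivative_at[OF has_derivative_mult[OF assms[unfolded frechet_derivative_works]]], of v]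
  by (simp add: algebra_simps)

text \<open>Leibniz rule and induction on \<open>N\<close>, for all \<open>h\<close> at once, since
  the derivatives of \<open>h\<close> occur as multipliers in the next step.\<close>

lemma deriv_bound_mult:
  fixes h :: "'a::euclidean_space \<Rightarrow> complex"
  assumes "smooth_on UNIV h" "compact K"
  shows "\<exists>B\<ge>0. \<forall>f c. smooth_on UNIV f \<longrightarrow> deriv_bound N K c f \<longrightarrow> deriv_bound N K (B * c) (\<lambda>x. h x * f x)"
  using assms(1)
proof (induction N arbitrary: h)
  have *: "\<exists>M\<ge>0. \<forall>x\<in>K. norm (h x) \<le> M" if "smooth_on UNIV h" for h :: "'a \<Rightarrow> complex"
    using compact_imp_bounded[OF compact_continuous_image[OF continuous_on_subset[OF smooth_on_continuous_on[OF that]] assms(2)]]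
    unfolding bounded_pos by (auto intro: less_imp_le)
  {
    case 0
    obtain M where M: "M \<ge> 0" "\<forall>x\<in>K. norm (h x) \<le> M" using *[OF 0] by blast
    have "norm (h x * f x) \<le> M * c" if "\<forall>x\<in>K. norm (f x) \<le> c" "x \<in> K" for f :: "'a \<Rightarrow> complex" and c x
      unfolding norm_mult using M that by (intro mult_mono) auto
    then show ?case using M(1) unfolding deriv_bound_0_iff by blast
  next
    case (Suc N)
    obtain M where M: "M \<ge> 0" "\<forall>x\<in>K. norm (h x) \<le> M" using *[OF Suc.prems] by blast
    obtain B0 where B0: "B0 \<ge> 0"
      "\<And>f c. smooth_on UNIV f \<Longrightarrow> deriv_bound N K c f \<Longrightarrow> deriv_bound N K (B0 * c) (\<lambda>x. h x * f x)"
      using Suc.IH[OF Suc.prems] by blast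
    have "\<forall>v. \<exists>B\<ge>0. \<forall>f c. smooth_on UNIV f \<longrightarrow> deriv_bound N K c f \<longrightarrow>
        deriv_bound N K (B * c) (\<lambda>x. frechet_derivative h (at x) v * f x)"
      using Suc.IH smooth_on_frechet[OF Suc.prems] by blast
    then obtain Bv where Bv: "\<And>v. Bv v \<ge> 0"
      "\<And>v f c. smooth_on UNIV f \<Longrightarrow> deriv_bound N K c f \<Longrightarrow>
        deriv_bound N K (Bv v * c) (\<lambda>x. frechet_derivative h (at x) v * f x)"
      by metis
    define B where "B = M + (B0 + (\<Sum>v\<in>Basis. Bv v))"
    have sum: "0 \<le> (\<Sum>v\<in>Basis. Bv v)" "\<And>v. v \<in> Basis \<Longrightarrow> Bv v \<le> (\<Sum>v\<in>Basis. Bv v)"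
      using Bv(1) by (auto intro: sum_nonneg member_le_sum)
    show ?case
    proof (intro exI[of _ B] conjI allI impI)
      show "0 \<le> B" using M(1) B0(1) sum(1) by (simp add: B_def)
      fix f :: "'a \<Rightarrow> complex" and c assume f: "smooth_on UNIV f" "deriv_bound (Suc N) K c f"
      show "deriv_bound (Suc N) K (B * c) (\<lambda>x. h x * f x)"
      \<comment> \<open>For nonempty \<open>K\<close> the bound \<open>c\<close> is nonnegative,
        which the comparison of the constants requires.\<close>
      proof (cases "K = {}")
        case False
        have c: "0 \<le> c" using deriv_bound_nonneg[OF f(2) False] .
        have fN: "deriv_bound N K c f" using deriv_bound_mono[OF f(2), of N c K] by simp
        show ?thesis
          unfolding deriv_bound_Suc_iff
        proof (intro conjI ballI)
          fix x assume x: "x \<in> K"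
          have "norm (h x * f x) \<le> M * c"
            unfolding norm_mult using M x deriv_bound_le[OF f(2) x] by (intro mult_mono) auto
          also have "M * c \<le> B * c" using c B0(1) sum(1) by (intro mult_right_mono) (auto simp: B_def)
          finally show "norm (h x * f x) \<le> B * c" .
        next
          fix v :: 'a assume v: "v \<in> Basis"
          have "(\<lambda>x. frechet_derivative (\<lambda>x. h x * f x) (at x) v) =
              (\<lambda>x. frechet_derivative h (at x) v * f x + h x * frechet_derivative f (at x) v)"
            by (intro ext frechet_derivative_mult smooth_on_imp_differentiable[OF f(1)]
                smooth_on_imp_differentiable[OF Suc.prems] UNIV_I)
          moreover have "deriv_bound N K (Bv v * c + B0 * c)
              (\<lambda>x. frechet_derivative h (at x) v * f x + h x * frechet_derivative f (at x) v)"
            using f v by (intro deriv_bound_add smooth_on_mult smooth_on_frechet Suc.prems Bv(2) B0(2) fN)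
              (auto simp: deriv_bound_Suc_iff)
          moreover have "Bv v * c + B0 * c \<le> B * c"
            using c sum(2)[OF v] M(1) by (auto simp: B_def distrib_right[symmetric] intro!: mult_right_mono)
          ultimately show "deriv_bound N K (B * c) (\<lambda>x. frechet_derivative (\<lambda>x. h x * f x) (at x) v)"
            by (simp add: deriv_bound_mono[OF _ order_refl _ subset_refl])
        qed
      qed (simp add: deriv_bound_empty)
    qed
  }
qed

lemma fs_bounded_mult:
  assumes "smooth_on UNIV h" shows "fs_bounded smooth_fns (\<lambda>f x. h x * f x)"
  unfolding fs_bounded_def
proof (intro allI impI)
  fix N and K :: "'a set" assume K: "compact K"
  show "\<exists>N' K' B. compact K' \<and> 0 \<le> B \<and>
     (\<forall>f\<in>smooth_fns. \<forall>c. deriv_bound N' K' c f \<longrightarrow> deriv_bound N K (B * c) (\<lambda>x. h x * f x))"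
    using deriv_bound_mult[OF assms K, of N] K by blast
qed

lemma frechet_compose_real:
  fixes s :: "real \<Rightarrow> real" and f :: "real \<Rightarrow> complex"
  assumes "f differentiable at (s x)" "s differentiable at x"
  shows "frechet_derivative (\<lambda>x. f (s x)) (at x) 1 =
    of_real (frechet_derivative s (at x) 1) * frechet_derivative f (at (s x)) 1"
proof -
  have "((f \<circ> s) has_vector_derivative frechet_derivative s (at x) 1 *\<^sub>R frechet_derivative f (at (s x)) 1) (at x)"
    by (intro vector_diff_chain_at has_vector_derivative_frechet assms)
  from vector_derivative_frechet[OF this, of 1] show ?thesis by (simp add: o_def scaleR_conv_of_real)
qed

lemma smooth_on_of_real: "open U \<Longrightarrow> smooth_on U f \<Longrightarrow> smooth_on U (\<lambda>x. of_real (f x) :: complex)"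
  by (rule smooth_on_linear_comp[OF _ bounded_linear_of_real])

text \<open>By the chain rule the derivative is a fixed smooth factor times \<open>f'\<close>
  composed with \<open>s\<close>, so the induction passes to \<open>f'\<close> on the same image of
  \<open>K\<close> and \<open>deriv_bound_mult\<close> absorbs the factor.\<close>

lemma deriv_bound_comp:
  fixes s :: "real \<Rightarrow> real"
  assumes "smooth_on UNIV s" "compact K"
  shows "\<exists>B\<ge>0. \<forall>f c. smooth_on UNIV f \<longrightarrow> deriv_bound N (s ` K) c f \<longrightarrow> deriv_bound N K (B * c) (\<lambda>x. f (s x))"
proof (induction N)
  case 0
  show ?case by (rule exI[of _ 1]) (auto simp: deriv_bound_0_iff)
next
  case (Suc N)
  obtain B0 where B0: "B0 \<ge> 0"
    "\<And>f c. smooth_on UNIV f \<Longrightarrow> deriv_bound N (s ` K) c f \<Longrightarrow> deriv_bound N K (B0 * c) (\<lambda>x. f (s x))"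
    using Suc by blast
  let ?s' = "\<lambda>x. of_real (frechet_derivative s (at x) 1) :: complex"
  have s': "smooth_on UNIV ?s'" by (intro smooth_on_of_real smooth_on_frechet assms) auto
  obtain B1 where B1: "B1 \<ge> 0"
    "\<And>f c. smooth_on UNIV f \<Longrightarrow> deriv_bound N K c f \<Longrightarrow> deriv_bound N K (B1 * c) (\<lambda>x. ?s' x * f x)"
    using deriv_bound_mult[OF s' assms(2), of N] by blast
  show ?case
  proof (intro exI[of _ "1 + B1 * B0"] conjI allI impI)
    show "0 \<le> 1 + B1 * B0" using B0 B1 by simp
    fix f :: "real \<Rightarrow> complex" and c assume f: "smooth_on UNIV f" "deriv_bound (Suc N) (s ` K) c f"
    show "deriv_bound (Suc N) K ((1 + B1 * B0) * c) (\<lambda>x. f (s x))"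
    proof (cases "K = {}")
      case False
      then have c: "0 \<le> c" using deriv_bound_nonneg[OF f(2)] by blast
      have *: "(\<lambda>x. frechet_derivative (\<lambda>x. f (s x)) (at x) 1) = (\<lambda>x. ?s' x * frechet_derivative f (at (s x)) 1)"
        by (intro ext frechet_compose_real smooth_on_imp_differentiable[OF f(1)]
            smooth_on_imp_differentiable[OF assms(1)] UNIV_I)
      have "deriv_bound N K (B1 * (B0 * c)) (\<lambda>x. ?s' x * frechet_derivative f (at (s x)) 1)"
      proof (rule B1(2))
        have "smooth_on UNIV (\<lambda>x. frechet_derivative f (at x) 1)" by (rule smooth_on_frechet[OF f(1)])
        moreover have "deriv_bound N (s ` K) c (\<lambda>x. frechet_derivative f (at x) 1)"
          using f(2) by (simp add: deriv_bound_Suc_iff)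
        ultimately show "deriv_bound N K (B0 * c) (\<lambda>x. frechet_derivative f (at (s x)) 1)"
          by (rule B0(2))
        show "smooth_on UNIV (\<lambda>x. frechet_derivative f (at (s x)) 1)"
          by (rule smooth_on_compose_real[OF open_UNIV open_UNIV smooth_on_frechet[OF f(1)] assms(1)]) simp
      qed
      moreover have "B1 * (B0 * c) \<le> (1 + B1 * B0) * c" "c \<le> (1 + B1 * B0) * c"
        using c B0(1) B1(1) by (auto simp: algebra_simps)
      ultimately have "deriv_bound N K ((1 + B1 * B0) * c) (\<lambda>x. frechet_derivative (\<lambda>x. f (s x)) (at x) 1)"
        unfolding * by (simp add: deriv_bound_mono[OF _ order_refl _ subset_refl])
      moreover have "norm (f (s x)) \<le> (1 + B1 * B0) * c" if "x \<in> K" for x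
        using deriv_bound_le[OF f(2), of "s x"] that \<open>c \<le> (1 + B1 * B0) * c\<close> by auto
      ultimately show ?thesis unfolding deriv_bound_Suc_iff by simp
    qed (simp add: deriv_bound_empty)
  qed
qed

lemma fs_bounded_comp:
  fixes s :: "real \<Rightarrow> real"
  assumes "smooth_on UNIV s" shows "fs_bounded smooth_fns (\<lambda>f x. f (s x))"
  unfolding fs_bounded_def
proof (intro allI impI)
  fix N and K :: "real set" assume K: "compact K"
  then have "compact (s ` K)"
    using compact_continuous_image continuous_on_subset[OF smooth_on_continuous_on[OF assms]] by blast
  then show "\<exists>N' K' B. compact K' \<and> 0 \<le> B \<and>
     (\<forall>f\<in>smooth_fns. \<forall>c. deriv_bound N' K' c f \<longrightarrow> deriv_bound N K (B * c) (\<lambda>x. f (s x)))"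
    using deriv_bound_comp[OF assms K, of N] by blast
qed

text \<open>With the angle as integration variable the singular kernels of half order become
  continuous weights on a fixed interval, and the result is defined for all real \<open>r\<close>,
  even in \<open>r\<close> whenever \<open>f\<close> is even.\<close>

definition dilate_int :: "(real \<Rightarrow> real) \<Rightarrow> (real \<Rightarrow> complex) \<Rightarrow> real \<Rightarrow> complex" where
  "dilate_int w f r = integral {0..pi / 2} (\<lambda>\<theta>. of_real (w \<theta>) * f (r * sin \<theta>))"

lemma continuous_on_dilate_integrand:
  fixes w :: "real \<Rightarrow> real" and f :: "real \<Rightarrow> complex"
  assumes "continuous_on UNIV w" "continuous_on UNIV f"
  shows "continuous_on A (\<lambda>(r, \<theta>). of_real (w \<theta>) * f (r * sin \<theta>) :: complex)"
proof -
  have "continuous_on A (\<lambda>x. w (snd x))" "continuous_on A (\<lambda>x. f (fst x * sin (snd x)))"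
    by (rule continuous_on_compose2[OF assms(1) continuous_on_snd[OF continuous_on_id]], simp)
      (rule continuous_on_compose2[OF assms(2) continuous_on_mult[OF continuous_on_fst[OF continuous_on_id]
          continuous_on_sin[OF continuous_on_snd[OF continuous_on_id]]]], simp)
  then show ?thesis unfolding split_beta by (intro continuous_intros)
qed

lemma dilate_integrable:
  fixes w :: "real \<Rightarrow> real" and f :: "real \<Rightarrow> complex"
  assumes "continuous_on UNIV w" "continuous_on UNIV f"
  shows "(\<lambda>\<theta>. of_real (w \<theta>) * f (r * sin \<theta>) :: complex) integrable_on {a..b}"
proof -
  have "continuous_on {a..b} w" "continuous_on {a..b} (\<lambda>\<theta>. f (r * sin \<theta>))"
    by (rule continuous_on_subset[OF assms(1)], simp)
      (rule continuous_on_compose2[OF assms(2) continuous_on_mult[OF continuous_on_const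
          continuous_on_sin[OF continuous_on_id]]], simp)
  then show ?thesis by (intro integrable_continuous_real continuous_intros)
qed

lemma dilate_int_continuous:
  assumes "continuous_on UNIV w" "continuous_on UNIV f"
  shows "continuous_on UNIV (dilate_int w f)"
  using integral_continuous_on_param[OF continuous_on_dilate_integrand[OF assms, of "UNIV \<times> cbox 0 (pi / 2)"]]
  unfolding dilate_int_def[abs_def] by (simp add: cbox_interval)

lemma dilate_int_bound:
  assumes "continuous_on UNIV w" "continuous_on UNIV f" "\<And>\<theta>. \<bar>w \<theta>\<bar> \<le> M" "\<bar>r\<bar> \<le> R"
    and "\<And>x. \<bar>x\<bar> \<le> R \<Longrightarrow> norm (f x) \<le> e"
  shows "norm (dilate_int w f r) \<le> M * (pi / 2) * e"
proof -
  have "norm (integral (cbox 0 (pi / 2)) (\<lambda>\<theta>. of_real (w \<theta>) * f (r * sin \<theta>))) \<le> (M * e) * measure lborel (cbox 0 (pi / 2))"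
  proof (rule integrable_bound)
    have "0 \<le> M" "0 \<le> e"
      using assms(3)[of 0] order_trans[OF norm_ge_zero assms(5)[of r]] assms(4) by auto
    then show "0 \<le> M * e" by simp
    show "(\<lambda>\<theta>. of_real (w \<theta>) * f (r * sin \<theta>)) integrable_on cbox 0 (pi / 2)"
      using dilate_integrable[OF assms(1,2)] by (simp add: cbox_interval)
    fix x assume "x \<in> cbox 0 (pi / 2)"
    have "\<bar>r * sin x\<bar> \<le> \<bar>r\<bar>" using abs_sin_le_one[of x] by (simp add: abs_mult mult_left_le)
    then show "norm (of_real (w x) * f (r * sin x)) \<le> M * e"
      unfolding norm_mult using assms(3,4) \<open>0 \<le> M\<close> by (intro mult_mono assms(5)) auto
  qed
  then show ?thesis by (simp add: dilate_int_def cbox_interval mult_ac)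
qed

lemma dilate_int_has_derivative:
  assumes w: "continuous_on UNIV w" and f: "smooth_on UNIV f"
  shows "(dilate_int w f has_vector_derivative dilate_int (\<lambda>\<theta>. w \<theta> * sin \<theta>) (nth_deriv 1 f) r) (at r)"
proof -
  have "((\<lambda>r. integral (cbox 0 (pi / 2)) (\<lambda>\<theta>. of_real (w \<theta>) * f (r * sin \<theta>))) has_vector_derivative
      integral (cbox 0 (pi / 2)) (\<lambda>\<theta>. of_real (w \<theta> * sin \<theta>) * nth_deriv 1 f (r * sin \<theta>))) (at r within UNIV)"
  proof (rule leibniz_rule_vector_derivative)
    fix x \<theta> :: real
    have "((f \<circ> (\<lambda>x. x * sin \<theta>)) has_vector_derivative sin \<theta> *\<^sub>R nth_deriv 1 f (x * sin \<theta>)) (at x)"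
      using has_vector_derivative_iter[OF f, of "x * sin \<theta>" 0]
      by (intro vector_diff_chain_at) (auto intro!: derivative_eq_intros simp: has_real_derivative_iff_has_vector_derivative[symmetric])
    then have "((\<lambda>x. of_real (w \<theta>) * f (x * sin \<theta>)) has_vector_derivative
        of_real (w \<theta>) * (sin \<theta> *\<^sub>R nth_deriv 1 f (x * sin \<theta>))) (at x)"
      unfolding o_def by (rule has_vector_derivative_mult_right)
    then show "((\<lambda>x. of_real (w \<theta>) * f (x * sin \<theta>)) has_vector_derivative
        of_real (w \<theta> * sin \<theta>) * nth_deriv 1 f (x * sin \<theta>)) (at x within UNIV)"
      by (simp add: scaleR_conv_of_real mult_ac)
  next
    show "(\<lambda>\<theta>. of_real (w \<theta>) * f (x * sin \<theta>)) integrable_on cbox 0 (pi / 2)" for x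
      using dilate_integrable[OF w smooth_on_continuous_on[OF f]] by (simp add: cbox_interval)
    show "continuous_on (UNIV \<times> cbox 0 (pi / 2)) (\<lambda>(x, \<theta>). of_real (w \<theta> * sin \<theta>) * nth_deriv 1 f (x * sin \<theta>))"
      by (intro continuous_on_dilate_integrand continuous_intros w smooth_on_continuous_on smooth_on_iter_deriv f)
  qed auto
  then show ?thesis by (simp add: dilate_int_def[abs_def] cbox_interval)
qed

text \<open>Differentiation under the integral only multiplies the weight by
  \<open>sin \<theta>\<close>, so all derivatives are again averages of dilates.\<close>

lemma dilate_int_smooth:
  assumes w: "continuous_on UNIV w" and f: "smooth_on UNIV f"
  shows "smooth_on UNIV (dilate_int w f)"
    and "nth_deriv j (dilate_int w f) r = dilate_int (\<lambda>\<theta>. w \<theta> * sin \<theta> ^ j) (nth_deriv j f) r"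
proof -
  define F where "F j = dilate_int (\<lambda>\<theta>. w \<theta> * sin \<theta> ^ j) (nth_deriv j f)" for j
  have "(F j has_vector_derivative F (Suc j) r) (at r)" for j r
  proof -
    have "continuous_on UNIV (\<lambda>\<theta>. w \<theta> * sin \<theta> ^ j)" by (intro continuous_intros w)
    from dilate_int_has_derivative[OF this smooth_on_iter_deriv[OF f], of "replicate j 1" r]
    have "(F j has_vector_derivative dilate_int (\<lambda>\<theta>. w \<theta> * sin \<theta> ^ j * sin \<theta>) (nth_deriv 1 (nth_deriv j f)) r) (at r)"
      by (simp add: F_def)
    moreover have "(\<lambda>\<theta>. w \<theta> * sin \<theta> ^ j * sin \<theta>) = (\<lambda>\<theta>. w \<theta> * sin \<theta> ^ Suc j)"
      by (simp add: fun_eq_iff)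
    ultimately show ?thesis unfolding F_def by simp
  qed
  from smooth_on_seq[of UNIV F, OF _ this]
  show "smooth_on UNIV (dilate_int w f)"
    "nth_deriv j (dilate_int w f) r = dilate_int (\<lambda>\<theta>. w \<theta> * sin \<theta> ^ j) (nth_deriv j f) r"
    by (auto simp: F_def)
qed

lemma deriv_bound_real_iff:
  "deriv_bound N K c f \<longleftrightarrow> (\<forall>j\<le>N. \<forall>x\<in>K. norm (nth_deriv j f x) \<le> c)"
proof
  assume *: "deriv_bound N K c f"
  show "\<forall>j\<le>N. \<forall>x\<in>K. norm (nth_deriv j f x) \<le> c"
  proof (intro allI impI ballI)
    fix j x assume "j \<le> N" "x \<in> K"
    then show "norm (nth_deriv j f x) \<le> c"
      using *[unfolded deriv_bound_def, rule_format, of "replicate j 1" x] by (auto simp: set_replicate_conv_if)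
  qed
next
  assume *: "\<forall>j\<le>N. \<forall>x\<in>K. norm (nth_deriv j f x) \<le> c"
  show "deriv_bound N K c f"
    unfolding deriv_bound_def using * set_Basis_real by metis
qed

text \<open>Powers of \<open>sin\<close> do not increase the bound of the weight, so one constant
  serves all orders and no derivative is lost. The compact set is enlarged to a symmetric interval
  because it must contain all \<open>r * sin \<theta>\<close>.\<close>

lemma fs_bounded_dilate_int:
  assumes w: "continuous_on UNIV w" and M: "\<And>\<theta>. \<bar>w \<theta>\<bar> \<le> M"
  shows "fs_bounded smooth_fns (dilate_int w)"
  unfolding fs_bounded_def
proof (intro allI impI)
  fix N and K :: "real set" assume "compact K"
  then obtain R where R: "\<And>x. x \<in> K \<Longrightarrow> \<bar>x\<bar> \<le> R"
    using compact_imp_bounded bounded_iff by (metis real_norm_def)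
  have "0 \<le> M" using M[of 0] by simp
  show "\<exists>N' K' B. compact K' \<and> 0 \<le> B \<and>
     (\<forall>f\<in>smooth_fns. \<forall>c. deriv_bound N' K' c f \<longrightarrow> deriv_bound N K (B * c) (dilate_int w f))"
  proof (intro exI[of _ N] exI[of _ "{-R..R}"] exI[of _ "M * (pi / 2)"] conjI ballI allI impI)
    show "0 \<le> M * (pi / 2)" using \<open>0 \<le> M\<close> by simp
    fix f c assume f: "f \<in> smooth_fns" "deriv_bound N {- R..R} c f"
    show "deriv_bound N K (M * (pi / 2) * c) (dilate_int w f)"
      unfolding deriv_bound_real_iff
    proof (intro allI impI ballI)
      fix j r assume j: "j \<le> N" and r: "r \<in> K"
      have "\<bar>w \<theta> * sin \<theta> ^ j\<bar> \<le> M" for \<theta>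
        using mult_mono[OF M[of \<theta>] power_le_one[of "\<bar>sin \<theta>\<bar>" j]] \<open>0 \<le> M\<close> abs_sin_le_one[of \<theta>]
        by (simp add: abs_mult power_abs)
      then show "norm (nth_deriv j (dilate_int w f) r) \<le> M * (pi / 2) * c"
        using f j R[OF r] smooth_on_iter_deriv[THEN smooth_on_continuous_on]
        unfolding dilate_int_smooth(2)[OF w, of f, OF f(1)[unfolded mem_Collect_eq]]
        by (intro dilate_int_bound[where R = R]) (auto intro!: continuous_intros w simp: deriv_bound_real_iff abs_le_iff)
    qed
  qed auto
qed

lemma dilate_int_add:
  assumes "continuous_on UNIV w" "continuous_on UNIV f" "continuous_on UNIV g"
  shows "dilate_int w (\<lambda>x. f x + g x) = (\<lambda>r. dilate_int w f r + dilate_int w g r)"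
  unfolding dilate_int_def[abs_def]
  using dilate_integrable[OF assms(1,2)] dilate_integrable[OF assms(1,3)]
  by (simp add: distrib_left integral_add)

lemma dilate_int_cmult: "dilate_int w (\<lambda>x. c * f x) = (\<lambda>r. c * dilate_int w f r)"
  unfolding dilate_int_def[abs_def] by (subst integral_mult_right[symmetric]) (simp add: mult_ac)

lemma dilate_int_scale: "dilate_int (\<lambda>\<theta>. a * w \<theta>) f r = of_real a * dilate_int w f r"
  unfolding dilate_int_def by (subst integral_mult_right[symmetric]) (simp add: mult_ac)

lemma fs_op_dilate_int:
  assumes w: "continuous_on UNIV w" and M: "\<And>\<theta>. \<bar>w \<theta>\<bar> \<le> M"
  shows "fs_op even_smooth even_smooth (dilate_int w)"
  unfolding fs_op_def
proof (intro conjI ballI allI)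
  show "dilate_int w f \<in> even_smooth" if "f \<in> even_smooth" for f
    using dilate_int_smooth(1)[OF w, of f] that by (auto simp: even_smooth_def dilate_int_def)
  show "dilate_int w (\<lambda>x. f x + g x) = (\<lambda>r. dilate_int w f r + dilate_int w g r)"
    if "f \<in> even_smooth" "g \<in> even_smooth" for f g
    using that by (intro dilate_int_add w smooth_on_continuous_on) (auto simp: even_smooth_def)
  show "fs_bounded even_smooth (dilate_int w)"
    using fs_bounded_dilate_int[OF w M] by (rule fs_bounded_subset) (auto simp: even_smooth_def)
qed (rule dilate_int_cmult)

lemma fs_op_mult:
  assumes "h \<in> even_smooth" shows "fs_op even_smooth even_smooth (\<lambda>f x. h x * f x)"
  unfolding fs_op_def
proof (intro conjI ballI allI)
  show "(\<lambda>x. h x * f x) \<in> even_smooth" if "f \<in> even_smooth" for f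
    using that assms by (auto simp: even_smooth_def intro: smooth_on_mult)
  show "fs_bounded even_smooth (\<lambda>f x. h x * f x)"
    by (rule fs_bounded_subset[OF fs_bounded_mult]) (use assms in \<open>auto simp: even_smooth_def\<close>)
qed (auto simp: algebra_simps)

lemma fs_iso_mult:
  assumes "smooth_on UNIV p" "\<And>x. p (- x) = p x" "\<And>x. 0 < (p x :: real)"
  shows "fs_iso even_smooth even_smooth (\<lambda>f x. of_real (p x) * f x)"
proof -
  have "(\<lambda>x. of_real (p x)) \<in> even_smooth" "(\<lambda>x. of_real (inverse (p x))) \<in> even_smooth"
    using assms unfolding even_smooth_def
    by (auto intro!: smooth_on_of_real smooth_on_compose_real[OF _ _ smooth_on_inverse assms(1)] simp del: of_real_inverse)
  then have *: "fs_op even_smooth even_smooth (\<lambda>f x. of_real (p x) * f x)"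
    "fs_op even_smooth even_smooth (\<lambda>f x. of_real (inverse (p x)) * f x)"
    by (auto intro: fs_op_mult)
  have "p x \<noteq> 0" for x using assms(3)[of x] by simp
  then show ?thesis
    unfolding fs_iso_def using * by (intro conjI exI[of _ "\<lambda>f x. of_real (inverse (p x)) * f x"]) auto
qed

lemma fs_op_compose:
  fixes s :: "real \<Rightarrow> real"
  assumes "smooth_on UNIV s" "\<And>x. s (- x) = - s x"
  shows "fs_op even_smooth even_smooth (\<lambda>f x. f (s x))"
  unfolding fs_op_def
proof (intro conjI ballI allI)
  show "(\<lambda>x. f (s x)) \<in> even_smooth" if "f \<in> even_smooth" for f
    using that assms by (auto simp: even_smooth_def intro: smooth_on_compose_real[of UNIV UNIV])
  show "fs_bounded even_smooth (\<lambda>f x. f (s x))"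
    by (rule fs_bounded_subset[OF fs_bounded_comp]) (use assms in \<open>auto simp: even_smooth_def\<close>)
qed auto

lemma smooth_on_sinh: "smooth_on UNIV (sinh :: real \<Rightarrow> real)"
  and smooth_on_cosh: "smooth_on UNIV (cosh :: real \<Rightarrow> real)"
proof -
  have "smooth_on UNIV (\<lambda>x :: real. exp (- x))"
    by (intro smooth_on_compose_real[OF _ open_UNIV smooth_on_exp] smooth_on_minus smooth_on_bounded_linear
        bounded_linear_ident) auto
  then have "smooth_on UNIV (\<lambda>x :: real. (1 / 2) * (exp x - exp (- x)))"
    "smooth_on UNIV (\<lambda>x :: real. (1 / 2) * (exp x + exp (- x)))"
    by (intro smooth_on_mult smooth_on_const smooth_on_diff smooth_on_add smooth_on_exp open_UNIV; assumption)+
  then show "smooth_on UNIV (sinh :: real \<Rightarrow> real)" "smooth_on UNIV (cosh :: real \<Rightarrow> real)"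
    by (simp_all add: sinh_def[abs_def] cosh_def[abs_def])
qed

lemma smooth_on_arsinh: "smooth_on UNIV (arsinh :: real \<Rightarrow> real)"
proof (rule smooth_on_deriv1)
  show "(arsinh has_vector_derivative inverse (sqrt (x * x + 1))) (at x)" for x :: real
    unfolding has_real_derivative_iff_has_vector_derivative[symmetric]
    by (auto intro!: derivative_eq_intros simp: power2_eq_square divide_inverse)
  have "0 < x * x + 1" for x :: real by (simp add: add_nonneg_pos)
  then show "smooth_on UNIV (\<lambda>x :: real. inverse (sqrt (x * x + 1)))"
    by (intro smooth_on_compose_real[OF _ _ smooth_on_inverse] smooth_on_compose_real[OF _ _ smooth_on_sqrt]
        smooth_on_add smooth_on_mult smooth_on_const smooth_on_bounded_linear bounded_linear_ident) auto
qed auto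

lemma smooth_on_scale_arg:
  fixes f :: "real \<Rightarrow> 'b::real_normed_vector"
  shows "smooth_on UNIV f \<Longrightarrow> smooth_on UNIV (\<lambda>x. f (c * x))"
  by (rule smooth_on_compose_real[of UNIV UNIV])
    (auto intro!: smooth_on_bounded_linear bounded_linear_mult_right)

text \<open>\<open>sinh\<close> is an odd diffeomorphism of the line, so substituting it or its
  inverse preserves evenness. This moves between the variable \<open>r\<close> and
  \<open>x = sinh (\<tau> r)\<close>.\<close>

lemma fs_iso_sinh:
  assumes "\<tau> \<noteq> 0"
  shows "fs_iso even_smooth even_smooth (\<lambda>f x. f (sinh (\<tau> * x)))"
    and "fs_iso even_smooth even_smooth (\<lambda>f x. f ((1 / \<tau>) * arsinh x))"
proof -
  have 1: "fs_op even_smooth even_smooth (\<lambda>f x. f (sinh (\<tau> * x)))"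
    by (intro fs_op_compose smooth_on_scale_arg smooth_on_sinh) auto
  have 2: "fs_op even_smooth even_smooth (\<lambda>f x. f ((1 / \<tau>) * arsinh x))"
    by (intro fs_op_compose smooth_on_mult smooth_on_const smooth_on_arsinh) auto
  have "\<tau> * (1 / \<tau> * arsinh x) = arsinh x" "1 / \<tau> * (\<tau> * x) = x" for x
    using assms by simp_all
  then have *: "(\<lambda>x. f (1 / \<tau> * arsinh (sinh (\<tau> * x)))) = f"
    "(\<lambda>x. f (sinh (\<tau> * (1 / \<tau> * arsinh x)))) = f" for f :: "real \<Rightarrow> complex"
    by (simp_all add: arsinh_sinh_real)
  show "fs_iso even_smooth even_smooth (\<lambda>f x. f (sinh (\<tau> * x)))"
    unfolding fs_iso_def by (rule conjI[OF 1], rule exI, rule conjI[OF 2]) (use * in blast)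
  show "fs_iso even_smooth even_smooth (\<lambda>f x. f ((1 / \<tau>) * arsinh x))"
    unfolding fs_iso_def by (rule conjI[OF 2], rule exI, rule conjI[OF 1]) (use * in blast)
qed

section \<open>Erdelyi-Kober operators\<close>

lemma Gamma_half_nonzero: "0 < n \<Longrightarrow> Gamma (real n / 2) \<noteq> 0"
  using Gamma_real_pos[of "real n / 2"] less_imp_neq[of 0 "Gamma (real n / 2)"] by simp

definition ek_weight :: "nat \<Rightarrow> nat \<Rightarrow> real \<Rightarrow> real" where
  "ek_weight j d \<theta> = 2 / Gamma (real d / 2) * (cos \<theta> ^ (d - 1) * sin \<theta> ^ j)"

text \<open>For \<open>x > 0\<close> and \<open>t = x^2\<close>, the product
  \<open>x^(j + d - 1) * ek j d f x\<close> is the Riemann-Liouville integral of order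
  \<open>d / 2\<close> in \<open>t\<close> of \<open>t^((j - 1) / 2) * f (sqrt t)\<close>. So
  \<open>d\<close> counts half orders, and the factor \<open>2 / Gamma (d / 2)\<close> in the weight
  is the one for which orders add up.\<close>

definition ek :: "nat \<Rightarrow> nat \<Rightarrow> (real \<Rightarrow> complex) \<Rightarrow> real \<Rightarrow> complex" where
  "ek j d f = (if d = 0 then f else dilate_int (ek_weight j d) f)"

lemma ek_0 [simp]: "ek j 0 f = f"
  by (simp add: ek_def)

lemma ek_weight_continuous: "continuous_on A (ek_weight j d)"
  unfolding ek_weight_def[abs_def] by (intro continuous_intros)

lemma ek_weight_bound: "\<bar>ek_weight j d \<theta>\<bar> \<le> \<bar>2 / Gamma (real d / 2)\<bar>"
proof -
  have "\<bar>cos \<theta>\<bar> ^ (d - 1) * \<bar>sin \<theta>\<bar> ^ j \<le> 1" by (intro mult_le_one power_le_one) auto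
  from mult_left_mono[OF this, of "\<bar>2 / Gamma (real d / 2)\<bar>"]
  show ?thesis unfolding ek_weight_def abs_mult power_abs by simp
qed

lemma fs_op_ek: "fs_op even_smooth even_smooth (ek j d)"
proof (cases "d = 0")
  case True
  have "fs_op even_smooth even_smooth (\<lambda>f x. of_real 1 * f x)"
    using fs_iso_mult[of "\<lambda>_. 1"] unfolding fs_iso_def by (auto intro: smooth_on_const)
  then show ?thesis using True by (simp add: ek_def[abs_def])
next
  case False
  then show ?thesis
    unfolding ek_def[abs_def] using fs_op_dilate_int[OF ek_weight_continuous ek_weight_bound] by simp
qed

lemma ek_continuous: "continuous_on UNIV f \<Longrightarrow> continuous_on UNIV (ek j d f)"
  unfolding ek_def by (auto intro: dilate_int_continuous ek_weight_continuous)

lemma ek_add: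
  "continuous_on UNIV f \<Longrightarrow> continuous_on UNIV g \<Longrightarrow> ek j d (\<lambda>x. f x + g x) = (\<lambda>r. ek j d f r + ek j d g r)"
  unfolding ek_def by (auto intro: dilate_int_add ek_weight_continuous)

lemma ek_cmult: "ek j d (\<lambda>x. c * f x) = (\<lambda>r. c * ek j d f r)"
  unfolding ek_def by (auto simp: dilate_int_cmult)

lemma ek_bound:
  assumes "continuous_on UNIV f" "0 < d" "\<bar>r\<bar> \<le> R" "\<And>x. \<bar>x\<bar> \<le> R \<Longrightarrow> norm (f x) \<le> e"
  shows "norm (ek j d f r) \<le> \<bar>2 / Gamma (real d / 2)\<bar> * (pi / 2) * e"
proof -
  have "ek j d f r = dilate_int (ek_weight j d) f r" using assms(2) by (simp add: ek_def)
  then show ?thesis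
    using dilate_int_bound[OF ek_weight_continuous assms(1) ek_weight_bound assms(3,4)] by (simp only:)
qed

lemma ek_deriv:
  assumes f: "smooth_on UNIV f" and "0 < d"
  shows "smooth_on UNIV (ek j d f)" "nth_deriv 1 (ek j d f) r = ek (Suc j) d (nth_deriv 1 f) r"
proof -
  show "smooth_on UNIV (ek j d f)"
    using assms dilate_int_smooth(1)[OF ek_weight_continuous f] by (simp add: ek_def)
  have "(\<lambda>\<theta>. ek_weight j d \<theta> * sin \<theta> ^ 1) = ek_weight (Suc j) d"
    by (simp add: ek_weight_def fun_eq_iff mult_ac)
  then show "nth_deriv 1 (ek j d f) r = ek (Suc j) d (nth_deriv 1 f) r"
    using assms(2) dilate_int_smooth(2)[OF ek_weight_continuous f, where j = 1 and r = r] by (simp add: ek_def)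
qed

lemma ek_eq_integral:
  assumes "0 < d"
  shows "ek j d f r = of_real (2 / Gamma (real d / 2)) *
    integral {0..pi / 2} (\<lambda>\<theta>. of_real (cos \<theta> ^ (d - 1) * sin \<theta> ^ j) * f (r * sin \<theta>))"
  using assms dilate_int_scale[of "2 / Gamma (real d / 2)" "\<lambda>\<theta>. cos \<theta> ^ (d - 1) * sin \<theta> ^ j" f r]
  by (simp add: ek_def dilate_int_def ek_weight_def)

text \<open>Both sides average \<open>f (r * sin x * sin y)\<close> over the same square; Fubini for
  a continuous integrand.\<close>

lemma ek_commute:
  assumes "continuous_on UNIV f"
  shows "ek i d (ek j \<mu> f) = ek j \<mu> (ek i d f)"
proof (cases "d = 0 \<or> \<mu> = 0")
  case False
  define u where "u = ek_weight i d"
  define v where "v = ek_weight j \<mu>"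
  have cu: "continuous_on A u" and cv: "continuous_on A v" for A
    unfolding u_def v_def by (rule ek_weight_continuous)+
  have "dilate_int u (dilate_int v f) r = dilate_int v (dilate_int u f) r" for r
  proof -
    have "continuous_on (cbox (0, 0) (pi / 2, pi / 2))
        (\<lambda>(x, y). of_real (u x) * (of_real (v y) * f (r * sin x * sin y)))"
    proof -
      have "continuous_on A (\<lambda>x. f (r * sin (fst x) * sin (snd x)))" for A :: "(real \<times> real) set"
        by (rule continuous_on_compose2[OF assms]) (auto intro!: continuous_intros)
      moreover have "continuous_on A (\<lambda>x. u (fst x))" "continuous_on A (\<lambda>x. v (snd x))" for A :: "(real \<times> real) set"
        by (rule continuous_on_compose2[OF cu[of UNIV]] continuous_on_compose2[OF cv[of UNIV]]; auto intro!: continuous_intros)+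
      ultimately show ?thesis unfolding split_beta by (intro continuous_intros)
    qed
    from integral_swap_continuous[OF this]
    have *: "integral {0..pi / 2} (\<lambda>x. integral {0..pi / 2} (\<lambda>y. of_real (u x) * (of_real (v y) * f (r * sin x * sin y)))) =
      integral {0..pi / 2} (\<lambda>y. integral {0..pi / 2} (\<lambda>x. of_real (u x) * (of_real (v y) * f (r * sin x * sin y))))"
      by (simp add: cbox_interval)
    have "integral {0..pi / 2} (\<lambda>y. integral {0..pi / 2} (\<lambda>x. of_real (u x) * (of_real (v y) * f (r * sin x * sin y)))) =
      integral {0..pi / 2} (\<lambda>y. of_real (v y) * integral {0..pi / 2} (\<lambda>x. of_real (u x) * f (r * sin y * sin x)))"
      by (subst integral_mult_right[symmetric]) (simp add: mult_ac)
    moreover have "integral {0..pi / 2} (\<lambda>x. integral {0..pi / 2} (\<lambda>y. of_real (u x) * (of_real (v y) * f (r * sin x * sin y)))) =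
      integral {0..pi / 2} (\<lambda>x. of_real (u x) * integral {0..pi / 2} (\<lambda>y. of_real (v y) * f (r * sin x * sin y)))"
      by simp
    ultimately show ?thesis using * unfolding dilate_int_def by simp
  qed
  then show ?thesis using False by (simp add: ek_def u_def v_def fun_eq_iff)
qed auto

text \<open>The Wallis integral is a Beta integral in the variable \<open>t = sin\<^sup>2 \<theta>\<close>; the recursion
  avoids the singular substitution.\<close>

lemma wallis_step:
  "real (a + b + 2) * integral {0..pi / 2} (\<lambda>\<theta>. cos \<theta> ^ a * sin \<theta> ^ (b + 2)) =
   real (b + 1) * integral {0..pi / 2} (\<lambda>\<theta>. cos \<theta> ^ a * sin \<theta> ^ b)"
proof -
  \<comment> \<open>\<open>?F\<close> vanishes at both ends, so its derivative, rewritten with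
    \<open>cos^2 = 1 - sin^2\<close>, integrates to zero.\<close>
  let ?F = "\<lambda>\<theta>. cos \<theta> ^ (a + 1) * sin \<theta> ^ (b + 1)"
  have A: "((\<lambda>\<theta>. real (b + 1) * (cos \<theta> ^ a * sin \<theta> ^ b) - real (a + b + 2) * (cos \<theta> ^ a * sin \<theta> ^ (b + 2)))
      has_integral ?F (pi / 2) - ?F 0) {0..pi / 2}"
  proof (rule fundamental_theorem_of_calculus)
    fix \<theta> :: real
    have c: "cos \<theta> ^ (a + 2) = cos \<theta> ^ a * (1 - sin \<theta> ^ 2)" by (simp only: power_add cos_squared_eq)
    have "((\<lambda>\<theta>. cos \<theta> ^ Suc a * sin \<theta> ^ Suc b) has_real_derivative
        (1 + real a) * (- sin \<theta> * cos \<theta> ^ a) * sin \<theta> ^ Suc b + (1 + real b) * (cos \<theta> * sin \<theta> ^ b) * cos \<theta> ^ Suc a)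
        (at \<theta> within {0..pi / 2})"
      by (rule DERIV_mult; rule DERIV_power_Suc; auto intro!: derivative_eq_intros)
    then have "(?F has_real_derivative (real (b + 1) * (cos \<theta> ^ (a + 2) * sin \<theta> ^ b) - real (a + 1) * (cos \<theta> ^ a * sin \<theta> ^ (b + 2))))
        (at \<theta> within {0..pi / 2})"
      unfolding Suc_eq_plus1
    proof (rule DERIV_cong)
      have "(1 + x) * (- s * C) * (S * s) + (1 + y) * (c * S) * (C * c) = (y + 1) * (C * (c * c) * S) - (x + 1) * (C * (S * (s * s)))"
        for x y s c S C :: real by (simp add: algebra_simps)
      from this[of "real a" "sin \<theta>" "cos \<theta> ^ a" "sin \<theta> ^ b" "real b" "cos \<theta>"]
      show "(1 + real a) * (- sin \<theta> * cos \<theta> ^ a) * sin \<theta> ^ (b + 1) + (1 + real b) * (cos \<theta> * sin \<theta> ^ b) * cos \<theta> ^ (a + 1) =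
        real (b + 1) * (cos \<theta> ^ (a + 2) * sin \<theta> ^ b) - real (a + 1) * (cos \<theta> ^ a * sin \<theta> ^ (b + 2))"
        by (simp only: power_add power_one_right power2_eq_square of_nat_add of_nat_1)
    qed
    also have "real (b + 1) * (cos \<theta> ^ (a + 2) * sin \<theta> ^ b) - real (a + 1) * (cos \<theta> ^ a * sin \<theta> ^ (b + 2)) =
        real (b + 1) * (cos \<theta> ^ a * sin \<theta> ^ b) - real (a + b + 2) * (cos \<theta> ^ a * sin \<theta> ^ (b + 2))"

    proof -
      have s: "sin \<theta> ^ (b + 2) = sin \<theta> ^ b * sin \<theta> ^ 2" by (rule power_add)
      have n: "real (a + b + 2) = real (a + 1) + real (b + 1)" by simp
      have "q * (C * (1 - t) * S) - p * (C * (S * t)) = q * (C * S) - (p + q) * (C * (S * t))" for p q C S t :: real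
        by (simp add: algebra_simps)
      then show ?thesis unfolding c s n .
    qed
    finally show "(?F has_vector_derivative
        real (b + 1) * (cos \<theta> ^ a * sin \<theta> ^ b) - real (a + b + 2) * (cos \<theta> ^ a * sin \<theta> ^ (b + 2))) (at \<theta> within {0..pi / 2})"
      by (simp add: has_real_derivative_iff_has_vector_derivative)
  qed simp
  have B: "((\<lambda>\<theta>. real (b + 1) * (cos \<theta> ^ a * sin \<theta> ^ b) - real (a + b + 2) * (cos \<theta> ^ a * sin \<theta> ^ (b + 2)))
      has_integral real (b + 1) * integral {0..pi / 2} (\<lambda>\<theta>. cos \<theta> ^ a * sin \<theta> ^ b) -
        real (a + b + 2) * integral {0..pi / 2} (\<lambda>\<theta>. cos \<theta> ^ a * sin \<theta> ^ (b + 2))) {0..pi / 2}"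
    by (intro has_integral_diff has_integral_mult_right integrable_integral integrable_continuous_real continuous_intros)
  have "?F (pi / 2) - ?F 0 = 0" by simp
  with has_integral_unique[OF A B] show ?thesis by linarith
qed

lemma wallis_sym:
  "integral {0..pi / 2} (\<lambda>\<theta>. cos \<theta> ^ a * sin \<theta> ^ b) = integral {0..pi / 2} (\<lambda>\<theta>. cos \<theta> ^ b * (sin \<theta> :: real) ^ a)"
proof -
  have "((\<lambda>\<theta>. cos \<theta> ^ a * sin \<theta> ^ b :: real) has_integral
      integral {0..pi / 2} (\<lambda>\<theta>. cos \<theta> ^ a * sin \<theta> ^ b)) (cbox 0 (pi / 2))"
    by (auto intro!: integrable_integral integrable_continuous_real continuous_intros)
  from has_integral_affinity[OF this, of "-1" "pi / 2"]
  have "((\<lambda>\<theta>. cos (pi / 2 - \<theta>) ^ a * sin (pi / 2 - \<theta>) ^ b :: real) has_integral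
      integral {0..pi / 2} (\<lambda>\<theta>. cos \<theta> ^ a * sin \<theta> ^ b)) ((\<lambda>x. pi / 2 - x) ` {0..pi / 2})"
    by (simp add: cbox_interval image_def)
  moreover have "(\<lambda>x. pi / 2 - x) ` {0..pi / 2} = {0..pi / 2}"
    by (auto simp: image_iff intro!: bexI[of _ "pi / 2 - _"])
  moreover have "(\<lambda>\<theta>. cos (pi / 2 - \<theta>) ^ a * sin (pi / 2 - \<theta>) ^ b :: real) = (\<lambda>\<theta>. cos \<theta> ^ b * sin \<theta> ^ a)"
    by (simp add: fun_eq_iff mult.commute sin_diff cos_diff)
  ultimately show ?thesis by (simp add: integral_unique)
qed

text \<open>The Gamma quotient is symmetric and satisfies the recursion of
  \<open>wallis_step\<close> in \<open>b\<close>. Three base values give the rows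
  \<open>a = 0\<close> and \<open>a = 1\<close>; symmetry turns these into the columns
  \<open>b = 0\<close> and \<open>b = 1\<close>, from which the recursion reaches every
  \<open>b\<close>.\<close>

lemma wallis:
  "integral {0..pi / 2} (\<lambda>\<theta>. cos \<theta> ^ a * sin \<theta> ^ b) =
   Gamma (real (a + 1) / 2) * Gamma (real (b + 1) / 2) / (2 * Gamma (real (a + b + 2) / 2))"
proof -
  define W where "W a b = integral {0..pi / 2} (\<lambda>\<theta>. cos \<theta> ^ a * (sin \<theta> :: real) ^ b)" for a b
  define G where "G a b = Gamma (real (a + 1) / 2) * Gamma (real (b + 1) / 2) / (2 * Gamma (real (a + b + 2) / 2))" for a b
  have Gplus: "Gamma (real (n + 2 + 1) / 2) = real (n + 1) / 2 * Gamma (real (n + 1) / 2)" for n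
  proof -
    have "real (n + 1) / 2 \<notin> \<int>\<^sub>\<le>\<^sub>0" using nonpos_Ints_nonpos[of "real (n + 1) / 2"] by fastforce
    moreover have "real (n + 1) / 2 + 1 = real (n + 2 + 1) / 2" by (simp add: field_simps)
    ultimately show ?thesis using Gamma_plus1[of "real (n + 1) / 2"] by metis
  qed
  have G_step: "real (a + b + 2) * G a (b + 2) = real (b + 1) * G a b" for a b
  proof -
    have e: "a + (b + 2) + 2 = (a + b + 1) + 2 + 1" "a + b + 1 + 1 = a + b + 2" by simp_all
    have alg: "p * (g * (q / 2 * x) / (2 * (p / 2 * y))) = q * (g * x / (2 * y))" if "p \<noteq> 0" "y \<noteq> 0" for p g q x y :: real
      using that by (simp add: field_simps)
    have "Gamma (real (a + b + 2) / 2) \<noteq> 0" by (rule Gamma_half_nonzero) simp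
    then show ?thesis unfolding G_def e(1) Gplus e(2) by (intro alg) auto
  qed
  have W_step: "real (a + b + 2) * W a (b + 2) = real (b + 1) * W a b" for a b
    using wallis_step[of a b] by (simp add: W_def)
  have up: "W a (b + 2) = G a (b + 2)" if "W a b = G a b" for a b
    using G_step[of a b] W_step[of a b] that by (metis mult_cancel_left of_nat_eq_0_iff add_2_eq_Suc' nat.simps(3))
  have Wsym: "W a b = W b a" and Gsym: "G a b = G b a" for a b
    using wallis_sym[of a b] by (simp_all add: W_def G_def mult_ac add_ac)
  have base: "W 0 0 = G 0 0" "W 0 1 = G 0 1" "W 1 1 = G 1 1"
  proof -
    show "W 0 0 = G 0 0" by (simp add: W_def G_def Gamma_one_half_real power2_eq_square[symmetric])
    have "((\<lambda>\<theta>. sin \<theta>) has_integral (- cos (pi / 2) - - cos 0)) {0..pi / 2 :: real}"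
      by (intro fundamental_theorem_of_calculus)
        (auto intro!: derivative_eq_intros simp: has_real_derivative_iff_has_vector_derivative[symmetric])
    then have "W 0 1 = 1" by (simp add: W_def integral_unique)
    then show "W 0 1 = G 0 1" using Gplus[of 0] Gamma_half_nonzero[of 3] by (simp add: G_def)
    have "((\<lambda>\<theta>. cos \<theta> * sin \<theta>) has_integral (sin (pi / 2) ^ 2 / 2 - sin 0 ^ 2 / 2)) {0..pi / 2 :: real}"
      by (intro fundamental_theorem_of_calculus)
        (auto intro!: derivative_eq_intros simp: has_real_derivative_iff_has_vector_derivative[symmetric] power2_eq_square)
    then have "W 1 1 = 1 / 2" by (simp add: W_def integral_unique)
    then show "W 1 1 = G 1 1" by (simp add: G_def Gamma_numeral)
  qed
  have "W 0 b = G 0 b \<and> W 1 b = G 1 b" for b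
  proof (induction b rule: nat_less_induct)
    case (1 b)
    show ?case
    proof (cases "b < 2")
      case True
      then have "b = 0 \<or> b = 1" by auto
      then show ?thesis using base Wsym[of 1 0] Gsym[of 1 0] by auto
    next
      case False
      then obtain c where "b = c + 2" by (metis add.commute le_add_diff_inverse not_less)
      then show ?thesis using 1 up[of 0 c] up[of 1 c] by simp
    qed
  qed
  then have *: "W b 0 = G b 0" "W b 1 = G b 1" for b
    using Wsym Gsym by metis+
  have "W a b = G a b"
  proof (induction b rule: nat_less_induct)
    case (1 b)
    show ?case
    proof (cases "b < 2")
      case True
      then have "b = 0 \<or> b = 1" by auto
      then show ?thesis using * by auto
    next
      case False
      then obtain c where "b = c + 2" by (metis add.commute le_add_diff_inverse not_less)
      then show ?thesis using 1 up[of a c] by simp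
    qed
  qed
  then show ?thesis by (simp add: W_def G_def)
qed

text \<open>Dilation pulls \<open>r ^ p\<close> out, so monomials are eigenvectors. The denominator
  of the eigenvalue is the numerator of the one for \<open>ek (j + d) \<mu>\<close>; this
  cancellation is the semigroup law on polynomials.\<close>

lemma ek_monomial:
  "ek j d (\<lambda>x. of_real (x ^ p)) r =
   of_real (Gamma (real (j + p + 1) / 2) / Gamma (real (j + p + d + 1) / 2) * r ^ p)"
proof (cases "d = 0")
  case True
  have nz: "Gamma (real (j + p + 1) / 2) \<noteq> 0" by (rule Gamma_half_nonzero) simp
  then show ?thesis unfolding True add_0_right ek_0 divide_self[OF nz] mult_1 by simp
next
  case False
  have "integral {0..pi / 2} (\<lambda>\<theta>. of_real (cos \<theta> ^ (d - 1) * sin \<theta> ^ j) * of_real ((r * sin \<theta>) ^ p) :: complex) =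
      integral {0..pi / 2} (\<lambda>\<theta>. of_real (r ^ p * (cos \<theta> ^ (d - 1) * sin \<theta> ^ (j + p))))"
    by (simp add: power_mult_distrib power_add mult_ac)
  also have "\<dots> = of_real (integral {0..pi / 2} (\<lambda>\<theta>. r ^ p * (cos \<theta> ^ (d - 1) * sin \<theta> ^ (j + p))))"
    by (rule integral_unique[OF has_integral_of_real])
      (intro integrable_integral integrable_continuous_real continuous_intros)
  also have "integral {0..pi / 2} (\<lambda>\<theta>. r ^ p * (cos \<theta> ^ (d - 1) * sin \<theta> ^ (j + p))) =
      r ^ p * (Gamma (real d / 2) * Gamma (real (j + p + 1) / 2) / (2 * Gamma (real (j + p + d + 1) / 2)))"
    unfolding integral_mult_right wallis using False by (simp add: add_ac)
  finally show ?thesis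
    using False Gamma_half_nonzero[of d] unfolding ek_eq_integral[OF False[unfolded neq0_conv]]
    by (simp add: field_simps)
qed

lemma real_polynomial_ek_semigroup:
  assumes "real_polynomial_function g"
  shows "ek (j + d) \<mu> (ek j d (\<lambda>x. of_real (g x))) r = ek j (d + \<mu>) (\<lambda>x. of_real (g x)) r"
proof -
  obtain a n where g: "g = (\<lambda>x. \<Sum>i\<le>n. a i * x ^ i)"
    using assms real_polynomial_function_iff_sum by blast
  have *: "ek i \<nu> (\<lambda>x. \<Sum>i\<le>n. of_real (b i) * of_real (x ^ i)) =
      (\<lambda>r. \<Sum>l\<le>n. of_real (b l) * of_real (Gamma (real (i + l + 1) / 2) / Gamma (real (i + l + \<nu> + 1) / 2)) * of_real (r ^ l))"
    for b i \<nu>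
  proof (induction n)
    case 0
    then show ?case using ek_cmult[of i \<nu> "of_real (b 0)" "\<lambda>x. of_real (x ^ 0)"] ek_monomial[of i \<nu> 0]
      by (simp add: fun_eq_iff)
  next
    case (Suc n)
    have "ek i \<nu> (\<lambda>x. \<Sum>i\<le>Suc n. of_real (b i) * of_real (x ^ i)) =
        ek i \<nu> (\<lambda>x. (\<Sum>i\<le>n. of_real (b i) * of_real (x ^ i)) + of_real (b (Suc n)) * of_real (x ^ Suc n))"
      by simp
    also have "\<dots> = (\<lambda>r. ek i \<nu> (\<lambda>x. \<Sum>i\<le>n. of_real (b i) * of_real (x ^ i)) r +
        ek i \<nu> (\<lambda>x. of_real (b (Suc n)) * of_real (x ^ Suc n)) r)"
      by (intro ek_add continuous_intros)
    finally show ?case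
      unfolding Suc.IH ek_cmult ek_monomial by (simp add: fun_eq_iff mult.assoc)
  qed
  have Gn: "Gamma (real (j + l + d + 1) / 2) \<noteq> 0" for l
    by (rule Gamma_half_nonzero) simp
  have "ek j d (\<lambda>x. of_real (g x)) =
      (\<lambda>x. \<Sum>l\<le>n. of_real (a l * (Gamma (real (j + l + 1) / 2) / Gamma (real (j + l + d + 1) / 2))) * of_real (x ^ l))"
    using *[of j d a] by (simp add: g)
  then have "ek (j + d) \<mu> (ek j d (\<lambda>x. of_real (g x))) r =
      (\<Sum>l\<le>n. of_real (a l * (Gamma (real (j + l + 1) / 2) / Gamma (real (j + l + d + 1) / 2))) *
        of_real (Gamma (real (j + d + l + 1) / 2) / Gamma (real (j + d + l + \<mu> + 1) / 2)) * of_real (r ^ l))"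
    using *[of "j + d" \<mu> "\<lambda>l. a l * (Gamma (real (j + l + 1) / 2) / Gamma (real (j + l + d + 1) / 2))"] by simp
  also have "\<dots> = (\<Sum>l\<le>n. of_real (a l) * of_real (Gamma (real (j + l + 1) / 2) / Gamma (real (j + l + (d + \<mu>) + 1) / 2)) * of_real (r ^ l))"
  proof (intro sum.cong refl)
    fix l
    have alg: "of_real (a * (x / y)) * of_real (y / z) * w = of_real a * of_real (x / z) * w"
      if "y \<noteq> 0" for a x y z :: real and w :: complex
      using that by simp
    have e: "j + d + l + 1 = j + l + d + 1" "j + d + l + \<mu> + 1 = j + l + (d + \<mu>) + 1" by simp_all
    show "of_real (a l * (Gamma (real (j + l + 1) / 2) / Gamma (real (j + l + d + 1) / 2))) *
        of_real (Gamma (real (j + d + l + 1) / 2) / Gamma (real (j + d + l + \<mu> + 1) / 2)) * of_real (r ^ l) =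
      of_real (a l) * of_real (Gamma (real (j + l + 1) / 2) / Gamma (real (j + l + (d + \<mu>) + 1) / 2)) * (of_real (r ^ l) :: complex)"
      unfolding e by (rule alg[OF Gn])
  qed
  also have "\<dots> = ek j (d + \<mu>) (\<lambda>x. of_real (g x)) r"
    using *[of j "d + \<mu>" a] by (simp add: g)
  finally show ?thesis .
qed

text \<open>Both sides at \<open>r\<close> depend continuously on \<open>f\<close> in the supremum
  norm of the interval from \<open>-|r|\<close> to \<open>|r|\<close>. Weierstrass approximation
  therefore reduces the claim to polynomials, split into real and imaginary parts.\<close>

lemma ek_semigroup:
  assumes f: "continuous_on UNIV f"
  shows "ek (j + d) \<mu> (ek j d f) = ek j (d + \<mu>) f"
proof (cases "d = 0 \<or> \<mu> = 0")
  case False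
  define D where "D f r = ek (j + d) \<mu> (ek j d f) r - ek j (d + \<mu>) f r" for f r
  define C where "C \<nu> = \<bar>2 / Gamma (real \<nu> / 2)\<bar> * (pi / 2)" for \<nu> :: nat
  have C0: "0 \<le> C \<nu>" for \<nu> by (simp add: C_def)
  have "D f r = 0" for r
  proof (rule ccontr)
    assume ne: "D f r \<noteq> 0"
    \<comment> \<open>Chosen so that the bounds of all operators involved, times \<open>e\<close>,
      amount to half of the assumed nonzero defect; \<open>+ 1\<close> keeps the denominator
      positive.\<close>
    define e where "e = norm (D f r) / (2 * (C \<mu> * C d + C (d + \<mu>) + 1))"
    have pos: "0 < C \<mu> * C d + C (d + \<mu>) + 1" using C0 by (simp add: add_nonneg_pos)
    then have e: "0 < e" using ne by (simp add: e_def)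
    obtain g where g: "polynomial_function g" "\<And>x. x \<in> {-\<bar>r\<bar>..\<bar>r\<bar>} \<Longrightarrow> norm (f x - g x) < e"
      using Stone_Weierstrass_polynomial_function[OF _ continuous_on_subset[OF f] e, of "{-\<bar>r\<bar>..\<bar>r\<bar>}"] by auto
    have gc: "continuous_on UNIV g"
      using g(1) by (simp add: continuous_on_polymonial_function)
    have re: "real_polynomial_function (\<lambda>x. Re (g x))" "real_polynomial_function (\<lambda>x. Im (g x))"
      using g(1) bounded_linear_Re bounded_linear_Im unfolding polynomial_function_def o_def by blast+
    have rc: "continuous_on UNIV (\<lambda>x. of_real (Re (g x)) :: complex)" "continuous_on UNIV (\<lambda>x. of_real (Im (g x)) :: complex)"
      by (intro continuous_intros gc)+
    have gsplit: "g = (\<lambda>x. of_real (Re (g x)) + \<i> * of_real (Im (g x)))"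
      by (simp add: fun_eq_iff complex_eq[symmetric] complex_eq_iff)
    have Dlin: "D (\<lambda>x. u x + c * v x) r = D u r + c * D v r"
      if "continuous_on UNIV u" "continuous_on UNIV v" for u v c
    proof -
      have cv: "continuous_on UNIV (\<lambda>x. c * v x)" "continuous_on UNIV (\<lambda>x. c * ek j d v x)"
        using that by (auto intro!: continuous_intros ek_continuous)
      show ?thesis
        unfolding D_def using that cv
        by (simp add: ek_add ek_continuous ek_cmult algebra_simps)
    qed
    have "D g r = 0"
      by (subst gsplit, subst Dlin[OF rc])
        (simp add: D_def real_polynomial_ek_semigroup[OF re(1)] real_polynomial_ek_semigroup[OF re(2)])
    moreover have "D (\<lambda>x. f x + (-1) * g x) r = D f r + (-1) * D g r" by (rule Dlin[OF f gc])
    ultimately have Dh: "D f r = D (\<lambda>x. f x + (-1) * g x) r" by simp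
    let ?h = "\<lambda>x. f x + (-1) * g x"
    have hc: "continuous_on UNIV ?h" by (intro continuous_intros f gc)
    have hb: "norm (?h x) \<le> e" if "\<bar>x\<bar> \<le> \<bar>r\<bar>" for x using g(2)[of x] that by (auto simp: abs_le_iff)
    have pm: "0 < d" "0 < \<mu>" "0 < d + \<mu>" using False by auto
    have "norm (ek j d ?h x) \<le> C d * e" if "\<bar>x\<bar> \<le> \<bar>r\<bar>" for x
      unfolding C_def by (rule ek_bound[OF hc pm(1) that hb])
    then have "norm (ek (j + d) \<mu> (ek j d ?h) r) \<le> C \<mu> * (C d * e)"
      unfolding C_def[of \<mu>] by (intro ek_bound[OF ek_continuous[OF hc] pm(2), of r "\<bar>r\<bar>"]) auto
    moreover have "norm (ek j (d + \<mu>) ?h r) \<le> C (d + \<mu>) * e"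
      unfolding C_def by (rule ek_bound[OF hc pm(3) _ hb]) auto
    ultimately have "norm (D ?h r) \<le> C \<mu> * (C d * e) + C (d + \<mu>) * e"
      unfolding D_def by (intro order_trans[OF norm_triangle_ineq4] add_mono)
    also have "\<dots> \<le> (C \<mu> * C d + C (d + \<mu>) + 1) * e" using e by (simp add: algebra_simps)
    also have "\<dots> = norm (D f r) / 2"
    proof -
      have "K * (x / (2 * K)) = x / 2" if "0 < K" for K x :: real using that by simp
      from this[OF pos] show ?thesis unfolding e_def .
    qed
    finally show False using ne Dh by simp
  qed
  then show ?thesis by (simp add: D_def fun_eq_iff)
qed auto

text \<open>On monomials \<open>ek j 2\<close> acts as \<open>x\<^sup>p \<mapsto> 2 / (j + p + 1) x\<^sup>p\<close>, which suggests its inverse.\<close>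

definition ek_inv2 :: "nat \<Rightarrow> (real \<Rightarrow> complex) \<Rightarrow> real \<Rightarrow> complex" where
  "ek_inv2 j f r = of_real ((real j + 1) / 2) * f r + of_real (r / 2) * nth_deriv 1 f r"

lemma fs_op_ek_inv2: "fs_op even_smooth even_smooth (ek_inv2 j)"
  unfolding fs_op_def
proof (intro conjI ballI allI)
  have idsm: "smooth_on UNIV (\<lambda>r. of_real (r / 2) :: complex)"
    by (intro smooth_on_of_real smooth_on_bounded_linear bounded_linear_divide) auto
  have sm: "smooth_on UNIV (ek_inv2 j f)" if "smooth_on UNIV f" for f
    unfolding ek_inv2_def[abs_def]
    by (intro smooth_on_add smooth_on_mult smooth_on_const smooth_on_iter_deriv that idsm) auto
  show "ek_inv2 j f \<in> even_smooth" if f: "f \<in> even_smooth" for f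
  proof -
    have s: "smooth_on UNIV f" and ev: "\<And>x. f (- x) = f x" using f by (auto simp: even_smooth_def)
    have "((\<lambda>x. f (- x)) has_vector_derivative - nth_deriv 1 f (- x)) (at x)" for x
    proof -
      have "(uminus has_vector_derivative -1) (at x)"
        by (auto simp: has_real_derivative_iff_has_vector_derivative[symmetric] intro!: derivative_eq_intros)
      from vector_diff_chain_at[OF this, of f "nth_deriv 1 f (- x)"] show ?thesis
        using has_vector_derivative_iter[OF s, of "- x" 0] by (simp add: o_def)
    qed
    then have fv: "(f has_vector_derivative - nth_deriv 1 f (- x)) (at x)" for x by (simp add: ev)
    \<comment> \<open>The derivative of an even function is odd, so its product with
      \<open>r\<close> is even again.\<close>
    have "nth_deriv 1 f (- x) = - nth_deriv 1 f x" for x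
    proof -
      have "(f has_vector_derivative nth_deriv 1 f x) (at x)" using has_vector_derivative_iter[OF s, of x 0] by simp
      from vector_derivative_unique_at[OF this fv]
      show ?thesis by simp
    qed
    then show ?thesis using sm[OF s] ev by (simp add: even_smooth_def ek_inv2_def)
  qed
  fix f g :: "real \<Rightarrow> complex" and c assume f: "f \<in> even_smooth"
  then have s: "smooth_on UNIV f" by (auto simp: even_smooth_def)
  have z: "smooth_on UNIV (\<lambda>x. 0 :: complex)" by (simp add: smooth_on_const)
  show "ek_inv2 j (\<lambda>x. c * f x) = (\<lambda>y. c * ek_inv2 j f y)"
  proof -
    have "nth_deriv 1 (\<lambda>x. 0 + c * f x) = (\<lambda>x. nth_deriv 1 (\<lambda>x. 0) x + c * nth_deriv 1 f x)"
      by (rule iter_deriv_linear[OF z s])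
    then have "nth_deriv 1 (\<lambda>x. c * f x) y = c * nth_deriv 1 f y" for y
      by (simp add: frechet_derivative_const)
    then show ?thesis unfolding ek_inv2_def[abs_def] by (simp only: distrib_left mult.left_commute)
  qed
  assume "g \<in> even_smooth"
  then show "ek_inv2 j (\<lambda>x. f x + g x) = (\<lambda>y. ek_inv2 j f y + ek_inv2 j g y)"
  proof -
    assume "g \<in> even_smooth"
    then have "smooth_on UNIV g" by (simp add: even_smooth_def)
    from iter_deriv_linear[OF s this, of "replicate 1 1" 1]
    have "nth_deriv 1 (\<lambda>x. f x + g x) y = nth_deriv 1 f y + nth_deriv 1 g y" for y
      by simp
    then show ?thesis unfolding ek_inv2_def[abs_def] by (simp only: distrib_left add_ac)
  qed
next
  show "fs_bounded even_smooth (ek_inv2 j)"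
    unfolding fs_bounded_def
  proof (intro allI impI)
    fix N and K :: "real set" assume K: "compact K"
    have idsm: "smooth_on UNIV (\<lambda>r. of_real (r / 2) :: complex)"
      by (intro smooth_on_of_real smooth_on_bounded_linear bounded_linear_divide) auto
    have csm: "smooth_on UNIV (\<lambda>r :: real. of_real ((real j + 1) / 2) :: complex)" by (simp add: smooth_on_const)
    obtain B1 where B1: "B1 \<ge> 0" "\<And>f c. smooth_on UNIV f \<Longrightarrow> deriv_bound N K c f \<Longrightarrow>
        deriv_bound N K (B1 * c) (\<lambda>r. of_real ((real j + 1) / 2) * f r)"
      using deriv_bound_mult[OF csm K, of N] by blast
    obtain B2 where B2: "B2 \<ge> 0" "\<And>f c. smooth_on UNIV f \<Longrightarrow> deriv_bound N K c f \<Longrightarrow>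
        deriv_bound N K (B2 * c) (\<lambda>r. of_real (r / 2) * f r)"
      using deriv_bound_mult[OF idsm K, of N] by blast
    show "\<exists>N' K' B. compact K' \<and> 0 \<le> B \<and>
       (\<forall>f\<in>even_smooth. \<forall>c. deriv_bound N' K' c f \<longrightarrow> deriv_bound N K (B * c) (ek_inv2 j f))"
    \<comment> \<open>One more derivative on the source side, \<open>ek_inv2\<close> being a
      first-order operator.\<close>
    proof (intro exI[of _ "Suc N"] exI[of _ K] exI[of _ "B1 + B2"] conjI ballI allI impI)
      fix f c assume f: "f \<in> even_smooth" "deriv_bound (Suc N) K c f"
      then have s: "smooth_on UNIV f" by (auto simp: even_smooth_def)
      have "deriv_bound N K c f" by (rule deriv_bound_mono[OF f(2)]) auto
      moreover have "deriv_bound N K c (nth_deriv 1 f)" using f(2) by (simp add: deriv_bound_Suc_iff)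
      ultimately have "deriv_bound N K (B1 * c + B2 * c)
          (\<lambda>r. of_real ((real j + 1) / 2) * f r + of_real (r / 2) * nth_deriv 1 f r)"
        by (intro deriv_bound_add smooth_on_mult smooth_on_iter_deriv s csm idsm B1(2) B2(2) open_UNIV)
      then show "deriv_bound N K ((B1 + B2) * c) (ek_inv2 j f)"
        by (simp add: ek_inv2_def[abs_def] distrib_right)
    qed (use K B1 B2 in auto)
  qed
qed

text \<open>The integrand is the derivative in \<open>\<theta>\<close> of
  \<open>sin \<theta> ^ Suc j * f (r * sin \<theta>)\<close>, which is \<open>f r\<close> at
  \<open>pi / 2\<close> and zero at \<open>0\<close>.\<close>

lemma ek2_core:
  assumes f: "smooth_on UNIV f"
  shows "integral {0..pi / 2} (\<lambda>\<theta>. of_real ((real j + 1) * cos \<theta> * sin \<theta> ^ j) * f (r * sin \<theta>) +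
    of_real (r * cos \<theta> * sin \<theta> ^ Suc j) * nth_deriv 1 f (r * sin \<theta>)) = f r"
proof -
  have "((\<lambda>\<theta>. of_real ((real j + 1) * cos \<theta> * sin \<theta> ^ j) * f (r * sin \<theta>) +
    of_real (r * cos \<theta> * sin \<theta> ^ Suc j) * nth_deriv 1 f (r * sin \<theta>)) has_integral
      (\<lambda>\<theta>. of_real (sin \<theta> ^ Suc j) * f (r * sin \<theta>)) (pi / 2) - (\<lambda>\<theta>. of_real (sin \<theta> ^ Suc j) * f (r * sin \<theta>)) 0) {0..pi / 2}"
  proof (rule fundamental_theorem_of_calculus)
    fix \<theta> :: real
    have "((f \<circ> (\<lambda>\<theta>. r * sin \<theta>)) has_vector_derivative (r * cos \<theta>) *\<^sub>R nth_deriv 1 f (r * sin \<theta>)) (at \<theta> within {0..pi / 2})"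
      using has_vector_derivative_at_within[OF has_vector_derivative_iter[OF f, of "r * sin \<theta>" 0]]
      by (intro vector_diff_chain_within)
        (auto intro!: derivative_eq_intros simp: has_real_derivative_iff_has_vector_derivative[symmetric])
    moreover have "((\<lambda>\<theta>. of_real (sin \<theta> ^ Suc j) :: complex) has_vector_derivative
        of_real ((real j + 1) * cos \<theta> * sin \<theta> ^ j)) (at \<theta> within {0..pi / 2})"
    proof -
      have "((\<lambda>\<theta>. sin \<theta> ^ Suc j) has_vector_derivative (real j + 1) * cos \<theta> * sin \<theta> ^ j) (at \<theta> within {0..pi / 2})"
        unfolding has_real_derivative_iff_has_vector_derivative[symmetric]
        by (auto intro!: derivative_eq_intros simp: algebra_simps simp del: power_Suc)
      from bounded_linear.has_vector_derivative[OF bounded_linear_of_real this] show ?thesis .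
    qed
    ultimately show "((\<lambda>\<theta>. of_real (sin \<theta> ^ Suc j) * f (r * sin \<theta>)) has_vector_derivative
      of_real ((real j + 1) * cos \<theta> * sin \<theta> ^ j) * f (r * sin \<theta>) +
      of_real (r * cos \<theta> * sin \<theta> ^ Suc j) * nth_deriv 1 f (r * sin \<theta>)) (at \<theta> within {0..pi / 2})"
      using has_vector_derivative_mult[of "\<lambda>\<theta>. of_real (sin \<theta> ^ Suc j)" _ \<theta> "{0..pi / 2}" "f \<circ> (\<lambda>\<theta>. r * sin \<theta>)"]
      by (fastforce simp: o_def scaleR_conv_of_real algebra_simps elim: has_vector_derivative_eq_rhs)
  qed simp
  then show ?thesis by (simp add: integral_unique)
qed

lemma ek_inv2_ek:
  assumes f: "smooth_on UNIV f"
  shows "ek_inv2 j (ek j 2 f) = f"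
proof
  fix r
  have fc: "continuous_on UNIV f" "continuous_on UNIV (nth_deriv 1 f)"
    by (intro smooth_on_continuous_on smooth_on_iter_deriv f)+
  have i1: "(\<lambda>\<theta>. of_real (cos \<theta> ^ 1 * sin \<theta> ^ j) * f (r * sin \<theta>)) integrable_on {0..pi / 2}"
    by (rule dilate_integrable[OF _ fc(1)]) (intro continuous_intros)
  have i2: "(\<lambda>\<theta>. of_real (cos \<theta> ^ 1 * sin \<theta> ^ Suc j) * nth_deriv 1 f (r * sin \<theta>)) integrable_on {0..pi / 2}"
    by (rule dilate_integrable[OF _ fc(2)]) (intro continuous_intros)
  have "ek_inv2 j (ek j 2 f) r = of_real (real j + 1) * integral {0..pi / 2} (\<lambda>\<theta>. of_real (cos \<theta> ^ 1 * sin \<theta> ^ j) * f (r * sin \<theta>)) +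
     of_real r * integral {0..pi / 2} (\<lambda>\<theta>. of_real (cos \<theta> ^ 1 * sin \<theta> ^ Suc j) * nth_deriv 1 f (r * sin \<theta>))"
    unfolding ek_inv2_def ek_deriv(2)[OF f zero_less_numeral] by (simp add: ek_eq_integral)
  also have "\<dots> = f r"
    unfolding integral_mult_right[symmetric]
      integral_add[OF integrable_on_mult_right[OF i1] integrable_on_mult_right[OF i2], symmetric]
    by (subst ek2_core[OF f, of j r, symmetric]) (simp add: mult_ac)
  finally show "ek_inv2 j (ek j 2 f) r = f r" .
qed

text \<open>The Euler operator \<open>r d/dr\<close> commutes with every dilation, hence with
  averages of dilates.\<close>

lemma ek_ek_inv2:
  assumes f: "smooth_on UNIV f" and "0 < d"
  shows "ek i d (ek_inv2 j f) = ek_inv2 j (ek i d f)"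
proof
  fix r
  have fc: "continuous_on UNIV f" "continuous_on UNIV (nth_deriv 1 f)"
    by (intro smooth_on_continuous_on smooth_on_iter_deriv f)+
  have c: "continuous_on UNIV (\<lambda>r. of_real ((real j + 1) / 2) * f r)"
    "continuous_on UNIV (\<lambda>r. of_real (r / 2) * nth_deriv 1 f r)"
    by (intro continuous_intros fc; simp)+
  have "ek i d (\<lambda>r. of_real (r / 2) * nth_deriv 1 f r) r = of_real (r / 2) * ek (Suc i) d (nth_deriv 1 f) r"
    unfolding ek_eq_integral[OF assms(2)] mult.left_commute[of "of_real (r / 2)"]
    by (subst integral_mult_right[symmetric]) (simp add: mult_ac)
  then show "ek i d (ek_inv2 j f) r = ek_inv2 j (ek i d f) r"
    unfolding ek_inv2_def[abs_def] ek_deriv(2)[OF assms] ek_add[OF c] by (simp only: ek_cmult)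
qed

text \<open>A half step followed by a second one is the full step \<open>ek j 2\<close>, which
  \<open>ek_inv2 j\<close> inverts; so \<open>ek_inv2 j\<close> after \<open>ek (j + 1) 1\<close> is
  a left inverse. It is a right inverse as well because these operators commute.\<close>

lemma fs_iso_ek1: "fs_iso even_smooth even_smooth (ek j 1)"
proof -
  have "fs_op even_smooth even_smooth (\<lambda>f. ek_inv2 j (ek (j + 1) 1 f))"
    by (rule fs_op_comp[OF fs_op_ek fs_op_ek_inv2])
  moreover have "ek_inv2 j (ek (j + 1) 1 (ek j 1 f)) = f" "ek j 1 (ek_inv2 j (ek (j + 1) 1 f)) = f"
    if "f \<in> even_smooth" for f
  proof -
    have s: "smooth_on UNIV f" using that by (simp add: even_smooth_def)
    have c: "continuous_on UNIV f" by (rule smooth_on_continuous_on[OF s])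
    show 1: "ek_inv2 j (ek (j + 1) 1 (ek j 1 f)) = f"
      using ek_semigroup[OF c, of j 1 1] ek_inv2_ek[OF s, of j] by (simp only: one_add_one)
    have "ek j 1 (ek_inv2 j (ek (j + 1) 1 f)) = ek_inv2 j (ek j 1 (ek (j + 1) 1 f))"
      by (intro ek_ek_inv2 ek_deriv s) auto
    also have "ek j 1 (ek (j + 1) 1 f) = ek (j + 1) 1 (ek j 1 f)" by (rule ek_commute[OF c])
    finally show "ek j 1 (ek_inv2 j (ek (j + 1) 1 f)) = f" using 1 by simp
  qed
  ultimately show ?thesis unfolding fs_iso_def using fs_op_ek by blast
qed

lemma fs_iso_ek: "fs_iso even_smooth even_smooth (ek j d)"
proof (induction d)
  case 0
  have "fs_iso even_smooth even_smooth (\<lambda>f x. of_real 1 * f x)"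
    using fs_iso_mult[of "\<lambda>_. 1"] by (auto intro: smooth_on_const)
  then show ?case by (simp add: ek_def[abs_def])
next
  case (Suc d)
  have "fs_iso even_smooth even_smooth (\<lambda>f. ek (j + d) 1 (ek j d f))"
    by (rule fs_iso_comp[OF Suc fs_iso_ek1])
  then show ?case
    by (rule fs_iso_cong[OF _ even_smooth_subspace])
      (simp add: ek_semigroup smooth_on_continuous_on even_smooth_def)
qed

section \<open>Riemann-Liouville transforms\<close>

text \<open>The function \<open>x^(j - 1) * G x\<close> at \<open>x = sinh (\<tau> s / 2)\<close>,
  written as a quotient so that \<open>j = 0\<close> gives \<open>G x / x\<close>. A transform of
  order \<open>d / 2\<close> sends it to the state with \<open>j + d\<close> and
  \<open>ek j d G\<close>, up to the factor \<open>2 powr (d / 2)\<close>.\<close>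

definition rl_state :: "real \<Rightarrow> nat \<Rightarrow> (real \<Rightarrow> complex) \<Rightarrow> real \<Rightarrow> complex" where
  "rl_state \<tau> j G s = of_real (sinh (\<tau> * s / 2) ^ j / sinh (\<tau> * s / 2)) * G (sinh (\<tau> * s / 2))"

lemma cosh_minus_cosh: "cosh (\<tau> * r) - cosh (\<tau> * s) = 2 * (sinh (\<tau> * r / 2) ^ 2 - sinh (\<tau> * s / 2) ^ 2 :: real)"
proof -
  have "cosh (2 * x) = 1 + 2 * sinh x ^ 2" for x :: real
    using cosh_double[of x] cosh_square_eq[of x] by simp
  from this[of "\<tau> * r / 2"] this[of "\<tau> * s / 2"] show ?thesis by simp
qed

lemma sinh_double_half: "sinh (\<tau> * s) = 2 * sinh (\<tau> * s / 2) * cosh (\<tau> * s / 2 :: real)"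
  using sinh_double[of "\<tau> * s / 2"] by simp

text \<open>Substitution \<open>sinh (\<tau> s / 2) = sinh (\<tau> r / 2) sin \<theta>\<close>.\<close>

lemma rl_integral:
  fixes G :: "real \<Rightarrow> complex"
  assumes G: "continuous_on UNIV G" and \<tau>: "0 < \<tau>" and r: "0 < r" and d: "0 < d"
    and H: "\<And>s. 0 < s \<Longrightarrow> s < r \<Longrightarrow> H s = rl_state \<tau> j G s"
  shows "((\<lambda>s. of_real (\<tau> * sinh (\<tau> * s) * (cosh (\<tau> * r) - cosh (\<tau> * s)) powr (real d / 2 - 1)) * H s)
    has_integral of_real (Gamma (real d / 2) * 2 powr (real d / 2)) * rl_state \<tau> (j + d) (ek j d G) r) {0..r}"
proof -
  define R where "R = sinh (\<tau> * r / 2)"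
  have R: "0 < R" using \<tau> r by (simp add: R_def)
  define g where "g \<theta> = 2 / \<tau> * arsinh (R * sin \<theta>)" for \<theta>
  define g' where "g' \<theta> = 2 / \<tau> * (R * cos \<theta> / sqrt ((R * sin \<theta>)\<^sup>2 + 1))" for \<theta>
  define F where "F s = of_real (\<tau> * sinh (\<tau> * s) * (cosh (\<tau> * r) - cosh (\<tau> * s)) powr (real d / 2 - 1)) * rl_state \<tau> j G s" for s
  define W where "W \<theta> = of_real (2 powr (real d / 2 + 1) * R ^ (j + d) / R) *
      (of_real (cos \<theta> ^ (d - 1) * sin \<theta> ^ j) * G (R * sin \<theta>))" for \<theta>
  let ?S = "{0<..<pi / 2}"
  have sg: "sinh (\<tau> * g \<theta> / 2) = R * sin \<theta>" for \<theta> using \<tau> by (simp add: g_def)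
  have dg: "(g has_field_derivative g' \<theta>) (at \<theta> within ?S)" for \<theta>
  proof -
    have "((\<lambda>\<theta>. arsinh (R * sin \<theta>)) has_field_derivative 1 / sqrt ((R * sin \<theta>)\<^sup>2 + 1) * (R * cos \<theta>)) (at \<theta> within ?S)"
      by (rule DERIV_chain2[OF arsinh_real_has_field_derivative]) (auto intro!: derivative_eq_intros)
    from DERIV_cmult[OF this, of "2 / \<tau>"] show ?thesis by (simp add: g_def[abs_def] g'_def)
  qed
  have sc: "0 < sin \<theta>" "0 < cos \<theta>" "sin \<theta> < 1" if "\<theta> \<in> ?S" for \<theta>
  proof -
    show "0 < sin \<theta>" "0 < cos \<theta>" using that by (auto intro: sin_gt_zero cos_gt_zero)
    show "sin \<theta> < 1" using sin_monotone_2pi[of \<theta> "pi / 2"] that by auto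
  qed
  have g_r: "g (pi / 2) = r" using \<tau> by (simp add: g_def R_def arsinh_sinh_real)
  have g_mono: "g \<theta> < g \<theta>'" if "0 \<le> \<theta>" "\<theta> < \<theta>'" "\<theta>' \<le> pi / 2" for \<theta> \<theta>'
    using sin_monotone_2pi[of \<theta> \<theta>'] that R \<tau> by (auto simp: g_def divide_simps)
  have inj: "inj_on g ?S"
    using g_mono by (intro linorder_inj_onI) (auto, metis less_irrefl less_imp_le)
  have img: "g ` ?S = {0<..<r}"
  proof
    show "g ` ?S \<subseteq> {0<..<r}"
      using g_mono[of 0] g_mono[of _ "pi / 2"] g_r by (auto simp: g_def)
    show "{0<..<r} \<subseteq> g ` ?S"
    proof
      fix s assume s: "s \<in> {0<..<r}"
      define t where "t = sinh (\<tau> * s / 2) / R"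
      have t: "0 < t" "t < 1" using s \<tau> r R by (auto simp: t_def R_def divide_simps)
      have "arcsin t \<in> ?S" using t arcsin_less_arcsin[of 0 t] arcsin_lt_bounded[of t] by auto
      moreover have "g (arcsin t) = s" using t R \<tau> by (simp add: g_def t_def arsinh_sinh_real)
      ultimately show "s \<in> g ` ?S" by (metis image_eqI)
    qed
  qed
  \<comment> \<open>\<open>g'\<close> cancels the factor \<open>cosh\<close> in
    \<open>sinh (\<tau> s)\<close> and leaves \<open>4 R^2 cos sin\<close>, while the kernel gives a
    constant times \<open>(R cos)^(d - 2)\<close>. Together \<open>cos^(d - 1)\<close> remains, so
    \<open>W\<close> is continuous even for \<open>d = 1\<close>, where the kernel is
    singular.\<close>
  have key: "\<bar>g' \<theta>\<bar> *\<^sub>R F (g \<theta>) = W \<theta>" if \<theta>: "\<theta> \<in> ?S" for \<theta>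
  proof -
    let ?s = "sin \<theta>" and ?c = "cos \<theta>"
    have cosh: "cosh (\<tau> * g \<theta> / 2) = sqrt ((R * ?s)\<^sup>2 + 1)"
      using \<tau> by (simp add: g_def cosh_arsinh_real)
    have q: "0 < sqrt ((R * ?s)\<^sup>2 + 1)" by (simp add: add_nonneg_pos)
    have "cosh (\<tau> * r) - cosh (\<tau> * g \<theta>) = 2 * (R ^ 2 * ?c ^ 2)"
      unfolding cosh_minus_cosh sg R_def[symmetric]
      by (simp add: cos_squared_eq power_mult_distrib algebra_simps)
    also have "\<dots> powr (real d / 2 - 1) = 2 powr (real d / 2 - 1) * (R * ?c) powr (real d - 2)"
    proof -
      have "(R^2 * ?c\<^sup>2) powr (real d / 2 - 1) = ((R * ?c) powr 2) powr (real d / 2 - 1)"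
        using R sc[OF \<theta>] by (simp add: powr_numeral power_mult_distrib)
      also have "\<dots> = (R * ?c) powr (real d - 2)" unfolding powr_powr by (simp add: algebra_simps)
      finally show ?thesis using R sc[OF \<theta>] by (simp add: powr_mult)
    qed
    finally have pw: "(cosh (\<tau> * r) - cosh (\<tau> * g \<theta>)) powr (real d / 2 - 1) =
      2 powr (real d / 2 - 1) * (R * ?c) powr (real d - 2)" .
    have ab: "\<bar>g' \<theta>\<bar> = g' \<theta>" using R sc[OF \<theta>] \<tau> q by (simp add: g'_def)
    have "g' \<theta> * (\<tau> * sinh (\<tau> * g \<theta>) * (cosh (\<tau> * r) - cosh (\<tau> * g \<theta>)) powr (real d / 2 - 1)) *
        ((R * ?s) ^ j / (R * ?s)) = 2 powr (real d / 2 + 1) * R ^ (j + d) / R * (?c ^ (d - 1) * ?s ^ j)"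
    proof -
      have p1: "2 powr (real d / 2 + 1) = 4 * 2 powr (real d / 2 - 1)"
        using powr_add[of 2 "real d / 2 - 1" 2] by (simp add: powr_numeral add.commute)
      have p2: "(R * ?c) ^ d = (R * ?c) powr (real d - 2) * (R * ?c) ^ 2"
        using powr_add[of "R * ?c" "real d - 2" 2] R sc[OF \<theta>] by (simp add: powr_realpow powr_numeral)
      have p3: "(R * ?c) ^ d = R ^ d * (?c ^ (d - 1) * ?c)"
        using power_minus_mult[OF d, of ?c] by (simp only: power_mult_distrib)
      have "g' \<theta> * (\<tau> * sinh (\<tau> * g \<theta>)) = 4 * R ^ 2 * ?c * ?s"
        unfolding sinh_double_half sg cosh g'_def using q \<tau> by (simp add: field_simps power2_eq_square)
      moreover have "g' \<theta> * (\<tau> * sinh (\<tau> * g \<theta>) * P) * Q = (g' \<theta> * (\<tau> * sinh (\<tau> * g \<theta>))) * P * Q" for P Q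
        by (simp only: mult.assoc)
      ultimately have "g' \<theta> * (\<tau> * sinh (\<tau> * g \<theta>) * (cosh (\<tau> * r) - cosh (\<tau> * g \<theta>)) powr (real d / 2 - 1)) *
        ((R * ?s) ^ j / (R * ?s)) = (4 * R ^ 2 * ?c * ?s) * (2 powr (real d / 2 - 1) * (R * ?c) powr (real d - 2)) * ((R * ?s) ^ j / (R * ?s))"
        unfolding pw by (simp only:)
      also have "\<dots> = 2 powr (real d / 2 + 1) * ((R * ?c) powr (real d - 2) * (R * ?c) ^ 2) / ?c * R ^ j * ?s ^ j / R"
        unfolding p1 using R sc[OF \<theta>] by (simp add: field_simps power_mult_distrib power2_eq_square)
      also have "\<dots> = 2 powr (real d / 2 + 1) * R ^ (j + d) / R * (?c ^ (d - 1) * ?s ^ j)"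
        unfolding p2[symmetric] p3 using sc[OF \<theta>] by (simp add: power_add)
      finally show ?thesis .
    qed
    from arg_cong[OF this, of complex_of_real] show ?thesis
      unfolding W_def F_def rl_state_def sg ab scaleR_conv_of_real of_real_mult[symmetric] mult.assoc[symmetric]
      by (simp only: of_real_mult mult_ac)
  qed
  have Wc: "continuous_on A W" for A
  proof -
    have "continuous_on A (\<lambda>\<theta>. G (R * sin \<theta>))"
      by (rule continuous_on_compose2[OF G]) (auto intro!: continuous_intros)
    then show ?thesis unfolding W_def[abs_def] by (intro continuous_intros)
  qed
  have Wint: "(W has_integral integral {0..pi / 2} W) {0..pi / 2}"
    by (intro integrable_integral integrable_continuous_real Wc)
  have Wabs: "W absolutely_integrable_on ?S"
    by (rule set_integrable_subset[OF absolutely_integrable_continuous_real[OF Wc[of "{0..pi / 2}"]]]) auto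
  have "integral ?S W = integral {0..pi / 2} W"
    using Wint integral_unique unfolding has_integral_Icc_iff_Ioo by blast
  moreover have "(\<lambda>\<theta>. \<bar>g' \<theta>\<bar> *\<^sub>R F (g \<theta>)) absolutely_integrable_on ?S"
    using Wabs by (rule absolutely_integrable_spike[OF _ negligible_empty]) (use key in auto)
  moreover have "integral ?S (\<lambda>\<theta>. \<bar>g' \<theta>\<bar> *\<^sub>R F (g \<theta>)) = integral ?S W"
    by (intro integral_cong key)
  \<comment> \<open>Integrability is transferred backwards, from the continuous \<open>W\<close> to
    the possibly singular \<open>F\<close>; hence the open intervals, whose end points are restored
    afterwards.\<close>
  ultimately have "F absolutely_integrable_on {0<..<r} \<and> integral {0<..<r} F = integral {0..pi / 2} W"
    using has_absolute_integral_change_of_variables_real[of ?S g g' F, OF _ dg inj] unfolding img by auto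
  then have "(F has_integral integral {0..pi / 2} W) {0<..<r}"
    using set_lebesgue_integral_eq_integral(1) integrable_integral by metis
  then have "(F has_integral integral {0..pi / 2} W) {0..r}"
    unfolding has_integral_Icc_iff_Ioo .
  then have "((\<lambda>s. of_real (\<tau> * sinh (\<tau> * s) * (cosh (\<tau> * r) - cosh (\<tau> * s)) powr (real d / 2 - 1)) * H s)
      has_integral integral {0..pi / 2} W) {0..r}"
    by (rule has_integral_spike_finite[of "{0, r}", rotated 2]) (auto simp: F_def H)
  moreover have "integral {0..pi / 2} W = of_real (Gamma (real d / 2) * 2 powr (real d / 2)) * rl_state \<tau> (j + d) (ek j d G) r"
  proof -
    have "integral {0..pi / 2} W = of_real (2 powr (real d / 2 + 1) * R ^ (j + d) / R) *
        integral {0..pi / 2} (\<lambda>\<theta>. of_real (cos \<theta> ^ (d - 1) * sin \<theta> ^ j) * G (R * sin \<theta>))"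
      unfolding W_def[abs_def] by (rule integral_mult_right)
    also have "\<dots> = of_real (2 powr (real d / 2 + 1) * R ^ (j + d) / R) * (of_real (Gamma (real d / 2) / 2) * ek j d G R)"
      unfolding ek_eq_integral[OF d] using Gamma_half_nonzero[OF d] by simp
    finally show ?thesis
      unfolding rl_state_def R_def[symmetric] by (simp add: powr_add)
  qed
  ultimately show ?thesis by simp
qed

lemma riemann_liouville_0 [simp]: "riemann_liouville \<tau> 0 f = f"
  by (simp add: riemann_liouville_def fun_eq_iff)

text \<open>Only the result of the \<open>M\<close> inner derivatives enters, so positive orders
  (\<open>M = 0\<close>) and negative orders are covered alike, once those derivatives are known to
  form a state. For a nonnegative base and a real exponent the complex \<open>powr\<close> is the
  real one.\<close>

lemma riemann_liouville_general:
  assumes \<tau>: "0 < \<tau>" and r: "0 < r" and d: "0 < d" and \<mu>: "\<mu> \<noteq> 0"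
    and least: "(LEAST M :: nat. Re \<mu> > - real M) = M" and e: "\<mu> + of_nat M = of_real (real d / 2)"
    and G: "continuous_on UNIV G"
    and H: "\<And>s. 0 < s \<Longrightarrow> s < r \<Longrightarrow> (cosh_deriv \<tau> ^^ M) f s = rl_state \<tau> j G s"
  shows "riemann_liouville \<tau> \<mu> f r = of_real (2 powr (real d / 2)) * rl_state \<tau> (j + d) (ek j d G) r"
proof -
  have "((\<lambda>s. of_real (\<tau> * sinh (\<tau> * s)) * of_real (cosh (\<tau> * r) - cosh (\<tau> * s)) powr (\<mu> + of_nat M - 1) *
      (cosh_deriv \<tau> ^^ M) f s) has_integral of_real (Gamma (real d / 2) * 2 powr (real d / 2)) * rl_state \<tau> (j + d) (ek j d G) r) {0..r}"
  proof (rule has_integral_eq[OF _ rl_integral[OF G \<tau> r d H]])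
    fix s assume s: "s \<in> {0..r}"
    then have "cosh (\<tau> * s) \<le> cosh (\<tau> * r)" using \<tau> by (simp add: cosh_real_nonneg_le_iff)
    then have p: "of_real (cosh (\<tau> * r) - cosh (\<tau> * s)) powr (of_real (real d / 2 - 1) :: complex) =
        of_real ((cosh (\<tau> * r) - cosh (\<tau> * s)) powr (real d / 2 - 1))"
      by (intro powr_of_real) simp
    have m: "\<mu> + of_nat M - 1 = of_real (real d / 2 - 1)" unfolding e by simp
    show "of_real (\<tau> * sinh (\<tau> * s) * (cosh (\<tau> * r) - cosh (\<tau> * s)) powr (real d / 2 - 1)) * (cosh_deriv \<tau> ^^ M) f s =
      of_real (\<tau> * sinh (\<tau> * s)) * of_real (cosh (\<tau> * r) - cosh (\<tau> * s)) powr (\<mu> + of_nat M - 1) * (cosh_deriv \<tau> ^^ M) f s"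
      unfolding m p of_real_mult by (rule refl)
  qed
  from integral_unique[OF this] show ?thesis
    unfolding riemann_liouville_def Let_def least e Gamma_complex_of_real
    using \<mu> Gamma_half_nonzero[OF d] by simp
qed

lemma riemann_liouville_pos:
  assumes "0 < \<tau>" "0 < r" "continuous_on UNIV G"
    and H: "\<And>s. 0 < s \<Longrightarrow> s \<le> r \<Longrightarrow> f s = rl_state \<tau> j G s"
  shows "riemann_liouville \<tau> (of_nat d / 2) f r = of_real (2 powr (real d / 2)) * rl_state \<tau> (j + d) (ek j d G) r"
proof (cases "d = 0")
  \<comment> \<open>Order zero is the identity by definition and reads \<open>f\<close> at
    \<open>r\<close> itself; hence the assumption includes \<open>s = r\<close>.\<close>
  case True
  then show ?thesis using H[of r] assms by simp
next
  case False
  show ?thesis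
  proof (rule riemann_liouville_general[where M = 0])
    show "(LEAST M :: nat. Re (of_nat d / 2) > - real M) = 0"
      using False by (intro Least_equality) auto
  qed (use assms False in auto)
qed

text \<open>With \<open>y = R * sin \<theta>\<close> the full step \<open>ek j 2\<close> becomes an
  ordinary primitive of \<open>y ^ j * G y\<close>, so the fundamental theorem of calculus shows
  that \<open>d / d (cosh \<tau> s)\<close> lowers \<open>j + 2\<close> to \<open>j\<close>.\<close>

lemma cosh_deriv_rl_state:
  assumes G: "continuous_on UNIV G" and \<tau>: "0 < \<tau>" and s: "0 < s"
  shows "((\<lambda>s. 2 * rl_state \<tau> (j + 2) (ek j 2 G) s) has_vector_derivative
      of_real (\<tau> * sinh (\<tau> * s)) * rl_state \<tau> j G s) (at s)"
proof -
  define P where "P x = 4 * integral {0..x} (\<lambda>y. of_real (y ^ j) * G y)" for x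
  have *: "2 * rl_state \<tau> (j + 2) (ek j 2 G) s = P (sinh (\<tau> * s / 2))" if s: "0 < s" for s
  proof -
    define R where "R = sinh (\<tau> * s / 2)"
    have R: "0 < R" using \<tau> s by (simp add: R_def)
    have "((\<lambda>\<theta>. (R * cos \<theta>) *\<^sub>R (of_real ((R * sin \<theta>) ^ j) * G (R * sin \<theta>))) has_integral
        integral {R * sin 0..R * sin (pi / 2)} (\<lambda>y. of_real (y ^ j) * G y)) {0..pi / 2}"
    proof (rule has_integral_substitution[where c = 0 and d = R])
      show "(\<lambda>\<theta>. R * sin \<theta>) ` {0..pi / 2} \<subseteq> {0..R}"
        using R by (auto intro!: mult_nonneg_nonneg sin_ge_zero simp: mult_le_cancel_left1)
      show "continuous_on {0..R} (\<lambda>y. of_real (y ^ j) * G y)"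
        by (intro continuous_intros continuous_on_subset[OF G]) auto
    qed (use R in \<open>auto intro!: derivative_eq_intros\<close>)
    moreover have "((\<lambda>\<theta>. (R * cos \<theta>) *\<^sub>R (of_real ((R * sin \<theta>) ^ j) * G (R * sin \<theta>)))) =
        (\<lambda>\<theta>. of_real (R ^ (j + 1)) * (of_real (cos \<theta> ^ 1 * sin \<theta> ^ j) * G (R * sin \<theta>)))"
      by (simp add: fun_eq_iff scaleR_conv_of_real power_mult_distrib mult_ac)
    ultimately have "integral {0..R} (\<lambda>y. of_real (y ^ j) * G y) =
        of_real (R ^ (j + 1)) * integral {0..pi / 2} (\<lambda>\<theta>. of_real (cos \<theta> ^ 1 * sin \<theta> ^ j) * G (R * sin \<theta>))"
      by (simp only: integral_mult_right[symmetric] integral_unique sin_zero sin_pi_half mult_zero_right mult_1_right)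
    then show ?thesis
      using R unfolding rl_state_def R_def[symmetric] P_def ek_eq_integral[OF zero_less_numeral]
      by (simp add: power_add)
  qed
  define R where "R = sinh (\<tau> * s / 2)"
  have R: "0 < R" using \<tau> s by (simp add: R_def)
  have "((\<lambda>x. integral {0..x} (\<lambda>y. of_real (y ^ j) * G y)) has_vector_derivative of_real (R ^ j) * G R) (at R within {0..R + 1})"
    using R by (intro integral_has_vector_derivative continuous_intros continuous_on_subset[OF G]) auto
  then have "(P has_vector_derivative 4 * (of_real (R ^ j) * G R)) (at R within {0..R + 1})"
    unfolding P_def by (rule has_vector_derivative_mult_right)
  then have P': "(P has_vector_derivative 4 * (of_real (R ^ j) * G R)) (at R)"
    using at_within_interior[of R "{0..R + 1}"] R by simp
  have "((\<lambda>s. sinh (\<tau> * s / 2)) has_vector_derivative \<tau> / 2 * cosh (\<tau> * s / 2)) (at s)"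
    by (auto intro!: derivative_eq_intros simp: has_real_derivative_iff_has_vector_derivative[symmetric])
  from vector_diff_chain_at[OF this P'[unfolded R_def]]
  have "((\<lambda>s. P (sinh (\<tau> * s / 2))) has_vector_derivative
      (\<tau> / 2 * cosh (\<tau> * s / 2)) *\<^sub>R (4 * (of_real (R ^ j) * G R))) (at s)"
    by (simp add: o_def R_def)
  moreover have "(\<tau> / 2 * cosh (\<tau> * s / 2)) *\<^sub>R (4 * (of_real (R ^ j) * G R)) = of_real (\<tau> * sinh (\<tau> * s)) * rl_state \<tau> j G s"
    using R unfolding rl_state_def sinh_double_half R_def[symmetric]
    by (simp add: scaleR_conv_of_real field_simps)
  ultimately show ?thesis
    using has_vector_derivative_transform_within_open[of "\<lambda>s. P (sinh (\<tau> * s / 2))" _ s "{0<..}"] * s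
    by simp
qed

lemma cosh_deriv_eq:
  assumes "(f has_vector_derivative of_real (\<tau> * sinh (\<tau> * s)) * d) (at s)" "0 < \<tau>" "0 < s"
  shows "cosh_deriv \<tau> f s = d"
  using vector_derivative_at[OF assms(1)] assms(2,3) by (simp add: cosh_deriv_def)

text \<open>Each \<open>cosh_deriv\<close> removes two half steps and a factor 2. The function
  \<open>f\<close> varies in the induction, since the derivative applied first is the innermost
  one.\<close>

lemma cosh_deriv_funpow:
  assumes G: "continuous_on UNIV G" and \<tau>: "0 < \<tau>"
    and H: "\<And>s. 0 < s \<Longrightarrow> f s = of_real (2 powr (real d / 2 + real p)) * rl_state \<tau> (j + d + 2 * p) (ek j (d + 2 * p) G) s"
    and s: "0 < s"
  shows "(cosh_deriv \<tau> ^^ p) f s = of_real (2 powr (real d / 2)) * rl_state \<tau> (j + d) (ek j d G) s"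
  using H s
proof (induction p arbitrary: f s)
  case 0
  then show ?case by simp
next
  case (Suc p)
  have "(cosh_deriv \<tau> ^^ Suc p) f s = (cosh_deriv \<tau> ^^ p) (cosh_deriv \<tau> f) s"
    by (simp only: funpow_Suc_right o_def)
  also have "\<dots> = of_real (2 powr (real d / 2)) * rl_state \<tau> (j + d) (ek j d G) s"
  proof (rule Suc.IH[OF _ Suc.prems(2)])
    fix t :: real assume t: "0 < t"
    let ?E = "ek j (d + 2 * p) G"
    have "((\<lambda>s. of_real (2 powr (real d / 2 + real p)) * (2 * rl_state \<tau> ((j + d + 2 * p) + 2) (ek (j + d + 2 * p) 2 ?E) s)) has_vector_derivative
      of_real (2 powr (real d / 2 + real p)) * (of_real (\<tau> * sinh (\<tau> * t)) * rl_state \<tau> (j + d + 2 * p) ?E t)) (at t)"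
      by (intro has_vector_derivative_mult_right cosh_deriv_rl_state ek_continuous G \<tau> t)
    moreover have "ek (j + d + 2 * p) 2 ?E = ek j (d + 2 * Suc p) G"
      using ek_semigroup[OF G, of j "d + 2 * p" 2] by (simp add: add_ac)
    ultimately have "((\<lambda>s. of_real (2 powr (real d / 2 + real (Suc p))) * rl_state \<tau> (j + d + 2 * Suc p) (ek j (d + 2 * Suc p) G) s) has_vector_derivative
      of_real (\<tau> * sinh (\<tau> * t)) * (of_real (2 powr (real d / 2 + real p)) * rl_state \<tau> (j + d + 2 * p) ?E t)) (at t)"
      by (simp add: powr_add mult_ac add_ac)
    then have "(f has_vector_derivative
      of_real (\<tau> * sinh (\<tau> * t)) * (of_real (2 powr (real d / 2 + real p)) * rl_state \<tau> (j + d + 2 * p) ?E t)) (at t)"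
      by (rule has_vector_derivative_transform_within_open[of _ _ t "{0<..}"]) (use t Suc.prems(1) in auto)
    then show "cosh_deriv \<tau> f t = of_real (2 powr (real d / 2 + real p)) * rl_state \<tau> (j + d + 2 * p) ?E t"
      by (rule cosh_deriv_eq[OF _ \<tau> t])
  qed
  finally show ?case .
qed

text \<open>Orders add up: \<open>d / 2\<close> followed by \<open>1 - d / 2\<close> leaves one full
  step, a primitive rather than the original. What happens on the way depends on \<open>d\<close>:
  the identity for \<open>d = 2\<close>, derivatives and a half step for odd \<open>d\<close>, and
  for even \<open>d \<ge> 4\<close> one derivative too many, repaired by an integration of order
  one.\<close>

lemma riemann_liouville_inverse:
  assumes G: "continuous_on UNIV G" and \<tau>: "0 < \<tau>" and r: "0 < r" and d: "0 < d"
    and H: "\<And>s. 0 < s \<Longrightarrow> f s = of_real (2 powr (real d / 2)) * rl_state \<tau> (j + d) (ek j d G) s"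
  shows "riemann_liouville \<tau> (1 - of_nat d / 2) f r = 2 * rl_state \<tau> (j + 2) (ek j 2 G) r"
proof -
  have half: "2 powr (1 / 2) * (2 powr (1 / 2)) = (2 :: real)" by (simp add: powr_add[symmetric])
  have odd_case: "of_real (2 powr (real 1 / 2)) * rl_state \<tau> (j + 1 + 1) (ek (j + 1) 1 (\<lambda>x. of_real (2 powr (1 / 2)) * ek j 1 G x)) r
      = 2 * rl_state \<tau> (j + 2) (ek j 2 G) r"
  proof -
    have "ek (j + 1) 1 (\<lambda>x. of_real (2 powr (1 / 2)) * ek j 1 G x) = (\<lambda>x. of_real (2 powr (1 / 2)) * ek j 2 G x)"
      unfolding ek_cmult ek_semigroup[OF G] by (simp only: one_add_one)
    then show ?thesis
      using arg_cong[OF half, of complex_of_real] by (simp add: rl_state_def mult_ac)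
  qed
  consider "d = 2" | p where "d = 2 * p + 1" | p where "d = 2 * p + 4"
  proof -
    have "d = 2 \<or> (\<exists>p. d = 2 * p + 1) \<or> (\<exists>p. d = 2 * p + 4)" using d by presburger
    then show ?thesis using that by blast
  qed
  then show ?thesis
  proof cases
    case 1
    then show ?thesis using H[OF r] by (simp add: powr_numeral)
  next
    case (2 p)
    have "riemann_liouville \<tau> (1 - of_nat d / 2) f r = of_real (2 powr (real 1 / 2)) *
        rl_state \<tau> (j + 1 + 1) (ek (j + 1) 1 (\<lambda>x. of_real (2 powr (1 / 2)) * ek j 1 G x)) r"
    proof (rule riemann_liouville_general[OF \<tau> r, where M = p])
      have re: "Re (1 - of_nat d / 2) = 1 / 2 - real p" using 2 by (simp add: add_divide_distrib)
      show "(1 - of_nat d / 2 :: complex) \<noteq> 0"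
      proof
        assume "(1 - of_nat d / 2 :: complex) = 0"
        then have "1 / 2 = real p" using re by simp
        then have "real (2 * p) = real 1" by simp
        then have "2 * p = 1" unfolding of_nat_eq_iff .
        then show False by presburger
      qed
      show "(LEAST M :: nat. Re (1 - of_nat d / 2) > - real M) = p"
      proof (rule Least_equality)
        fix y :: nat assume "- real y < Re (1 - of_nat d / 2)"
        then have "real (2 * p) < real (2 * y + 1)" unfolding re by simp
        then show "p \<le> y" unfolding of_nat_less_iff by simp
      next
        have "- x < 1 / 2 - x" for x :: real by simp
        then show "- real p < Re (1 - of_nat d / 2)" unfolding re .
      qed
      show "1 - of_nat d / 2 + of_nat p = complex_of_real (real 1 / 2)"
        using 2 by (simp add: field_simps)
      show "continuous_on UNIV (\<lambda>x. of_real (2 powr (1 / 2)) * ek j 1 G x)"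
        by (intro continuous_intros ek_continuous G)
      fix s assume "0 < s" "s < r"
      then have "(cosh_deriv \<tau> ^^ p) f s = of_real (2 powr (real 1 / 2)) * rl_state \<tau> (j + 1) (ek j 1 G) s"
        by (intro cosh_deriv_funpow[OF G \<tau>]) (auto simp: H 2 add_ac add_divide_distrib)
      then show "(cosh_deriv \<tau> ^^ p) f s = rl_state \<tau> (j + 1) (\<lambda>x. of_real (2 powr (1 / 2)) * ek j 1 G x) s"
        by (simp add: rl_state_def mult_ac)
    qed simp
    then show ?thesis using odd_case by simp
  next
    case (3 p)
    have "riemann_liouville \<tau> (1 - of_nat d / 2) f r = of_real (2 powr (real 2 / 2)) * rl_state \<tau> (j + 2) (ek j 2 G) r"
    proof (rule riemann_liouville_general[OF \<tau> r _ _ _ _ G, where M = "p + 2"])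
      have re: "Re (1 - of_nat d / 2) = - 1 - real p" using 3 by (simp add: add_divide_distrib)
      show "(1 - of_nat d / 2 :: complex) \<noteq> 0"
      proof
        assume "(1 - of_nat d / 2 :: complex) = 0"
        then show False using re by simp
      qed
      \<comment> \<open>The order is the integer \<open>-1 - p\<close> and the inequality is strict,
        so \<open>M = p + 1\<close> is not admissible.\<close>
      show "(LEAST M :: nat. Re (1 - of_nat d / 2) > - real M) = p + 2"
        unfolding re by (intro Least_equality) auto
      show "1 - of_nat d / 2 + of_nat (p + 2) = complex_of_real (real 2 / 2)"
        using 3 by (simp add: field_simps)
      fix s assume "0 < s" "s < r"
      then have "(cosh_deriv \<tau> ^^ (p + 2)) f s = of_real (2 powr (real 0 / 2)) * rl_state \<tau> (j + 0) (ek j 0 G) s"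
      proof (intro cosh_deriv_funpow[OF G \<tau>])
        have e: "d = 0 + 2 * (p + 2)" "j + d = j + 0 + 2 * (p + 2)" "real d / 2 = real 0 / 2 + real (p + 2)"
          using 3 by simp_all
        fix t :: real assume t: "0 < t"
        show "f t = of_real (2 powr (real 0 / 2 + real (p + 2))) * rl_state \<tau> (j + 0 + 2 * (p + 2)) (ek j (0 + 2 * (p + 2)) G) t"
          unfolding H[OF t] e(2) e(3) by (simp only: e(1)[symmetric])
      qed
      then show "(cosh_deriv \<tau> ^^ (p + 2)) f s = rl_state \<tau> j G s" by simp
    qed simp
    then show ?thesis by simp
  qed
qed

section \<open>The dual Abel transform as a composition of Erdelyi-Kober operators\<close>

text \<open>The \<open>G\<close> for which \<open>g t / sinh (t / 2)\<close> is the state with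
  \<open>\<tau> = 1 / 2\<close> and \<open>j = 0\<close>: there \<open>x = sinh (t / 4)\<close> and
  \<open>sinh (t / 2) = 2 * x * cosh (t / 4)\<close>.\<close>

definition abel_inner :: "(real \<Rightarrow> complex) \<Rightarrow> real \<Rightarrow> complex" where
  "abel_inner g x = of_real (inverse (2 * cosh (arsinh x))) * g (4 * arsinh x)"

text \<open>Rewrites a state for \<open>\<tau> = 1 / 2\<close> as one for \<open>\<tau> = 1\<close>,
  including the factor \<open>1 / cosh (s / 2)\<close>. Here \<open>x = sinh (s / 2)\<close>, and
  the powers of \<open>2 * cosh (s / 4)\<close> come from
  \<open>sinh (s / 2) = 2 * sinh (s / 4) * cosh (s / 4)\<close>. All factors are even, smooth and
  positive in \<open>x\<close>, hence invertible.\<close>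

definition abel_outer :: "nat \<Rightarrow> (real \<Rightarrow> complex) \<Rightarrow> real \<Rightarrow> complex" where
  "abel_outer m g x = of_real (inverse (cosh (arsinh x)) * (2 * cosh (arsinh x / 2) * inverse ((2 * cosh (arsinh x / 2)) ^ m))) *
     ek 0 m (abel_inner g) (sinh (arsinh x / 2))"

text \<open>The right-hand side of the explicit formula in a form that is smooth and even across
  \<open>r = 0\<close>: dividing by \<open>sinh (r / 2) ^ m * sinh r ^ (k - 1)\<close> cancels all
  powers of \<open>sinh (r / 2)\<close> in the final state and leaves powers of
  \<open>2 * cosh (r / 2)\<close>.\<close>

definition abel_op :: "nat \<Rightarrow> nat \<Rightarrow> (real \<Rightarrow> complex) \<Rightarrow> real \<Rightarrow> complex" where
  "abel_op m k g r = of_real (c2 (m + k + 1) / 2 * 2 powr (real m / 2) * 2 powr (real k / 2) *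
     inverse ((2 * cosh (r / 2)) ^ (k - 1))) * ek m k (abel_outer m g) (sinh (r / 2))"

lemma c2_pos: "0 < c2 n" if "0 < n"
  using that by (simp add: c2_def Gamma_real_pos)

lemma smooth_on_cosh_scaled: "smooth_on UNIV (\<lambda>x. cosh (a * x) :: real)"
  by (rule smooth_on_scale_arg[OF smooth_on_cosh])

lemma fs_iso_abel_inner: "fs_iso even_smooth even_smooth abel_inner"
proof -
  have "fs_iso even_smooth even_smooth (\<lambda>f x. of_real (inverse (2 * cosh (1 / 4 * x))) * f x)"
  proof (rule fs_iso_mult)
    show "smooth_on UNIV (\<lambda>x :: real. inverse (2 * cosh (1 / 4 * x)))"
      by (rule smooth_on_compose_real[OF _ _ smooth_on_inverse])
        (auto intro!: smooth_on_mult smooth_on_const smooth_on_cosh_scaled simp del: times_divide_eq_left)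
  qed auto
  from fs_iso_comp[OF this fs_iso_sinh(2)[of "1 / 4"]]
  have "fs_iso even_smooth even_smooth (\<lambda>f x. of_real (inverse (2 * cosh (1 / 4 * (1 / (1 / 4) * arsinh x)))) * f (1 / (1 / 4) * arsinh x))"
    by simp
  then show ?thesis by (rule fs_iso_cong[OF _ even_smooth_subspace]) (simp add: abel_inner_def fun_eq_iff)
qed

lemma fs_iso_abel_outer: "fs_iso even_smooth even_smooth (abel_outer m)"
proof -
  have 1: "fs_iso even_smooth even_smooth (\<lambda>f x. ek 0 m (abel_inner f) (sinh (1 / 4 * x)))"
    by (rule fs_iso_comp[OF fs_iso_comp[OF fs_iso_abel_inner fs_iso_ek] fs_iso_sinh(1)]) simp
  have "fs_iso even_smooth even_smooth (\<lambda>f x. of_real (inverse (cosh (1 / 2 * x)) *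
      (2 * cosh (1 / 4 * x) * inverse ((2 * cosh (1 / 4 * x)) ^ m))) * f x)"
  proof (rule fs_iso_mult)
    show "smooth_on UNIV (\<lambda>x :: real. inverse (cosh (1 / 2 * x)) * (2 * cosh (1 / 4 * x) * inverse ((2 * cosh (1 / 4 * x)) ^ m)))"
      by (intro smooth_on_compose_real[OF _ _ smooth_on_inverse] smooth_on_mult smooth_on_power smooth_on_const
          smooth_on_cosh_scaled) auto
  qed auto
  from fs_iso_comp[OF fs_iso_comp[OF 1 this] fs_iso_sinh(2)[of "1 / 2"]]
  have "fs_iso even_smooth even_smooth (\<lambda>f x. of_real (inverse (cosh (1 / 2 * (1 / (1 / 2) * arsinh x))) *
      (2 * cosh (1 / 4 * (1 / (1 / 2) * arsinh x)) * inverse ((2 * cosh (1 / 4 * (1 / (1 / 2) * arsinh x))) ^ m))) *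
      ek 0 m (abel_inner f) (sinh (1 / 4 * (1 / (1 / 2) * arsinh x))))"
    by simp
  then show ?thesis by (rule fs_iso_cong[OF _ even_smooth_subspace]) (simp add: abel_outer_def fun_eq_iff)
qed

lemma fs_iso_abel_op: "fs_iso even_smooth even_smooth (abel_op m k)"
proof -
  have 1: "fs_iso even_smooth even_smooth (\<lambda>f x. ek m k (abel_outer m f) (sinh (1 / 2 * x)))"
    by (rule fs_iso_comp[OF fs_iso_comp[OF fs_iso_abel_outer fs_iso_ek] fs_iso_sinh(1)]) simp
  have "fs_iso even_smooth even_smooth (\<lambda>f x. of_real (c2 (m + k + 1) / 2 * 2 powr (real m / 2) * 2 powr (real k / 2) *
      inverse ((2 * cosh (1 / 2 * x)) ^ (k - 1))) * f x)"
  proof (rule fs_iso_mult)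
    show "smooth_on UNIV (\<lambda>x :: real. c2 (m + k + 1) / 2 * 2 powr (real m / 2) * 2 powr (real k / 2) *
        inverse ((2 * cosh (1 / 2 * x)) ^ (k - 1)))"
      by (intro smooth_on_compose_real[OF _ _ smooth_on_inverse] smooth_on_mult smooth_on_power smooth_on_const
          smooth_on_cosh_scaled) auto
  qed (auto intro!: mult_pos_pos c2_pos)
  from fs_iso_comp[OF 1 this] show ?thesis
    by (rule fs_iso_cong[OF _ even_smooth_subspace]) (simp add: abel_op_def fun_eq_iff)
qed

lemma abel_inner_continuous:
  assumes "continuous_on UNIV g" shows "continuous_on UNIV (abel_inner g)"
proof -
  have "continuous_on UNIV (\<lambda>x. g (4 * arsinh x))"
    by (rule continuous_on_compose2[OF assms]) (auto intro!: continuous_intros)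
  then show ?thesis unfolding abel_inner_def[abs_def] by (intro continuous_intros) auto
qed

lemma abel_outer_continuous:
  assumes "continuous_on UNIV g" shows "continuous_on UNIV (abel_outer m g)"
proof -
  have "continuous_on UNIV (\<lambda>x. ek 0 m (abel_inner g) (sinh (arsinh x / 2)))"
    by (rule continuous_on_compose2[OF ek_continuous[OF abel_inner_continuous[OF assms]]]) (auto intro!: continuous_intros)
  then show ?thesis unfolding abel_outer_def[abs_def] by (intro continuous_intros) auto
qed

lemma abel_inner_cmult: "abel_inner (\<lambda>x. c * g x) = (\<lambda>x. c * abel_inner g x)"
  by (simp add: abel_inner_def fun_eq_iff)

lemma abel_outer_cmult: "abel_outer m (\<lambda>x. c * g x) = (\<lambda>x. c * abel_outer m g x)"
  by (simp add: abel_outer_def fun_eq_iff abel_inner_cmult ek_cmult)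

lemma abel_op_cmult: "abel_op m k (\<lambda>x. c * g x) = (\<lambda>x. c * abel_op m k g x)"
  by (simp add: abel_op_def fun_eq_iff abel_outer_cmult ek_cmult)

lemma abel_op_add:
  assumes "continuous_on UNIV f" "continuous_on UNIV g"
  shows "abel_op m k (\<lambda>x. f x + g x) = (\<lambda>r. abel_op m k f r + abel_op m k g r)"
proof -
  have 1: "abel_inner (\<lambda>x. f x + g x) = (\<lambda>x. abel_inner f x + abel_inner g x)"
    by (simp add: abel_inner_def fun_eq_iff distrib_left)
  have 2: "abel_outer m (\<lambda>x. f x + g x) = (\<lambda>x. abel_outer m f x + abel_outer m g x)"
    unfolding abel_outer_def[abs_def] 1
    by (simp add: ek_add abel_inner_continuous assms distrib_left)
  show ?thesis
    unfolding abel_op_def[abs_def] 2 by (simp add: ek_add abel_outer_continuous assms distrib_left)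
qed

lemma abel_inner_state: "0 < t \<Longrightarrow> rl_state (1 / 2) 0 (abel_inner g) t = of_real (inverse (sinh (t / 2))) * g t"
  using sinh_double[of "t / 4"] by (simp add: rl_state_def abel_inner_def arsinh_sinh_real field_simps)

lemma abel_outer_state:
  assumes "0 < s"
  shows "rl_state 1 m (abel_outer m g) s = of_real (inverse (cosh (s / 2))) * rl_state (1 / 2) m (ek 0 m (abel_inner g)) s"
proof -
  have d: "sinh (s / 2) = 2 * sinh (s / 4) * cosh (s / 4)" using sinh_double[of "s / 4"] by simp
  have p: "0 < sinh (s / 4)" using assms by simp
  have c: "cosh (s / 4) \<noteq> 0" using cosh_real_pos[of "s / 4"] by linarith
  have "(2 * x * y) ^ m / (2 * x * y) * (inverse w * (2 * y * inverse ((2 * y) ^ m))) = inverse w * (x ^ m / x)"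
    if "x \<noteq> 0" "y \<noteq> 0" for x y w :: real
  proof -
    have e: "(2 * x * y) ^ m = (2 * y) ^ m * x ^ m" by (simp add: power_mult_distrib mult_ac)
    have "Y * X / (2 * x * y) * (v * (2 * y * inverse Y)) = v * (X / x)" if "Y \<noteq> 0" for X Y v :: real
      using that \<open>x \<noteq> 0\<close> \<open>y \<noteq> 0\<close> by (simp add: field_simps)
    moreover have "(2 * y) ^ m \<noteq> 0" using that by simp
    ultimately show ?thesis unfolding e by blast
  qed
  from arg_cong[OF this[of "sinh (s / 4)" "cosh (s / 4)" "cosh (s / 2)"], of complex_of_real] p c
  have *: "complex_of_real ((sinh (s / 2)) ^ m / sinh (s / 2)) * of_real (inverse (cosh (s / 2)) * (2 * cosh (s / 4) * inverse ((2 * cosh (s / 4)) ^ m))) =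
    of_real (inverse (cosh (s / 2))) * of_real (sinh (s / 4) ^ m / sinh (s / 4))"
    unfolding d of_real_mult[symmetric] by simp
  have q: "1 * s / 2 = s / 2" "s / 2 / 2 = s / 4" "1 / 2 * s / 2 = s / 4" by simp_all
  show ?thesis
    unfolding rl_state_def abel_outer_def q arsinh_sinh_real
    using arg_cong[OF *, of "\<lambda>z. z * ek 0 m (abel_inner g) (sinh (s / 4))"] by (simp only: mult.assoc)
qed

lemma rl_state_cmult: "rl_state \<tau> j (\<lambda>x. c * G x) s = c * rl_state \<tau> j G s"
  by (simp add: rl_state_def)

lemma abel_op_state:
  assumes "1 \<le> k" "0 < s"
  shows "of_real (sinh (s / 2) ^ m * sinh s ^ (k - 1)) * abel_op m k g s =
    of_real (c2 (m + k + 1) / 2 * 2 powr (real m / 2)) * (of_real (2 powr (real k / 2)) * rl_state 1 (m + k) (ek m k (abel_outer m g)) s)"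
proof -
  obtain l where k: "k = Suc l" using assms(1) by (cases k) auto
  have d: "sinh s = 2 * sinh (s / 2) * cosh (s / 2)" using sinh_double[of "s / 2"] by simp
  have p: "0 < sinh (s / 2)" using assms by simp
  have c: "cosh (s / 2) \<noteq> 0" using cosh_real_pos[of "s / 2"] by linarith
  have "(x ^ m * (2 * x * y) ^ l) * (C * inverse ((2 * y) ^ l)) = C * (x ^ (m + Suc l) / x)" if "x \<noteq> 0" "y \<noteq> 0" for x y C :: real
  proof -
    have e: "(2 * x * y) ^ l = (2 * y) ^ l * x ^ l" by (simp add: power_mult_distrib mult_ac)
    have "M * (Y * X) * (C * inverse Y) = C * (M * (x * X) / x)" if "Y \<noteq> 0" for M X Y :: real
      using that \<open>x \<noteq> 0\<close> by (simp add: field_simps)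
    moreover have "(2 * y) ^ l \<noteq> 0" using that by simp
    ultimately show ?thesis unfolding e power_add power_Suc by blast
  qed
  from arg_cong[OF this[of "sinh (s / 2)" "cosh (s / 2)" "c2 (m + k + 1) / 2 * 2 powr (real m / 2) * 2 powr (real k / 2)"], of complex_of_real] p c
  have "complex_of_real (sinh (s / 2) ^ m * sinh s ^ (k - 1)) *
      of_real (c2 (m + k + 1) / 2 * 2 powr (real m / 2) * 2 powr (real k / 2) * inverse ((2 * cosh (s / 2)) ^ (k - 1))) =
      of_real (c2 (m + k + 1) / 2 * 2 powr (real m / 2) * 2 powr (real k / 2)) * of_real (sinh (s / 2) ^ (m + k) / sinh (s / 2))"
    unfolding d k of_real_mult[symmetric] by simp
  then show ?thesis
    unfolding abel_op_def rl_state_def mult.assoc[symmetric] mult_1 by (simp only: of_real_mult mult.assoc)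
qed

lemma abel_op_eq_riemann_liouville:
  assumes g: "continuous_on UNIV g" and k: "1 \<le> k" and r: "0 < r"
  shows "abel_op m k g r =
    of_real (c2 (m + k + 1) / 2 * inverse (sinh (r / 2) ^ m) * inverse (sinh r ^ (k - 1))) *
    riemann_liouville 1 (of_nat k / 2)
      (\<lambda>s. of_real (inverse (cosh (s / 2))) *
        riemann_liouville (1 / 2) (of_nat m / 2) (\<lambda>t. of_real (inverse (sinh (t / 2))) * g t) s) r"
proof -
  let ?h = "\<lambda>s. complex_of_real (inverse (cosh (s / 2))) * riemann_liouville (1 / 2) (of_nat m / 2) (\<lambda>t. of_real (inverse (sinh (t / 2))) * g t) s"
  have inner: "riemann_liouville (1 / 2) (of_nat m / 2) (\<lambda>t. of_real (inverse (sinh (t / 2))) * g t) s =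
      of_real (2 powr (real m / 2)) * rl_state (1 / 2) (0 + m) (ek 0 m (abel_inner g)) s" if "0 < s" for s
    by (rule riemann_liouville_pos) (use that g abel_inner_state in \<open>auto intro: abel_inner_continuous\<close>)
  then have "?h s =
      rl_state 1 m (\<lambda>x. of_real (2 powr (real m / 2)) * abel_outer m g x) s" if "0 < s" for s
    unfolding rl_state_cmult abel_outer_state[OF that] inner[OF that] add_0 using that by (simp only: mult.left_commute)
  then have "riemann_liouville 1 (of_nat k / 2)
      ?h r =
      of_real (2 powr (real k / 2)) * rl_state 1 (m + k) (ek m k (\<lambda>x. of_real (2 powr (real m / 2)) * abel_outer m g x)) r"
    using r by (intro riemann_liouville_pos) (auto intro!: continuous_intros abel_outer_continuous g)
  then have *: "of_real (c2 (m + k + 1) / 2) * riemann_liouville 1 (of_nat k / 2)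
      ?h r =
      of_real (sinh (r / 2) ^ m * sinh r ^ (k - 1)) * abel_op m k g r"
    unfolding abel_op_state[OF k r] ek_cmult rl_state_cmult by (simp only: of_real_mult mult_ac)
  have nz: "sinh (r / 2) ^ m * sinh r ^ (k - 1) \<noteq> 0" using r by simp
  have "complex_of_real (inverse (sinh (r / 2) ^ m) * inverse (sinh r ^ (k - 1))) * of_real (sinh (r / 2) ^ m * sinh r ^ (k - 1)) = 1"
  proof -
    have "inverse a * inverse b * (a * b) = 1" if "a * b \<noteq> 0" for a b :: real using that by (simp add: field_simps)
    from this[OF nz] show ?thesis unfolding of_real_mult[symmetric] by (simp only: of_real_1)
  qed
  then have "abel_op m k g r = of_real (inverse (sinh (r / 2) ^ m) * inverse (sinh r ^ (k - 1))) *
      (of_real (sinh (r / 2) ^ m * sinh r ^ (k - 1)) * abel_op m k g r)"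
    by (simp only: mult.assoc[symmetric] mult_1)
  then show ?thesis unfolding *[symmetric] by (simp only: of_real_mult mult_ac)
qed

section \<open>Inversion formulas\<close>

text \<open>Both sides are integrals of the same function, with respect to \<open>d(cosh t)\<close> and to \<open>d(cosh (t / 2))\<close>.\<close>

lemma rl_state_change:
  assumes g: "continuous_on UNIV g" and r: "0 < r"
  shows "2 * rl_state 1 (m + 2) (ek m 2 (abel_outer m g)) r =
    4 * (2 * rl_state (1 / 2) (m + 2) (ek 0 (m + 2) (abel_inner g)) r)"
proof -
  let ?H = "\<lambda>t. rl_state 1 m (abel_outer m g) t" and ?K = "\<lambda>t. rl_state (1 / 2) m (ek 0 m (abel_inner g)) t"
  have 1: "((\<lambda>s. of_real (1 * sinh (1 * s) * (cosh (1 * r) - cosh (1 * s)) powr (real 2 / 2 - 1)) * ?H s)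
    has_integral of_real (Gamma (real 2 / 2) * 2 powr (real 2 / 2)) * rl_state 1 (m + 2) (ek m 2 (abel_outer m g)) r) {0..r}"
    by (rule rl_integral) (auto intro: abel_outer_continuous g r)
  have 2: "((\<lambda>s. of_real (1 / 2 * sinh (1 / 2 * s) * (cosh (1 / 2 * r) - cosh (1 / 2 * s)) powr (real 2 / 2 - 1)) * ?K s)
    has_integral of_real (Gamma (real 2 / 2) * 2 powr (real 2 / 2)) * rl_state (1 / 2) (m + 2) (ek m 2 (ek 0 m (abel_inner g))) r) {0..r}"
    by (rule rl_integral) (auto intro: ek_continuous abel_inner_continuous g r)
  \<comment> \<open>As \<open>sinh s / cosh (s / 2) = 2 * sinh (s / 2)\<close>, the two integrands
    differ by the factor 4.\<close>
  have "((\<lambda>s. 4 * (of_real (1 / 2 * sinh (1 / 2 * s) * (cosh (1 / 2 * r) - cosh (1 / 2 * s)) powr (real 2 / 2 - 1)) * ?K s))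
    has_integral of_real (Gamma (real 2 / 2) * 2 powr (real 2 / 2)) * rl_state 1 (m + 2) (ek m 2 (abel_outer m g)) r) {0..r}"
  \<comment> \<open>The end points are left out: at \<open>r\<close> both kernels are
    \<open>0 powr 0 = 0\<close>, and the relation between the states holds for
    \<open>s > 0\<close>.\<close>
  proof (rule has_integral_spike_finite[OF _ _ 1, of "{0, r}"])
    fix s assume s: "s \<in> {0..r} - {0, r}"
    then have "0 < s" "s < r" by auto
    then have c: "cosh (1 * r) - cosh (1 * s) \<noteq> 0" "cosh (1 / 2 * r) - cosh (1 / 2 * s) \<noteq> 0"
      using cosh_real_strict_mono[of s r] cosh_real_strict_mono[of "s / 2" "r / 2"] by auto
    have p: "x powr (real 2 / 2 - 1) = 1" if "x \<noteq> 0" for x :: real using that by simp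
    have d: "sinh s = 2 * sinh (s / 2) * cosh (s / 2)" using sinh_double[of "s / 2"] by simp
    have n: "cosh (s / 2) \<noteq> 0" using cosh_real_pos[of "s / 2"] by linarith
    show "4 * (of_real (1 / 2 * sinh (1 / 2 * s) * (cosh (1 / 2 * r) - cosh (1 / 2 * s)) powr (real 2 / 2 - 1)) * ?K s) =
      of_real (1 * sinh (1 * s) * (cosh (1 * r) - cosh (1 * s)) powr (real 2 / 2 - 1)) * ?H s"
      unfolding p[OF c(1)] p[OF c(2)] abel_outer_state[OF \<open>0 < s\<close>] using n by (simp add: d)
  qed simp
  from has_integral_unique[OF this has_integral_mult_right[OF 2, of 4]]
  have "of_real (Gamma (real 2 / 2) * 2 powr (real 2 / 2)) * rl_state 1 (m + 2) (ek m 2 (abel_outer m g)) r =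
    4 * (of_real (Gamma (real 2 / 2) * 2 powr (real 2 / 2)) * rl_state (1 / 2) (m + 2) (ek m 2 (ek 0 m (abel_inner g))) r)" .
  then show ?thesis
    using ek_semigroup[OF abel_inner_continuous[OF g], of 0 m 2] by (simp add: Gamma_numeral powr_numeral)
qed

text \<open>What the inversion formulas produce before the final \<open>d/dr\<close>: a primitive of
  \<open>c2 n * g\<close>, written as a state with one full step at
  \<open>\<tau> = 1 / 2\<close>.\<close>

definition abel_primitive :: "nat \<Rightarrow> (real \<Rightarrow> complex) \<Rightarrow> real \<Rightarrow> complex" where
  "abel_primitive n g r = of_real (c2 n) * (2 * rl_state (1 / 2) 2 (ek 0 2 (\<lambda>x. 2 * abel_inner g x)) r)"

lemma abel_primitive_deriv:
  assumes g: "continuous_on UNIV g" and r: "0 < r" and \<Phi>: "\<And>s. 0 < s \<Longrightarrow> \<Phi> s = abel_primitive n g s"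
  shows "(\<Phi> has_vector_derivative of_real (c2 n) * g r) (at r)"
proof -
  have "((\<lambda>r. of_real (c2 n) * (2 * rl_state (1 / 2) (0 + 2) (ek 0 2 (\<lambda>x. 2 * abel_inner g x)) r)) has_vector_derivative
      of_real (c2 n) * (of_real (1 / 2 * sinh (1 / 2 * r)) * rl_state (1 / 2) 0 (\<lambda>x. 2 * abel_inner g x) r)) (at r)"
    by (intro has_vector_derivative_mult_right cosh_deriv_rl_state continuous_intros abel_inner_continuous g r) auto
  moreover have "of_real (1 / 2 * sinh (1 / 2 * r)) * rl_state (1 / 2) 0 (\<lambda>x. 2 * abel_inner g x) r = g r"
    unfolding rl_state_cmult abel_inner_state[OF r] using r by simp
  ultimately have "(abel_primitive n g has_vector_derivative of_real (c2 n) * g r) (at r)"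
    unfolding abel_primitive_def[abs_def] add_0 by simp
  then show ?thesis
    by (rule has_vector_derivative_transform_within_open[of _ _ r "{0<..}"]) (use r \<Phi> in auto)
qed

text \<open>The constant \<open>c\<close> is \<open>sqrt pi\<close> in the integral formula for odd
  \<open>k\<close>, where a Gamma factor is left over, and 1 otherwise.\<close>

lemma abel_primitive_conclusion:
  assumes g: "continuous_on UNIV g" and r: "0 < r" and n: "0 < n" and c: "c \<noteq> 0"
    and \<Phi>: "\<And>s. 0 < s \<Longrightarrow> \<Phi> s = abel_primitive n (\<lambda>x. of_real c * g x) s"
  shows "\<Phi> differentiable (at r) \<and> g r = of_real (1 / (c2 n * c)) * vector_derivative \<Phi> (at r)"
proof -
  have d: "(\<Phi> has_vector_derivative of_real (c2 n) * (of_real c * g r)) (at r)"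
    by (rule abel_primitive_deriv[OF _ r \<Phi>]) (intro continuous_intros g)
  have "\<Phi> differentiable (at r)"
    using d unfolding has_vector_derivative_def differentiable_def by blast
  then show ?thesis using c2_pos[OF n] c unfolding vector_derivative_at[OF d] by simp
qed

text \<open>After the outer inversion one full step remains at \<open>\<tau> = 1\<close>;
  \<open>rl_state_change\<close> moves it to \<open>\<tau> = 1 / 2\<close>, where it joins the
  \<open>m\<close> inner half steps. So the inner inversion starts from \<open>m + 2\<close> half
  steps, ends again with one full step, and a plain \<open>d/dr\<close> removes that.\<close>

lemma abel_mid_state:
  assumes g: "continuous_on UNIV g" and r: "0 < r"
  shows "2 * rl_state 1 (m + 2) (ek m 2 (\<lambda>x. of_real (c / 2 * 2 powr (real m / 2)) * abel_outer m g x)) r =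
    of_real (2 powr (real (m + 2) / 2)) * rl_state (1 / 2) (0 + (m + 2)) (ek 0 (m + 2) (\<lambda>x. of_real (2 * c) * abel_inner g x)) r"
proof -
  have e: "2 powr (real (m + 2) / 2) = 2 powr (real m / 2) * (2 :: real)"
    by (simp add: add_divide_distrib powr_add)
  have "2 * rl_state 1 (m + 2) (ek m 2 (\<lambda>x. of_real (c / 2 * 2 powr (real m / 2)) * abel_outer m g x)) r =
      of_real (c / 2 * 2 powr (real m / 2)) * (2 * rl_state 1 (m + 2) (ek m 2 (abel_outer m g)) r)"
    unfolding ek_cmult rl_state_cmult by (simp only: mult.left_commute)
  also have "\<dots> = of_real (c / 2 * 2 powr (real m / 2)) * (4 * (2 * rl_state (1 / 2) (m + 2) (ek 0 (m + 2) (abel_inner g)) r))"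
    unfolding rl_state_change[OF g r] ..
  finally show ?thesis unfolding e ek_cmult rl_state_cmult by simp
qed

lemma abel_primitive_eq:
  "2 * rl_state (1 / 2) (0 + 2) (ek 0 2 (\<lambda>x. of_real (2 * c2 n) * abel_inner g x)) r = abel_primitive n g r"
  unfolding abel_primitive_def ek_cmult rl_state_cmult add_0 of_real_mult by simp

lemma abel_inverse_riemann_liouville:
  assumes g: "continuous_on UNIV g" and k: "1 \<le> k" and r: "0 < r"
  shows "riemann_liouville (1 / 2) (- of_nat m / 2)
      (riemann_liouville 1 (- of_nat k / 2 + 1) (\<lambda>s. of_real (sinh (s / 2) ^ m * sinh s ^ (k - 1)) * abel_op m k g s)) r =
    abel_primitive (m + k + 1) g r"
proof -
  let ?G1 = "\<lambda>x. of_real (c2 (m + k + 1) / 2 * 2 powr (real m / 2)) * abel_outer m g x"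
  let ?F = "\<lambda>s. of_real (sinh (s / 2) ^ m * sinh s ^ (k - 1)) * abel_op m k g s"
  have F: "?F s = of_real (2 powr (real k / 2)) * rl_state 1 (m + k) (ek m k ?G1) s" if "0 < s" for s
    unfolding abel_op_state[OF k that] ek_cmult rl_state_cmult by (rule mult.left_commute)
  have G1: "continuous_on UNIV ?G1" by (intro continuous_intros abel_outer_continuous g)
  have "riemann_liouville 1 (1 - of_nat k / 2) ?F s = 2 * rl_state 1 (m + 2) (ek m 2 ?G1) s" if "0 < s" for s
    by (rule riemann_liouville_inverse[OF G1 _ that _ F]) (use k in auto)
  then have H: "riemann_liouville 1 (1 - of_nat k / 2) ?F s = of_real (2 powr (real (m + 2) / 2)) *
      rl_state (1 / 2) (0 + (m + 2)) (ek 0 (m + 2) (\<lambda>x. of_real (2 * c2 (m + k + 1)) * abel_inner g x)) s" if "0 < s" for s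
    unfolding abel_mid_state[OF g that, symmetric] using that by blast
  have "riemann_liouville (1 / 2) (1 - of_nat (m + 2) / 2) (riemann_liouville 1 (1 - of_nat k / 2) ?F) r =
      2 * rl_state (1 / 2) (0 + 2) (ek 0 2 (\<lambda>x. of_real (2 * c2 (m + k + 1)) * abel_inner g x)) r"
    by (rule riemann_liouville_inverse[OF _ _ r _ H]) (auto intro!: continuous_intros abel_inner_continuous g)
  moreover have "1 - of_nat (m + 2) / 2 = (- of_nat m / 2 :: complex)" "1 - of_nat k / 2 = (- of_nat k / 2 + 1 :: complex)"
    by (simp_all add: add_divide_distrib)
  ultimately show ?thesis unfolding abel_primitive_eq by (simp only:)
qed

text \<open>Common to both parities of \<open>k\<close>: if \<open>F\<close> carries
  \<open>2 + 2 * p\<close> outer half steps, then \<open>p\<close> derivatives leave one full step,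
  and after the change of scale \<open>m div 2\<close> derivatives leave one again.\<close>

lemma abel_inverse_differential:
  assumes g: "continuous_on UNIV g" and m: "even m" and r: "0 < r"
    and F: "\<And>s. 0 < s \<Longrightarrow> F s = of_real (2 powr (real 2 / 2 + real p)) *
      rl_state 1 (m + 2 + 2 * p) (ek m (2 + 2 * p) (\<lambda>x. of_real (c2 n / 2 * 2 powr (real m / 2)) * abel_outer m g x)) s"
  shows "(cosh_deriv (1 / 2) ^^ (m div 2)) ((cosh_deriv 1 ^^ p) F) r = abel_primitive n g r"
proof -
  let ?G1 = "\<lambda>x. of_real (c2 n / 2 * 2 powr (real m / 2)) * abel_outer m g x"
  have G1: "continuous_on UNIV ?G1" by (intro continuous_intros abel_outer_continuous g)
  have m2: "2 * (m div 2) = m" "real (m div 2) = real m / 2" using m by auto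
  have e: "real 2 / 2 + real (m div 2) = real (m + 2) / 2" "0 + 2 + 2 * (m div 2) = 0 + (m + 2)" "2 + 2 * (m div 2) = m + 2"
    unfolding m2 by simp_all
  have "(cosh_deriv 1 ^^ p) F s = of_real (2 powr (real 2 / 2)) * rl_state 1 (m + 2) (ek m 2 ?G1) s" if "0 < s" for s
    by (rule cosh_deriv_funpow[OF G1 _ F that]) auto
  then have H: "(cosh_deriv 1 ^^ p) F s = of_real (2 powr (real 2 / 2 + real (m div 2))) *
      rl_state (1 / 2) (0 + 2 + 2 * (m div 2)) (ek 0 (2 + 2 * (m div 2)) (\<lambda>x. of_real (2 * c2 n) * abel_inner g x)) s" if "0 < s" for s
    unfolding e abel_mid_state[OF g that, symmetric] using that by simp
  have "(cosh_deriv (1 / 2) ^^ (m div 2)) ((cosh_deriv 1 ^^ p) F) r =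
      of_real (2 powr (real 2 / 2)) * rl_state (1 / 2) (0 + 2) (ek 0 2 (\<lambda>x. of_real (2 * c2 n) * abel_inner g x)) r"
    by (rule cosh_deriv_funpow[OF _ _ H r]) (auto intro!: continuous_intros abel_inner_continuous g)
  also have "\<dots> = abel_primitive n g r"
    unfolding abel_primitive_eq[symmetric] by simp
  finally show ?thesis .
qed

lemma abel_inverse_even:
  assumes g: "continuous_on UNIV g" and m: "even m" and k: "1 \<le> k" "even k" and r: "0 < r"
  shows "(cosh_deriv (1 / 2) ^^ (m div 2)) ((cosh_deriv 1 ^^ (k div 2 - 1))
      (\<lambda>s. of_real (sinh (s / 2) ^ m * sinh s ^ (k - 1)) * abel_op m k g s)) r = abel_primitive (m + k + 1) g r"
proof (rule abel_inverse_differential[OF g m r])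
  fix s :: real assume s: "0 < s"
  \<comment> \<open>An even \<open>k \<ge> 1\<close> is at least 2, so the natural subtraction is
    exact.\<close>
  have k2: "m + 2 + 2 * (k div 2 - 1) = m + k" "2 + 2 * (k div 2 - 1) = k" "real 2 / 2 + real (k div 2 - 1) = real k / 2"
  proof -
    obtain l where l: "k = 2 * l" using k(2) by blast
    show "m + 2 + 2 * (k div 2 - 1) = m + k" "2 + 2 * (k div 2 - 1) = k" "real 2 / 2 + real (k div 2 - 1) = real k / 2"
      using k(1) unfolding l by (auto simp: of_nat_diff)
  qed
  show "of_real (sinh (s / 2) ^ m * sinh s ^ (k - 1)) * abel_op m k g s =
    of_real (2 powr (real 2 / 2 + real (k div 2 - 1))) * rl_state 1 (m + 2 + 2 * (k div 2 - 1))
      (ek m (2 + 2 * (k div 2 - 1)) (\<lambda>x. of_real (c2 (m + k + 1) / 2 * 2 powr (real m / 2)) * abel_outer m g x)) s"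
    unfolding k2 abel_op_state[OF k(1) s] ek_cmult rl_state_cmult by (rule mult.left_commute)
qed

text \<open>The kernel \<open>1 / sqrt (cosh t - cosh s)\<close> adds one half step to the odd
  number \<open>k\<close>, at the cost of \<open>Gamma (1 / 2) = sqrt pi\<close>; this factor is
  absorbed into \<open>g\<close>.\<close>

lemma abel_inverse_odd:
  assumes g: "continuous_on UNIV g" and m: "even m" and k: "odd k" and r: "0 < r"
  shows "(cosh_deriv (1 / 2) ^^ (m div 2)) ((cosh_deriv 1 ^^ ((k - 1) div 2))
      (\<lambda>t. integral {0..t} (\<lambda>s. of_real (sinh (s / 2) ^ m * sinh s ^ k / sqrt (cosh t - cosh s)) * abel_op m k g s))) r =
    abel_primitive (m + k + 1) (\<lambda>x. of_real (sqrt pi) * g x) r"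
proof (rule abel_inverse_differential[OF _ m r])
  show "continuous_on UNIV (\<lambda>x. of_real (sqrt pi) * g x)" by (intro continuous_intros g)
  fix t :: real assume t: "0 < t"
  obtain l where l: "k = 2 * l + 1" using k by (elim oddE)
  have k1: "1 \<le> k" using l by simp
  have k2: "m + 2 + 2 * ((k - 1) div 2) = m + k + 1" "2 + 2 * ((k - 1) div 2) = k + 1"
    "real 2 / 2 + real ((k - 1) div 2) = real k / 2 + 1 / 2"
    unfolding l by (auto simp: add_divide_distrib)
  let ?G1 = "\<lambda>x. of_real (c2 (m + k + 1) / 2 * 2 powr (real m / 2)) * abel_outer m g x"
  let ?F = "\<lambda>s. of_real (sinh (s / 2) ^ m * sinh s ^ (k - 1)) * abel_op m k g s"
  have G1: "continuous_on UNIV ?G1" by (intro continuous_intros abel_outer_continuous g)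
  have F: "?F s = rl_state 1 (m + k) (\<lambda>x. of_real (2 powr (real k / 2)) * ek m k ?G1 x) s" if "0 < s" for s
    unfolding abel_op_state[OF k1 that] ek_cmult rl_state_cmult by (rule mult.left_commute)
  have "((\<lambda>s. of_real (1 * sinh (1 * s) * (cosh (1 * t) - cosh (1 * s)) powr (real 1 / 2 - 1)) * ?F s)
    has_integral of_real (Gamma (real 1 / 2) * 2 powr (real 1 / 2)) *
      rl_state 1 (m + k + 1) (ek (m + k) 1 (\<lambda>x. of_real (2 powr (real k / 2)) * ek m k ?G1 x)) t) {0..t}"
    by (rule rl_integral[OF _ _ t _ F]) (intro continuous_intros ek_continuous G1, simp_all)
  moreover have "of_real (1 * sinh (1 * s) * (cosh (1 * t) - cosh (1 * s)) powr (real 1 / 2 - 1)) * ?F s =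
      of_real (sinh (s / 2) ^ m * sinh s ^ k / sqrt (cosh t - cosh s)) * abel_op m k g s" if s: "s \<in> {0..t}" for s
  proof -
    have "cosh s \<le> cosh t" using s by (simp add: cosh_real_nonneg_le_iff)
    then have "(cosh t - cosh s) powr (real 1 / 2 - 1) = 1 / sqrt (cosh t - cosh s)"
      using powr_minus_divide[of "cosh t - cosh s" "1 / 2"] by (simp add: powr_half_sqrt)
    moreover have "sinh s ^ k = sinh s * sinh s ^ (k - 1)" using l by simp
    ultimately show ?thesis by (simp add: field_simps)
  qed
  ultimately have "((\<lambda>s. of_real (sinh (s / 2) ^ m * sinh s ^ k / sqrt (cosh t - cosh s)) * abel_op m k g s)
    has_integral of_real (Gamma (real 1 / 2) * 2 powr (real 1 / 2)) *
      rl_state 1 (m + k + 1) (ek (m + k) 1 (\<lambda>x. of_real (2 powr (real k / 2)) * ek m k ?G1 x)) t) {0..t}"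
    by (rule has_integral_eq[rotated])
  from integral_unique[OF this]
  have "integral {0..t} (\<lambda>s. of_real (sinh (s / 2) ^ m * sinh s ^ k / sqrt (cosh t - cosh s)) * abel_op m k g s) =
    of_real (sqrt pi) * (of_real (2 powr (1 / 2)) * (of_real (2 powr (real k / 2)) * rl_state 1 (m + k + 1) (ek m (k + 1) ?G1) t))"
    unfolding ek_cmult[of "m + k" 1 "of_real (2 powr (real k / 2))"] ek_semigroup[OF G1] rl_state_cmult[of 1 "m + k + 1" "of_real (2 powr (real k / 2))"]
    by (simp add: Gamma_one_half_real)
  then show "integral {0..t} (\<lambda>s. of_real (sinh (s / 2) ^ m * sinh s ^ k / sqrt (cosh t - cosh s)) * abel_op m k g s) =
    of_real (2 powr (real 2 / 2 + real ((k - 1) div 2))) * rl_state 1 (m + 2 + 2 * ((k - 1) div 2))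
      (ek m (2 + 2 * ((k - 1) div 2)) (\<lambda>x. of_real (c2 (m + k + 1) / 2 * 2 powr (real m / 2)) * abel_outer m (\<lambda>x. of_real (sqrt pi) * g x) x)) t"
    unfolding k2 abel_outer_cmult powr_add ek_cmult rl_state_cmult of_real_mult by (simp only: mult_ac)
qed

text \<open>Legendre duplication at half-integers: raising \<open>n\<close> exchanges the two
  factors and multiplies the smaller argument's value by \<open>(n + 1) / 2\<close>.\<close>

lemma Gamma_half_duplication:
  "Gamma (real (n + 1) / 2) * Gamma (real (n + 2) / 2) = fact n * sqrt pi / 2 ^ n"
proof (induction n)
  case 0
  then show ?case by (simp add: Gamma_one_half_real)
next
  case (Suc n)
  have "Gamma (real (Suc n + 2) / 2) = real (n + 1) / 2 * Gamma (real (n + 1) / 2)"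
  proof -
    have "real (n + 1) / 2 \<notin> \<int>\<^sub>\<le>\<^sub>0" using nonpos_Ints_nonpos[of "real (n + 1) / 2"] by fastforce
    moreover have "real (n + 1) / 2 + 1 = real (Suc n + 2) / 2" by (simp add: field_simps)
    ultimately show ?thesis using Gamma_plus1[of "real (n + 1) / 2"] by metis
  qed
  then have "Gamma (real (Suc n + 1) / 2) * Gamma (real (Suc n + 2) / 2) =
      real (n + 1) / 2 * (Gamma (real (n + 1) / 2) * Gamma (real (n + 2) / 2))"
    by (simp only: Suc_eq_plus1 add.assoc one_add_one mult_ac)
  then show ?case unfolding Suc.IH by simp
qed

lemma c2_factorial:
  assumes "0 < n"
  shows "c2 n = fact (n - 1) / (2 powr ((real n - 1) / 2) * Gamma ((real n + 1) / 2))"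
proof -
  obtain l where n: "n = Suc l" using assms by (cases n) auto
  define p where "p = 2 powr (real l / 2)"
  have p: "p * p = 2 ^ l" "0 < p"
    by (simp_all add: p_def powr_add[symmetric] powr_realpow[symmetric])
  have g: "Gamma (real (l + 2) / 2) \<noteq> 0" by (rule Gamma_half_nonzero) simp
  have "Gamma (real (l + 1) / 2) = fact l * sqrt pi / (p * p) / Gamma (real (l + 2) / 2)"
    unfolding p(1) Gamma_half_duplication[symmetric] using g by simp
  then have "p * Gamma (real (l + 1) / 2) / sqrt pi = fact l / (p * Gamma (real (l + 2) / 2))"
    using g p(2) by simp
  moreover have "(real n - 1) / 2 = real l / 2" "real n / 2 = real (l + 1) / 2" "(real n + 1) / 2 = real (l + 2) / 2"
    unfolding n by simp_all
  ultimately show ?thesis unfolding c2_def p_def[symmetric] by (simp add: n p_def)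
qed

text \<open>At \<open>0\<close> every dilate takes the value at \<open>0\<close>, so only constants
  remain, and they cancel precisely because of the value of \<open>c2\<close>. This covers radius
  zero, where the spherical mean is defined as the value at the identity.\<close>

lemma abel_op_0:
  assumes k: "1 \<le> k" shows "abel_op m k f 0 = f 0"
proof -
  obtain l where l: "k = Suc l" using k by (cases k) auto
  have ek0: "ek j d g 0 = of_real (Gamma (real (j + 1) / 2) / Gamma (real (j + d + 1) / 2)) * g 0" for j d g
  proof (cases "d = 0")
    case False
    have "ek j d g 0 = ek j d (\<lambda>x. g 0 * of_real (x ^ 0)) 0"
      using False by (simp add: ek_eq_integral)
    also have "\<dots> = of_real (Gamma (real (j + 1) / 2) / Gamma (real (j + d + 1) / 2)) * g 0"
      unfolding ek_cmult ek_monomial by simp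
    finally show ?thesis .
  qed (use Gamma_half_nonzero[of "j + 1"] in simp)
  have nz: "Gamma (real (m + 1) / 2) \<noteq> 0" "Gamma (real (m + k + 1) / 2) \<noteq> 0" by (rule Gamma_half_nonzero, simp)+
  have i0: "abel_inner f 0 = of_real (inverse 2) * f 0" by (simp add: abel_inner_def)
  have o0: "abel_outer m f 0 = of_real (2 * inverse (2 ^ m)) * ek 0 m (abel_inner f) 0" by (simp add: abel_outer_def)
  have a0: "abel_op m k f 0 = of_real (c2 (m + k + 1) / 2 * 2 powr (real m / 2) * 2 powr (real k / 2) * inverse (2 ^ l)) *
      ek m k (abel_outer m f) 0" by (simp add: abel_op_def l)
  have "abel_op m k f 0 = of_real (c2 (m + k + 1) / 2 * 2 powr (real m / 2) * 2 powr (real k / 2) * inverse (2 ^ l) *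
      (Gamma (real (m + 1) / 2) / Gamma (real (m + k + 1) / 2)) * (2 * inverse (2 ^ m)) *
      (Gamma (real (0 + 1) / 2) / Gamma (real (0 + m + 1) / 2)) * inverse 2) * f 0"
    unfolding a0 ek0[of m k] o0 ek0[of 0 m] i0 by (simp only: of_real_mult mult.assoc)
  also have "c2 (m + k + 1) / 2 * 2 powr (real m / 2) * 2 powr (real k / 2) * inverse (2 ^ l) *
      (Gamma (real (m + 1) / 2) / Gamma (real (m + k + 1) / 2)) * (2 * inverse (2 ^ m)) *
      (Gamma (real (0 + 1) / 2) / Gamma (real (0 + m + 1) / 2)) * inverse 2 =
      c2 (m + k + 1) * (sqrt pi / Gamma (real (m + k + 1) / 2)) * (2 powr (real m / 2) * 2 powr (real k / 2) / (2 ^ m * 2 ^ k))"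
    using nz l by (simp add: Gamma_one_half_real field_simps)
  also have "\<dots> = 2 powr (real (m + k) / 2) * (2 powr (real m / 2) * 2 powr (real k / 2) / (2 ^ m * 2 ^ k))"
    using nz by (simp add: c2_def)
  also have "\<dots> = 1"
  proof -
    have "2 powr (real (m + k) / 2) * (2 powr (real m / 2) * 2 powr (real k / 2)) = 2 powr (real (m + k))"
      by (simp add: powr_add[symmetric] add_divide_distrib)
    also have "\<dots> = 2 ^ (m + k)" by (rule powr_realpow) simp
    finally show ?thesis by (simp add: power_add)
  qed
  finally show ?thesis by simp
qed

section \<open>The Riemannian distance of a Damek-Ricci space\<close>

lemma restr_linear: "linear (restr I)"
  by (rule linearI) (auto simp: restr_def vec_eq_iff)

lemma restr_add: "restr I (x + y) = restr I x + restr I y"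
  and restr_scaleR: "restr I (c *\<^sub>R x) = c *\<^sub>R restr I x"
  and restr_diff: "restr I (x - y) = restr I x - restr I y"
  and restr_0 [simp]: "restr I 0 = 0"
  by (auto simp: restr_def vec_eq_iff)

lemma bounded_linear_restr: "bounded_linear (restr I)"
  using restr_linear linear_conv_bounded_linear by blast

lemma restr_supported [simp]: "restr I w \<in> supported I"
  by (simp add: restr_def supported_def)

lemma restr_id: "w \<in> supported I \<Longrightarrow> restr I w = w"
  by (auto simp: restr_def supported_def vec_eq_iff)

lemma restr_restr [simp]: "restr I (restr I w) = restr I w"
  by (auto simp: restr_def vec_eq_iff)

lemma restr_compl: "w \<in> supported (- I) \<Longrightarrow> restr I w = 0" "w \<in> supported I \<Longrightarrow> restr (- I) w = 0"
  by (auto simp: restr_def supported_def vec_eq_iff)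

lemma restr_restr_compl [simp]: "restr I (restr (- I) w) = 0" "restr (- I) (restr I w) = 0"
  by (auto simp: restr_def vec_eq_iff)

lemma restr_sum [simp]: "restr I w + restr (- I) w = w"
  by (auto simp: restr_def vec_eq_iff)

lemma supported_add: "x \<in> supported I \<Longrightarrow> y \<in> supported I \<Longrightarrow> x + y \<in> supported I"
  and supported_diff: "x \<in> supported I \<Longrightarrow> y \<in> supported I \<Longrightarrow> x - y \<in> supported I"
  and supported_scaleR: "x \<in> supported I \<Longrightarrow> c *\<^sub>R x \<in> supported I"
  and supported_0 [simp]: "0 \<in> supported I"
  by (auto simp: supported_def)

lemma inner_supported: "x \<in> supported I \<Longrightarrow> y \<in> supported (- I) \<Longrightarrow> x \<bullet> y = 0"
  "x \<in> supported I \<Longrightarrow> y \<in> supported (- I) \<Longrightarrow> y \<bullet> x = 0"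
proof -
  assume "x \<in> supported I" "y \<in> supported (- I)"
  then have "x $ i * y $ i = 0" for i by (cases "i \<in> I") (auto simp: supported_def)
  then have "x \<bullet> y = 0" unfolding inner_vec_def inner_real_def by (intro sum.neutral) auto
  then show "x \<bullet> y = 0" "y \<bullet> x = 0" by (simp_all add: inner_commute)
qed

lemma inner_restr_split: "v \<bullet> w = restr I v \<bullet> restr I w + restr (- I) v \<bullet> restr (- I) w"
proof -
  have "v \<bullet> w = (restr I v + restr (- I) v) \<bullet> (restr I w + restr (- I) w)" by simp
  also have "\<dots> = restr I v \<bullet> restr I w + restr (- I) v \<bullet> restr (- I) w"
    unfolding inner_add_left inner_add_right
    using inner_supported(1)[of "restr I v" I "restr (- I) w"] inner_supported(2)[of "restr I w" I "restr (- I) v"] by simp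
  finally show ?thesis .
qed

text \<open>At \<open>e = 0\<close> this is an equality. It expresses that the regularized distance
  still has gradient of norm at most 1.\<close>

lemma regularized_gap:
  assumes "1 \<le> c" "0 < (e::real)" shows "4 * (c^2 - c) \<le> (2 * c - 1 + e)\<^sup>2 - 1"
proof -
  have "0 \<le> e * (2 * c - 1)" using assms by simp
  moreover have "(2 * c - 1 + e)\<^sup>2 - 1 - 4 * (c^2 - c) = 2 * (e * (2 * c - 1)) + e^2"
    by (simp add: power2_eq_square algebra_simps)
  ultimately show ?thesis using zero_le_power2[of e] by linarith
qed

section \<open>Heisenberg-type algebra, the left-invariant frame and the function
  \<open>cc\<close>\<close>

locale damek_ricci =
  fixes I :: "'i::finite set" and br :: "real^'i \<Rightarrow> real^'i \<Rightarrow> real^'i"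
  assumes heis: "heisenberg_type I br" and center: "- I \<noteq> {}"
begin

lemma br_bilinear: "bilinear br"
  using heis by (simp add: heisenberg_type_def)

lemma br_bounded_bilinear: "bounded_bilinear br"
  using br_bilinear bilinear_conv_bounded_bilinear by blast

lemma br_supported: "X \<in> supported I \<Longrightarrow> X' \<in> supported I \<Longrightarrow> br X X' \<in> supported (- I)"
  using heis unfolding heisenberg_type_def by blast

lemma br_skew: "X \<in> supported I \<Longrightarrow> X' \<in> supported I \<Longrightarrow> br X' X = - br X X'"
  using heis unfolding heisenberg_type_def by blast

lemma br_self [simp]: "X \<in> supported I \<Longrightarrow> br X X = 0"
proof -
  assume "X \<in> supported I"
  from br_skew[OF this this] have e: "br X X = - br X X" .
  have "br X X $ i = 0" for i
    by (rule equal_neg_zero[THEN iffD1, OF arg_cong[OF e, of "\<lambda>v. v $ i", unfolded vector_uminus_component]])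
  then show "br X X = 0" unfolding vec_eq_iff zero_index by (rule allI)
qed

lemmas br_lin = bilinear_ladd[OF br_bilinear] bilinear_radd[OF br_bilinear] bilinear_lmul[OF br_bilinear]
  bilinear_rmul[OF br_bilinear] bilinear_lzero[OF br_bilinear] bilinear_rzero[OF br_bilinear]

text \<open>Chosen separately for each \<open>Y\<close>, so linearity in \<open>Y\<close> has to be
  proved. On \<open>supported I\<close> the inner product identity determines the map; elsewhere it
  is an unspecified linear extension.\<close>

definition J :: "real^'i \<Rightarrow> real^'i \<Rightarrow> real^'i" where
  "J Y = (SOME J. linear J \<and> J ` supported I \<subseteq> supported I \<and>
        (\<forall>X\<in>supported I. \<forall>X'\<in>supported I. J X \<bullet> X' = Y \<bullet> br X X') \<and>
        (\<forall>X\<in>supported I. J (J X) = - ((norm Y)\<^sup>2 *\<^sub>R X)))"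

lemma J:
  assumes "Y \<in> supported (- I)"
  shows "linear (J Y)" "X \<in> supported I \<Longrightarrow> J Y X \<in> supported I"
    "X \<in> supported I \<Longrightarrow> X' \<in> supported I \<Longrightarrow> J Y X \<bullet> X' = Y \<bullet> br X X'"
    "X \<in> supported I \<Longrightarrow> J Y (J Y X) = - ((norm Y)\<^sup>2 *\<^sub>R X)"
proof -
  have "\<exists>J. linear J \<and> J ` supported I \<subseteq> supported I \<and>
        (\<forall>X\<in>supported I. \<forall>X'\<in>supported I. J X \<bullet> X' = Y \<bullet> br X X') \<and>
        (\<forall>X\<in>supported I. J (J X) = - ((norm Y)\<^sup>2 *\<^sub>R X))"
    using heis assms unfolding heisenberg_type_def by blast
  then have *: "linear (J Y) \<and> J Y ` supported I \<subseteq> supported I \<and>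
        (\<forall>X\<in>supported I. \<forall>X'\<in>supported I. J Y X \<bullet> X' = Y \<bullet> br X X') \<and>
        (\<forall>X\<in>supported I. J Y (J Y X) = - ((norm Y)\<^sup>2 *\<^sub>R X))"
    unfolding J_def by (rule someI_ex)
  show "linear (J Y)" using * by blast
  show "X \<in> supported I \<Longrightarrow> J Y X \<in> supported I" using * by blast
  show "X \<in> supported I \<Longrightarrow> X' \<in> supported I \<Longrightarrow> J Y X \<bullet> X' = Y \<bullet> br X X'" using * by blast
  show "X \<in> supported I \<Longrightarrow> J Y (J Y X) = - ((norm Y)\<^sup>2 *\<^sub>R X)" using * by blast
qed

lemma J_orthogonal: "Y \<in> supported (- I) \<Longrightarrow> X \<in> supported I \<Longrightarrow> J Y X \<bullet> X = 0"
  using J(3)[of Y X X] by simp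

lemma J_inner:
  assumes "Y \<in> supported (- I)" "X \<in> supported I"
  shows "J Y X \<bullet> J Y X = (Y \<bullet> Y) * (X \<bullet> X)"
proof -
  note JX = J(2)[OF assms]
  have "J Y X \<bullet> J Y X = Y \<bullet> br X (J Y X)" by (rule J(3)[OF assms JX])
  also have "\<dots> = - (Y \<bullet> br (J Y X) X)" using br_skew[OF JX assms(2)] by simp
  also have "\<dots> = - (J Y (J Y X) \<bullet> X)" using J(3)[OF assms(1) JX assms(2)] by simp
  also have "\<dots> = (Y \<bullet> Y) * (X \<bullet> X)" unfolding J(4)[OF assms] by (simp add: dot_square_norm)
  finally show ?thesis .
qed

text \<open>By the defining identity the difference is a vector of \<open>supported I\<close> that
  is orthogonal to itself.\<close>

lemma J_add:
  assumes "Y \<in> supported (- I)" "Z \<in> supported (- I)" "X \<in> supported I"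
  shows "J (Y + Z) X = J Y X + J Z X"
proof -
  let ?d = "J (Y + Z) X - (J Y X + J Z X)"
  have YZ: "Y + Z \<in> supported (- I)" by (rule supported_add[OF assms(1,2)])
  have d: "?d \<in> supported I"
    by (intro supported_diff supported_add J(2) assms YZ)
  have "?d \<bullet> ?d = (Y + Z) \<bullet> br X ?d - (Y \<bullet> br X ?d + Z \<bullet> br X ?d)"
    using J(3)[OF YZ assms(3) d] J(3)[OF assms(1,3) d] J(3)[OF assms(2,3) d]
    by (simp add: inner_diff_left inner_add_left)
  then show ?thesis by (simp add: inner_add_left)
qed

text \<open>Polarizing \<open>|J Y V|^2 = |Y|^2 |V|^2\<close> in \<open>Y\<close> gives
  \<open>J Y V \<bullet> J n V = (Y \<bullet> n) |V|^2\<close>, and the left side is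
  \<open>Y \<bullet> br V (J n V)\<close>.\<close>

lemma br_J:
  assumes n: "n \<in> supported (- I)" and V: "V \<in> supported I"
  shows "br V (J n V) = (V \<bullet> V) *\<^sub>R n"
proof -
  let ?d = "br V (J n V) - (V \<bullet> V) *\<^sub>R n"
  have d: "?d \<in> supported (- I)"
    by (intro supported_diff supported_scaleR br_supported J(2) n V)
  have "Y \<bullet> br V (J n V) = (V \<bullet> V) * (Y \<bullet> n)" if Y: "Y \<in> supported (- I)" for Y
  proof -
    have "Y \<bullet> br V (J n V) = J Y V \<bullet> J n V" using J(3)[OF Y V J(2)[OF n V]] by simp
    moreover have "J (Y + n) V \<bullet> J (Y + n) V = J Y V \<bullet> J Y V + 2 * (J Y V \<bullet> J n V) + J n V \<bullet> J n V"
      unfolding J_add[OF Y n V] by (simp add: inner_add_left inner_add_right inner_commute)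
    ultimately show ?thesis
      unfolding J_inner[OF supported_add[OF Y n] V] J_inner[OF Y V] J_inner[OF n V]
      by (simp add: inner_add_left inner_add_right inner_commute algebra_simps)
  qed
  from this[OF d] have "?d \<bullet> ?d = 0" by (simp add: inner_diff_right)
  then show ?thesis by simp
qed

abbreviation xc :: "(real^'i) \<times> real \<Rightarrow> real^'i" where "xc p \<equiv> restr I (fst p)"
abbreviation yc :: "(real^'i) \<times> real \<Rightarrow> real^'i" where "yc p \<equiv> restr (- I) (fst p)"

text \<open>The components of a tangent vector in the left-invariant orthonormal frame.\<close>

definition frame :: "(real^'i) \<times> real \<Rightarrow> (real^'i) \<times> real \<Rightarrow> (real^'i) \<times> real" where
  "frame p u = (exp (- snd p / 2) *\<^sub>R xc u + exp (- snd p) *\<^sub>R (yc u - (1 / 2) *\<^sub>R br (xc p) (xc u)), snd u)"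

text \<open>Left translation is affine, \<open>q \<mapsto> p + coframe p q\<close>, so this is its
  differential at the identity; \<open>frame\<close> inverts it.\<close>

definition coframe :: "(real^'i) \<times> real \<Rightarrow> (real^'i) \<times> real \<Rightarrow> (real^'i) \<times> real" where
  "coframe p u = (exp (snd p / 2) *\<^sub>R xc u + exp (snd p) *\<^sub>R yc u + (1 / 2 * exp (snd p / 2)) *\<^sub>R br (xc p) (xc u), snd u)"

lemma xc_coframe: "xc (coframe p u) = exp (snd p / 2) *\<^sub>R xc u"
  and yc_coframe: "yc (coframe p u) = exp (snd p) *\<^sub>R yc u + (1 / 2 * exp (snd p / 2)) *\<^sub>R br (xc p) (xc u)"
  by (simp_all add: coframe_def restr_add restr_scaleR restr_compl br_supported restr_id)

lemma xc_frame: "xc (frame p u) = exp (- snd p / 2) *\<^sub>R xc u"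
  and yc_frame: "yc (frame p u) = exp (- snd p) *\<^sub>R (yc u - (1 / 2) *\<^sub>R br (xc p) (xc u))"
  by (simp_all add: frame_def restr_add restr_diff restr_scaleR restr_compl br_supported restr_id)

lemma frame_coframe: "frame p (coframe p u) = u"
proof (rule prod_eqI)
  have "exp (- snd p / 2) * exp (snd p / 2) = 1" "exp (- snd p) * exp (snd p) = 1"
    by (simp_all add: exp_add[symmetric])
  then show "fst (frame p (coframe p u)) = fst u"
    unfolding frame_def[of p "coframe p u"] xc_coframe yc_coframe
    by (simp add: br_lin scaleR_scaleR[symmetric] del: scaleR_scaleR)
      (simp add: mult.commute)
qed (simp add: frame_def coframe_def)

lemma coframe_frame: "coframe p (frame p u) = u"
proof (rule prod_eqI)
  have "exp (- snd p / 2) * exp (snd p / 2) = 1" "exp (snd p / 2) * exp (- snd p / 2) = 1" "exp (snd p) * exp (- snd p) = 1"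
    by (simp_all add: exp_add[symmetric])
  then show "fst (coframe p (frame p u)) = fst u"
    unfolding coframe_def[of p "frame p u"] xc_frame yc_frame
    by (simp add: br_lin)
qed (simp add: frame_def coframe_def)

lemma linear_coframe: "linear (coframe p)"
  by (rule linearI) (auto simp: coframe_def restr_add restr_scaleR br_lin algebra_simps)

lemma linear_frame: "linear (frame p)"
  by (rule linearI) (auto simp: frame_def restr_add restr_scaleR br_lin algebra_simps)

lemma dr_mult_eq: "dr_mult I br p q = p + coframe p q"
  by (rule prod_eqI) (auto simp: dr_mult_def coframe_def Let_def algebra_simps)

lemma dr_metric_frame: "dr_metric I br p u w = frame p u \<bullet> frame p w"
proof -
  have "(dr_mult I br p has_derivative coframe p) (at 0)"
    unfolding dr_mult_eq[abs_def]
    using has_derivative_add[OF has_derivative_const[of p] bounded_linear_imp_has_derivative, of "coframe p"]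
      linear_coframe linear_conv_bounded_linear by fastforce
  from frechet_derivative_at[OF this]
  have "frechet_derivative (dr_mult I br p) (at 0) = coframe p" by simp
  moreover have "inv (coframe p) = frame p"
    by (rule inv_unique_comp; rule ext; simp add: frame_coframe coframe_frame)
  ultimately show ?thesis by (simp add: dr_metric_def Let_def)
qed

text \<open>\<open>cc p\<close> is the squared hyperbolic cosine of half the distance from \<open>p\<close> to the identity.\<close>

definition bb :: "(real^'i) \<times> real \<Rightarrow> real" where
  "bb p = 1 + exp (snd p) + (xc p \<bullet> xc p) / 4"

definition cc :: "(real^'i) \<times> real \<Rightarrow> real" where
  "cc p = ((bb p)\<^sup>2 + yc p \<bullet> yc p) / 4 * exp (- snd p)"

text \<open>The gradient of \<open>cc\<close> in components of the orthonormal frame; the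
  \<open>J\<close> term comes from the bracket in the central component of
  \<open>frame\<close>.\<close>

definition cc_grad :: "(real^'i) \<times> real \<Rightarrow> (real^'i) \<times> real" where
  "cc_grad p = ((exp (- snd p / 2) / 4) *\<^sub>R (bb p *\<^sub>R xc p + J (yc p) (xc p)) + (1 / 2) *\<^sub>R yc p, bb p / 2 - cc p)"

lemma cc_eq: "(bb p)\<^sup>2 + yc p \<bullet> yc p = 4 * exp (snd p) * cc p"
  by (simp add: cc_def exp_minus field_simps)

lemma cc_ge_1: "1 \<le> cc p"
proof -
  have "4 * exp (snd p) \<le> (1 + exp (snd p))\<^sup>2"
    using zero_le_power2[of "1 - exp (snd p)"] by (simp add: power2_eq_square algebra_simps)
  also have "\<dots> \<le> (bb p)\<^sup>2" by (rule power_mono) (auto simp: bb_def)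
  also have "\<dots> \<le> 4 * exp (snd p) * cc p" using cc_eq[of p] inner_ge_zero[of "yc p"] by linarith
  finally show ?thesis by simp
qed

lemma cc_0: "cc 0 = 1"
  by (simp add: cc_def bb_def)

lemma cc_has_derivative: "(cc has_derivative (\<lambda>u. cc_grad p \<bullet> frame p u)) (at p)"
proof -
  have dx: "(xc has_derivative xc) (at p)" and dy: "(yc has_derivative yc) (at p)"
    by (intro bounded_linear_imp_has_derivative bounded_linear_compose[OF bounded_linear_restr bounded_linear_fst])+
  have "(cc has_derivative (\<lambda>u. ((2 * bb p * (exp (snd p) * snd u + (xc p \<bullet> xc u) / 2) + 2 * (yc p \<bullet> yc u)) / 4) * exp (- snd p) - cc p * snd u)) (at p)"
    unfolding cc_def[abs_def] bb_def[abs_def]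
    by (rule derivative_eq_intros dx dy refl | simp)+
      (auto simp: fun_eq_iff bb_def inner_commute field_simps power2_eq_square)
  moreover have "((2 * bb p * (exp (snd p) * snd u + (xc p \<bullet> xc u) / 2) + 2 * (yc p \<bullet> yc u)) / 4) * exp (- snd p) - cc p * snd u =
      cc_grad p \<bullet> frame p u" for u
  proof -
    have e: "exp (- snd p / 2) * exp (- snd p / 2) = exp (- snd p)" "exp (snd p) * exp (- snd p) = 1"
      by (simp_all add: exp_add[symmetric])
    have b: "br (xc p) (xc u) \<in> supported (- I)" by (simp add: br_supported)
    have JX: "J (yc p) (xc p) \<bullet> xc u = yc p \<bullet> br (xc p) (xc u)" "J (yc p) (xc p) \<in> supported I"
      by (simp_all add: J)
    have "fst (cc_grad p) \<bullet> fst (frame p u) = (exp (- snd p / 2) / 4) * exp (- snd p / 2) * (bb p * (xc p \<bullet> xc u) + J (yc p) (xc p) \<bullet> xc u) +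
        (1 / 2) * exp (- snd p) * (yc p \<bullet> yc u - (1 / 2) * (yc p \<bullet> br (xc p) (xc u)))"
      unfolding cc_grad_def frame_def fst_conv inner_add_left inner_add_right inner_scaleR_left inner_scaleR_right inner_diff_right
      using inner_supported[of "xc p" I "yc u"] inner_supported[of "xc p" I "br (xc p) (xc u)"] inner_supported[of "J (yc p) (xc p)" I "yc u"]
        inner_supported[of "J (yc p) (xc p)" I "br (xc p) (xc u)"] inner_supported[of "xc u" I "yc p"] b JX(2)
      by (simp add: algebra_simps)
    also have "\<dots> = exp (- snd p) * (bb p * (xc p \<bullet> xc u) / 4 + (yc p \<bullet> yc u) / 2)"
      unfolding JX(1) using e(1) by (simp add: algebra_simps)
    finally show ?thesis
      using e(2) by (simp add: inner_prod_def cc_grad_def frame_def algebra_simps)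
  qed
  ultimately show ?thesis by (simp only:)
qed

text \<open>With \<open>cc = cosh^2 (\<rho> / 2)\<close> this says that \<open>\<rho>\<close> has
  gradient of norm 1. The Heisenberg condition enters here: \<open>J Y X\<close> is orthogonal to
  \<open>X\<close> and has norm \<open>|Y| |X|\<close>, so that
  \<open>(bb p)^2 + |Y|^2 = 4 exp z * cc p\<close> can be factored out.\<close>

lemma cc_grad_inner: "cc_grad p \<bullet> cc_grad p = (cc p)\<^sup>2 - cc p"
proof -
  have e: "exp (- snd p / 2) * exp (- snd p / 2) = exp (- snd p)" "exp (- snd p) * exp (snd p) = 1"
    by (simp_all add: exp_add[symmetric])
  have JX: "J (yc p) (xc p) \<in> supported I" "J (yc p) (xc p) \<bullet> xc p = 0" "xc p \<bullet> J (yc p) (xc p) = 0"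
    "J (yc p) (xc p) \<bullet> J (yc p) (xc p) = (yc p \<bullet> yc p) * (xc p \<bullet> xc p)"
    using J_orthogonal[of "yc p" "xc p"] J(2)[of "yc p" "xc p"] J_inner[of "yc p" "xc p"]
    by (simp_all add: inner_commute)
  have "fst (cc_grad p) \<bullet> fst (cc_grad p) = (exp (- snd p / 2) * exp (- snd p / 2)) / 16 * (((bb p)\<^sup>2 + yc p \<bullet> yc p) * (xc p \<bullet> xc p)) + (yc p \<bullet> yc p) / 4"
    unfolding cc_grad_def fst_conv inner_add_left inner_add_right inner_scaleR_left inner_scaleR_right JX
    using inner_supported[of "xc p" I "yc p"] inner_supported[of "J (yc p) (xc p)" I "yc p"] JX(1)
    by (simp add: algebra_simps power2_eq_square)
  also have "\<dots> = cc p * (xc p \<bullet> xc p) / 4 + (yc p \<bullet> yc p) / 4"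
    unfolding e(1) cc_eq using e(2) by (simp add: algebra_simps)
  finally have "cc_grad p \<bullet> cc_grad p = cc p * (xc p \<bullet> xc p) / 4 + (yc p \<bullet> yc p) / 4 + (bb p / 2 - cc p)\<^sup>2"
    by (simp add: inner_prod_def cc_grad_def power2_eq_square)
  also have "\<dots> = cc p * (xc p \<bullet> xc p) / 4 + ((bb p)\<^sup>2 + yc p \<bullet> yc p) / 4 - bb p * cc p + (cc p)\<^sup>2"
    by (simp add: power2_eq_square algebra_simps add_divide_distrib)
  also have "\<dots> = (cc p)\<^sup>2 - cc p"
    unfolding cc_eq unfolding bb_def by (simp add: algebra_simps)
  finally show ?thesis .
qed

lemma continuous_on_frame:
  assumes "continuous_on S f" "continuous_on S g"
  shows "continuous_on S (\<lambda>x. frame (f x) (g x))"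
proof -
  have r: "continuous_on S (\<lambda>x. restr K (h x))" if "continuous_on S h" for h :: "_ \<Rightarrow> real^'i" and K
    using bounded_linear.continuous_on[OF bounded_linear_restr that] .
  show ?thesis
    unfolding frame_def
    by (intro continuous_intros r assms bounded_bilinear.continuous_on[OF br_bounded_bilinear]) auto
qed

lemma continuous_on_cc: "continuous_on S cc"
  by (meson cc_has_derivative continuous_at_imp_continuous_on has_derivative_continuous)

section \<open>The distance to the identity: lower bound and minimizing curves\<close>

definition speed :: "(real \<Rightarrow> (real^'i) \<times> real) \<Rightarrow> real \<Rightarrow> real" where
  "speed \<gamma> t = norm (frame (\<gamma> t) (vector_derivative \<gamma> (at t)))"

lemma curve_length_speed: "curve_length (dr_metric I br) \<gamma> = integral {0..1} (speed \<gamma>)"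
  unfolding curve_length_def dr_metric_frame speed_def[abs_def] norm_eq_sqrt_inner ..

definition dist0 :: "(real^'i) \<times> real \<Rightarrow> real" where
  "dist0 p = arcosh (2 * cc p - 1)"

text \<open>The function \<open>arcosh (2 cc - 1)\<close> has gradient of norm 1 but is singular at the identity; adding \<open>e\<close>
  removes the singularity.\<close>

lemma dist0_le_length_aux:
  assumes \<gamma>: "\<gamma> C1_differentiable_on {0..1}" "\<gamma> 1 = 0" and e: "0 < e"
  shows "arcosh (2 * cc (\<gamma> 0) - 1 + e) \<le> arcosh (1 + e) + curve_length (dr_metric I br) \<gamma>"
proof -
  obtain D where D: "\<And>t. t \<in> {0..1} \<Longrightarrow> (\<gamma> has_vector_derivative D t) (at t)" "continuous_on {0..1} D"
    using \<gamma>(1) unfolding C1_differentiable_on_def by blast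
  have sp: "speed \<gamma> t = norm (frame (\<gamma> t) (D t))" if "t \<in> {0..1}" for t
    unfolding speed_def vector_derivative_at[OF D(1)[OF that]] ..
  have \<gamma>c: "continuous_on {0..1} \<gamma>"
    using D(1) by (meson continuous_at_imp_continuous_on has_vector_derivative_continuous)
  have "continuous_on {0..1} (\<lambda>t. norm (frame (\<gamma> t) (D t)))"
    by (intro continuous_intros continuous_on_frame \<gamma>c D(2))
  then have spi: "speed \<gamma> integrable_on {0..1}"
    by (rule integrable_eq[OF integrable_continuous_real]) (simp add: sp)
  let ?h = "\<lambda>t. 2 * cc (\<gamma> t) - 1 + e"
  let ?d = "\<lambda>t. 2 * (cc_grad (\<gamma> t) \<bullet> frame (\<gamma> t) (D t)) / sqrt ((?h t)\<^sup>2 - 1)"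
  have h1: "1 < ?h t" for t using cc_ge_1[of "\<gamma> t"] e by linarith
  have der: "((\<lambda>t. arcosh (?h t)) has_vector_derivative ?d t) (at t within {0..1})" if t: "t \<in> {0..1}" for t
  proof -
    have "((cc \<circ> \<gamma>) has_derivative (\<lambda>s. cc_grad (\<gamma> t) \<bullet> frame (\<gamma> t) (s *\<^sub>R D t))) (at t)"
      using diff_chain_at[OF D(1)[OF t, unfolded has_vector_derivative_def] cc_has_derivative] by (simp add: o_def)
    then have "((\<lambda>t. cc (\<gamma> t)) has_real_derivative cc_grad (\<gamma> t) \<bullet> frame (\<gamma> t) (D t)) (at t)"
      unfolding has_real_derivative_iff_has_vector_derivative has_vector_derivative_def linear_scale[OF linear_frame]
      by (simp add: o_def)
    then have "(?h has_real_derivative 2 * (cc_grad (\<gamma> t) \<bullet> frame (\<gamma> t) (D t))) (at t)"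
      by (auto intro!: derivative_eq_intros)
    from DERIV_chain2[OF arcosh_real_has_field_derivative[OF h1] this]
    show ?thesis
      by (simp add: has_real_derivative_iff_has_vector_derivative[symmetric] has_field_derivative_at_within)
  qed
  \<comment> \<open>Cauchy-Schwarz, where the gradient has norm
    \<open>sqrt (cc^2 - cc)\<close>.\<close>
  have bound: "norm (?d t) \<le> speed \<gamma> t" if "t \<in> {0..1}" for t
  proof -
    let ?c = "cc (\<gamma> t)"
    have "norm (cc_grad (\<gamma> t)) = sqrt (?c\<^sup>2 - ?c)" by (simp add: norm_eq_sqrt_inner cc_grad_inner)
    moreover have "2 * sqrt (?c\<^sup>2 - ?c) \<le> sqrt ((?h t)\<^sup>2 - 1)"
    proof -
      have "4 * (?c\<^sup>2 - ?c) \<le> (?h t)\<^sup>2 - 1"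
        by (rule regularized_gap[OF cc_ge_1 e])
      then have "sqrt (4 * (?c\<^sup>2 - ?c)) \<le> sqrt ((?h t)\<^sup>2 - 1)" by (rule real_sqrt_le_mono)
      then show ?thesis unfolding real_sqrt_mult by simp
    qed
    ultimately have "2 * norm (cc_grad (\<gamma> t)) * norm (frame (\<gamma> t) (D t)) \<le> sqrt ((?h t)\<^sup>2 - 1) * norm (frame (\<gamma> t) (D t))"
      by (intro mult_right_mono) auto
    then have "2 * \<bar>cc_grad (\<gamma> t) \<bullet> frame (\<gamma> t) (D t)\<bar> \<le> sqrt ((?h t)\<^sup>2 - 1) * norm (frame (\<gamma> t) (D t))"
      using Cauchy_Schwarz_ineq2[of "cc_grad (\<gamma> t)" "frame (\<gamma> t) (D t)"] by linarith
    moreover have "0 < sqrt ((?h t)\<^sup>2 - 1)" using h1[of t] one_less_power[of "?h t" 2] by simp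
    ultimately show ?thesis unfolding sp[OF that] by (simp add: abs_mult pos_divide_le_eq mult.commute)
  qed
  have ftc: "(?d has_integral arcosh (?h 1) - arcosh (?h 0)) {0..1}"
    by (rule fundamental_theorem_of_calculus[OF _ der]) auto
  then have "norm (arcosh (?h 1) - arcosh (?h 0)) \<le> integral {0..1} (speed \<gamma>)"
    using integral_norm_bound_integral[OF has_integral_integrable[OF ftc] spi bound] integral_unique[OF ftc] by simp
  then show ?thesis unfolding curve_length_speed using \<gamma>(2) by (simp add: cc_0)
qed

lemma dist0_le_length:
  assumes "\<gamma> C1_differentiable_on {0..1}" "\<gamma> 0 = p" "\<gamma> 1 = 0"
  shows "dist0 p \<le> curve_length (dr_metric I br) \<gamma>"
proof -
  have lim: "((\<lambda>e. arcosh (x + e)) \<longlongrightarrow> arcosh x) (at_right 0)" if "1 \<le> x" for x :: real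
  proof -
    have "continuous_on {0..} (\<lambda>e. arcosh (x + e))"
      using that by (intro continuous_on_arcosh' continuous_intros) auto
    then have *: "\<forall>d\<in>{0..}. ((\<lambda>e. arcosh (x + e)) \<longlongrightarrow> arcosh (x + d)) (at d within {0..})"
      unfolding continuous_on_def .
    have "((\<lambda>e. arcosh (x + e)) \<longlongrightarrow> arcosh (x + 0)) (at 0 within {0..})"
      by (rule bspec[OF *]) simp
    then show ?thesis by (auto intro: tendsto_within_subset)
  qed
  have 1: "1 \<le> 2 * cc p - 1" using cc_ge_1[of p] by simp
  have "arcosh (2 * cc p - 1) \<le> arcosh 1 + curve_length (dr_metric I br) \<gamma>"
  proof (rule tendsto_le[OF _ tendsto_add[OF lim[of 1] tendsto_const] lim[OF 1]])
    show "\<forall>\<^sub>F e in at_right 0. arcosh (2 * cc p - 1 + e) \<le> arcosh (1 + e) + curve_length (dr_metric I br) \<gamma>"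
      using dist0_le_length_aux[OF assms(1,3)] assms(2) unfolding eventually_at_right_field
      by (auto intro!: exI[of _ 1])
  qed auto
  then show ?thesis by (simp add: dist0_def)
qed

text \<open>The geodesic from the identity, which in the ball model is a ray: with \<open>w = u + i v\<close> and \<open>i\<close> acting on \<open>V\<close>
  through \<open>J n\<close>, the point at parameter \<open>s\<close> has \<open>X = 2 s (1 - s w)\<^sup>-\<^sup>1 V\<close> and
  \<open>exp z + \<bar>X\<bar>\<^sup>2 / 4 + i \<bar>Y\<bar> = (1 + s w) / (1 - s w)\<close>.\<close>

lemma geodesic_speed_identity:
  fixes u v s q :: real
  defines "D \<equiv> 1 - 2 * s * u + s^2 * (u^2 + v^2)" and "P \<equiv> 1 - s^2 * q"
  assumes "0 < D" "0 < P"
  shows "(2 / D)\<^sup>2 * (q - u^2 - v^2) * (D / P) + (2 * v * P / D^2)\<^sup>2 * (D / P)\<^sup>2 +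
    (2 * s * q / P + (2 * s * (u^2 + v^2) - 2 * u) / D)\<^sup>2 = 4 * q / P^2"
proof -
  \<comment> \<open>The claim cleared of the denominator \<open>(D * P)^2\<close>, a polynomial
    identity.\<close>
  have id: "4 * (q - u^2 - v^2) * D * P + 4 * v^2 * P^2 + (2 * s * q * D + (2 * s * (u^2 + v^2) - 2 * u) * P)\<^sup>2 = 4 * q * D^2"
    unfolding D_def P_def by algebra
  have nz: "D \<noteq> 0" "P \<noteq> 0" using assms by auto
  have "(2 / D)\<^sup>2 * (q - u^2 - v^2) * (D / P) = 4 * (q - u^2 - v^2) * D * P / (D * P)\<^sup>2"
    "(2 * v * P / D^2)\<^sup>2 * (D / P)\<^sup>2 = 4 * v^2 * P^2 / (D * P)\<^sup>2"
    "(2 * s * q / P + (2 * s * (u^2 + v^2) - 2 * u) / D)\<^sup>2 = (2 * s * q * D + (2 * s * (u^2 + v^2) - 2 * u) * P)\<^sup>2 / (D * P)\<^sup>2"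
    "4 * q / P^2 = 4 * q * D^2 / (D * P)\<^sup>2"
    using nz by (simp_all add: divide_simps) (simp_all add: power2_eq_square algebra_simps)
  then show ?thesis using id by (simp add: add_divide_distrib[symmetric])
qed

text \<open>Here \<open>D s = |1 - s w|^2\<close>, and \<open>P s = 1 - s^2 q\<close> with
  \<open>q\<close> the squared norm of the direction in the ball. The speed in \<open>s\<close> is
  \<open>2 sqrt q / (1 - s^2 q)\<close>, the radial speed of the ball model, whose integral over the
  unit interval is the logarithm.\<close>

lemma geodesic:
  assumes n: "n \<in> supported (- I)" "n \<bullet> n = 1" and V: "V \<in> supported I"
    and q: "q = u^2 + v^2 + V \<bullet> V" "q < 1"
  defines "D \<equiv> \<lambda>s. 1 - 2 * s * u + s^2 * (u^2 + v^2)" and "P \<equiv> \<lambda>s. 1 - s^2 * q"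
  defines "\<Gamma> \<equiv> \<lambda>s. ((2 * s * (1 - s * u) / D s) *\<^sub>R V + (2 * s^2 * v / D s) *\<^sub>R J n V + (2 * s * v / D s) *\<^sub>R n, ln (P s) - ln (D s))"
  shows "\<exists>\<gamma>. \<gamma> C1_differentiable_on {0..1} \<and> \<gamma> 0 = \<Gamma> 1 \<and> \<gamma> 1 = 0 \<and>
    curve_length (dr_metric I br) \<gamma> = ln ((1 + sqrt q) / (1 - sqrt q))"
proof -
  have q0: "0 \<le> q" "u^2 + v^2 \<le> q" unfolding q(1) by auto
  define \<rho> where "\<rho> = sqrt q"
  have \<rho>: "0 \<le> \<rho>" "\<rho> < 1" "q = \<rho>^2" using q0 q(2) by (auto simp: \<rho>_def)
  have JV: "J n V \<in> supported I" by (rule J(2)[OF n(1) V])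
  define a where "a s = 2 * s * (1 - s * u) / D s" for s
  define b where "b s = 2 * s^2 * v / D s" for s
  define c where "c s = 2 * s * v / D s" for s
  define a' where "a' s = 2 * ((1 - s * u)\<^sup>2 - s^2 * v^2) / (D s)\<^sup>2" for s
  define b' where "b' s = 4 * (1 - s * u) * s * v / (D s)\<^sup>2" for s
  define c' where "c' s = 2 * v * (1 - s^2 * (u^2 + v^2)) / (D s)\<^sup>2" for s
  define z' where "z' s = - (2 * s * q / P s + (2 * s * (u^2 + v^2) - 2 * u) / D s)" for s
  define \<Gamma>' where "\<Gamma>' s = (a' s *\<^sub>R V + b' s *\<^sub>R J n V + c' s *\<^sub>R n, z' s)" for s
  have pos: "0 < D s" "0 < P s" if s: "s \<in> {0..1}" for s
  proof -
    have s2: "s^2 \<le> 1" using s by (simp add: power_le_one)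
    have "s^2 * q \<le> q" using mult_right_mono[OF s2 q0(1)] by simp
    then show "0 < P s" using q(2) by (simp add: P_def)
    have "\<bar>u\<bar> < 1"
    proof -
      have "u^2 < 1" using q0(2) q(2) zero_le_power2[of v] by linarith
      then show ?thesis by (simp add: abs_square_less_1)
    qed
    then have "s * u < 1"
    proof -
      have "s * u \<le> s * \<bar>u\<bar>" using s by (intro mult_left_mono) auto
      also have "\<dots> \<le> 1 * \<bar>u\<bar>" using s by (intro mult_right_mono) auto
      finally show ?thesis using \<open>\<bar>u\<bar> < 1\<close> by simp
    qed
    then have "0 < (1 - s * u)\<^sup>2 + (s * v)\<^sup>2" by (intro add_pos_nonneg) auto
    also have "\<dots> = D s" by (simp add: D_def power2_eq_square algebra_simps)
    finally show "0 < D s" .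
  qed
  have dD: "(D has_real_derivative 2 * s * (u^2 + v^2) - 2 * u) (at s)" for s
    unfolding D_def by (auto intro!: derivative_eq_intros)
  have dP: "(P has_real_derivative - (2 * s * q)) (at s)" for s
    unfolding P_def by (auto intro!: derivative_eq_intros)
  have da: "(a has_real_derivative a' s) (at s)" and db: "(b has_real_derivative b' s) (at s)"
    and dc: "(c has_real_derivative c' s) (at s)" and dz: "((\<lambda>s. ln (P s) - ln (D s)) has_real_derivative z' s) (at s)"
    if s: "s \<in> {0..1}" for s
  proof -
    have nz: "D s \<noteq> 0" "P s \<noteq> 0" "0 < D s" "0 < P s" using pos[OF s] by auto
    have "((\<lambda>s. 2 * s * (1 - s * u)) has_real_derivative 2 * (1 - s * u) - 2 * s * u) (at s)"
      "((\<lambda>s. 2 * s^2 * v) has_real_derivative 4 * s * v) (at s)" "((\<lambda>s. 2 * s * v) has_real_derivative 2 * v) (at s)"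
      by (auto intro!: derivative_eq_intros)
    note d = this[THEN DERIV_divide, OF dD nz(1)]
    have "((2 * (1 - s * u) - 2 * s * u) * D s - 2 * s * (1 - s * u) * (2 * s * (u^2 + v^2) - 2 * u)) = 2 * ((1 - s * u)\<^sup>2 - s^2 * v^2)"
      "4 * s * v * D s - 2 * s^2 * v * (2 * s * (u^2 + v^2) - 2 * u) = 4 * (1 - s * u) * s * v"
      "2 * v * D s - 2 * s * v * (2 * s * (u^2 + v^2) - 2 * u) = 2 * v * (1 - s^2 * (u^2 + v^2))"
      by (simp_all add: D_def power2_eq_square algebra_simps)
    then show "(a has_real_derivative a' s) (at s)" "(b has_real_derivative b' s) (at s)" "(c has_real_derivative c' s) (at s)"
      using d unfolding a_def[abs_def] b_def[abs_def] c_def[abs_def] a'_def b'_def c'_def power2_eq_square[of "D s"] by simp_all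
    show "((\<lambda>s. ln (P s) - ln (D s)) has_real_derivative z' s) (at s)"
      unfolding z'_def using nz by (auto intro!: derivative_eq_intros dP dD simp: field_simps)
  qed
  have d\<Gamma>: "(\<Gamma> has_vector_derivative \<Gamma>' s) (at s)" if s: "s \<in> {0..1}" for s
    using da[OF s] db[OF s] dc[OF s] dz[OF s]
    unfolding \<Gamma>_def \<Gamma>'_def has_real_derivative_iff_has_vector_derivative a_def[symmetric] b_def[symmetric] c_def[symmetric]
    by (auto intro!: has_vector_derivative_Pair has_vector_derivative_add has_vector_derivative_scaleR[THEN has_vector_derivative_eq_rhs]
        has_vector_derivative_const simp: has_real_derivative_iff_has_vector_derivative)
  have \<Gamma>'c: "continuous_on {0..1} \<Gamma>'"
  proof -
    have Dc: "continuous_on {0..1} D" "continuous_on {0..1} P"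
      unfolding D_def P_def by (intro continuous_intros)+
    have nz: "\<forall>s\<in>{0..1}. D s \<noteq> 0" "\<forall>s\<in>{0..1}. P s \<noteq> 0" "\<forall>s\<in>{0..1}. (D s)\<^sup>2 \<noteq> 0" using pos by force+
    show ?thesis
      unfolding \<Gamma>'_def[abs_def] a'_def b'_def c'_def z'_def by (intro continuous_intros Dc nz)
  qed
  have sp: "norm (frame (\<Gamma> s) (\<Gamma>' s)) = 2 * \<rho> / P s" if s: "s \<in> {0..1}" for s
  proof -
    have p: "0 < D s" "0 < P s" using pos[OF s] by auto
    have xs: "xc (\<Gamma> s) = a s *\<^sub>R V + b s *\<^sub>R J n V" "xc (\<Gamma>' s) = a' s *\<^sub>R V + b' s *\<^sub>R J n V" "yc (\<Gamma>' s) = c' s *\<^sub>R n"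
      using V JV n(1)
      by (simp_all add: \<Gamma>_def \<Gamma>'_def restr_add restr_scaleR restr_id restr_compl a_def b_def)
    have "a s * b' s - b s * a' s = 4 * s^2 * v * D s / (D s ^ 3)"
    proof -
      have e: "(1 - s * u) * (2 * (1 - s * u)) - ((1 - s * u)\<^sup>2 - s^2 * v^2) = D s"
        by (simp add: D_def power2_eq_square algebra_simps)
      have "a s * b' s - b s * a' s = 4 * s^2 * v * ((1 - s * u) * (2 * (1 - s * u)) - ((1 - s * u)\<^sup>2 - s^2 * v^2)) / (D s ^ 3)"
        using p(1) unfolding a_def b_def a'_def b'_def by (simp add: field_simps power2_eq_square power3_eq_cube)
      then show ?thesis unfolding e .
    qed
    then have ab: "a s * b' s - b s * a' s = 4 * s^2 * v / (D s)\<^sup>2"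
      using p(1) by (simp add: power2_eq_square power3_eq_cube)
    have brJ: "br V (J n V) = (V \<bullet> V) *\<^sub>R n" "br (J n V) V = - ((V \<bullet> V) *\<^sub>R n)"
      using br_J[OF n(1) V] br_skew[OF V JV] by simp_all
    have "br (xc (\<Gamma> s)) (xc (\<Gamma>' s)) = (a s * b' s - b s * a' s) *\<^sub>R ((V \<bullet> V) *\<^sub>R n)"
      unfolding xs by (simp add: br_lin brJ V JV algebra_simps)
    then have brx: "yc (\<Gamma>' s) - (1 / 2) *\<^sub>R br (xc (\<Gamma> s)) (xc (\<Gamma>' s)) = (c' s - 2 * s^2 * v / (D s)\<^sup>2 * (V \<bullet> V)) *\<^sub>R n"
      unfolding xs ab by (simp add: algebra_simps)
    have VV: "V \<bullet> V = q - u^2 - v^2" using q(1) by simp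
    have cc': "c' s - 2 * s^2 * v / (D s)\<^sup>2 * (V \<bullet> V) = 2 * v * P s / (D s)\<^sup>2"
    proof -
      have "2 * v * (1 - s^2 * (u^2 + v^2)) - 2 * s^2 * v * (q - u^2 - v^2) = 2 * v * P s"
        by (simp add: P_def algebra_simps)
      then show ?thesis unfolding c'_def VV by (simp add: diff_divide_distrib[symmetric])
    qed
    have xx: "xc (\<Gamma>' s) \<bullet> xc (\<Gamma>' s) = (2 / D s)\<^sup>2 * (q - u^2 - v^2)"
    proof -
      have "xc (\<Gamma>' s) \<bullet> xc (\<Gamma>' s) = ((a' s)\<^sup>2 + (b' s)\<^sup>2) * (V \<bullet> V)"
        unfolding xs using J_orthogonal[OF n(1) V] J_inner[OF n(1) V] n(2)
        by (simp add: inner_add_left inner_add_right inner_commute power2_eq_square algebra_simps)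
      \<comment> \<open>\<open>a + i b = 2 s / (1 - s w)\<close> has derivative
        \<open>2 / (1 - s w)^2\<close>, of modulus \<open>2 / D s\<close>.\<close>
      moreover have "(a' s)\<^sup>2 + (b' s)\<^sup>2 = (2 / D s)\<^sup>2"
      proof -
        have "(2 * ((1 - s * u)\<^sup>2 - s^2 * v^2))\<^sup>2 + (4 * (1 - s * u) * s * v)\<^sup>2 = 4 * (D s)\<^sup>2"
          unfolding D_def by algebra
        then have "(a' s)\<^sup>2 + (b' s)\<^sup>2 = 4 * (D s)\<^sup>2 / ((D s)\<^sup>2)\<^sup>2"
          unfolding a'_def b'_def power_divide add_divide_distrib[symmetric] by simp
        then show ?thesis using p(1) by (simp add: power2_eq_square)
      qed
      ultimately show ?thesis unfolding VV by simp
    qed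
    have ez: "exp (- snd (\<Gamma> s)) = D s / P s" "exp (- snd (\<Gamma> s) / 2) * exp (- snd (\<Gamma> s) / 2) = D s / P s"
      using p by (simp_all add: \<Gamma>_def exp_diff exp_add[symmetric])
    have "frame (\<Gamma> s) (\<Gamma>' s) = (exp (- snd (\<Gamma> s) / 2) *\<^sub>R xc (\<Gamma>' s) + exp (- snd (\<Gamma> s)) *\<^sub>R ((2 * v * P s / (D s)\<^sup>2) *\<^sub>R n), z' s)"
      unfolding frame_def brx cc' by (simp add: \<Gamma>'_def)
    then have "frame (\<Gamma> s) (\<Gamma>' s) \<bullet> frame (\<Gamma> s) (\<Gamma>' s) =
        (exp (- snd (\<Gamma> s) / 2) * exp (- snd (\<Gamma> s) / 2)) * (xc (\<Gamma>' s) \<bullet> xc (\<Gamma>' s)) + (exp (- snd (\<Gamma> s)))\<^sup>2 * (2 * v * P s / (D s)\<^sup>2)\<^sup>2 + (z' s)\<^sup>2"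
      using inner_supported[of "xc (\<Gamma>' s)" I n] n
      by (simp add: inner_prod_def inner_add_left inner_add_right power2_eq_square)
    also have "\<dots> = 4 * q / (P s)\<^sup>2"
      unfolding ez xx z'_def power2_minus using geodesic_speed_identity[of s u v q] p
      by (simp add: D_def P_def mult_ac)
    finally have "norm (frame (\<Gamma> s) (\<Gamma>' s)) = sqrt ((2 * \<rho> / P s)\<^sup>2)"
      unfolding norm_eq_sqrt_inner \<rho>(3) by (simp add: power_divide power_mult_distrib)
    then show ?thesis using p \<rho>(1) by simp
  qed
  \<comment> \<open>Reversed, as the curve has to run towards the identity.\<close>
  define \<gamma> where "\<gamma> t = \<Gamma> (1 - t)" for t
  have d\<gamma>: "(\<gamma> has_vector_derivative - \<Gamma>' (1 - t)) (at t)" if t: "t \<in> {0..1}" for t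
  proof -
    have "((\<lambda>t. 1 - t) has_vector_derivative - 1) (at t)"
      by (auto intro!: derivative_eq_intros)
    from vector_diff_chain_at[OF this d\<Gamma>] t show ?thesis unfolding \<gamma>_def[abs_def] by (simp add: o_def)
  qed
  have "\<gamma> C1_differentiable_on {0..1}"
    unfolding C1_differentiable_on_def
  proof (intro exI[of _ "\<lambda>t. - \<Gamma>' (1 - t)"] conjI ballI d\<gamma>)
    show "continuous_on {0..1} (\<lambda>t. - \<Gamma>' (1 - t))"
      by (intro continuous_intros continuous_on_compose2[OF \<Gamma>'c]) auto
  qed
  moreover have "\<gamma> 0 = \<Gamma> 1" "\<gamma> 1 = 0"
    by (simp_all add: \<gamma>_def \<Gamma>_def D_def P_def zero_prod_def)
  moreover have "curve_length (dr_metric I br) \<gamma> = ln ((1 + sqrt q) / (1 - sqrt q))"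
  proof -
    have "((\<lambda>t. 2 * \<rho> / P (1 - t)) has_integral (- (ln (1 + (1 - 1) * \<rho>) - ln (1 - (1 - 1) * \<rho>)) - - (ln (1 + (1 - 0) * \<rho>) - ln (1 - (1 - 0) * \<rho>)))) {0..1}"
    proof (rule fundamental_theorem_of_calculus)
      fix t :: real assume t: "t \<in> {0..1}"
      have "(1 - t) * \<rho> \<le> 1 * \<rho>" "0 \<le> (1 - t) * \<rho>" using t \<rho> mult_right_mono[of "1 - t" 1 \<rho>] by auto
      then have nz: "0 < 1 + (1 - t) * \<rho>" "0 < 1 - (1 - t) * \<rho>" using \<rho> by auto
      have "P (1 - t) = (1 + (1 - t) * \<rho>) * (1 - (1 - t) * \<rho>)"
        by (simp add: P_def \<rho>(3) power2_eq_square algebra_simps)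
      moreover have "((\<lambda>t. - (ln (1 + (1 - t) * \<rho>) - ln (1 - (1 - t) * \<rho>))) has_real_derivative
          \<rho> / (1 + (1 - t) * \<rho>) + \<rho> / (1 - (1 - t) * \<rho>)) (at t within {0..1})"
        using nz by (auto intro!: derivative_eq_intros simp: divide_inverse)
      moreover have "\<rho> / x + \<rho> / y = \<rho> * (x + y) / (x * y)" if "0 < x" "0 < y" for x y
        using that by (simp add: field_simps)
      from this[OF nz] have "\<rho> / (1 + (1 - t) * \<rho>) + \<rho> / (1 - (1 - t) * \<rho>) = 2 * \<rho> / ((1 + (1 - t) * \<rho>) * (1 - (1 - t) * \<rho>))"
        by simp
      ultimately show "((\<lambda>t. - (ln (1 + (1 - t) * \<rho>) - ln (1 - (1 - t) * \<rho>))) has_vector_derivative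
          2 * \<rho> / P (1 - t)) (at t within {0..1})"
        by (simp add: has_real_derivative_iff_has_vector_derivative)
    qed simp
    moreover have "speed \<gamma> t = 2 * \<rho> / P (1 - t)" if t: "t \<in> {0..1}" for t
    proof -
      have "frame (\<gamma> t) (- \<Gamma>' (1 - t)) = - frame (\<Gamma> (1 - t)) (\<Gamma>' (1 - t))"
        unfolding \<gamma>_def by (rule linear_neg[OF linear_frame])
      then show ?thesis
        unfolding speed_def vector_derivative_at[OF d\<gamma>[OF t]] using sp[of "1 - t"] t by simp
    qed
    ultimately have "(speed \<gamma> has_integral ln (1 + \<rho>) - ln (1 - \<rho>)) {0..1}"
      by (subst has_integral_cong) auto
    then show ?thesis
      unfolding curve_length_speed using \<rho> by (simp add: integral_unique ln_div \<rho>_def[symmetric])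
  qed
  ultimately show ?thesis by blast
qed

lemma unit_center: obtains n where "n \<in> supported (- I)" "n \<bullet> n = 1"
proof -
  obtain i where "i \<notin> I" using center by blast
  then show ?thesis
    by (intro that[of "axis i 1"]; simp add: inner_axis_axis) (auto simp: supported_def axis_def)
qed

lemma exists_minimizing_curve:
  "\<exists>\<gamma>. \<gamma> C1_differentiable_on {0..1} \<and> \<gamma> 0 = p \<and> \<gamma> 1 = 0 \<and> curve_length (dr_metric I br) \<gamma> = dist0 p"
proof -
  let ?X = "xc p" and ?Y = "yc p"
  \<comment> \<open>A unit direction is required even if \<open>Y = 0\<close>; then any one serves,
    with \<open>y = 0\<close>.\<close>
  obtain n y where n: "n \<in> supported (- I)" "n \<bullet> n = 1" "?Y = y *\<^sub>R n"
  proof (cases "?Y = 0")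
    case True
    then show ?thesis using unit_center that[of _ 0] by (metis scaleR_zero_left)
  next
    case False
    then have "((1 / norm ?Y) *\<^sub>R ?Y) \<bullet> ((1 / norm ?Y) *\<^sub>R ?Y) = 1"
      by (simp add: dot_square_norm power2_eq_square)
    then show ?thesis using False by (intro that[of "(1 / norm ?Y) *\<^sub>R ?Y" "norm ?Y"]) (auto intro: supported_scaleR)
  qed
  define a where "a = exp (snd p)"
  define T where "T = a + (?X \<bullet> ?X) / 4"
  define M where "M = (1 + T)\<^sup>2 + y^2"
  \<comment> \<open>The end point \<open>s = 1\<close> solved for the direction: with
    \<open>\<zeta> = T + i y\<close>, the Cayley transform gives
    \<open>w = (\<zeta> - 1) / (\<zeta> + 1)\<close> and \<open>V = (1 - w) X / 2\<close>, where
    \<open>M = |1 + \<zeta>|^2\<close>. This leads to \<open>1 - q = 1 / cc p\<close>.\<close>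
  define u where "u = (T^2 + y^2 - 1) / M"
  define v where "v = 2 * y / M"
  define V where "V = ((1 + T) / M) *\<^sub>R ?X - (y / M) *\<^sub>R J n ?X"
  define q where "q = u^2 + v^2 + V \<bullet> V"
  have a: "0 < a" by (simp add: a_def)
  have T: "0 < T" using a by (simp add: T_def add_pos_nonneg)
  have M: "0 < M" using T by (simp add: M_def add_pos_nonneg)
  have JX: "J n ?X \<in> supported I" by (rule J(2)[OF n(1)]) simp
  have V: "V \<in> supported I" unfolding V_def by (intro supported_diff supported_scaleR JX) simp
  have ccM: "M = 4 * a * cc p"
    using cc_eq[of p] n by (simp add: M_def T_def a_def bb_def power2_eq_square add.assoc)
  have VV: "V \<bullet> V = (?X \<bullet> ?X) / M"
  proof -
    have "(A *\<^sub>R ?X - B *\<^sub>R J n ?X) \<bullet> (A *\<^sub>R ?X - B *\<^sub>R J n ?X) = (A^2 + B^2) * (?X \<bullet> ?X)" for A B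
      using J_orthogonal[OF n(1), of ?X] J_inner[OF n(1), of ?X] n(2)
      by (simp add: inner_diff_left inner_diff_right inner_commute power2_eq_square algebra_simps)
    then have "V \<bullet> V = (((1 + T) / M)\<^sup>2 + (y / M)\<^sup>2) * (?X \<bullet> ?X)"
      unfolding V_def .
    also have "((1 + T) / M)\<^sup>2 + (y / M)\<^sup>2 = M / M^2"
      unfolding power_divide add_divide_distrib[symmetric] M_def[symmetric] ..
    finally show ?thesis using M by (simp add: power2_eq_square)
  qed
  have uv: "u^2 + v^2 = 1 - 4 * T / M" "1 - 2 * u + (u^2 + v^2) = 4 / M" "1 - u = 2 * (1 + T) / M"
  proof -
    have "(T^2 + y^2 - 1)\<^sup>2 + (2 * y)\<^sup>2 = (M - 4 * T) * M" unfolding M_def by algebra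
    then have "u^2 + v^2 = (M - 4 * T) * M / M^2"
      unfolding u_def v_def power_divide add_divide_distrib[symmetric] by simp
    then show 1: "u^2 + v^2 = 1 - 4 * T / M" using M by (simp add: power2_eq_square diff_divide_distrib)
    show 3: "1 - u = 2 * (1 + T) / M"
      using M by (simp add: u_def divide_simps) (simp add: M_def power2_eq_square algebra_simps)
    have "1 - 2 * u + (u^2 + v^2) = 2 * (1 - u) - 4 * T / M" unfolding 1 by simp
    also have "\<dots> = 4 / M" unfolding 3 using M by (simp add: field_simps)
    finally show "1 - 2 * u + (u^2 + v^2) = 4 / M" .
  qed
  have q1: "1 - q = 4 * a / M" "1 - q = 1 / cc p"
  proof -
    show 1: "1 - q = 4 * a / M" unfolding q_def uv(1) VV by (simp add: T_def add_divide_distrib)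
    show "1 - q = 1 / cc p" unfolding 1 ccM using a by simp
  qed
  have q: "q < 1" "0 \<le> q" using q1(1) a M by (simp_all add: q_def) (smt (verit) divide_pos_pos)
  let ?D = "1 - 2 * 1 * u + 1\<^sup>2 * (u^2 + v^2)"
  let ?G = "((2 * 1 * (1 - 1 * u) / (?D)) *\<^sub>R V +
        (2 * 1\<^sup>2 * v / (?D)) *\<^sub>R J n V + (2 * 1 * v / (?D)) *\<^sub>R n,
        ln (1 - 1\<^sup>2 * q) - ln (?D))"
  have "\<exists>\<gamma>. \<gamma> C1_differentiable_on {0..1} \<and> \<gamma> 0 = ?G \<and> \<gamma> 1 = 0 \<and>
    curve_length (dr_metric I br) \<gamma> = ln ((1 + sqrt q) / (1 - sqrt q))"
    by (rule geodesic[OF n(1,2) V q_def q(1)])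
  moreover have "?G = p"
  proof (rule prod_eqI)
    have "J n V = ((1 + T) / M) *\<^sub>R J n ?X + (y / M) *\<^sub>R ?X"
      unfolding V_def using J(4)[OF n(1), of ?X] n(2)
      by (simp add: linear_diff[OF J(1)[OF n(1)]] linear_scale[OF J(1)[OF n(1)]] power2_norm_eq_inner)
    moreover have "c *\<^sub>R (A *\<^sub>R x - B *\<^sub>R k) + y *\<^sub>R (A *\<^sub>R k + B *\<^sub>R x) = (c * A + y * B) *\<^sub>R x + (y * A - c * B) *\<^sub>R k"
      for A B c and x k :: "real^'i" by (simp add: algebra_simps)
    ultimately have "(1 + T) *\<^sub>R V + y *\<^sub>R J n V = ((1 + T) * ((1 + T) / M) + y * (y / M)) *\<^sub>R ?X +
        (y * ((1 + T) / M) - (1 + T) * (y / M)) *\<^sub>R J n ?X"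
      unfolding V_def by simp
    also have "\<dots> = (((1 + T)\<^sup>2 + y^2) / M) *\<^sub>R ?X"
    proof -
      have "c * (c / M) + y * (y / M) = (c^2 + y^2) / M" "y * (c / M) - c * (y / M) = 0" for c
        by (simp_all add: power2_eq_square add_divide_distrib)
      then show ?thesis by (simp only: scaleR_zero_left add_0_right)
    qed
    also have "\<dots> = ?X" using M unfolding M_def[symmetric] by simp
    finally have XV: "(1 + T) *\<^sub>R V + y *\<^sub>R J n V = ?X" .
    have f: "2 * (1 - u) / (4 / M) = 1 + T" "2 * v / (4 / M) = y"
      unfolding uv(3) using M by (simp_all add: v_def)
    show "fst ?G = fst p"
      unfolding fst_conv mult_1_right one_power2 mult_1 uv(2) f XV n(3)[symmetric] by (rule restr_sum)
    have "ln (1 - q) - ln (4 / M) = snd p"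
      unfolding q1(1) using a M by (simp add: ln_div ln_mult a_def)
    then show "snd ?G = snd p"
      unfolding snd_conv mult_1_right one_power2 mult_1 uv(2) by simp
  qed
  moreover have "ln ((1 + sqrt q) / (1 - sqrt q)) = dist0 p"
  proof -
    define \<rho> where "\<rho> = sqrt q"
    have \<rho>: "0 \<le> \<rho>" "\<rho> < 1" "q = \<rho>^2" using q by (auto simp: \<rho>_def)
    let ?l = "ln ((1 + \<rho>) / (1 - \<rho>))"
    have l: "0 \<le> ?l" using \<rho> by (intro ln_ge_zero) (simp add: field_simps)
    have cq: "cc p = 1 / (1 - q)" unfolding q1(2) by simp
    have e: "exp ?l = (1 + \<rho>) / (1 - \<rho>)" "exp (- ?l) = (1 - \<rho>) / (1 + \<rho>)"
      using \<rho> by (simp_all add: exp_minus)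
    have "cosh ?l = 2 * cc p - 1"
      unfolding cosh_field_def e cq \<rho>(3) using \<rho>(1,2) abs_square_less_1[of \<rho>] by (simp add: divide_simps power2_eq_square) (simp add: algebra_simps)
    then show ?thesis unfolding dist0_def \<rho>_def[symmetric] using arcosh_cosh_real[OF l] by simp
  qed
  ultimately show ?thesis by metis
qed

theorem dr_dist_eq: "dr_dist I br p 0 = dist0 p"
proof -
  let ?S = "{curve_length (dr_metric I br) \<gamma> |\<gamma>. \<gamma> C1_differentiable_on {0..1} \<and> \<gamma> 0 = p \<and> \<gamma> 1 = 0}"
  have lb: "dist0 p \<le> x" if "x \<in> ?S" for x using that dist0_le_length by blast
  have mem: "dist0 p \<in> ?S" using exists_minimizing_curve[of p] by (smt (verit) mem_Collect_eq)
  have "Inf ?S = dist0 p" using mem lb by (intro cInf_eq_minimum) auto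
  then show ?thesis by (simp add: dr_dist_def riemannian_dist_def)
qed

lemma cosh_dist0: "cosh (dist0 p) = 2 * cc p - 1" "0 \<le> dist0 p"
  using cc_ge_1[of p] by (simp_all add: dist0_def)

lemma dist0_eq_iff: "0 \<le> r \<Longrightarrow> dist0 p = r \<longleftrightarrow> cc p = (cosh (r / 2))\<^sup>2"
proof -
  assume r: "0 \<le> r"
  have "dist0 p = r \<longleftrightarrow> cosh (dist0 p) = cosh r"
    using r cosh_dist0(2)[of p] cosh_real_nonneg_le_iff[of r "dist0 p"] cosh_real_nonneg_le_iff[of "dist0 p" r] by (auto intro: antisym)
  also have "\<dots> \<longleftrightarrow> cc p = (cosh (r / 2))\<^sup>2"
    unfolding cosh_dist0 using cosh_double_cosh[of "r / 2"] by simp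
  finally show ?thesis .
qed

text \<open>The vertical axis through the identity meets every geodesic sphere; radial functions are
  later recovered from their values on it.\<close>

lemma dist0_vertical: "dist0 (0, z) = \<bar>z\<bar>"
proof -
  have "cc (0, z) = (cosh (\<bar>z\<bar> / 2))\<^sup>2"
  proof -
    have "(cosh (z / 2))\<^sup>2 = (cosh z + 1) / 2" using cosh_double_cosh[of "z / 2"] by simp
    also have "\<dots> = cc (0, z)"
    proof -
      have "exp z * exp (- z) = 1" by (simp add: exp_add[symmetric])
      moreover have "(1 + exp z)\<^sup>2 * exp (- z) = exp (- z) + 2 * (exp z * exp (- z)) + exp z * (exp z * exp (- z))"
        by (simp add: power2_eq_square algebra_simps)
      ultimately show ?thesis
        by (simp add: cc_def bb_def cosh_field_def)
    qed
    finally show ?thesis by (cases "0 \<le> z") (simp_all add: abs_if)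
  qed
  then show ?thesis by (simp add: dist0_eq_iff)
qed

end

section \<open>Change of variables for nonnegative functions\<close>

text \<open>The library proves the change of variables formula only for well-ordered index types.\<close>

typedef 'a enumerated = "UNIV :: 'a set" by simp

instantiation enumerated :: (finite) "{finite, wellorder}"
begin

definition less_eq_enumerated :: "'a enumerated \<Rightarrow> 'a enumerated \<Rightarrow> bool" where
  "less_eq_enumerated x y \<longleftrightarrow> to_nat (Rep_enumerated x) \<le> to_nat (Rep_enumerated y)"

definition less_enumerated :: "'a enumerated \<Rightarrow> 'a enumerated \<Rightarrow> bool" where
  "less_enumerated x y \<longleftrightarrow> to_nat (Rep_enumerated x) < to_nat (Rep_enumerated y)"

instance
proof
  fix x y z :: "'a enumerated" and P
  show "finite (UNIV :: 'a enumerated set)"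
    using finite_imageI[of UNIV "Abs_enumerated :: 'a \<Rightarrow> _"] by (simp add: Abs_enumerated_cases image_def)
      (metis (mono_tags, lifting) Abs_enumerated_cases UNIV_eq_I finite mem_Collect_eq)
  show "x < y \<longleftrightarrow> x \<le> y \<and> \<not> y \<le> x" "x \<le> x" "x \<le> y \<Longrightarrow> y \<le> z \<Longrightarrow> x \<le> z" "x \<le> y \<or> y \<le> x"
    by (auto simp: less_eq_enumerated_def less_enumerated_def)
  show "x \<le> y \<Longrightarrow> y \<le> x \<Longrightarrow> x = y"
    by (simp add: less_eq_enumerated_def Rep_enumerated_inject)
  show "(\<And>x. (\<And>y. y < x \<Longrightarrow> P y) \<Longrightarrow> P x) \<Longrightarrow> P x"
    using wf_induct_rule[OF wf_measure[of "\<lambda>x. to_nat (Rep_enumerated x)"], of P x]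
    by (auto simp: less_enumerated_def)
qed

end

definition to_enum :: "real^'i \<Rightarrow> real^('i::finite) enumerated" where
  "to_enum x = (\<chi> j. x $ Rep_enumerated j)"

definition of_enum :: "real^('i::finite) enumerated \<Rightarrow> real^'i" where
  "of_enum y = (\<chi> i. y $ Abs_enumerated i)"

lemma enum_inverse [simp]: "of_enum (to_enum x) = x" "to_enum (of_enum y) = y"
  by (simp_all add: of_enum_def to_enum_def vec_eq_iff Abs_enumerated_inverse Rep_enumerated_inverse)

lemma linear_to_enum: "linear to_enum" and linear_of_enum: "linear of_enum"
  by (rule linearI; simp add: to_enum_def of_enum_def vec_eq_iff)+

lemma bij_Rep_enumerated: "bij (Rep_enumerated :: 'i enumerated \<Rightarrow> 'i)"
  by (rule bijI') (auto simp: Rep_enumerated_inject intro: Abs_enumerated_inverse[symmetric])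

lemma prod_Basis_vec: "(\<Prod>b\<in>Basis. x \<bullet> b) = (\<Prod>i\<in>UNIV. (x :: real^'i) $ i)"
proof -
  have B: "(Basis :: (real^'i) set) = range (\<lambda>i. axis i 1)" by (auto simp: Basis_vec_def)
  have "inj (\<lambda>i :: 'i. axis i (1 :: real))" by (auto simp: inj_on_def axis_eq_axis)
  then have "(\<Prod>b\<in>range (\<lambda>i. axis i 1). x \<bullet> b) = (\<Prod>i\<in>UNIV. x $ i)" by (subst prod.reindex) (simp_all add: inner_axis)
  then show ?thesis unfolding B .
qed

lemma emeasure_lborel_box_vec:
  "emeasure lborel (box l u) = (if \<forall>i. l $ i \<le> u $ i then ennreal (\<Prod>i\<in>UNIV. ((u :: real^'i) - l) $ i) else 0)"
  unfolding emeasure_lborel_box_eq prod_Basis_vec by (simp add: Basis_vec_def inner_axis)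

lemma measurable_linear_vec:
  fixes f :: "'a::euclidean_space \<Rightarrow> 'b::euclidean_space"
  shows "linear f \<Longrightarrow> f \<in> borel_measurable borel"
  using linear_continuous_on linear_conv_bounded_linear borel_measurable_continuous_onI by blast

lemma lborel_to_enum: "distr lborel borel to_enum = (lborel :: (real^('i::finite) enumerated) measure)"
proof (rule lborel_eqI[symmetric])
  fix l u :: "real^'i enumerated" assume "\<And>b. b \<in> Basis \<Longrightarrow> l \<bullet> b \<le> u \<bullet> b"
  then have le: "l $ j \<le> u $ j" for j by (metis axis_in_Basis_iff inner_axis inner_real_def mult.right_neutral Basis_real_def insertI1)
  have pre: "to_enum -` box l u = (box (of_enum l) (of_enum u) :: (real^'i) set)"
    by (auto simp: mem_box_cart to_enum_def of_enum_def Rep_enumerated_inverse)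
      (metis Abs_enumerated_inverse UNIV_I Rep_enumerated_inverse)+
  have "emeasure (distr lborel borel to_enum) (box l u) = emeasure lborel (box (of_enum l) (of_enum u) :: (real^'i) set)"
    by (subst emeasure_distr) (auto simp: pre measurable_linear_vec[OF linear_to_enum])
  also have "\<dots> = ennreal (\<Prod>i\<in>UNIV. (of_enum u - of_enum l) $ i)"
    unfolding emeasure_lborel_box_vec using le by (simp add: of_enum_def)
  also have "(\<Prod>i\<in>UNIV. (of_enum u - of_enum l) $ i) = (\<Prod>j\<in>UNIV. (u - l) $ j)"
    by (rule prod.reindex_bij_betw[OF bij_Rep_enumerated, symmetric, THEN trans])
      (simp add: of_enum_def Rep_enumerated_inverse)
  finally show "emeasure (distr lborel borel to_enum) (box l u) = ennreal (\<Prod>b\<in>Basis. (u - l) \<bullet> b)"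
    unfolding prod_Basis_vec .
qed simp

lemma det_reindex:
  fixes A :: "real^'i^'i" and f :: "'j::finite \<Rightarrow> 'i::finite"
  assumes "bij f"
  shows "det (\<chi> i j. A $ f i $ f j) = det A"
proof -
  have inj: "inj f" using assms by (simp add: bij_is_inj)
  let ?m = "map_permutation UNIV f"
  have m: "?m p (f i) = f (p i)" for p i
    using inj assms by (simp add: map_permutation_def restrict_id_def bij_is_surj)
  have bij: "bij_betw ?m {p. p permutes UNIV} {p. p permutes (UNIV :: 'i set)}"
  proof -
    have "?m = (\<lambda>\<pi> x. if x \<in> UNIV then f (\<pi> (inv f x)) else x)"
      using assms by (simp add: fun_eq_iff map_permutation_def restrict_id_def bij_is_surj)
    then show ?thesis using bij_betw_permutations[of f UNIV UNIV] assms by simp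
  qed
  have "det A = (\<Sum>p | p permutes (UNIV :: 'j set). of_int (sign (?m p)) * (\<Prod>i\<in>UNIV. A $ i $ ?m p i))"
    unfolding det_def by (rule sum.reindex_bij_betw[OF bij, symmetric])
  also have "\<dots> = (\<Sum>p | p permutes (UNIV :: 'j set). of_int (sign p) * (\<Prod>i\<in>UNIV. A $ f i $ f (p i)))"
  proof (intro sum.cong refl arg_cong2[of _ _ _ _ "(*)"])
    fix p assume "p \<in> {p. p permutes (UNIV :: 'j set)}"
    then show "of_int (sign (?m p)) = (of_int (sign p) :: real)" using sign_map_permutation[OF inj, of p] by simp
    show "(\<Prod>i\<in>UNIV. A $ i $ ?m p i) = (\<Prod>i\<in>UNIV. A $ f i $ f (p i))"
      by (subst prod.reindex_bij_betw[OF assms, symmetric]) (simp add: m)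
  qed
  finally show ?thesis by (simp add: det_def)
qed

lemma det_to_enum:
  assumes "linear D"
  shows "det (matrix (\<lambda>y. to_enum (D (of_enum y)))) = det (matrix D)"
proof -
  have "matrix (\<lambda>y. to_enum (D (of_enum y))) = (\<chi> i j. matrix D $ Rep_enumerated i $ Rep_enumerated j)"
  proof -
    have "of_enum (axis j 1) = (axis (Rep_enumerated j) 1 :: real^'a)" for j :: "'a enumerated"
      by (simp add: of_enum_def axis_def vec_eq_iff) (metis Abs_enumerated_inverse Rep_enumerated_inverse UNIV_I)
    then show ?thesis unfolding matrix_def to_enum_def by (simp add: vec_eq_iff[of "\<chi> _. _"])
  qed
  then show ?thesis using det_reindex[OF bij_Rep_enumerated] by metis
qed

text \<open>The push-forward of the weighted measure on \<open>S\<close> is compared with Lebesgue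
  measure on the image, at first on bounded sets, where volumes are finite, and then along balls
  that exhaust the space. This reduces the formula for nonnegative functions to volumes of images of
  sets.\<close>

lemma nn_integral_change_from_measure:
  fixes g :: "'a::euclidean_space \<Rightarrow> 'b::euclidean_space" and w :: "'a \<Rightarrow> ennreal" and f :: "'b \<Rightarrow> ennreal"
  assumes S: "S \<in> sets borel" and gS: "g ` S \<in> sets borel" and g: "continuous_on S g" and inj: "inj_on g S"
    and w: "(\<lambda>x. w x * indicator S x) \<in> borel_measurable borel" and f: "f \<in> borel_measurable borel"
    and A: "\<And>A. A \<in> sets borel \<Longrightarrow> A \<subseteq> S \<Longrightarrow> bounded (g ` A) \<Longrightarrow> g ` A \<in> sets borel \<Longrightarrow>
      emeasure lborel (g ` A) = (\<integral>\<^sup>+ x. w x * indicator A x \<partial>lborel)"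
  shows "(\<integral>\<^sup>+ y. f y * indicator (g ` S) y \<partial>lborel) = (\<integral>\<^sup>+ x. w x * f (g x) * indicator S x \<partial>lborel)"
proof -
  define g0 where "g0 x = (if x \<in> S then g x else 0)" for x
  have g0m: "g0 \<in> borel_measurable borel"
    unfolding g0_def using borel_measurable_continuous_on_if[OF S g continuous_on_const] by simp
  define \<nu> where "\<nu> = distr (density lborel (\<lambda>x. w x * indicator S x)) borel g0"
  have \<nu>: "emeasure \<nu> B = (\<integral>\<^sup>+ x. w x * indicator (S \<inter> g0 -` B) x \<partial>lborel)" if "B \<in> sets borel" for B
  proof -
    have m: "g0 -` B \<in> sets borel" using measurable_sets[OF g0m that] by simp
    have "emeasure \<nu> B = (\<integral>\<^sup>+ x. w x * indicator S x * indicator (g0 -` B) x \<partial>lborel)"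
      unfolding \<nu>_def using g0m that m w by (simp add: emeasure_distr emeasure_density)
    then show ?thesis by (simp add: indicator_inter_arith mult.assoc)
  qed
  have img: "g ` (S \<inter> g0 -` B) = g ` S \<inter> B" for B by (auto simp: g0_def)
  have bd: "emeasure \<nu> B = emeasure lborel (g ` S \<inter> B)" if B: "B \<in> sets borel" "bounded B" for B
  proof -
    have "emeasure lborel (g ` (S \<inter> g0 -` B)) = (\<integral>\<^sup>+ x. w x * indicator (S \<inter> g0 -` B) x \<partial>lborel)"
    proof (rule A)
      show "S \<inter> g0 -` B \<in> sets borel" using measurable_sets[OF g0m B(1)] S by auto
      show "bounded (g ` (S \<inter> g0 -` B))" unfolding img using B(2) by (rule bounded_subset) auto
      show "g ` (S \<inter> g0 -` B) \<in> sets borel" unfolding img using gS B(1) by auto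
    qed auto
    then show ?thesis unfolding img \<nu>[OF B(1)] by simp
  qed
  have "\<nu> = density lborel (indicator (g ` S))"
  proof (rule measure_eqI)
    fix B assume "B \<in> sets \<nu>"
    then have B: "B \<in> sets borel" by (simp add: \<nu>_def)
    let ?C = "\<lambda>n. B \<inter> ball 0 (real n)"
    have U: "(\<Union>n. ?C n) = B" using reals_Archimedean2 by (auto simp: dist_norm)
    have inc: "incseq ?C" by (auto simp: incseq_def)
    have "emeasure \<nu> B = (SUP n. emeasure \<nu> (?C n))"
    proof -
      have r: "range ?C \<subseteq> sets \<nu>" using B by (auto simp: \<nu>_def)
      show ?thesis using SUP_emeasure_incseq[OF r inc] unfolding U by (rule sym)
    qed
    also have "\<dots> = (SUP n. emeasure lborel (g ` S \<inter> ?C n))"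
      using B by (intro SUP_cong refl bd) (auto intro: bounded_subset[OF bounded_ball])
    also have "\<dots> = emeasure lborel (\<Union>n. g ` S \<inter> ?C n)"
      using B gS by (intro SUP_emeasure_incseq) (auto simp: incseq_def)
    also have "(\<Union>n. g ` S \<inter> ?C n) = g ` S \<inter> B" using U by blast
    finally show "emeasure \<nu> B = emeasure (density lborel (indicator (g ` S))) B"
      using B gS by (simp add: emeasure_density indicator_inter_arith[symmetric] Int_commute)
  qed (simp add: \<nu>_def)
  then have "integral\<^sup>N (density lborel (indicator (g ` S))) f = integral\<^sup>N \<nu> f" by simp
  moreover have "integral\<^sup>N \<nu> f = (\<integral>\<^sup>+ x. w x * indicator S x * f (g0 x) \<partial>lborel)"
    unfolding \<nu>_def using g0m f w by (simp add: nn_integral_distr nn_integral_density)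
  moreover have "w x * indicator S x * f (g0 x) = w x * f (g x) * indicator S x" for x
    by (simp add: g0_def indicator_def)
  moreover have "integral\<^sup>N (density lborel (indicator (g ` S))) f = (\<integral>\<^sup>+ y. f y * indicator (g ` S) y \<partial>lborel)"
    using gS f by (simp add: nn_integral_density mult.commute)
  ultimately show ?thesis by simp
qed

lemma nn_integral_abs_det_wellorder:
  fixes g :: "real^'m::{finite,wellorder} \<Rightarrow> real^'m::_"
  assumes A: "A \<in> sets borel" and d: "\<And>x. x \<in> A \<Longrightarrow> (g has_derivative g' x) (at x within A)"
    and inj: "inj_on g A" and b: "bounded (g ` A)" "g ` A \<in> sets borel"
  shows "emeasure lborel (g ` A) = (\<integral>\<^sup>+ x. ennreal \<bar>det (matrix (g' x))\<bar> * indicator A x \<partial>lborel)"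
proof -
  have fin: "emeasure lborel (g ` A) < \<infinity>" using emeasure_bounded_finite[OF b(1)] .
  then have lm: "g ` A \<in> lmeasurable" using b(2) by (simp add: fmeasurable_def)
  have "((\<lambda>x. \<bar>det (matrix (g' x))\<bar>) has_integral measure lebesgue (g ` A)) A"
    using has_measure_differentiable_image[of A g g' "measure lebesgue (g ` A)", OF _ d inj] A lm by simp
  from nn_integral_has_integral_lebesgue'[OF _ this]
  have "(\<integral>\<^sup>+ x. ennreal \<bar>det (matrix (g' x))\<bar> * indicator A x \<partial>lborel) = ennreal (measure lebesgue (g ` A))" by simp
  also have "\<dots> = emeasure lborel (g ` A)"
    using fin b(2) by (simp add: emeasure_eq_ennreal_measure measure_completion)
  finally show ?thesis by simp
qed

text \<open>Transport along the coordinate relabelling \<open>to_enum\<close>, which preserves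
  Lebesgue measure and determinants.\<close>

lemma nn_integral_abs_det:
  fixes g :: "real^'i \<Rightarrow> real^'i"
  assumes A: "A \<in> sets borel" and d: "\<And>x. x \<in> A \<Longrightarrow> (g has_derivative g' x) (at x within A)"
    and inj: "inj_on g A" and b: "bounded (g ` A)" "g ` A \<in> sets borel"
    and w: "(\<lambda>x. ennreal \<bar>det (matrix (g' x))\<bar> * indicator A x) \<in> borel_measurable borel"
  shows "emeasure lborel (g ` A) = (\<integral>\<^sup>+ x. ennreal \<bar>det (matrix (g' x))\<bar> * indicator A x \<partial>lborel)"
proof -
  have im: "to_enum ` B = of_enum -` B" for B :: "(real^'i) set"
    by (auto simp: image_iff) (metis enum_inverse(2))
  have bor: "to_enum ` B \<in> sets borel" if "B \<in> sets borel" for B :: "(real^'i) set"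
    unfolding im using measurable_sets[OF measurable_linear_vec[OF linear_of_enum] that] by simp
  let ?h = "\<lambda>y. to_enum (g (of_enum y))"
  have him: "?h ` (to_enum ` A) = to_enum ` (g ` A)" by (simp add: image_image)
  have bl: "bounded_linear (to_enum :: real^'i \<Rightarrow> _)" "bounded_linear (of_enum :: _ \<Rightarrow> real^'i)"
    using linear_to_enum linear_of_enum linear_conv_bounded_linear by blast+
  have em: "emeasure lborel B = emeasure lborel (to_enum ` B)" if "B \<in> sets borel" for B :: "(real^'i) set"
  proof -
    have "emeasure (distr lborel borel to_enum) (to_enum ` B) = emeasure lborel (to_enum -` (to_enum ` B))"
      using bor[OF that] by (simp add: emeasure_distr measurable_linear_vec[OF linear_to_enum])
    moreover have "to_enum -` (to_enum ` B) = B" by (auto simp: image_iff) (metis enum_inverse(1))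
    ultimately show ?thesis by (simp add: lborel_to_enum)
  qed
  have "emeasure lborel (?h ` (to_enum ` A)) =
    (\<integral>\<^sup>+ y. ennreal \<bar>det (matrix (\<lambda>v. to_enum (g' (of_enum y) (of_enum v))))\<bar> * indicator (to_enum ` A) y \<partial>lborel)"
  proof (rule nn_integral_abs_det_wellorder)
    fix y assume "y \<in> to_enum ` A"
    then have y: "of_enum y \<in> A" "of_enum ` (to_enum ` A) = A" by (auto simp: image_image)
    have "((\<lambda>y. g (of_enum y)) has_derivative (\<lambda>v. g' (of_enum y) (of_enum v))) (at y within to_enum ` A)"
      using has_derivative_in_compose[OF bounded_linear.has_derivative[OF bl(2) has_derivative_ident], of g "g' (of_enum y)" y "to_enum ` A"] d[OF y(1)] y(2)
      by simp
    then show "(?h has_derivative (\<lambda>v. to_enum (g' (of_enum y) (of_enum v)))) (at y within to_enum ` A)"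
      by (rule bounded_linear.has_derivative[OF bl(1)])
  next
    show "inj_on ?h (to_enum ` A)"
      using inj by (auto simp: inj_on_def) (metis enum_inverse(1))
    show "bounded (?h ` to_enum ` A)" unfolding him using b(1) bl(1) by (rule bounded_linear_image)
  qed (use A b bor in \<open>auto simp: him\<close>)
  also have "\<dots> = (\<integral>\<^sup>+ y. ennreal \<bar>det (matrix (g' (of_enum y)))\<bar> * indicator A (of_enum y) \<partial>lborel)"
  proof (rule nn_integral_cong)
    fix y :: "real^'i enumerated"
    have "linear (g' (of_enum y))" if "of_enum y \<in> A" using has_derivative_linear[OF d[OF that]] .
    then show "ennreal \<bar>det (matrix (\<lambda>v. to_enum (g' (of_enum y) (of_enum v))))\<bar> * indicator (to_enum ` A) y =
      ennreal \<bar>det (matrix (g' (of_enum y)))\<bar> * indicator A (of_enum y)"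
      unfolding im by (auto simp: indicator_def det_to_enum)
  qed
  also have "\<dots> = (\<integral>\<^sup>+ y. ennreal \<bar>det (matrix (g' (of_enum y)))\<bar> * indicator A (of_enum y) \<partial>distr lborel borel to_enum)"
    unfolding lborel_to_enum ..
  also have "\<dots> = (\<integral>\<^sup>+ x. ennreal \<bar>det (matrix (g' x))\<bar> * indicator A x \<partial>lborel)"
    by (subst nn_integral_distr)
      (auto simp: measurable_linear_vec[OF linear_to_enum] intro: measurable_compose[OF measurable_linear_vec[OF linear_of_enum] w])
  finally show ?thesis unfolding him em[OF b(2)] .
qed

lemma nn_integral_change_of_variables:
  fixes g :: "real^'i \<Rightarrow> real^'i" and f :: "real^'i \<Rightarrow> ennreal"
  assumes S: "S \<in> sets borel" and gS: "g ` S \<in> sets borel"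
    and d: "\<And>x. x \<in> S \<Longrightarrow> (g has_derivative g' x) (at x within S)" and inj: "inj_on g S"
    and w: "(\<lambda>x. ennreal \<bar>det (matrix (g' x))\<bar> * indicator S x) \<in> borel_measurable borel"
    and f: "f \<in> borel_measurable borel"
  shows "(\<integral>\<^sup>+ y. f y * indicator (g ` S) y \<partial>lborel) = (\<integral>\<^sup>+ x. ennreal \<bar>det (matrix (g' x))\<bar> * f (g x) * indicator S x \<partial>lborel)"
proof (rule nn_integral_change_from_measure[OF S gS _ inj w f])
  show "continuous_on S g"
    using d by (meson continuous_on_eq_continuous_within has_derivative_continuous)
  fix A assume A: "A \<in> sets borel" "A \<subseteq> S" "bounded (g ` A)" "g ` A \<in> sets borel"
  have "(\<lambda>x. ennreal \<bar>det (matrix (g' x))\<bar> * indicator S x * indicator A x) \<in> borel_measurable borel"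
    using w A(1) by measurable
  moreover have "ennreal \<bar>det (matrix (g' x))\<bar> * indicator S x * indicator A x = ennreal \<bar>det (matrix (g' x))\<bar> * indicator A x" for x
    using A(2) by (auto simp: indicator_def)
  ultimately have wA: "(\<lambda>x. ennreal \<bar>det (matrix (g' x))\<bar> * indicator A x) \<in> borel_measurable borel" by simp
  show "emeasure lborel (g ` A) = (\<integral>\<^sup>+ x. ennreal \<bar>det (matrix (g' x))\<bar> * indicator A x \<partial>lborel)"
  proof (rule nn_integral_abs_det[OF A(1) _ _ A(3,4) wA])
    show "(g has_derivative g' x) (at x within A)" if "x \<in> A" for x
      using d[of x] A(2) that by (meson has_derivative_subset subsetD)
    show "inj_on g A" using inj A(2) by (rule inj_on_subset)
  qed
qed

lemma nn_integral_change_of_variables_1: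
  fixes g :: "real \<Rightarrow> real" and f :: "real \<Rightarrow> ennreal"
  assumes S: "S \<in> sets borel" and gS: "g ` S \<in> sets borel"
    and d: "\<And>x. x \<in> S \<Longrightarrow> (g has_real_derivative g' x) (at x within S)" and inj: "inj_on g S"
    and w: "(\<lambda>x. ennreal \<bar>g' x\<bar> * indicator S x) \<in> borel_measurable borel"
    and f: "f \<in> borel_measurable borel"
  shows "(\<integral>\<^sup>+ y. f y * indicator (g ` S) y \<partial>lborel) = (\<integral>\<^sup>+ x. ennreal \<bar>g' x\<bar> * f (g x) * indicator S x \<partial>lborel)"
proof (rule nn_integral_change_from_measure[OF S gS _ inj w f])
  show "continuous_on S g" using d by (rule DERIV_continuous_on)
  fix A assume A: "A \<in> sets borel" "A \<subseteq> S" "bounded (g ` A)" "g ` A \<in> sets borel"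
  have dA: "(g has_field_derivative g' x) (at x within A)" if "x \<in> A" for x
    using d[of x] A(2) that by (meson DERIV_subset subsetD)
  have fin: "emeasure lborel (g ` A) < \<infinity>" using emeasure_bounded_finite[OF A(3)] .
  then have lm: "g ` A \<in> lmeasurable" using A(4) by (simp add: fmeasurable_def)
  have "(\<lambda>_. 1 :: real) absolutely_integrable_on g ` A" "integral (g ` A) (\<lambda>_. 1) = measure lebesgue (g ` A)"
    using absolutely_integrable_on_const[OF lm] lmeasure_integral[OF lm] by simp_all
  then have *: "(\<lambda>x. \<bar>g' x\<bar> * 1) absolutely_integrable_on A" "integral A (\<lambda>x. \<bar>g' x\<bar> * 1) = measure lebesgue (g ` A)"
    using has_absolute_integral_change_of_variables_1'[OF _ dA inj_on_subset[OF inj A(2)], of "\<lambda>_. 1" "measure lebesgue (g ` A)"] A(1)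
    by auto
  then have "((\<lambda>x. \<bar>g' x\<bar>) has_integral measure lebesgue (g ` A)) A"
    using integrable_integral[OF set_lebesgue_integral_eq_integral(1)[OF *(1)]] by simp
  from nn_integral_has_integral_lebesgue'[OF _ this]
  have "(\<integral>\<^sup>+ x. ennreal \<bar>g' x\<bar> * indicator A x \<partial>lborel) = ennreal (measure lebesgue (g ` A))" by simp
  also have "\<dots> = emeasure lborel (g ` A)"
    using fin A(4) by (simp add: emeasure_eq_ennreal_measure measure_completion)
  finally show "emeasure lborel (g ` A) = (\<integral>\<^sup>+ x. ennreal \<bar>g' x\<bar> * indicator A x \<partial>lborel)" by simp
qed

section \<open>The surface measure of a geodesic sphere\<close>

text \<open>With \<open>M\<close> the matrix of \<open>B\<close>, the Gram matrix \<open>G\<close>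
  changes by congruence to \<open>M^T G M\<close>.\<close>

lemma det_gram_compose:
  fixes L :: "real^'i \<Rightarrow> 'v::real_inner" and B :: "real^'i \<Rightarrow> real^'i"
  assumes L: "linear L" and B: "linear B"
  shows "det (\<chi> a b. L (B (axis a 1)) \<bullet> L (B (axis b 1))) =
    (det (matrix B))\<^sup>2 * det (\<chi> a b. L (axis a 1) \<bullet> L (axis b 1))"
proof -
  let ?M = "matrix B" and ?G = "\<chi> a b. L (axis a 1) \<bullet> L (axis b 1)"
  have LB: "L (B (axis a 1)) = (\<Sum>c\<in>UNIV. ?M $ c $ a *\<^sub>R L (axis c 1))" for a
  proof -
    have "B (axis a 1) = (\<Sum>c\<in>UNIV. ?M $ c $ a *\<^sub>R axis c 1)"
      using basis_expansion[of "B (axis a 1)"] by (simp add: matrix_def scalar_mult_eq_scaleR)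
    then show ?thesis by (simp add: linear_sum[OF L] linear_scale[OF L])
  qed
  have "(\<chi> a b. L (B (axis a 1)) \<bullet> L (B (axis b 1))) = transpose ?M ** (?G ** ?M)"
    unfolding LB matrix_matrix_mult_def transpose_def
    by (simp add: vec_eq_iff inner_sum_left inner_sum_right sum_distrib_left mult_ac, intro allI, subst sum.swap, simp add: mult_ac)
  then show ?thesis by (simp add: det_mul det_transpose power2_eq_square)
qed

text \<open>The determinant of \<open>1 + v v^T\<close>. A rotation moves \<open>v\<close> to a
  multiple of a coordinate axis, where the matrix is diagonal, and by
  \<open>det_gram_compose\<close> it leaves the determinant unchanged.\<close>

lemma det_rank_one_update:
  fixes v :: "real^'i"
  shows "det (\<chi> a b. axis a 1 \<bullet> (axis b 1 :: real^'i) + (v \<bullet> axis a 1) * (v \<bullet> axis b 1)) = 1 + v \<bullet> v"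
proof -
  obtain k :: 'i where True by blast
  obtain f :: "real^'i \<Rightarrow> real^'i" where f: "orthogonal_transformation f" "f (norm v *\<^sub>R axis k 1) = v"
    using orthogonal_transformation_exists[of "norm v *\<^sub>R axis k 1" v] by (auto simp: norm_axis_1)
  let ?L = "\<lambda>w. (w, v \<bullet> w)"
  have L: "linear ?L" by (rule linearI) (simp_all add: inner_add_right)
  have lf: "linear f" using f(1) by (simp add: orthogonal_transformation_linear)
  have ff: "f x \<bullet> f y = x \<bullet> y" for x y using f(1) by (simp add: orthogonal_transformation_def)
  have "det (\<chi> a b. ?L (f (axis a 1)) \<bullet> ?L (f (axis b 1))) =
      (det (matrix f))\<^sup>2 * det (\<chi> a b. ?L (axis a 1) \<bullet> ?L (axis b 1))"
    by (rule det_gram_compose[OF L lf])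
  moreover have "(det (matrix f))\<^sup>2 = 1"
    using orthogonal_transformation_det[OF f(1)] power2_abs[of "det (matrix f)"] by simp
  moreover have "(\<chi> a b. ?L (f (axis a 1)) \<bullet> ?L (f (axis b 1))) =
      (\<chi> a b. if a = b then (if a = k then 1 + v \<bullet> v else 1) else 0)"
  proof -
    have "v \<bullet> f (axis a 1) = (if a = k then norm v else 0)" for a
      using ff[of "norm v *\<^sub>R axis k 1" "axis a 1"] unfolding f(2) by (simp add: inner_axis_axis)
    then show ?thesis
      by (simp add: vec_eq_iff ff inner_axis_axis power2_norm_eq_inner[symmetric] power2_eq_square)
  qed
  moreover have "det (\<chi> a b. if a = b then (if a = k then 1 + v \<bullet> v else 1) else 0 :: real^'i^'i) = 1 + v \<bullet> v"
    by (subst det_diagonal) (auto simp: prod.If_cases)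
  ultimately have "det (\<chi> a b. ?L (axis a 1) \<bullet> ?L (axis b 1)) = 1 + v \<bullet> v" by simp
  then show ?thesis by simp
qed

text \<open>The volume of a hyperplane with normal vector \<open>N\<close> seen through its projection along the last coordinate.\<close>

lemma det_gram_hyperplane:
  fixes A :: "real^'i \<Rightarrow> real^'i" and s :: "real^'i \<Rightarrow> real"
  assumes A: "linear A" and N: "snd N \<noteq> 0" and orth: "\<And>e. N \<bullet> (A e, s e) = 0"
  shows "det (\<chi> a b. (A (axis a 1), s (axis a 1)) \<bullet> (A (axis b 1), s (axis b 1))) =
    (det (matrix A))\<^sup>2 * ((N \<bullet> N) / (snd N)\<^sup>2)"
proof -
  let ?v = "(- 1 / snd N) *\<^sub>R fst N"
  let ?L = "\<lambda>w. (w, ?v \<bullet> w)"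
  have L: "linear ?L" by (rule linearI) (auto simp: inner_add_right)
  have "s e = ?v \<bullet> A e" for e
    using orth[of e] N by (simp add: inner_prod_def field_simps)
  then have "det (\<chi> a b. (A (axis a 1), s (axis a 1)) \<bullet> (A (axis b 1), s (axis b 1))) =
      (det (matrix A))\<^sup>2 * det (\<chi> a b. ?L (axis a 1) \<bullet> ?L (axis b 1))"
    using det_gram_compose[OF L A] by simp
  also have "det (\<chi> a b. ?L (axis a 1) \<bullet> ?L (axis b 1)) = 1 + ?v \<bullet> ?v"
    unfolding det_rank_one_update[symmetric] by (simp add: inner_prod_def)
  also have "\<dots> = (N \<bullet> N) / (snd N)\<^sup>2"
    using N by (simp add: inner_prod_def power2_eq_square field_simps)
  finally show ?thesis .
qed

lemma continuous_on_det:
  fixes A :: "'a::topological_space \<Rightarrow> real^'i^'i"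
  assumes "\<And>i j. continuous_on S (\<lambda>x. A x $ i $ j)"
  shows "continuous_on S (\<lambda>x. det (A x))"
  unfolding det_def by (intro continuous_intros assms)

section \<open>Stereographic charts of a geodesic sphere\<close>

locale damek_ricci_sphere = damek_ricci I br for I :: "'i::finite set" and br +
  fixes r :: real
  assumes r_pos: "0 < r"
begin

text \<open>\<open>C\<close> is the value of \<open>cc\<close> on the sphere. In the coordinates
  that make it round, \<open>R\<close> is its radius and \<open>2 * C\<close> the height of its
  centre.\<close>

definition C :: real where "C = (cosh (r / 2))\<^sup>2"
definition R :: real where "R = sinh r"
definition \<Sigma> :: "((real^'i) \<times> real) set" where "\<Sigma> = {p. cc p = C}"

lemma C_gt_1: "1 < C" and C_pos: "0 < C" and R_pos: "0 < R" and R2: "R^2 = 4 * C * (C - 1)" and R_less: "R < 2 * C"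
proof -
  have "1 < cosh (r / 2)" using cosh_real_strict_mono[of 0 "r / 2"] r_pos by simp
  then show C1: "1 < C" unfolding C_def by (rule one_less_power) simp
  then show "0 < C" by simp
  show "0 < R" using r_pos by (simp add: R_def)
  have "R = 2 * sinh (r / 2) * cosh (r / 2)" using sinh_double[of "r / 2"] by (simp add: R_def)
  then show R2: "R^2 = 4 * C * (C - 1)"
    by (simp add: C_def power_mult_distrib cosh_square_eq)
  have "(2 * C)\<^sup>2 - R^2 = 4 * C" unfolding R2 by (simp add: power2_eq_square algebra_simps)
  then have "R^2 < (2 * C)\<^sup>2" using C1 by linarith
  then show "R < 2 * C" by (rule power2_less_imp_less) (use C1 in simp)
qed

lemma dr_sphere_eq: "dr_sphere I br r = \<Sigma>"
  unfolding dr_sphere_def \<Sigma>_def dr_dist_eq using dist0_eq_iff[of r] r_pos by (auto simp: C_def)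

lemma closed_\<Sigma>: "closed \<Sigma>"
  unfolding \<Sigma>_def by (intro closed_Collect_eq continuous_on_cc continuous_on_const)

text \<open>In the coordinates \<open>(\<surd>C X, Y, bb)\<close> the geodesic sphere is a round sphere.\<close>

lemma round_sphere: "(bb p - 2 * C)\<^sup>2 + C * (xc p \<bullet> xc p) + yc p \<bullet> yc p - R^2 = 4 * exp (snd p) * (cc p - C)"
proof -
  have "4 * exp (snd p) * (cc p - C) = (bb p)\<^sup>2 + yc p \<bullet> yc p - 4 * exp (snd p) * C"
    using cc_eq[of p] by (simp add: algebra_simps)
  moreover have "4 * exp (snd p) * C = 4 * C * bb p - 4 * C - C * (xc p \<bullet> xc p)"
    by (simp add: bb_def algebra_simps)
  ultimately show ?thesis unfolding R2 by (simp add: power2_eq_square algebra_simps)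
qed

lemma \<Sigma>_iff: "p \<in> \<Sigma> \<longleftrightarrow> (bb p - 2 * C)\<^sup>2 + C * (xc p \<bullet> xc p) + yc p \<bullet> yc p = R^2"
  using round_sphere[of p] by (auto simp: \<Sigma>_def)

text \<open>Inverse stereographic projection of the round sphere, from the pole above the centre for
  \<open>j = 1\<close> and from the one below for \<open>j = -1\<close>; \<open>1 / sqrt C\<close>
  undoes the scaling of \<open>X\<close>. \<open>st_b\<close> is the height \<open>bb\<close>, and
  \<open>st_a\<close> recovers \<open>exp z\<close> from it. Each chart omits only its pole.\<close>

definition st_x :: "real^'i \<Rightarrow> real^'i" where
  "st_x w = (2 * R * inverse (1 + w \<bullet> w)) *\<^sub>R ((1 / sqrt C) *\<^sub>R restr I w + restr (- I) w)"

definition st_b :: "real \<Rightarrow> real^'i \<Rightarrow> real" where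
  "st_b j w = 2 * C + R * (j * (1 - 2 * inverse (1 + w \<bullet> w)))"

definition st_a :: "real \<Rightarrow> real^'i \<Rightarrow> real" where
  "st_a j w = st_b j w - 1 - (restr I (st_x w) \<bullet> restr I (st_x w)) / 4"

definition st :: "real \<Rightarrow> real^'i \<Rightarrow> (real^'i) \<times> real" where
  "st j w = (st_x w, ln (st_a j w))"

definition pr :: "real \<Rightarrow> (real^'i) \<times> real \<Rightarrow> real^'i" where
  "pr j p = (inverse (R - j * (bb p - 2 * C))) *\<^sub>R (sqrt C *\<^sub>R xc p + yc p)"

definition pole :: "real \<Rightarrow> (real^'i) \<times> real" where
  "pole j = (0, ln (2 * C + j * R - 1))"

lemma st_round:
  assumes "j^2 = 1"
  shows "(st_b j w - 2 * C)\<^sup>2 + C * (restr I (st_x w) \<bullet> restr I (st_x w)) + restr (- I) (st_x w) \<bullet> restr (- I) (st_x w) = R^2"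
proof -
  define n where "n = w \<bullet> w"
  define d where "d = inverse (1 + n)"
  have n: "0 \<le> n" by (simp add: n_def)
  have x: "restr I (st_x w) = (2 * R * d * (1 / sqrt C)) *\<^sub>R restr I w" "restr (- I) (st_x w) = (2 * R * d) *\<^sub>R restr (- I) w"
    by (simp_all add: st_x_def restr_scaleR restr_add d_def n_def)
  have "C * (restr I (st_x w) \<bullet> restr I (st_x w)) + restr (- I) (st_x w) \<bullet> restr (- I) (st_x w) = (2 * R * d)\<^sup>2 * (restr I w \<bullet> restr I w + restr (- I) w \<bullet> restr (- I) w)"
    unfolding x using C_pos by (simp add: power2_eq_square field_simps)
  also have "\<dots> = (2 * R * d)\<^sup>2 * n" unfolding n_def using inner_restr_split[of w w I] by simp
  finally have xy: "C * (restr I (st_x w) \<bullet> restr I (st_x w)) + restr (- I) (st_x w) \<bullet> restr (- I) (st_x w) = (2 * R * d)\<^sup>2 * n" .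
  have "st_b j w - 2 * C = R * (j * (1 - 2 * d))" by (simp add: st_b_def d_def n_def)
  then have "(st_b j w - 2 * C)\<^sup>2 + C * (restr I (st_x w) \<bullet> restr I (st_x w)) + restr (- I) (st_x w) \<bullet> restr (- I) (st_x w) =
      (R * (j * (1 - 2 * d)))\<^sup>2 + (2 * R * d)\<^sup>2 * n"
    using xy by simp
  also have "\<dots> = R^2 * (j^2 * (1 - 2 * d)\<^sup>2 + 4 * d^2 * n)"
    by (simp add: power_mult_distrib distrib_left)
  also have "j^2 * (1 - 2 * d)\<^sup>2 + 4 * d^2 * n = 1 - 4 * d + 4 * d * (d * (1 + n))"
    unfolding assms by (simp add: power2_eq_square algebra_simps)
  also have "d * (1 + n) = 1" using n by (simp add: d_def)
  finally show ?thesis by simp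
qed

text \<open>The whole round sphere has to lie in the range of the coordinates. Its equation can be
  read as \<open>4 * C * a = b^2 + |Y|^2\<close>, and \<open>b > 0\<close> because
  \<open>R < 2 * C\<close>.\<close>

lemma st_a_pos: assumes "j^2 = 1" shows "0 < st_a j w"
proof -
  have "\<bar>st_b j w - 2 * C\<bar> \<le> R"
  proof (rule abs_le_square_iff[THEN iffD2, of _ R, simplified abs_of_pos[OF R_pos]])
    have "0 \<le> C * (restr I (st_x w) \<bullet> restr I (st_x w)) + restr (- I) (st_x w) \<bullet> restr (- I) (st_x w)"
      using C_pos by (intro add_nonneg_nonneg mult_nonneg_nonneg) auto
    then show "(st_b j w - 2 * C)\<^sup>2 \<le> R\<^sup>2" using st_round[OF assms, of w] by linarith
  qed
  then have "0 < st_b j w" using R_less by linarith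
  moreover have "4 * C * st_a j w = (st_b j w)\<^sup>2 + restr (- I) (st_x w) \<bullet> restr (- I) (st_x w)"
    using st_round[OF assms, of w] unfolding R2 st_a_def by (simp add: power2_eq_square algebra_simps)
  ultimately have "0 < 4 * C * st_a j w" by (simp add: add_pos_nonneg)
  then show ?thesis using C_pos by (simp add: zero_less_mult_iff)
qed

lemma bb_st: assumes "j^2 = 1" shows "bb (st j w) = st_b j w"
  using st_a_pos[OF assms, of w] by (simp add: bb_def st_def st_a_def)

lemma st_in_\<Sigma>: "j^2 = 1 \<Longrightarrow> st j w \<in> \<Sigma>"
  using st_round[of j w] bb_st[of j w] by (simp add: \<Sigma>_iff) (simp add: st_def)

lemma st_regular: assumes "j^2 = 1"
  shows "R - j * (bb (st j w) - 2 * C) = 2 * R * inverse (1 + w \<bullet> w)" "R - j * (bb (st j w) - 2 * C) \<noteq> 0"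
proof -
  have "j * (bb (st j w) - 2 * C) = j^2 * (R * (1 - 2 * inverse (1 + w \<bullet> w)))"
    unfolding bb_st[OF assms] st_b_def by (simp add: power2_eq_square algebra_simps)
  then show *: "R - j * (bb (st j w) - 2 * C) = 2 * R * inverse (1 + w \<bullet> w)"
    unfolding assms by (simp add: algebra_simps)
  have "1 + w \<bullet> w \<noteq> 0" using inner_ge_zero[of w] by linarith
  then show "R - j * (bb (st j w) - 2 * C) \<noteq> 0" unfolding * using R_pos by simp
qed

lemma pr_st: assumes "j^2 = 1" shows "pr j (st j w) = w"
proof -
  have nz: "1 + w \<bullet> w \<noteq> 0" using inner_ge_zero[of w] by linarith
  let ?c = "2 * R * inverse (1 + w \<bullet> w)"
  have "sqrt C *\<^sub>R xc (st j w) + yc (st j w) = ?c *\<^sub>R restr I w + ?c *\<^sub>R restr (- I) w"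
    using C_pos by (simp add: st_def st_x_def restr_scaleR restr_add scaleR_add_right)
  also have "\<dots> = ?c *\<^sub>R w" unfolding scaleR_add_right[symmetric] restr_sum ..
  finally have "sqrt C *\<^sub>R xc (st j w) + yc (st j w) = ?c *\<^sub>R w" .
  then have "pr j (st j w) = (inverse ?c * ?c) *\<^sub>R w" unfolding pr_def st_regular(1)[OF assms] by simp
  also have "inverse ?c * ?c = 1" by (rule left_inverse) (use R_pos nz in simp)
  finally show ?thesis by simp
qed

lemma st_pr:
  assumes e: "j^2 = 1" and p: "p \<in> \<Sigma>" and nz: "R - j * (bb p - 2 * C) \<noteq> 0"
  shows "st j (pr j p) = p"
proof -
  define t where "t = bb p - 2 * C"
  define d where "d = R - j * t"
  have d: "d \<noteq> 0" using nz by (simp add: d_def t_def)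
  let ?u = "sqrt C *\<^sub>R xc p + yc p"
  have u: "restr I ?u = sqrt C *\<^sub>R xc p" "restr (- I) ?u = yc p"
    by (simp_all add: restr_add restr_scaleR)
  have "?u \<bullet> ?u = C * (xc p \<bullet> xc p) + yc p \<bullet> yc p"
    unfolding inner_restr_split[of ?u ?u I] u using C_pos by (simp add: power2_eq_square)
  also have "\<dots> = R^2 - j^2 * t^2" using p e unfolding \<Sigma>_iff t_def by simp
  finally have uu: "?u \<bullet> ?u = d * (R + j * t)" by (simp add: d_def power2_eq_square algebra_simps)
  have pp: "pr j p = inverse d *\<^sub>R ?u" by (simp add: pr_def d_def t_def)
  have "1 + pr j p \<bullet> pr j p = 1 + (R + j * t) / d"
    unfolding pp inner_scaleR_left inner_scaleR_right uu using d by (simp add: field_simps)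
  also have "\<dots> = 2 * R / d" using d by (simp add: field_simps) (simp add: d_def)
  finally have n: "inverse (1 + pr j p \<bullet> pr j p) = d / (2 * R)" by simp
  have x: "st_x (pr j p) = fst p"
  proof -
    have "st_x (pr j p) = d *\<^sub>R ((1 / sqrt C) *\<^sub>R restr I (pr j p) + restr (- I) (pr j p))"
      unfolding st_x_def n using R_pos by simp
    also have "\<dots> = xc p + yc p"
      unfolding pp restr_scaleR u using d C_pos by (simp add: scaleR_add_right)
    finally show ?thesis by simp
  qed
  have "st_b j (pr j p) = 2 * C + j * (R - d)"
    unfolding st_b_def n using R_pos by (simp add: field_simps)
  also have "\<dots> = 2 * C + j^2 * t" by (simp add: d_def power2_eq_square)
  finally have "st_b j (pr j p) = bb p" using e by (simp add: t_def)
  then have "st_a j (pr j p) = exp (snd p)" unfolding st_a_def x by (simp add: bb_def)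
  then show ?thesis unfolding st_def x by (simp add: prod_eq_iff)
qed

lemma R_less': "R < 2 * C - 1"
proof -
  have "(2 * C - 1)\<^sup>2 - R^2 = 1" unfolding R2 by (simp add: power2_eq_square algebra_simps)
  then have "R^2 < (2 * C - 1)\<^sup>2" by linarith
  then show ?thesis by (rule power2_less_imp_less) (use C_gt_1 in simp)
qed

lemma bb_pole: assumes "j^2 = 1" shows "bb (pole j) = 2 * C + j * R"
proof -
  have "j = 1 \<or> j = - 1" using assms by (simp add: power2_eq_1_iff)
  then have "0 < 2 * C + j * R - 1" using R_less' R_pos C_gt_1 by auto
  then show ?thesis by (simp add: bb_def pole_def)
qed

text \<open>A vanishing denominator of the projection means \<open>bb p = 2 * C + j * R\<close>, the
  extreme height, which forces \<open>X = Y = 0\<close>.\<close>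

lemma regular_iff:
  assumes e: "j^2 = 1" and p: "p \<in> \<Sigma>"
  shows "R - j * (bb p - 2 * C) = 0 \<longleftrightarrow> p = pole j"
proof
  have e': "j = 1 \<or> j = - 1" using e by (simp add: power2_eq_1_iff)
  assume "R - j * (bb p - 2 * C) = 0"
  then have t: "bb p - 2 * C = j * R" using e' by auto
  have "C * (xc p \<bullet> xc p) + yc p \<bullet> yc p = 0"
    using p unfolding \<Sigma>_iff t by (simp add: power_mult_distrib e)
  moreover have "0 \<le> C * (xc p \<bullet> xc p)" "0 \<le> yc p \<bullet> yc p" using C_pos by simp_all
  ultimately have "C * (xc p \<bullet> xc p) = 0" "yc p \<bullet> yc p = 0" by linarith+
  then have xy: "xc p = 0" "yc p = 0" using C_pos by simp_all
  then have "fst p = 0" using restr_sum[of I "fst p"] by simp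
  moreover have "exp (snd p) = 2 * C + j * R - 1" using t xy by (simp add: bb_def)
  then have "snd p = ln (2 * C + j * R - 1)" using ln_exp[of "snd p"] by simp
  ultimately show "p = pole j" by (simp add: pole_def prod_eq_iff)
next
  assume p: "p = pole j"
  have "j * (bb p - 2 * C) = j^2 * R" unfolding p bb_pole[OF e] by (simp add: power2_eq_square)
  then show "R - j * (bb p - 2 * C) = 0" using e by simp
qed

lemma range_st: assumes "j^2 = 1" shows "range (st j) = \<Sigma> - {pole j}"
proof
  show "range (st j) \<subseteq> \<Sigma> - {pole j}"
  proof
    fix p assume "p \<in> range (st j)"
    then obtain w where w: "p = st j w" by blast
    have "p \<noteq> pole j"
      using regular_iff[OF assms st_in_\<Sigma>[OF assms, of w]] st_regular(2)[OF assms, of w] unfolding w by blast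
    then show "p \<in> \<Sigma> - {pole j}" using st_in_\<Sigma>[OF assms, of w] w by blast
  qed
  show "\<Sigma> - {pole j} \<subseteq> range (st j)"
  proof
    fix p assume "p \<in> \<Sigma> - {pole j}"
    then have "st j (pr j p) = p" using st_pr[OF assms] regular_iff[OF assms] by blast
    then show "p \<in> range (st j)" by (metis rangeI)
  qed
qed

lemma smooth_on_inner:
  fixes f g :: "'a::real_normed_vector \<Rightarrow> 'b::real_inner"
  shows "open U \<Longrightarrow> smooth_on U f \<Longrightarrow> smooth_on U g \<Longrightarrow> smooth_on U (\<lambda>x. f x \<bullet> g x)"
  by (rule smooth_on_bilinear[OF _ bounded_bilinear_inner])

lemma smooth_on_restr: "open U \<Longrightarrow> smooth_on U f \<Longrightarrow> smooth_on U (\<lambda>x. restr K (f x))"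
  by (rule smooth_on_linear_comp[OF _ bounded_linear_restr])

lemma st_smooth: assumes e: "j^2 = 1" shows "smooth_on UNIV (st j)"
proof -
  have i: "smooth_on UNIV (\<lambda>w :: real^'i. w)" by (intro smooth_on_bounded_linear bounded_linear_ident) auto
  have n: "smooth_on UNIV (\<lambda>w :: real^'i. inverse (1 + w \<bullet> w))"
    by (intro smooth_on_compose_real[OF _ _ smooth_on_inverse] smooth_on_add smooth_on_const smooth_on_inner i)
      (auto simp: add_pos_nonneg)
  have x: "smooth_on UNIV st_x"
    unfolding st_x_def[abs_def]
    by (intro smooth_on_scaleR smooth_on_add smooth_on_mult smooth_on_const smooth_on_restr n i open_UNIV)
  have a: "smooth_on UNIV (st_a j)"
  proof -
    have "smooth_on UNIV (\<lambda>w. st_b j w - 1 - (1 / 4) * (restr I (st_x w) \<bullet> restr I (st_x w)))"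
      unfolding st_b_def[abs_def]
      by (intro smooth_on_diff smooth_on_add smooth_on_mult smooth_on_const smooth_on_inner smooth_on_restr n x open_UNIV)
    then show ?thesis by (simp add: st_a_def[abs_def])
  qed
  show ?thesis
    unfolding st_def[abs_def]
    by (intro smooth_on_Pair x smooth_on_compose_real[OF _ _ smooth_on_ln a]) (use st_a_pos[OF e] in auto)
qed

text \<open>An open set of the ambient space, so that \<open>pr j\<close> is smooth around the
  sphere minus its pole and not merely on it, and the chain rule applies to it.\<close>

definition regular :: "real \<Rightarrow> ((real^'i) \<times> real) set" where
  "regular j = {p. R - j * (bb p - 2 * C) \<noteq> 0}"

lemma bb_smooth: "open U \<Longrightarrow> smooth_on U bb"
proof -
  assume U: "open U"
  have f: "smooth_on U (fst :: (real^'i) \<times> real \<Rightarrow> _)" "smooth_on U (snd :: (real^'i) \<times> real \<Rightarrow> _)"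
    by (intro smooth_on_bounded_linear bounded_linear_fst bounded_linear_snd U)+
  have "smooth_on U (\<lambda>p. 1 + exp (snd p) + (1 / 4) * (xc p \<bullet> xc p))"
    by (intro smooth_on_add smooth_on_mult smooth_on_const smooth_on_inner smooth_on_restr f U
        smooth_on_compose_real[OF _ open_UNIV smooth_on_exp]) auto
  then show ?thesis by (simp add: bb_def[abs_def])
qed

lemma open_regular: "open (regular j)"
proof -
  have "continuous_on UNIV (\<lambda>p. R - j * (bb p - 2 * C))"
    by (intro continuous_intros smooth_on_continuous_on bb_smooth) auto
  then show ?thesis
    unfolding regular_def using open_Collect_neq[of "\<lambda>p. R - j * (bb p - 2 * C)" "\<lambda>_. 0"] by simp
qed

lemma smooth_on_inverse_neq: "smooth_on (- {0}) (inverse :: real \<Rightarrow> real)"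
proof -
  have "smooth_on {..<0} (\<lambda>x :: real. - inverse (- x))"
    by (intro smooth_on_minus smooth_on_compose_real[OF _ _ smooth_on_inverse] smooth_on_bounded_linear bounded_linear_ident) auto
  then have "smooth_on {..<0} (inverse :: real \<Rightarrow> real)" by simp
  then show ?thesis
    using smooth_on_inverse unfolding smooth_on_def by (metis Compl_iff greaterThan_iff insertI1 lessThan_iff linorder_neqE)
qed

lemma pr_smooth: "smooth_on (regular j) (pr j)"
proof -
  note U = open_regular[of j]
  have f: "smooth_on (regular j) (fst :: (real^'i) \<times> real \<Rightarrow> _)"
    by (intro smooth_on_bounded_linear bounded_linear_fst U)
  have "smooth_on (regular j) (\<lambda>p. inverse (R - j * (bb p - 2 * C)))"
    by (intro smooth_on_compose_real[OF U _ smooth_on_inverse_neq] smooth_on_diff smooth_on_mult smooth_on_const bb_smooth U)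
      (auto simp: regular_def)
  then show ?thesis
    unfolding pr_def[abs_def] by (intro smooth_on_scaleR smooth_on_add smooth_on_const smooth_on_restr f U)
qed

lemma \<Sigma>_regular: "j^2 = 1 \<Longrightarrow> p \<in> \<Sigma> \<Longrightarrow> p \<noteq> pole j \<Longrightarrow> p \<in> regular j"
  using regular_iff[of j p] by (auto simp: regular_def)

lemma st_local_param: assumes e: "j^2 = 1" shows "local_param \<Sigma> UNIV (st j)"
  unfolding local_param_def
proof (intro conjI ballI exI)
  show "st j ` UNIV \<subseteq> \<Sigma>" using st_in_\<Sigma>[OF e] by auto
  have "openin (top_of_set \<Sigma>) (\<Sigma> - {pole j})"
    by (auto simp: openin_open intro!: exI[of _ "- {pole j}"])
  then show "openin (top_of_set \<Sigma>) (st j ` UNIV)" unfolding range_st[OF e] .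
  show "smooth_on UNIV (st j)" by (rule st_smooth[OF e])
  show "homeomorphism UNIV (st j ` UNIV) (st j) (pr j)"
  proof (rule homeomorphismI)
    show "continuous_on UNIV (st j)" by (rule smooth_on_continuous_on[OF st_smooth[OF e]])
    have "range (st j) \<subseteq> regular j" unfolding range_st[OF e] using \<Sigma>_regular[OF e] by blast
    then show "continuous_on (range (st j)) (pr j)"
      using continuous_on_subset[OF smooth_on_continuous_on[OF pr_smooth]] by blast
  qed (use pr_st[OF e] in auto)
  \<comment> \<open>Differentiating \<open>pr j \<circ> st j = id\<close> gives a left inverse of
    the derivative.\<close>
  show "inj (frechet_derivative (st j) (at w))" for w
  proof -
    have 1: "(st j has_derivative frechet_derivative (st j) (at w)) (at w)"
      by (rule smooth_on_has_derivative[OF st_smooth[OF e]]) simp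
    have "st j w \<in> regular j" using st_regular(2)[OF e] by (simp add: regular_def)
    then have 2: "(pr j has_derivative frechet_derivative (pr j) (at (st j w))) (at (st j w))"
      by (rule smooth_on_has_derivative[OF pr_smooth])
    have "pr j \<circ> st j = id" using pr_st[OF e] by (auto simp: fun_eq_iff)
    with diff_chain_at[OF 1 2] have "frechet_derivative (pr j) (at (st j w)) \<circ> frechet_derivative (st j) (at w) = id"
      using has_derivative_unique[OF _ has_derivative_id] by (metis id_def)
    then show ?thesis by (metis inj_on_id inj_on_imageI2)
  qed
qed auto

section \<open>Densities in charts, existence and uniqueness of the surface measure\<close>

abbreviation metric where "metric \<equiv> dr_metric I br"

definition dens :: "(real^'i \<Rightarrow> (real^'i) \<times> real) \<Rightarrow> real^'i \<Rightarrow> real" where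
  "dens \<phi> u = sqrt (det (gram_matrix metric \<phi> u))"

lemma gram_matrix_frame: "gram_matrix metric \<phi> u =
    (\<chi> a b. frame (\<phi> u) (frechet_derivative \<phi> (at u) (axis a 1)) \<bullet> frame (\<phi> u) (frechet_derivative \<phi> (at u) (axis b 1)))"
  by (simp add: gram_matrix_def dr_metric_frame)

lemma dens_continuous:
  assumes "continuous_on U \<phi>" "\<And>v. continuous_on U (\<lambda>u. frechet_derivative \<phi> (at u) v)"
  shows "continuous_on U (dens \<phi>)"
  unfolding dens_def[abs_def] gram_matrix_frame
  by (intro continuous_on_real_sqrt continuous_on_det) (simp add: continuous_on_inner continuous_on_frame assms)

text \<open>A parametrization \<open>\<phi>\<close> that stays off the pole factors as
  \<open>st 1\<close> after \<open>pr 1 \<circ> \<phi>\<close>, a map between spaces of equal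
  dimension whose Jacobian relates the two densities. This lets a single chart determine the measure
  in all others.\<close>

lemma dens_chain:
  assumes \<phi>: "\<phi> differentiable (at u)" and pr: "pr 1 differentiable (at (\<phi> u))"
    and eq: "open U" "u \<in> U" "\<And>x. x \<in> U \<Longrightarrow> \<phi> x = st 1 (pr 1 (\<phi> x))"
  defines "B \<equiv> \<lambda>v. frechet_derivative (pr 1) (at (\<phi> u)) (frechet_derivative \<phi> (at u) v)"
  shows "((\<lambda>x. pr 1 (\<phi> x)) has_derivative B) (at u)"
    and "dens \<phi> u = \<bar>det (matrix B)\<bar> * dens (st 1) (pr 1 (\<phi> u))"
proof -
  show dB: "((\<lambda>x. pr 1 (\<phi> x)) has_derivative B) (at u)"
    using diff_chain_at[of \<phi> _ u "pr 1"] assms(1,2) unfolding B_def frechet_derivative_works by (simp add: o_def)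
  let ?D = "frechet_derivative (st 1) (at (pr 1 (\<phi> u)))"
  have dst: "(st 1 has_derivative ?D) (at (pr 1 (\<phi> u)))"
    by (rule smooth_on_has_derivative[OF st_smooth]) auto
  have "((\<lambda>x. st 1 (pr 1 (\<phi> x))) has_derivative (\<lambda>v. ?D (B v))) (at u)"
    using diff_chain_at[OF dB dst] by (simp add: o_def)
  then have "(\<phi> has_derivative (\<lambda>v. ?D (B v))) (at u)"
    by (rule has_derivative_transform_within_open[OF _ eq(1,2)]) (use eq(3) in auto)
  then have fd: "frechet_derivative \<phi> (at u) = (\<lambda>v. ?D (B v))" by (rule frechet_derivative_at[symmetric])
  have "det (gram_matrix metric \<phi> u) = (det (matrix B))\<^sup>2 * det (gram_matrix metric (st 1) (pr 1 (\<phi> u)))"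
    unfolding gram_matrix_frame fd eq(3)[OF eq(2), symmetric]
    using dst dB
    by (intro det_gram_compose[where L = "\<lambda>v. frame (\<phi> u) (?D v)"] linear_compose[of ?D "frame (\<phi> u)", unfolded o_def] linear_frame has_derivative_linear)
  then show "dens \<phi> u = \<bar>det (matrix B)\<bar> * dens (st 1) (pr 1 (\<phi> u))"
    by (simp add: dens_def real_sqrt_mult)
qed

text \<open>One chart is enough for the definition, since it misses a single point, to which no mass
  is assigned.\<close>

definition sphere_measure :: "((real^'i) \<times> real) measure" where
  "sphere_measure = distr (density lborel (\<lambda>w. ennreal (dens (st 1) w))) borel (st 1)"

lemma st_measurable: "st 1 \<in> borel_measurable borel"
  by (rule borel_measurable_continuous_onI[OF smooth_on_continuous_on[OF st_smooth]]) simp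

lemma dens_st_measurable: "dens (st 1) \<in> borel_measurable borel"
  by (intro borel_measurable_continuous_onI dens_continuous smooth_on_continuous_on smooth_on_frechet st_smooth) auto

lemma nn_integral_sphere_measure:
  assumes "F \<in> borel_measurable borel"
  shows "(\<integral>\<^sup>+ p. F p \<partial>sphere_measure) = (\<integral>\<^sup>+ w. ennreal (dens (st 1) w) * F (st 1 w) \<partial>lborel)"
  unfolding sphere_measure_def using assms st_measurable dens_st_measurable
  by (simp add: nn_integral_distr nn_integral_density)

text \<open>Change of variables along \<open>pr 1 \<circ> \<phi>\<close>.\<close>

lemma sphere_measure_transfer:
  fixes \<phi> :: "real^'i \<Rightarrow> (real^'i) \<times> real"
  assumes U: "open U" and d: "\<And>u. u \<in> U \<Longrightarrow> \<phi> differentiable (at u)"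
    and c: "\<And>v. continuous_on U (\<lambda>u. frechet_derivative \<phi> (at u) v)"
    and img: "\<phi> ` U \<subseteq> \<Sigma> - {pole 1}" and inj: "inj_on \<phi> U"
    and A: "A \<in> sets borel" "A \<subseteq> U" "\<phi> ` A \<in> sets borel" and F: "F \<in> borel_measurable borel"
  shows "(\<integral>\<^sup>+ p. F p * indicator (\<phi> ` A) p \<partial>sphere_measure) = (\<integral>\<^sup>+ u. F (\<phi> u) * ennreal (dens \<phi> u) * indicator A u \<partial>lborel)"
proof -
  let ?g = "\<lambda>u. pr 1 (\<phi> u)"
  let ?B = "\<lambda>u v. frechet_derivative (pr 1) (at (\<phi> u)) (frechet_derivative \<phi> (at u) v)"
  have reg: "\<phi> u \<in> regular 1" if "u \<in> U" for u
  proof -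
    have "\<phi> u \<in> \<Sigma>" "\<phi> u \<noteq> pole 1" using img that by blast+
    then show ?thesis by (intro \<Sigma>_regular) simp_all
  qed
  have prd: "pr 1 differentiable (at (\<phi> u))" if "u \<in> U" for u
    using smooth_on_imp_differentiable[OF pr_smooth reg[OF that]] .
  have stg: "\<phi> u = st 1 (?g u)" if "u \<in> U" for u
    using st_pr[of 1 "\<phi> u"] reg[OF that] img that by (auto simp: regular_def)
  note dg = dens_chain[OF d prd U _ stg]
  have \<phi>c: "continuous_on U \<phi>" using d by (meson continuous_at_imp_continuous_on differentiable_imp_continuous_within)
  have gA: "?g ` A = st 1 -` (\<phi> ` A)"
  proof
    show "?g ` A \<subseteq> st 1 -` (\<phi> ` A)" using stg A(2) by auto
    show "st 1 -` (\<phi> ` A) \<subseteq> ?g ` A"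
    proof
      fix w assume "w \<in> st 1 -` (\<phi> ` A)"
      then obtain u where "u \<in> A" "st 1 w = \<phi> u" by auto
      then show "w \<in> ?g ` A" using pr_st[of 1 w] by (metis image_eqI one_power2)
    qed
  qed
  have gAb: "?g ` A \<in> sets borel"
    unfolding gA using measurable_sets[OF st_measurable A(3)] by simp
  have Bc: "continuous_on U (\<lambda>u. det (matrix (?B u)))"
  proof (rule continuous_on_det)
    fix i j
    have "continuous_on U (\<lambda>u. frechet_derivative (pr 1) (at (\<phi> u)) b)" for b
      by (rule continuous_on_compose2[OF smooth_on_continuous_on[OF smooth_on_frechet[OF pr_smooth]] \<phi>c]) (use reg in auto)
    \<comment> \<open>Continuity in \<open>u\<close> is available for fixed directions only, so the
      moving direction is expanded in the basis.\<close>
    then have "continuous_on U (\<lambda>u. \<Sum>b\<in>Basis. (frechet_derivative \<phi> (at u) (axis j 1) \<bullet> b) *\<^sub>R frechet_derivative (pr 1) (at (\<phi> u)) b)"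
      by (intro continuous_intros c)
    moreover have "(\<Sum>b\<in>Basis. (frechet_derivative \<phi> (at u) (axis j 1) \<bullet> b) *\<^sub>R frechet_derivative (pr 1) (at (\<phi> u)) b) = ?B u (axis j 1)" if "u \<in> U" for u
    proof -
      have l: "linear (frechet_derivative (pr 1) (at (\<phi> u)))" by (rule linear_frechet_derivative[OF prd[OF that]])
      show ?thesis
        by (subst (2) euclidean_representation[of "frechet_derivative \<phi> (at u) (axis j 1)", symmetric])
          (simp only: linear_sum[OF l] linear_scale[OF l])
    qed
    ultimately have "continuous_on U (\<lambda>u. ?B u (axis j 1))" by (metis (no_types, lifting) continuous_on_cong)
    then show "continuous_on U (\<lambda>u. matrix (?B u) $ i $ j)"
      unfolding matrix_def by (simp add: continuous_on_component)
  qed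
  have "(\<integral>\<^sup>+ p. F p * indicator (\<phi> ` A) p \<partial>sphere_measure) = (\<integral>\<^sup>+ w. ennreal (dens (st 1) w) * (F (st 1 w) * indicator (\<phi> ` A) (st 1 w)) \<partial>lborel)"
    by (rule nn_integral_sphere_measure) (use F A(3) in measurable)
  also have "\<dots> = (\<integral>\<^sup>+ w. (ennreal (dens (st 1) w) * F (st 1 w)) * indicator (?g ` A) w \<partial>lborel)"
    unfolding gA by (simp add: indicator_def mult_ac)
  also have "\<dots> = (\<integral>\<^sup>+ u. ennreal \<bar>det (matrix (?B u))\<bar> * (ennreal (dens (st 1) (?g u)) * F (st 1 (?g u))) * indicator A u \<partial>lborel)"
  proof (rule nn_integral_change_of_variables[OF A(1) gAb])
    show "(?g has_derivative ?B u) (at u within A)" if "u \<in> A" for u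
      using dg(1)[of u] A(2) that by (meson has_derivative_at_withinI subsetD)
    show "inj_on ?g A" using inj stg A(2) by (auto simp: inj_on_def) (metis subsetD)
    have "continuous_on A (\<lambda>u. \<bar>det (matrix (?B u))\<bar>)"
      by (intro continuous_intros continuous_on_subset[OF Bc A(2)])
    then have "(\<lambda>u. \<bar>det (matrix (?B u))\<bar> * indicator A u) \<in> borel_measurable borel"
      using borel_measurable_continuous_on_indicator[OF A(1), of "\<lambda>u. \<bar>det (matrix (?B u))\<bar>"] by (simp add: mult.commute)
    then have "(\<lambda>u. ennreal (\<bar>det (matrix (?B u))\<bar> * indicator A u)) \<in> borel_measurable borel" by measurable
    moreover have "ennreal (\<bar>det (matrix (?B u))\<bar> * indicator A u) = ennreal \<bar>det (matrix (?B u))\<bar> * indicator A u" for u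
      by (simp add: indicator_def)
    ultimately show "(\<lambda>u. ennreal \<bar>det (matrix (?B u))\<bar> * indicator A u) \<in> borel_measurable borel" by simp
    show "(\<lambda>w. ennreal (dens (st 1) w) * F (st 1 w)) \<in> borel_measurable borel"
      using dens_st_measurable st_measurable F by measurable
  qed
  also have "\<dots> = (\<integral>\<^sup>+ u. F (\<phi> u) * ennreal (dens \<phi> u) * indicator A u \<partial>lborel)"
  proof (rule nn_integral_cong)
    fix u :: "real^'i"
    have "ennreal (dens \<phi> u) = ennreal \<bar>det (matrix (?B u))\<bar> * ennreal (dens (st 1) (?g u))" if "u \<in> A"
      using dg(2)[of u] A(2) that by (subst ennreal_mult'[symmetric]) auto
    then show "ennreal \<bar>det (matrix (?B u))\<bar> * (ennreal (dens (st 1) (?g u)) * F (st 1 (?g u))) * indicator A u =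
        F (\<phi> u) * ennreal (dens \<phi> u) * indicator A u"
      using stg[of u] A(2) by (auto simp: indicator_def mult_ac)
  qed
  finally show ?thesis .
qed

lemma local_param_image_borel:
  assumes "local_param \<Sigma> U \<phi>" "A \<in> sets borel" "A \<subseteq> U"
  shows "\<phi> ` A \<in> sets borel"
proof -
  obtain \<psi> where h: "homeomorphism U (\<phi> ` U) \<phi> \<psi>" and o: "openin (top_of_set \<Sigma>) (\<phi> ` U)"
    using assms(1) unfolding local_param_def by blast
  obtain V where V: "open V" "\<phi> ` U = \<Sigma> \<inter> V" using o unfolding openin_open by blast
  have b: "\<phi> ` U \<in> sets borel" unfolding V(2) using closed_\<Sigma> V(1) by auto
  have "continuous_on (\<phi> ` U) \<psi>" using h by (simp add: homeomorphism_def)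
  then have m: "(\<lambda>p. if p \<in> \<phi> ` U then \<psi> p else 0) \<in> borel_measurable borel"
    by (intro borel_measurable_continuous_on_if b continuous_on_const)
  have "\<phi> ` A = \<phi> ` U \<inter> (\<lambda>p. if p \<in> \<phi> ` U then \<psi> p else 0) -` A"
  proof -
    have "\<psi> (\<phi> u) = u" if "u \<in> U" for u using h that by (simp add: homeomorphism_def)
    then show ?thesis using assms(3) by (auto simp: image_iff) (metis subsetD)+
  qed
  then show ?thesis using b measurable_sets[OF m assms(2)] by simp
qed

text \<open>An injective chart passes through the pole at most once. Removing this parameter value
  leaves an open set, to which the transfer formula applies, and changes neither side, a point being
  null.\<close>

lemma is_surface_measure_sphere_measure: "is_surface_measure metric \<Sigma> sphere_measure"
  unfolding is_surface_measure_def
proof (intro conjI allI impI)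
  show "sets sphere_measure = sets borel" by (simp add: sphere_measure_def)
  have "st 1 -` (- \<Sigma>) = {}"
  proof (rule equals0I)
    show False if "w \<in> st 1 -` (- \<Sigma>)" for w using that st_in_\<Sigma>[of 1 w] by simp
  qed
  then show "emeasure sphere_measure (- \<Sigma>) = 0"
    unfolding sphere_measure_def using st_measurable closed_\<Sigma> by (subst emeasure_distr) auto
  fix U and \<phi> :: "real^'i \<Rightarrow> (real^'i) \<times> real" and A
  assume "local_param \<Sigma> U \<phi> \<and> A \<in> sets borel \<and> A \<subseteq> U"
  then have lp: "local_param \<Sigma> U \<phi>" and A: "A \<in> sets borel" "A \<subseteq> U" by auto
  have U: "open U" and img: "\<phi> ` U \<subseteq> \<Sigma>" and sm: "smooth_on U \<phi>" and inj: "inj_on \<phi> U"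
    using lp unfolding local_param_def homeomorphism_def by (auto intro: inj_on_inverseI)
  define U' where "U' = U - \<phi> -` {pole 1}"
  have "\<exists>u0. U \<inter> \<phi> -` {pole 1} \<subseteq> {u0}"
  proof (cases "U \<inter> \<phi> -` {pole 1} = {}")
    case False
    then obtain u0 where "u0 \<in> U" "\<phi> u0 = pole 1" by blast
    have "u = u0" if "u \<in> U" "\<phi> u = pole 1" for u
      by (rule inj_onD[OF inj _ that(1) \<open>u0 \<in> U\<close>]) (simp only: that \<open>\<phi> u0 = pole 1\<close>)
    then show ?thesis by blast
  qed blast
  then obtain u0 where u0: "U \<inter> \<phi> -` {pole 1} \<subseteq> {u0}" by blast
  have U'o: "open U'"
  proof -
    have "U' = U - (U \<inter> \<phi> -` {pole 1})" unfolding U'_def by blast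
    moreover have "finite (U \<inter> \<phi> -` {pole 1})" using u0 by (rule finite_subset) simp
    ultimately show ?thesis using U by (simp add: open_Diff finite_imp_closed)
  qed
  have U'U: "U' \<subseteq> U" unfolding U'_def by blast
  let ?A' = "A \<inter> U'"
  have A': "?A' \<in> sets borel" "?A' \<subseteq> U" using A U'o by auto
  have \<phi>A: "\<phi> ` A \<in> sets borel" "\<phi> ` ?A' \<in> sets borel"
    by (rule local_param_image_borel[OF lp A], rule local_param_image_borel[OF lp A'])
  have "emeasure sphere_measure (\<phi> ` A) = (\<integral>\<^sup>+ p. indicator (\<phi> ` A) p \<partial>sphere_measure)"
    using \<phi>A(1) by (simp add: sphere_measure_def)
  also have "\<dots> = (\<integral>\<^sup>+ p. 1 * indicator (\<phi> ` ?A') p \<partial>sphere_measure)"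
  proof -
    have "indicator (\<phi> ` A) (st 1 w) = (1 * indicator (\<phi> ` ?A') (st 1 w) :: ennreal)" for w
    proof -
      have "st 1 w \<in> range (st 1)" by (rule rangeI)
      then have "st 1 w \<noteq> pole 1" using range_st[of 1, simplified] by blast
      have "st 1 w \<in> \<phi> ` ?A'" if w: "st 1 w \<in> \<phi> ` A"
      proof -
        obtain u where u: "u \<in> A" "st 1 w = \<phi> u" using w by (rule imageE)
        then have "u \<in> U'" using A(2) \<open>st 1 w \<noteq> pole 1\<close> unfolding U'_def by auto
        then show ?thesis unfolding u(2) using u(1) by (intro imageI IntI)
      qed
      then have "st 1 w \<in> \<phi> ` A \<longleftrightarrow> st 1 w \<in> \<phi> ` ?A'"
        using image_mono[of ?A' A \<phi>] by blast
      then show ?thesis by (simp add: indicator_def)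
    qed
    then show ?thesis using \<phi>A by (simp add: nn_integral_sphere_measure)
  qed
  also have "\<dots> = (\<integral>\<^sup>+ u. 1 * ennreal (dens \<phi> u) * indicator ?A' u \<partial>lborel)"
  proof (rule sphere_measure_transfer[OF U'o])
    show "\<phi> differentiable at u" if "u \<in> U'" for u using smooth_on_imp_differentiable[OF sm] that U'U by blast
    show "continuous_on U' (\<lambda>u. frechet_derivative \<phi> (at u) v)" for v
      by (rule continuous_on_subset[OF smooth_on_continuous_on[OF smooth_on_frechet[OF sm]] U'U])
    show "\<phi> ` U' \<subseteq> \<Sigma> - {pole 1}"
    proof (rule image_subsetI)
      fix u assume u: "u \<in> U'"
      then have "u \<in> U" "\<phi> u \<noteq> pole 1" unfolding U'_def by simp_all
      then show "\<phi> u \<in> \<Sigma> - {pole 1}" using subsetD[OF img imageI, of u] by simp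
    qed
    show "inj_on \<phi> U'" using inj U'U by (rule inj_on_subset)
  qed (rule A'(1) Int_lower2 \<phi>A(2) borel_measurable_const)+
  also have "\<dots> = (\<integral>\<^sup>+ u. ennreal (dens \<phi> u) * indicator A u \<partial>lborel)"
  proof (rule nn_integral_cong_AE)
    have "AE u in lborel. u \<noteq> u0" by (rule AE_lborel_singleton)
    then show "AE u in lborel. 1 * ennreal (dens \<phi> u) * indicator ?A' u = ennreal (dens \<phi> u) * indicator A u"
    proof eventually_elim
      case (elim u)
      then have "u \<in> U'" if "u \<in> A" using u0 subsetD[OF A(2) that] unfolding U'_def by auto
      then show ?case by (simp add: indicator_def)
    qed
  qed
  finally show "emeasure sphere_measure (\<phi> ` A) = (\<integral>\<^sup>+ u\<in>A. ennreal (sqrt (det (gram_matrix metric \<phi> u))) \<partial>lborel)"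
    by (simp add: dens_def)
qed

text \<open>Off the pole the chart \<open>st 1\<close> prescribes the measure. The pole itself is
  covered by the opposite chart \<open>st (- 1)\<close>, where it is a single parameter value and
  therefore null.\<close>

lemma is_surface_measure_unique:
  assumes \<mu>: "is_surface_measure metric \<Sigma> \<mu>"
  shows "\<mu> = sphere_measure"
proof (rule measure_eqI)
  have sets: "sets \<mu> = sets borel" and null: "emeasure \<mu> (- \<Sigma>) = 0"
    and par: "\<And>U (\<phi> :: real^'i \<Rightarrow> _) A. local_param \<Sigma> U \<phi> \<Longrightarrow> A \<in> sets borel \<Longrightarrow> A \<subseteq> U \<Longrightarrow>
      emeasure \<mu> (\<phi> ` A) = (\<integral>\<^sup>+ u\<in>A. ennreal (sqrt (det (gram_matrix metric \<phi> u))) \<partial>lborel)"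
    using \<mu>[unfolded is_surface_measure_def] by simp_all
  show "sets \<mu> = sets sphere_measure" by (simp add: sets sphere_measure_def)
  have pole: "pole 1 \<in> range (st (- 1))"
  proof -
    have "pole 1 \<in> \<Sigma>" unfolding \<Sigma>_iff bb_pole[of 1, simplified] by (simp add: pole_def)
    moreover have "pole 1 \<noteq> pole (- 1)"
      using bb_pole[of 1] bb_pole[of "- 1"] R_pos by force
    moreover have "range (st (- 1)) = \<Sigma> - {pole (- 1)}" by (rule range_st) simp
    ultimately show ?thesis by blast
  qed
  have single: "emeasure \<mu> {pole 1} = 0"
  proof -
    obtain w where w: "pole 1 = st (- 1) w" using pole by blast
    have "emeasure \<mu> (st (- 1) ` {w}) = (\<integral>\<^sup>+ u\<in>{w}. ennreal (sqrt (det (gram_matrix metric (st (- 1)) u))) \<partial>lborel)"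
      by (rule par[OF st_local_param]) auto
    also have "\<dots> = (\<integral>\<^sup>+ u. 0 \<partial>(lborel :: (real^'i) measure))"
      by (rule nn_integral_cong_AE) (use AE_lborel_singleton[of w] in \<open>auto elim!: eventually_mono simp: indicator_def\<close>)
    finally show ?thesis using w by simp
  qed
  fix B assume "B \<in> sets \<mu>"
  then have B: "B \<in> sets borel" by (simp add: sets)
  let ?A = "st 1 -` B"
  have A: "?A \<in> sets borel" using measurable_sets[OF st_measurable B] by simp
  have stA: "st 1 ` ?A = B \<inter> (\<Sigma> - {pole 1})" unfolding image_vimage_eq range_st[of 1, simplified] ..
  have "emeasure \<mu> B = emeasure \<mu> (B \<inter> (\<Sigma> - {pole 1}))"
  proof (rule emeasure_eq_AE)
    have "- \<Sigma> \<in> null_sets \<mu>" "{pole 1} \<in> null_sets \<mu>"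
      using null single closed_\<Sigma> by (auto simp: null_sets_def sets)
    then have "AE p in \<mu>. p \<notin> - \<Sigma>" "AE p in \<mu>. p \<notin> {pole 1}" using AE_not_in by blast+
    then show "AE p in \<mu>. p \<in> B \<longleftrightarrow> p \<in> B \<inter> (\<Sigma> - {pole 1})" by eventually_elim auto
  qed (use B closed_\<Sigma> in \<open>auto simp: sets\<close>)
  also have "\<dots> = (\<integral>\<^sup>+ u\<in>?A. ennreal (dens (st 1) u) \<partial>lborel)"
    unfolding stA[symmetric] dens_def by (rule par[OF st_local_param A]) auto
  also have "\<dots> = emeasure sphere_measure B"
    unfolding sphere_measure_def using st_measurable dens_st_measurable B A
    by (simp add: emeasure_distr emeasure_density)
  finally show "emeasure \<mu> B = emeasure sphere_measure B" .
qed

theorem surface_measure_eq: "surface_measure metric (dr_sphere I br r) = sphere_measure"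
  unfolding surface_measure_def dr_sphere_eq
  using is_surface_measure_sphere_measure is_surface_measure_unique by (rule the_equality)

end

section \<open>Integration over geodesic spheres\<close>

lemma measure_eqI_atMost:
  fixes M N :: "real measure"
  assumes "sets M = sets borel" "sets N = sets borel"
    and "\<And>x. emeasure M {..x} < \<infinity>" "\<And>x. emeasure M {..x} = emeasure N {..x}"
  shows "M = N"
proof (rule measure_eqI_generator_eq[where E = "range atMost" and \<Omega> = UNIV and A = "\<lambda>n. {..real n}"])
  show "Int_stable (range (atMost :: real \<Rightarrow> _))"
    by (auto simp: Int_stable_def Int_atMost)
  have "sets borel = sigma_sets UNIV (range (atMost :: real \<Rightarrow> _))"
    unfolding borel_eq_atMost by (rule sets_measure_of) simp
  then show "sets M = sigma_sets UNIV (range atMost)" "sets N = sigma_sets UNIV (range atMost)"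
    using assms(1,2) by simp_all
  show "(\<Union>i. {..real i}) = UNIV" using real_arch_simple by auto
  show "emeasure M {..real i} \<noteq> \<infinity>" for i using assms(3)[of "real i"] by simp
qed (use assms(4) in auto)

text \<open>The density of \<open>|v|^2\<close> for \<open>v\<close> in \<open>n\<close>-dimensional
  space with Lebesgue measure: the derivative in \<open>x\<close> of the volume of the ball of
  radius \<open>sqrt x\<close>.\<close>

definition norm_sq_density :: "nat \<Rightarrow> real \<Rightarrow> real" where
  "norm_sq_density n x = pi powr (real n / 2) / Gamma (real n / 2) * x powr (real n / 2 - 1)"

text \<open>A point mass at 0 in dimension zero, so that the iterated integrals can be stated for
  \<open>m = 0\<close> as well.\<close>

definition norm_sq_measure :: "nat \<Rightarrow> real measure" where
  "norm_sq_measure n = (if n = 0 then distr (count_space {()}) borel (\<lambda>_. 0)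
     else density lborel (\<lambda>x. ennreal (norm_sq_density n x) * indicator {0<..} x))"

lemma norm_sq_density_nonneg: "0 \<le> norm_sq_density n x"
proof (cases "n = 0")
  case False
  then show ?thesis unfolding norm_sq_density_def by (intro mult_nonneg_nonneg divide_nonneg_nonneg) (auto intro: less_imp_le Gamma_real_pos)
qed (simp add: norm_sq_density_def)

lemma norm_sq_density_measurable [measurable]: "norm_sq_density n \<in> borel_measurable borel"
  unfolding norm_sq_density_def[abs_def] by measurable

lemma sets_norm_sq_measure [simp, measurable_cong]: "sets (norm_sq_measure n) = sets borel"
  by (simp add: norm_sq_measure_def)

lemma emeasure_norm_sq_measure:
  "emeasure (norm_sq_measure n) {..p} = (if p < 0 then 0 else ennreal (unit_ball_vol (real n) * sqrt p ^ n))"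
proof (cases "n = 0")
  case True
  then show ?thesis by (auto simp: norm_sq_measure_def unit_ball_vol_def emeasure_distr)
next
  case n: False
  have "emeasure (norm_sq_measure n) {..p} = (\<integral>\<^sup>+ x. ennreal (norm_sq_density n x) * indicator {0<..p} x \<partial>lborel)"
    using n by (simp add: norm_sq_measure_def emeasure_density) (auto simp: indicator_def intro!: nn_integral_cong)
  also have "\<dots> = (if p < 0 then 0 else ennreal (unit_ball_vol (real n) * sqrt p ^ n))"
  proof (cases "p < 0")
    case False
    have "((\<lambda>x. x powr (real n / 2 - 1)) has_integral p powr (real n / 2 - 1 + 1) / (real n / 2 - 1 + 1)) {0..p}"
      by (rule has_integral_powr_from_0) (use n False in auto)
    then have "(norm_sq_density n has_integral pi powr (real n / 2) / Gamma (real n / 2) * (p powr (real n / 2) / (real n / 2))) {0..p}"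
      unfolding norm_sq_density_def[abs_def] by (intro has_integral_mult_right) simp
    then have "(\<integral>\<^sup>+ x. ennreal (norm_sq_density n x) * indicator {0..p} x \<partial>lborel) = ennreal (pi powr (real n / 2) / Gamma (real n / 2) * (p powr (real n / 2) / (real n / 2)))"
      by (intro nn_integral_has_integral_lebesgue' norm_sq_density_nonneg)
    moreover have "pi powr (real n / 2) / Gamma (real n / 2) * (p powr (real n / 2) / (real n / 2)) = unit_ball_vol (real n) * sqrt p ^ n"
    proof -
      have g: "Gamma (real n / 2 + 1) = real n / 2 * Gamma (real n / 2)" by (rule Gamma_plus1) (use n in auto)
      moreover have "p powr (real n / 2) = sqrt p ^ n"
      proof (cases "p = 0")
        case False
        with \<open>\<not> p < 0\<close> have "0 < p" by simp
        then have "sqrt p ^ n = (p powr (1 / 2)) powr real n" by (simp add: powr_half_sqrt powr_realpow)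
        then show ?thesis by (simp add: powr_powr)
      qed (use n in simp)
      ultimately show ?thesis unfolding unit_ball_vol_def g by (simp add: mult_ac)
    qed
    moreover have "(\<integral>\<^sup>+ x. ennreal (norm_sq_density n x) * indicator {0<..p} x \<partial>lborel) = (\<integral>\<^sup>+ x. ennreal (norm_sq_density n x) * indicator {0..p} x \<partial>lborel)"
      by (rule nn_integral_cong_AE) (use AE_lborel_singleton[of "0 :: real"] in \<open>auto elim!: eventually_mono simp: indicator_def\<close>)
    ultimately show ?thesis using False by simp
  qed simp
  finally show ?thesis .
qed

lemma nn_integral_norm_sq_measure_0: "G \<in> borel_measurable borel \<Longrightarrow> (\<integral>\<^sup>+ x. G x \<partial>norm_sq_measure 0) = G 0"
  by (simp add: norm_sq_measure_def nn_integral_distr nn_integral_count_space_finite)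

lemma sigma_finite_norm_sq_measure: "sigma_finite_measure (norm_sq_measure n)"
proof (rule sigma_finite_measure.intro, rule exI, intro conjI)
  show "countable (range (\<lambda>i :: nat. {..real i}))" by simp
  show "\<Union> (range (\<lambda>i :: nat. {..real i})) = space (norm_sq_measure n)"
    using real_arch_simple sets_eq_imp_space_eq[OF sets_norm_sq_measure] by auto
qed (auto simp: emeasure_norm_sq_measure)

text \<open>Both measures agree on half-lines by the volume of balls. The volume formula is used for
  positive radii; radius zero follows by shrinking balls of radius \<open>1 / Suc i\<close>.\<close>

lemma distr_norm_sq:
  fixes A :: "'b set"
  assumes A: "finite A"
  shows "distr (\<Pi>\<^sub>M i\<in>A. lborel) borel (\<lambda>f. \<Sum>i\<in>A. (f i)\<^sup>2) = norm_sq_measure (card A)"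
proof (rule sym, rule measure_eqI_atMost)
  let ?M = "\<Pi>\<^sub>M i\<in>A. (lborel :: real measure)"
  let ?N = "\<lambda>f :: 'b \<Rightarrow> real. \<Sum>i\<in>A. (f i)\<^sup>2"
  have N [measurable]: "?N \<in> borel_measurable ?M" by measurable
  have aux: "emeasure ?M ({f. ?N f \<le> p} \<inter> space ?M) = ennreal (unit_ball_vol (real (card A)) * sqrt p ^ card A)" if "0 < p" for p
    using emeasure_cball_aux[OF A, of "sqrt p"] that by simp
  show "emeasure (norm_sq_measure (card A)) {..p} = emeasure (distr ?M borel ?N) {..p}" for p
  proof -
    have e: "emeasure (distr ?M borel ?N) {..p} = emeasure ?M ({f. ?N f \<le> p} \<inter> space ?M)"
      by (subst emeasure_distr[OF N]) (auto intro!: arg_cong[where f = "emeasure ?M"])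
    consider "0 < p" | "p < 0" | "p = 0" by linarith
    then show ?thesis
    proof cases
      case 2
      have "{f. ?N f \<le> p} = {}" using sum_nonneg[of A "\<lambda>i. (_ i)\<^sup>2"] 2 by (auto simp: not_le intro!: less_le_trans[OF 2] sum_nonneg)
      then show ?thesis using 2 unfolding e by (simp add: emeasure_norm_sq_measure)
    next
      case 3
      show ?thesis
      proof (cases "A = {}")
        case True
        then show ?thesis unfolding e 3 by (simp add: emeasure_norm_sq_measure unit_ball_vol_def PiM_empty emeasure_distr)
      next
        case False
        then have c: "card A \<noteq> 0" using A by simp
        have "emeasure ?M ({f. ?N f \<le> p} \<inter> space ?M) \<le> ennreal (unit_ball_vol (real (card A)) * inverse (real (Suc i)) ^ card A)" for i
        proof -
          have "emeasure ?M ({f. ?N f \<le> p} \<inter> space ?M) \<le> emeasure ?M ({f. ?N f \<le> inverse (real (Suc i)) ^ 2} \<inter> space ?M)"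
          proof (rule emeasure_mono)
            have "0 \<le> inverse (real (Suc i)) ^ 2" by simp
            then show "{f. ?N f \<le> p} \<inter> space ?M \<subseteq> {f. ?N f \<le> inverse (real (Suc i)) ^ 2} \<inter> space ?M" using 3 by (auto intro: order_trans)
            have "{f \<in> space ?M. ?N f \<le> inverse (real (Suc i)) ^ 2} \<in> sets ?M" by measurable
            then show "{f. ?N f \<le> inverse (real (Suc i)) ^ 2} \<inter> space ?M \<in> sets ?M" by (simp add: Int_def conj_commute)
          qed
          then show ?thesis using aux[of "inverse (real (Suc i)) ^ 2"] by simp
        qed
        moreover have "(\<lambda>i. ennreal (unit_ball_vol (real (card A)) * inverse (real (Suc i)) ^ card A)) \<longlonglongrightarrow> ennreal (unit_ball_vol (real (card A)) * 0 ^ card A)"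
          by (intro tendsto_ennrealI tendsto_intros LIMSEQ_inverse_real_of_nat)
        ultimately have "emeasure ?M ({f. ?N f \<le> p} \<inter> space ?M) \<le> ennreal (unit_ball_vol (real (card A)) * 0 ^ card A)"
          by (meson LIMSEQ_le_const)
        then have "emeasure ?M ({f. ?N f \<le> p} \<inter> space ?M) = 0" using c by (simp add: zero_power)
        then show ?thesis using c 3 unfolding e by (simp add: emeasure_norm_sq_measure)
      qed
    qed (simp add: e aux emeasure_norm_sq_measure)
  qed
qed (auto simp: emeasure_norm_sq_measure)

text \<open>Lebesgue measure is the product over \<open>I\<close> and \<open>- I\<close>, and the
  integrand depends on each factor through its squared norm only: polar coordinates in both factors
  at once.\<close>

lemma nn_integral_restr_norms:
  fixes G :: "real \<Rightarrow> real \<Rightarrow> ennreal" and I :: "'i::finite set"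
  assumes G [measurable]: "(\<lambda>(x, y). G x y) \<in> borel_measurable (borel \<Otimes>\<^sub>M borel)"
  shows "(\<integral>\<^sup>+ w. G (restr I w \<bullet> restr I w) (restr (- I) w \<bullet> restr (- I) w) \<partial>lborel) =
    (\<integral>\<^sup>+ x. \<integral>\<^sup>+ y. G x y \<partial>norm_sq_measure (card (- I)) \<partial>norm_sq_measure (card I))"
proof -
  define B where "B = (\<lambda>K :: 'i set. (\<lambda>i. axis i (1 :: real)) ` K)"
  have inj: "inj_on (\<lambda>i. axis i (1 :: real)) K" for K :: "'i set" by (auto simp: inj_on_def axis_eq_axis)
  have finB: "finite (B K)" and cardB: "card (B K) = card K" for K by (auto simp: B_def card_image[OF inj])
  have Basis: "Basis = B I \<union> B (- I)"
    unfolding B_def image_Un[symmetric] Basis_vec_def by (auto simp: Basis_real_def)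
  have disj: "B I \<inter> B (- I) = {}" by (auto simp: B_def axis_eq_axis)
  let ?S = "\<lambda>K f. \<Sum>b\<in>B K. (f b)\<^sup>2 :: real"
  have restr_sum: "restr K (\<Sum>b\<in>Basis. f b *\<^sub>R b) \<bullet> restr K (\<Sum>b\<in>Basis. f b *\<^sub>R b) = ?S K f" for f and K :: "'i set"
  proof -
    define v where "v = (\<Sum>b\<in>Basis. f b *\<^sub>R b :: real^'i)"
    have c: "v $ i = f (axis i 1)" for i
      unfolding v_def using inner_sum_left_Basis[of "axis i 1" f] by (simp add: inner_axis Basis_vec_def) auto
    have "restr K v \<bullet> restr K v = (\<Sum>i\<in>UNIV. if i \<in> K then (f (axis i 1))\<^sup>2 else 0)"
      unfolding inner_vec_def by (intro sum.cong) (auto simp: restr_def c power2_eq_square)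
    also have "\<dots> = (\<Sum>i\<in>K. (f (axis i 1))\<^sup>2)" by (simp add: sum.If_cases)
    also have "\<dots> = ?S K f" unfolding B_def by (simp add: sum.reindex[OF inj])
    finally show ?thesis unfolding v_def .
  qed
  interpret product_sigma_finite "\<lambda>_ :: real^'i. (lborel :: real measure)" by standard
  interpret k: sigma_finite_measure "norm_sq_measure (card (- I))" by (rule sigma_finite_norm_sq_measure)
  have rm: "(\<lambda>w. G (restr I w \<bullet> restr I w) (restr (- I) w \<bullet> restr (- I) w)) \<in> borel_measurable borel"
  proof -
    have "(\<lambda>w. restr K w \<bullet> restr K w) \<in> borel_measurable borel" for K :: "'i set"
      by (intro borel_measurable_continuous_onI continuous_intros linear_continuous_on bounded_linear_restr)
    note [measurable] = this
    show ?thesis by measurable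
  qed
  have "(\<integral>\<^sup>+ w. G (restr I w \<bullet> restr I w) (restr (- I) w \<bullet> restr (- I) w) \<partial>lborel) =
      (\<integral>\<^sup>+ f. G (?S I f) (?S (- I) f) \<partial>(\<Pi>\<^sub>M b\<in>Basis. lborel))"
    by (subst lborel_eq, subst nn_integral_distr) (use rm in \<open>auto simp: restr_sum\<close>)
  also have "\<dots> = (\<integral>\<^sup>+ f. G (?S I f) (?S (- I) f) \<partial>(\<Pi>\<^sub>M b\<in>B I \<union> B (- I). lborel))" unfolding Basis ..
  also have "\<dots> = (\<integral>\<^sup>+ x. \<integral>\<^sup>+ y. G (?S I (merge (B I) (B (- I)) (x, y))) (?S (- I) (merge (B I) (B (- I)) (x, y))) \<partial>(\<Pi>\<^sub>M b\<in>B (- I). lborel) \<partial>(\<Pi>\<^sub>M b\<in>B I. lborel))"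
    by (rule product_nn_integral_fold[OF disj finB finB]) measurable
  also have "\<dots> = (\<integral>\<^sup>+ x. \<integral>\<^sup>+ y. G (?S I x) (?S (- I) y) \<partial>(\<Pi>\<^sub>M b\<in>B (- I). lborel) \<partial>(\<Pi>\<^sub>M b\<in>B I. lborel))"
  proof -
    have "?S I (merge (B I) (B (- I)) (x, y)) = ?S I x" "?S (- I) (merge (B I) (B (- I)) (x, y)) = ?S (- I) y" for x y
      using disj by (auto intro!: sum.cong simp: merge_def)
    then show ?thesis by simp
  qed
  also have "\<dots> = (\<integral>\<^sup>+ x. \<integral>\<^sup>+ y. G (?S I x) y \<partial>norm_sq_measure (card (- I)) \<partial>(\<Pi>\<^sub>M b\<in>B I. lborel))"
    unfolding cardB[of "- I", symmetric] distr_norm_sq[OF finB, symmetric] by (simp add: nn_integral_distr)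
  also have "\<dots> = (\<integral>\<^sup>+ x. \<integral>\<^sup>+ y. G x y \<partial>norm_sq_measure (card (- I)) \<partial>norm_sq_measure (card I))"
    unfolding cardB[of I, symmetric] distr_norm_sq[OF finB[of I], symmetric] by (simp add: nn_integral_distr)
  finally show ?thesis .
qed

text \<open>Substitution \<open>y = A - t^2\<close> on the half-line where \<open>t\<close> has the
  sign \<open>j\<close>; the Jacobian \<open>2 |t|\<close> cancels \<open>1 / sqrt (A - y)\<close>
  up to the factor 2.\<close>

lemma nn_integral_norm_sq_branch:
  fixes G :: "real \<Rightarrow> ennreal"
  assumes G [measurable]: "G \<in> borel_measurable borel" and e: "j^2 = 1"
  shows "(\<integral>\<^sup>+ y. ennreal (norm_sq_density k y) * (ennreal (1 / sqrt (A - y)) * G (j * sqrt (A - y))) * indicator {0<..<A} y \<partial>lborel) =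
    2 * (\<integral>\<^sup>+ t. ennreal (norm_sq_density k (A - t^2)) * G t * indicator {t. 0 < j * t \<and> t\<^sup>2 < A} t \<partial>lborel)"
proof -
  let ?S = "{t. 0 < j * t \<and> t\<^sup>2 < A}" and ?g = "\<lambda>t. A - t^2"
  let ?f = "\<lambda>y. ennreal (norm_sq_density k y) * (ennreal (1 / sqrt (A - y)) * G (j * sqrt (A - y)))"
  have e': "j = 1 \<or> j = - 1" using e by (simp add: power2_eq_1_iff)
  have ab: "sqrt (t^2) = j * t" if "t \<in> ?S" for t using that e' by auto
  have img: "?g ` ?S = {0<..<A}"
  proof
    show "?g ` ?S \<subseteq> {0<..<A}"
    proof
      fix y assume "y \<in> ?g ` ?S"
      then obtain t where t: "t \<in> ?S" "y = A - t^2" by blast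
      then have "t \<noteq> 0" by auto
      then show "y \<in> {0<..<A}" using t by simp
    qed
    show "{0<..<A} \<subseteq> ?g ` ?S"
    proof
      fix y assume y: "y \<in> {0<..<A}"
      have "(j * sqrt (A - y))\<^sup>2 = A - y" using y by (simp add: power_mult_distrib e)
      moreover have "0 < j * (j * sqrt (A - y))" using y e' by auto
      ultimately show "y \<in> ?g ` ?S" using y by (intro image_eqI[of _ _ "j * sqrt (A - y)"]) auto
    qed
  qed
  have S [measurable]: "?S \<in> sets borel" by measurable
  have "(\<integral>\<^sup>+ y. ?f y * indicator {0<..<A} y \<partial>lborel) = (\<integral>\<^sup>+ t. ennreal \<bar>- (2 * t)\<bar> * ?f (?g t) * indicator ?S t \<partial>lborel)"
    unfolding img[symmetric]
  proof (rule nn_integral_change_of_variables_1[OF S])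
    show "?g ` ?S \<in> sets borel" unfolding img by simp
    show "(?g has_real_derivative - (2 * t)) (at t within ?S)" for t by (rule derivative_eq_intros refl | simp)+
    show "inj_on ?g ?S"
    proof (rule inj_onI)
      fix s t assume st: "s \<in> ?S" "t \<in> ?S" "?g s = ?g t"
      have "s^2 = t^2" using st(3) by simp
      then have "j * s = j * t" unfolding ab[OF st(1), symmetric] ab[OF st(2), symmetric] by (rule arg_cong)
      then show "s = t" using e' by auto
    qed
  qed measurable
  also have "\<dots> = (\<integral>\<^sup>+ t. 2 * (ennreal (norm_sq_density k (A - t^2)) * G t * indicator ?S t) \<partial>lborel)"
  proof (rule nn_integral_cong)
    fix t :: real
    show "ennreal \<bar>- (2 * t)\<bar> * ?f (?g t) * indicator ?S t = 2 * (ennreal (norm_sq_density k (A - t^2)) * G t * indicator ?S t)"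
    proof (cases "t \<in> ?S")
      case True
      have "ennreal \<bar>- (2 * t)\<bar> * ennreal (1 / sqrt (t^2)) = 2"
        using True e' by (subst ennreal_mult[symmetric]) (auto simp: zero_less_mult_iff)
      moreover have "j * sqrt (t^2) = t" unfolding ab[OF True] using e by (simp add: power2_eq_square mult.assoc[symmetric])
      moreover have "a * (d * (b * g)) * 1 = (a * b) * (d * g * 1)" for a b d g :: ennreal by (simp add: mult_ac)
      ultimately show ?thesis using True by (simp only: diff_diff_eq2 add_diff_cancel_left' indicator_simps)
    qed simp
  qed
  also have "\<dots> = 2 * (\<integral>\<^sup>+ t. ennreal (norm_sq_density k (A - t^2)) * G t * indicator ?S t \<partial>lborel)"
    by (rule nn_integral_cmult) measurable
  finally show ?thesis .
qed

lemma nn_integral_norm_sq_branches: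
  fixes G :: "real \<Rightarrow> ennreal"
  assumes G [measurable]: "G \<in> borel_measurable borel" and k: "k \<noteq> 0"
  shows "(\<integral>\<^sup>+ y. ennreal (1 / sqrt (A - y)) * (G (sqrt (A - y)) + G (- sqrt (A - y))) * indicator {..<A} y \<partial>norm_sq_measure k) =
    2 * (\<integral>\<^sup>+ t. ennreal (norm_sq_density k (A - t^2)) * G t * indicator {t. t\<^sup>2 < A} t \<partial>lborel)"
proof -
  let ?L = "\<lambda>j y. ennreal (norm_sq_density k y) * (ennreal (1 / sqrt (A - y)) * G (j * sqrt (A - y))) * indicator {0<..<A} y"
  let ?R = "\<lambda>j t. ennreal (norm_sq_density k (A - t^2)) * G t * indicator {t. 0 < j * t \<and> t\<^sup>2 < A} t"
  have "(\<integral>\<^sup>+ y. ennreal (1 / sqrt (A - y)) * (G (sqrt (A - y)) + G (- sqrt (A - y))) * indicator {..<A} y \<partial>norm_sq_measure k) =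
      (\<integral>\<^sup>+ y. ?L 1 y + ?L (- 1) y \<partial>lborel)"
    using k by (simp add: norm_sq_measure_def nn_integral_density)
      (auto simp: indicator_def distrib_left mult_ac intro!: nn_integral_cong)
  also have "\<dots> = (\<integral>\<^sup>+ y. ?L 1 y \<partial>lborel) + (\<integral>\<^sup>+ y. ?L (- 1) y \<partial>lborel)"
    by (rule nn_integral_add) measurable
  also have "\<dots> = 2 * (\<integral>\<^sup>+ t. ?R 1 t \<partial>lborel) + 2 * (\<integral>\<^sup>+ t. ?R (- 1) t \<partial>lborel)"
    by (subst (1 2) nn_integral_norm_sq_branch) (auto intro: G)
  also have "\<dots> = 2 * ((\<integral>\<^sup>+ t. ?R 1 t \<partial>lborel) + (\<integral>\<^sup>+ t. ?R (- 1) t \<partial>lborel))"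
    by (simp add: distrib_left)
  also have "(\<integral>\<^sup>+ t. ?R 1 t \<partial>lborel) + (\<integral>\<^sup>+ t. ?R (- 1) t \<partial>lborel) = (\<integral>\<^sup>+ t. ?R 1 t + ?R (- 1) t \<partial>lborel)"
    by (rule nn_integral_add[symmetric]) measurable
  also have "\<dots> = (\<integral>\<^sup>+ t. ennreal (norm_sq_density k (A - t^2)) * G t * indicator {t. t\<^sup>2 < A} t \<partial>lborel)"
    by (rule nn_integral_cong_AE) (use AE_lborel_singleton[of "0 :: real"] in \<open>auto elim!: eventually_mono simp: indicator_def\<close>)
  finally show ?thesis .
qed

text \<open>\<open>N\<close> maps into the second factor and vanishes on it, so
  \<open>T c = 1 + c N\<close> obeys \<open>T 1 \<circ> T 1 = T 2\<close>. Scaling the second factor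
  by 2 conjugates \<open>T 1\<close> to \<open>T 2\<close>, so \<open>det (T 1)\<close> equals its
  own square, and it is nonzero because \<open>T (- 1)\<close> inverts \<open>T 1\<close>.\<close>

lemma det_shear:
  fixes N :: "real^'i::finite \<Rightarrow> real^'i"
  assumes N: "linear N" "\<And>e. N (restr I e) = N e" "\<And>e. restr I (N e) = 0"
  shows "det (matrix (\<lambda>e. e + N e)) = 1"
proof -
  define T where "T = (\<lambda>c :: real. \<lambda>e. e + c *\<^sub>R N e)"
  define P where "P = (\<lambda>c :: real. \<lambda>e. restr I e + c *\<^sub>R restr (- I) e :: real^'i)"
  have lT: "linear (T c)" for c
    unfolding T_def by (intro linear_compose_add linear_compose_scale_right linear_ident N(1))
  have lP: "linear (P c)" for c
    unfolding P_def by (intro linear_compose_add linear_compose_scale_right restr_linear)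
  have NN: "N (N e) = 0" for e using N(2)[of "N e"] unfolding N(3) by (simp add: linear_0[OF N(1)])
  have sN: "restr (- I) (N e) = N e" for e using restr_sum[of I "N e"] unfolding N(3) by simp
  have NP: "N (P c e) = N e" for c e
    using N(2)[of "P c e"] N(2)[of e] by (simp add: P_def restr_add restr_scaleR)
  have dc: "det (matrix (\<lambda>e. f (g e))) = det (matrix f) * det (matrix g)" if "linear f" "linear g" for f g :: "real^'i \<Rightarrow> real^'i"
    using matrix_compose[OF that(2,1)] by (simp add: o_def det_mul)
  have det_id: "det (matrix (\<lambda>e :: real^'i. e)) = 1"
  proof -
    have "matrix (\<lambda>e :: real^'i. e) = mat 1" by (auto simp: matrix_def mat_def axis_def vec_eq_iff)
    then show ?thesis by (simp add: det_I)
  qed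
  have "(\<lambda>e. P 2 (T 1 e)) = (\<lambda>e. T 2 (P 2 e))"
  proof
    fix e
    have "P 2 (T 1 e) = P 2 e + P 2 (N e)" using linear_add[OF lP] by (simp add: T_def)
    also have "P 2 (N e) = 2 *\<^sub>R N (P 2 e)" unfolding NP by (simp add: P_def N(3) sN)
    finally show "P 2 (T 1 e) = T 2 (P 2 e)" by (simp add: T_def)
  qed
  from arg_cong[OF this, of "\<lambda>f. det (matrix f)"]
  have 1: "det (matrix (P 2)) * det (matrix (T 1)) = det (matrix (T 2)) * det (matrix (P 2))"
    by (simp add: dc lT lP)
  have "(\<lambda>e. T 1 (T 1 e)) = T 2"
    by (auto simp: fun_eq_iff T_def linear_add[OF N(1)] NN scaleR_2)
  from arg_cong[OF this, of "\<lambda>f. det (matrix f)"]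
  have 2: "det (matrix (T 1)) * det (matrix (T 1)) = det (matrix (T 2))" by (simp add: dc lT)
  have "(\<lambda>e. T 1 (T (- 1) e)) = (\<lambda>e. e)"
    by (auto simp: fun_eq_iff T_def linear_add[OF N(1)] linear_diff[OF N(1)] NN)
  from arg_cong[OF this, of "\<lambda>f. det (matrix f)"]
  have 3: "det (matrix (T 1)) * det (matrix (T (- 1))) = 1" by (simp add: dc lT det_id)
  have "P 2 (P (1 / 2) e) = e" for e
  proof -
    have "P 2 (P (1 / 2) e) = restr I e + restr (- I) e" unfolding P_def by (simp add: restr_add restr_scaleR)
    then show ?thesis by simp
  qed
  then have "(\<lambda>e. P 2 (P (1 / 2) e)) = (\<lambda>e. e)" by auto
  from arg_cong[OF this, of "\<lambda>f. det (matrix f)"]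
  have 4: "det (matrix (P 2)) * det (matrix (P (1 / 2))) = 1" by (simp add: dc lP det_id)
  have nz: "det (matrix (T 1)) \<noteq> 0" "det (matrix (P 2)) \<noteq> 0" using 3 4 by auto
  have "det (matrix (T 1)) = det (matrix (T 1)) * det (matrix (T 1))" using 1 2 nz by simp
  then have "det (matrix (T 1)) = 1" using nz by simp
  then show ?thesis by (simp add: T_def)
qed

lemma det_restr_scaling:
  fixes I :: "'i::finite set"
  shows "det (matrix (\<lambda>e :: real^'i. a *\<^sub>R restr I e + b *\<^sub>R restr (- I) e)) = a ^ card I * b ^ card (- I)"
proof -
  have m: "matrix (\<lambda>e :: real^'i. a *\<^sub>R restr I e + b *\<^sub>R restr (- I) e) = (\<chi> i j. if i = j then (if i \<in> I then a else b) else 0)"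
    by (auto simp: matrix_def vec_eq_iff restr_def axis_def)
  have "det (matrix (\<lambda>e :: real^'i. a *\<^sub>R restr I e + b *\<^sub>R restr (- I) e)) = (\<Prod>i\<in>UNIV. if i \<in> I then a else b)"
    unfolding m by (subst det_diagonal) simp_all
  then show ?thesis by (simp add: prod.If_cases Compl_eq_Diff_UNIV)
qed

section \<open>The sphere as a union of two graphs\<close>

context damek_ricci_sphere begin

definition Q :: real where "Q = real (card I) / 2 + real (card (- I))"

text \<open>On the \<open>(X, Y)\<close> part \<open>frame\<close> is a shear followed by the
  scalings \<open>exp (- z / 2)\<close> and \<open>exp (- z)\<close>; the determinants of these
  produce the exponent \<open>Q\<close>.\<close>

lemma det_frame: "det (matrix (\<lambda>e. fst (frame p (e, s e)))) = exp (- Q * snd p)"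
proof -
  define D where "D = (\<lambda>e :: real^'i. exp (- snd p / 2) *\<^sub>R restr I e + exp (- snd p) *\<^sub>R restr (- I) e)"
  define N where "N = (\<lambda>e. (- 1 / 2) *\<^sub>R br (xc p) (restr I e))"
  have lD: "linear D"
    unfolding D_def by (intro linear_compose_add linear_compose_scale_right restr_linear)
  have lN: "linear N"
    unfolding N_def by (rule linearI) (simp_all add: restr_add restr_scaleR br_lin scaleR_add_right)
  have N2: "N (restr I e) = N e" for e by (simp add: N_def)
  have N3: "restr I (N e) = 0" for e
    unfolding N_def restr_scaleR using restr_compl(1)[OF br_supported[of "xc p" "restr I e"]] by simp
  have sN: "restr (- I) (N e) = N e" for e using restr_sum[of I "N e"] unfolding N3 by simp
  have "fst (frame p (e, s e)) = D (e + N e)" for e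
  proof -
    have "D (e + N e) = exp (- snd p / 2) *\<^sub>R restr I e + exp (- snd p) *\<^sub>R (restr (- I) e + N e)"
      by (simp add: D_def restr_add N3 sN)
    then show ?thesis by (simp add: frame_def N_def)
  qed
  then have "matrix (\<lambda>e. fst (frame p (e, s e))) = matrix (D \<circ> (\<lambda>e. e + N e))" by (simp add: o_def)
  also have "\<dots> = matrix D ** matrix (\<lambda>e. e + N e)"
    by (intro matrix_compose linear_compose_add linear_ident lD lN)
  finally have "det (matrix (\<lambda>e. fst (frame p (e, s e)))) = exp (- snd p / 2) ^ card I * exp (- snd p) ^ card (- I)"
    by (simp add: det_mul det_shear[OF lN N2 N3] det_restr_scaling D_def)
  also have "\<dots> = exp (- Q * snd p)"
    unfolding exp_of_nat_mult[symmetric] exp_add[symmetric] by (rule arg_cong[of _ _ exp]) (simp add: Q_def algebra_simps)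
  finally show ?thesis .
qed

text \<open>Over \<open>w = (X, Y)\<close> the round sphere has the two heights
  \<open>bb = 2 * C + j * sqrt (sq w)\<close> with \<open>j = 1\<close> and \<open>j = -1\<close>;
  \<open>lv\<close> is the corresponding \<open>exp z\<close>, and \<open>disc\<close> is the open
  shadow of the sphere.\<close>

definition sq :: "real^'i \<Rightarrow> real" where
  "sq w = R^2 - C * (restr I w \<bullet> restr I w) - restr (- I) w \<bullet> restr (- I) w"

definition lv :: "real \<Rightarrow> real^'i \<Rightarrow> real" where
  "lv j w = 2 * C - 1 - (restr I w \<bullet> restr I w) / 4 + j * sqrt (sq w)"

definition gr :: "real \<Rightarrow> real^'i \<Rightarrow> (real^'i) \<times> real" where
  "gr j w = (w, ln (lv j w))"

definition disc :: "(real^'i) set" where "disc = {w. 0 < sq w}"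

lemma lv_pos: assumes e: "j^2 = 1" and w: "w \<in> disc" shows "0 < lv j w"
proof -
  define b where "b = 2 * C + j * sqrt (sq w)"
  have e': "j = 1 \<or> j = - 1" using e by (simp add: power2_eq_1_iff)
  have s: "0 < sq w" using w by (simp add: disc_def)
  have "0 \<le> C * (restr I w \<bullet> restr I w)" "0 \<le> restr (- I) w \<bullet> restr (- I) w" using C_pos by simp_all
  then have "sq w \<le> R\<^sup>2" unfolding sq_def by linarith
  then have "sqrt (sq w) \<le> R" using R_pos by (simp add: real_le_lsqrt)
  then have "0 < b" using e' R_less s by (auto simp: b_def add_pos_pos C_pos)
  have "(b - 2 * C)\<^sup>2 = sq w" unfolding b_def using s by (simp add: power_mult_distrib e)
  then have "4 * C * lv j w = b^2 + restr (- I) w \<bullet> restr (- I) w"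
  proof -
    have l: "lv j w = b - 1 - (restr I w \<bullet> restr I w) / 4" by (simp add: lv_def b_def)
    have "b^2 - 4 * C * b + 4 * C * C = 4 * C * (C - 1) - C * (restr I w \<bullet> restr I w) - restr (- I) w \<bullet> restr (- I) w"
      using \<open>(b - 2 * C)\<^sup>2 = sq w\<close> unfolding sq_def R2 by (simp add: power2_eq_square algebra_simps)
    then show ?thesis unfolding l by (simp add: algebra_simps)
  qed
  then have "0 < 4 * C * lv j w" using \<open>0 < b\<close> by (simp add: add_pos_nonneg)
  then show ?thesis using C_pos by (simp add: zero_less_mult_iff)
qed

lemma bb_gr: "j^2 = 1 \<Longrightarrow> w \<in> disc \<Longrightarrow> bb (gr j w) = 2 * C + j * sqrt (sq w)"
  using lv_pos[of j w] by (simp add: bb_def gr_def lv_def)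

lemma gr_in_\<Sigma>: assumes "j^2 = 1" "w \<in> disc" shows "gr j w \<in> \<Sigma>"
proof -
  have "(j * sqrt (sq w))\<^sup>2 = sq w" using assms by (simp add: power_mult_distrib disc_def)
  then show ?thesis unfolding \<Sigma>_iff bb_gr[OF assms] by (simp add: gr_def sq_def)
qed

lemma gr_image: assumes e: "j^2 = 1" shows "gr j ` disc = {p \<in> \<Sigma>. 0 < j * (bb p - 2 * C)}"
proof
  have e': "j = 1 \<or> j = - 1" using e by (simp add: power2_eq_1_iff)
  show "gr j ` disc \<subseteq> {p \<in> \<Sigma>. 0 < j * (bb p - 2 * C)}"
  proof (rule image_subsetI)
    fix w assume w: "w \<in> disc"
    have "0 < j * (bb (gr j w) - 2 * C)" unfolding bb_gr[OF e w] using e' w by (auto simp: disc_def)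
    then show "gr j w \<in> {p \<in> \<Sigma>. 0 < j * (bb p - 2 * C)}" using gr_in_\<Sigma>[OF e w] by simp
  qed
  show "{p \<in> \<Sigma>. 0 < j * (bb p - 2 * C)} \<subseteq> gr j ` disc"
  proof
    fix p assume "p \<in> {p \<in> \<Sigma>. 0 < j * (bb p - 2 * C)}"
    then have p: "p \<in> \<Sigma>" and t: "0 < j * (bb p - 2 * C)" by simp_all
    have s: "sq (fst p) = (bb p - 2 * C)\<^sup>2" using p unfolding \<Sigma>_iff sq_def by linarith
    have nz: "bb p - 2 * C \<noteq> 0" using t by auto
    then have d: "fst p \<in> disc" by (simp add: disc_def s)
    have "j * sqrt (sq (fst p)) = bb p - 2 * C" unfolding s using t e' by (auto simp: abs_if)
    then have "lv j (fst p) = exp (snd p)" unfolding lv_def by (simp add: bb_def)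
    then have "gr j (fst p) = p" by (simp add: gr_def prod_eq_iff)
    then show "p \<in> gr j ` disc" using d by (metis imageI)
  qed
qed

lemma continuous_on_sq: "continuous_on S sq"
  unfolding sq_def[abs_def] by (intro continuous_intros linear_continuous_on bounded_linear_restr)

lemma open_disc: "open disc"
  unfolding disc_def by (intro open_Collect_less continuous_on_const continuous_on_sq)

lemma gr_smooth: assumes e: "j^2 = 1" shows "smooth_on disc (gr j)"
proof -
  note o = open_disc
  have i: "smooth_on disc (\<lambda>w :: real^'i. w)" by (intro smooth_on_bounded_linear bounded_linear_ident o)
  have s: "smooth_on disc sq"
    unfolding sq_def[abs_def] by (intro smooth_on_diff smooth_on_mult smooth_on_const smooth_on_inner smooth_on_restr i o)
  have "smooth_on disc (\<lambda>w. sqrt (sq w))"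
    by (rule smooth_on_compose_real[OF o _ smooth_on_sqrt s]) (auto simp: disc_def)
  then have "smooth_on disc (\<lambda>w. 2 * C - 1 - (1 / 4) * (restr I w \<bullet> restr I w) + j * sqrt (sq w))"
    by (intro smooth_on_add smooth_on_diff smooth_on_mult smooth_on_const smooth_on_inner smooth_on_restr i o)
  then have "smooth_on disc (lv j)" by (simp add: lv_def[abs_def])
  then have "smooth_on disc (\<lambda>w. ln (lv j w))"
    using smooth_on_compose_real[OF o _ smooth_on_ln, of "lv j"] lv_pos[OF e] by auto
  then show ?thesis unfolding gr_def[abs_def] by (intro smooth_on_Pair i o)
qed

text \<open>The tangent space of the graph is orthogonal to \<open>cc_grad\<close>, so
  \<open>det_gram_hyperplane\<close> applies with this normal: its squared norm is
  \<open>C^2 - C = R^2 / 4\<close>, and its last component has square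
  \<open>sq w / 4\<close>.\<close>

lemma dens_gr:
  assumes e: "j^2 = 1" and w: "w \<in> disc"
  shows "dens (gr j) w = exp (- Q * ln (lv j w)) * (R / sqrt (sq w))"
proof -
  let ?p = "gr j w"
  define D where "D = frechet_derivative (gr j) (at w)"
  define s where "s = (\<lambda>e. snd (D e))"
  define A where "A = (\<lambda>e. fst (frame ?p (e, s e)))"
  have hd: "(gr j has_derivative D) (at w)"
    unfolding D_def by (rule smooth_on_has_derivative[OF gr_smooth[OF e] w])
  have "((\<lambda>w. fst (gr j w)) has_derivative (\<lambda>v. fst (D v))) (at w)"
    by (rule has_derivative_fst[OF hd])
  then have "((\<lambda>w :: real^'i. w) has_derivative (\<lambda>v. fst (D v))) (at w)" by (simp add: gr_def)
  then have "(\<lambda>v. fst (D v)) = (\<lambda>v. v)" using has_derivative_ident by (rule has_derivative_unique)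
  then have D: "D v = (v, s v)" for v by (metis prod.collapse s_def)
  have fr: "frame ?p (D v) = (A v, s v)" for v
    by (rule prod_eqI) (simp_all add: A_def D frame_def)
  have "((\<lambda>w. cc (gr j w)) has_derivative (\<lambda>v. cc_grad ?p \<bullet> frame ?p (D v))) (at w)"
    using diff_chain_at[OF hd cc_has_derivative] by (simp add: o_def)
  moreover have "((\<lambda>w. cc (gr j w)) has_derivative (\<lambda>v. 0)) (at w)"
    by (rule has_derivative_transform_within_open[OF has_derivative_const[of C] open_disc w])
      (use gr_in_\<Sigma>[OF e] in \<open>simp add: \<Sigma>_def\<close>)
  ultimately have "(\<lambda>v. cc_grad ?p \<bullet> frame ?p (D v)) = (\<lambda>v. 0)" by (rule has_derivative_unique)
  then have orth: "cc_grad ?p \<bullet> (A v, s v) = 0" for v unfolding fr by metis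
  have lA: "linear A"
  proof -
    have "linear (\<lambda>v. frame ?p (D v))"
      using linear_compose[OF has_derivative_linear[OF hd] linear_frame] by (simp add: o_def)
    then have "linear (\<lambda>v. fst (frame ?p (D v)))"
      using linear_compose[OF _ bounded_linear.linear[OF bounded_linear_fst]] by (auto simp: o_def)
    then show ?thesis by (simp add: fr)
  qed
  have sn: "(snd (cc_grad ?p))\<^sup>2 = sq w / 4"
  proof -
    have "cc ?p = C" using gr_in_\<Sigma>[OF e w] by (simp add: \<Sigma>_def)
    then have "snd (cc_grad ?p) = j * sqrt (sq w) / 2" by (simp add: cc_grad_def bb_gr[OF e w] field_simps)
    then have "(snd (cc_grad ?p))\<^sup>2 = (j * sqrt (sq w) / 2)\<^sup>2" by (rule arg_cong)
    then show ?thesis using w by (simp add: power_divide power_mult_distrib e disc_def)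
  qed
  have gg: "cc_grad ?p \<bullet> cc_grad ?p = R^2 / 4"
    using gr_in_\<Sigma>[OF e w] unfolding cc_grad_inner R2 by (simp add: \<Sigma>_def power2_eq_square algebra_simps)
  have s0: "0 < sq w" using w by (simp add: disc_def)
  have nz: "snd (cc_grad ?p) \<noteq> 0" using sn s0 by auto
  have "det (gram_matrix metric (gr j) w) = (exp (- Q * snd ?p))\<^sup>2 * (R^2 / 4 / (sq w / 4))"
    unfolding gram_matrix_frame D_def[symmetric] fr det_gram_hyperplane[OF lA nz orth] sn gg
    by (simp add: A_def det_frame)
  also have "\<dots> = (exp (- Q * ln (lv j w)) * (R / sqrt (sq w)))\<^sup>2"
    using s0 by (simp add: power_mult_distrib power_divide gr_def)
  finally show ?thesis
    unfolding dens_def using R_pos s0 by (simp add: real_sqrt_mult)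
qed

lemma sq_measurable [measurable]: "sq \<in> borel_measurable borel"
  by (intro borel_measurable_continuous_onI continuous_on_sq)

lemma lv_measurable [measurable]: "lv j \<in> borel_measurable borel"
proof -
  have "(\<lambda>w. restr I w \<bullet> restr I w) \<in> borel_measurable borel"
    by (intro borel_measurable_continuous_onI continuous_intros linear_continuous_on bounded_linear_restr)
  then show ?thesis unfolding lv_def[abs_def] by measurable
qed

text \<open>The two graphs fill the sphere up to the equator \<open>bb = 2 * C\<close> and the pole
  removed from them, and \<open>dens_gr\<close> is the density of each.\<close>

lemma nn_integral_sphere_graph:
  fixes H :: "real \<Rightarrow> ennreal"
  assumes H [measurable]: "H \<in> borel_measurable borel"
  defines "E \<equiv> \<lambda>a. ennreal (exp (- Q * ln a)) * H (ln a)"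
  shows "(\<integral>\<^sup>+ p. H (snd p) \<partial>sphere_measure) =
    (\<integral>\<^sup>+ w. ennreal (R / sqrt (sq w)) * (E (lv 1 w) + E (lv (- 1) w)) * indicator disc w \<partial>lborel)"
proof -
  \<comment> \<open>\<open>sphere_measure_transfer\<close> asks for images that avoid
    \<open>pole 1\<close>, which lies over \<open>w = 0\<close>.\<close>
  define A where "A = (\<lambda>j. disc - {w. gr j w = pole 1})"
  have fin: "finite {w. gr j w = pole 1}" for j
  proof (rule finite_subset)
    show "{w. gr j w = pole 1} \<subseteq> {0}" by (auto simp: gr_def pole_def)
  qed simp
  have oA: "open (A j)" for j
    unfolding A_def using open_disc finite_imp_closed[OF fin] by (rule open_Diff)
  have Ad: "A j \<subseteq> disc" for j unfolding A_def by blast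
  have bm [measurable]: "bb \<in> borel_measurable borel"
    by (intro borel_measurable_continuous_onI smooth_on_continuous_on bb_smooth open_UNIV)
  have \<Sigma>b [measurable]: "\<Sigma> \<in> sets borel" using closed_\<Sigma> by (rule borel_closed)
  have img: "gr j ` A j = {p. p \<in> \<Sigma> \<and> 0 < j * (bb p - 2 * C) \<and> p \<noteq> pole 1}" if "j^2 = 1" for j
  proof -
    have "gr j ` A j = gr j ` disc - {pole 1}" unfolding A_def by auto
    then show ?thesis unfolding gr_image[OF that] by auto
  qed
  have imgb: "gr j ` A j \<in> sets borel" if "j^2 = 1" for j
    unfolding img[OF that] by measurable
  have branch: "(\<integral>\<^sup>+ p. H (snd p) * indicator (gr j ` A j) p \<partial>sphere_measure) =
      (\<integral>\<^sup>+ w. ennreal (R / sqrt (sq w)) * E (lv j w) * indicator disc w \<partial>lborel)" if e: "j^2 = 1" for j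
  proof -
    have "(\<integral>\<^sup>+ p. H (snd p) * indicator (gr j ` A j) p \<partial>sphere_measure) =
        (\<integral>\<^sup>+ w. H (snd (gr j w)) * ennreal (dens (gr j) w) * indicator (A j) w \<partial>lborel)"
    proof (rule sphere_measure_transfer[OF oA])
      show "gr j differentiable at u" if "u \<in> A j" for u
        using smooth_on_imp_differentiable[OF gr_smooth[OF e]] subsetD[OF Ad that] .
      show "continuous_on (A j) (\<lambda>u. frechet_derivative (gr j) (at u) v)" for v
        by (rule continuous_on_subset[OF smooth_on_continuous_on[OF smooth_on_frechet[OF gr_smooth[OF e]]] Ad])
      show "gr j ` A j \<subseteq> \<Sigma> - {pole 1}" unfolding img[OF e] by blast
      show "inj_on (gr j) (A j)" by (rule inj_onI) (simp add: gr_def)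
      show "A j \<in> sets borel" using oA by (rule borel_open)
      show "gr j ` A j \<in> sets borel" by (rule imgb[OF e])
      show "(\<lambda>p. H (snd p)) \<in> borel_measurable borel"
        by (rule measurable_compose[OF _ H], intro borel_measurable_continuous_onI continuous_intros)
    qed blast
    also have "\<dots> = (\<integral>\<^sup>+ w. ennreal (R / sqrt (sq w)) * E (lv j w) * indicator disc w \<partial>lborel)"
    proof (rule nn_integral_cong_AE)
      have "AE w :: real^'i in lborel. w \<noteq> 0" by (rule AE_lborel_singleton)
      then show "AE w in lborel. H (snd (gr j w)) * ennreal (dens (gr j) w) * indicator (A j) w = ennreal (R / sqrt (sq w)) * E (lv j w) * indicator disc w"
      proof eventually_elim
        case (elim w)
        have "gr j w \<noteq> pole 1" using elim by (auto simp: gr_def pole_def)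
        then have iff: "w \<in> A j \<longleftrightarrow> w \<in> disc" unfolding A_def by blast
        show ?case
        proof (cases "w \<in> disc")
          case True
          have "0 \<le> R / sqrt (sq w)" using R_pos True by (simp add: disc_def)
          then have "ennreal (dens (gr j) w) = ennreal (exp (- Q * ln (lv j w))) * ennreal (R / sqrt (sq w))"
            unfolding dens_gr[OF e True] by (intro ennreal_mult) simp_all
          then show ?thesis unfolding E_def by (simp add: gr_def indicator_def iff True mult_ac)
        qed (simp add: indicator_def iff)
      qed
    qed
    finally show ?thesis .
  qed
  have Hs [measurable]: "(\<lambda>p. H (snd p)) \<in> borel_measurable (borel :: ((real^'i) \<times> real) measure)"
    by (rule measurable_compose[OF _ H], intro borel_measurable_continuous_onI continuous_intros)
  note [measurable] = imgb[of 1, simplified] imgb[of "- 1", simplified]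
  have "(\<integral>\<^sup>+ p. H (snd p) \<partial>sphere_measure) =
      (\<integral>\<^sup>+ p. H (snd p) * indicator (gr 1 ` A 1) p + H (snd p) * indicator (gr (- 1) ` A (- 1)) p \<partial>sphere_measure)"
  proof (subst (1 2) nn_integral_sphere_measure)
    \<comment> \<open>In the stereographic chart the equator is the unit sphere, a null set.\<close>
    have "sphere (0 :: real^'i) 1 \<in> null_sets lebesgue" using negligible_sphere negligible_iff_null_sets by blast
    then have "AE w in lborel. w \<notin> sphere (0 :: real^'i) 1"
      by (intro AE_not_in) (simp add: null_sets_completion_iff[of "sphere (0 :: real^'i) 1" lborel])
    then have "AE w in lborel. H (snd (st 1 w)) = H (snd (st 1 w)) * indicator (gr 1 ` A 1) (st 1 w) + H (snd (st 1 w)) * indicator (gr (- 1) ` A (- 1)) (st 1 w)"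
    proof eventually_elim
      case (elim w)
      have ww: "w \<bullet> w \<noteq> 1" using elim by (simp add: norm_eq_sqrt_inner)
      have "0 < 1 + w \<bullet> w" by (simp add: add_pos_nonneg)
      then have "1 - 2 * inverse (1 + w \<bullet> w) \<noteq> 0" using ww by (simp add: field_simps)
      then have nz: "bb (st 1 w) - 2 * C \<noteq> 0" using R_pos by (simp add: bb_st st_b_def)
      have "st 1 w \<in> \<Sigma> - {pole 1}" using range_st[of 1] by (metis one_power2 rangeI)
      then have "st 1 w \<in> gr 1 ` A 1 \<longleftrightarrow> \<not> st 1 w \<in> gr (- 1) ` A (- 1)"
        using nz unfolding img[of 1, simplified] img[of "- 1", simplified] by auto
      then show ?case by (simp add: indicator_def)
    qed
    then show "(\<integral>\<^sup>+ w. ennreal (dens (st 1) w) * H (snd (st 1 w)) \<partial>lborel) =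
      (\<integral>\<^sup>+ w. ennreal (dens (st 1) w) * (H (snd (st 1 w)) * indicator (gr 1 ` A 1) (st 1 w) + H (snd (st 1 w)) * indicator (gr (- 1) ` A (- 1)) (st 1 w)) \<partial>lborel)"
      by (intro nn_integral_cong_AE) (auto elim!: eventually_mono)
  qed measurable
  also have "\<dots> = (\<integral>\<^sup>+ p. H (snd p) * indicator (gr 1 ` A 1) p \<partial>sphere_measure) + (\<integral>\<^sup>+ p. H (snd p) * indicator (gr (- 1) ` A (- 1)) p \<partial>sphere_measure)"
    by (rule nn_integral_add) (simp_all add: sphere_measure_def)
  also have "\<dots> = (\<integral>\<^sup>+ w. ennreal (R / sqrt (sq w)) * E (lv 1 w) * indicator disc w \<partial>lborel) + (\<integral>\<^sup>+ w. ennreal (R / sqrt (sq w)) * E (lv (- 1) w) * indicator disc w \<partial>lborel)"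
    by (simp add: branch)
  also have "\<dots> = (\<integral>\<^sup>+ w. ennreal (R / sqrt (sq w)) * E (lv 1 w) * indicator disc w + ennreal (R / sqrt (sq w)) * E (lv (- 1) w) * indicator disc w \<partial>lborel)"
  proof (rule nn_integral_add[symmetric])
    have [measurable]: "disc \<in> sets borel" using open_disc by (rule borel_open)
    show "(\<lambda>w. ennreal (R / sqrt (sq w)) * E (lv j w) * indicator disc w) \<in> borel_measurable lborel" for j
      unfolding E_def by measurable
    then show "(\<lambda>w. ennreal (R / sqrt (sq w)) * E (lv (- 1) w) * indicator disc w) \<in> borel_measurable lborel" .
  qed
  finally show ?thesis by (simp add: distrib_left distrib_right)
qed

end

lemma cosh_measurable [measurable]: "(cosh :: real \<Rightarrow> real) \<in> borel_measurable borel"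
  and sinh_measurable [measurable]: "(sinh :: real \<Rightarrow> real) \<in> borel_measurable borel"
  by (intro borel_measurable_continuous_onI continuous_intros)+

lemma nn_integral_symmetric_interval:
  fixes h :: "real \<Rightarrow> ennreal"
  assumes h [measurable]: "h \<in> borel_measurable borel" and even: "\<And>z. h (- z) = h z"
  shows "(\<integral>\<^sup>+ z. h z * indicator {z. \<bar>z\<bar> < s} z \<partial>lborel) = 2 * (\<integral>\<^sup>+ z. h z * indicator {0<..<s} z \<partial>lborel)"
proof -
  have "(\<integral>\<^sup>+ z. h z * indicator {z. \<bar>z\<bar> < s} z \<partial>lborel) =
      (\<integral>\<^sup>+ z. h z * indicator {0<..<s} z + h (- z) * indicator {0<..<s} (- z) \<partial>lborel)"
    by (rule nn_integral_cong_AE) (use AE_lborel_singleton[of "0 :: real"] in \<open>auto elim!: eventually_mono simp: indicator_def even\<close>)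
  also have "\<dots> = (\<integral>\<^sup>+ z. h z * indicator {0<..<s} z \<partial>lborel) + (\<integral>\<^sup>+ z. h (- z) * indicator {0<..<s} (- z) \<partial>lborel)"
    by (rule nn_integral_add) measurable
  also have "(\<integral>\<^sup>+ z. h (- z) * indicator {0<..<s} (- z) \<partial>lborel) = (\<integral>\<^sup>+ z. h z * indicator {0<..<s} z \<partial>lborel)"
    using nn_integral_real_affine[of "\<lambda>z. h z * indicator {0<..<s} z" "- 1" 0] by simp
  finally show ?thesis by (simp add: mult_2)
qed

text \<open>Carries \<open>rl_integral\<close> over to the Lebesgue integral of nonnegative
  functions; comparing imaginary parts shows that the complex value is real.\<close>

lemma nn_integral_rl:
  fixes G :: "real \<Rightarrow> complex" and h :: "real \<Rightarrow> real"
  assumes G: "continuous_on UNIV G" and \<tau>: "0 < \<tau>" and r: "0 < r" and d: "0 < d"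
    and h: "\<And>s. 0 < s \<Longrightarrow> s < r \<Longrightarrow> of_real (h s) = rl_state \<tau> j G s" "\<And>s. 0 < s \<Longrightarrow> s < r \<Longrightarrow> 0 \<le> h s"
  obtains q where "0 \<le> q" "of_real q = rl_state \<tau> (j + d) (ek j d G) r"
    "(\<integral>\<^sup>+ s. ennreal (\<tau> * sinh (\<tau> * s) * (cosh (\<tau> * r) - cosh (\<tau> * s)) powr (real d / 2 - 1) * h s) * indicator {0<..<r} s \<partial>lborel) =
      ennreal (Gamma (real d / 2) * 2 powr (real d / 2) * q)"
proof -
  let ?v = "rl_state \<tau> (j + d) (ek j d G) r"
  let ?c = "Gamma (real d / 2) * 2 powr (real d / 2)"
  let ?w = "\<lambda>s. \<tau> * sinh (\<tau> * s) * (cosh (\<tau> * r) - cosh (\<tau> * s)) powr (real d / 2 - 1) * h s"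
  have c: "0 < ?c" using d by (simp add: Gamma_real_pos)
  have "((\<lambda>s. of_real (\<tau> * sinh (\<tau> * s) * (cosh (\<tau> * r) - cosh (\<tau> * s)) powr (real d / 2 - 1)) * of_real (h s))
    has_integral of_real ?c * ?v) {0..r}"
    by (rule rl_integral[OF G \<tau> r d]) (rule h(1))
  then have I: "((\<lambda>s. of_real (?w s)) has_integral of_real ?c * ?v) {0..r}" by simp
  have re: "(?w has_integral ?c * Re ?v) {0..r}"
    using has_integral_linear[OF I bounded_linear_Re] by (simp add: o_def)
  have "((\<lambda>s. 0 :: real) has_integral ?c * Im ?v) {0..r}"
    using has_integral_linear[OF I bounded_linear_Im] by (simp add: o_def)
  then have "?c * Im ?v = 0" using has_integral_0 by (rule has_integral_unique)
  moreover have "?c \<noteq> 0" using c by linarith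
  ultimately have im: "Im ?v = 0" unfolding mult_eq_0_iff by blast
  have re': "(?w has_integral ?c * Re ?v) {0<..<r}"
    using re by (simp add: has_integral_Icc_iff_Ioo)
  have nn: "0 \<le> ?w s" if "s \<in> {0<..<r}" for s
    using that \<tau> h(2) by (intro mult_nonneg_nonneg) auto
  have "0 \<le> ?c * Re ?v" by (rule has_integral_nonneg[OF re' nn])
  then have "0 \<le> Re ?v" using c by (simp add: zero_le_mult_iff)
  moreover have "of_real (Re ?v) = ?v" using im by (simp add: complex_eq_iff)
  moreover have "(\<integral>\<^sup>+ s. ennreal (?w s) * indicator {0<..<r} s \<partial>lborel) = ennreal (?c * Re ?v)"
    by (rule nn_integral_has_integral_lebesgue'[OF nn re'])
  ultimately show ?thesis by (rule that)
qed

section \<open>Slicing the sphere by the coordinate z\<close>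

context damek_ricci_sphere begin

abbreviation (input) mI :: nat where "mI \<equiv> card I"
abbreviation (input) kI :: nat where "kI \<equiv> card (- I)"

lemma kI_pos: "0 < kI"
  using center by (simp add: card_gt_0_iff)

text \<open>The value of \<open>|Y|^2\<close> on the sphere for given \<open>x = |X|^2\<close> and
  \<open>z\<close>, from \<open>bb^2 + |Y|^2 = 4 * C * exp z\<close>; where it is negative there is
  no such point.\<close>

definition dd :: "real \<Rightarrow> real \<Rightarrow> real" where
  "dd x z = 4 * C * exp z - (1 + exp z + x / 4)\<^sup>2"

lemma dd_measurable [measurable]: "(\<lambda>(x, z). dd x z) \<in> borel_measurable (borel \<Otimes>\<^sub>M borel)"
  unfolding dd_def by measurable

text \<open>Origin of the new variable \<open>s\<close>: it is the distance from the identity to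
  \<open>(X, 0, z)\<close>. Then \<open>bb = 2 * exp (z / 2) * cosh (s / 2)\<close>, and both
  \<open>|X|^2\<close> and \<open>|Y|^2\<close> become differences of hyperbolic cosines, the
  kernels of the two transforms.\<close>

lemma dd_eq: "dd (8 * exp (z / 2) * (cosh (s / 2) - cosh (z / 2))) z = 2 * exp z * (cosh r - cosh s)"
proof -
  define a where "a = exp (z / 2)"
  have a: "a * a = exp z" "a \<noteq> 0" by (simp_all add: a_def exp_add[symmetric])
  have "2 * a * cosh (z / 2) = 1 + exp z"
    unfolding a(1)[symmetric] using a(2) by (simp add: cosh_def exp_minus a_def[symmetric] field_simps)
  then have "1 + exp z + 8 * a * (cosh (s / 2) - cosh (z / 2)) / 4 = 2 * a * cosh (s / 2)"
    by (simp add: field_simps)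
  then have "dd (8 * a * (cosh (s / 2) - cosh (z / 2))) z = 4 * C * (a * a) - (2 * a * cosh (s / 2))\<^sup>2"
    unfolding dd_def a(1) by simp
  also have "\<dots> = 2 * (a * a) * (2 * C - 2 * (cosh (s / 2))\<^sup>2)" by (simp add: power2_eq_square algebra_simps)
  also have "2 * C - 2 * (cosh (s / 2))\<^sup>2 = cosh r - cosh s"
  proof -
    have "cosh (2 * x) = 2 * (cosh x)\<^sup>2 - 1" for x :: real
      unfolding cosh_double by (simp add: cosh_square_eq)
    from this[of "r / 2"] this[of "s / 2"] show ?thesis by (simp add: C_def)
  qed
  finally show ?thesis unfolding a(1) unfolding a_def .
qed

lemma dd_pos_iff: "0 < dd (8 * exp (z / 2) * (cosh (s / 2) - cosh (z / 2))) z \<longleftrightarrow> \<bar>s\<bar> < r"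
proof -
  have "0 < dd (8 * exp (z / 2) * (cosh (s / 2) - cosh (z / 2))) z \<longleftrightarrow> cosh \<bar>s\<bar> < cosh r"
    unfolding dd_eq by (simp add: zero_less_mult_iff)
  also have "\<dots> \<longleftrightarrow> \<bar>s\<bar> < r" using r_pos by (intro cosh_real_nonneg_less_iff) simp_all
  finally show ?thesis .
qed

text \<open>Up to the factor \<open>2 * R * exp (z - Q * z)\<close>, the density of the image of
  \<open>sphere_measure\<close> under the projection to \<open>z\<close>.\<close>

definition fibre :: "real \<Rightarrow> ennreal" where
  "fibre z = (\<integral>\<^sup>+ x. (if 0 < dd x z then ennreal (norm_sq_density kI (dd x z)) else 0) \<partial>norm_sq_measure mI)"

text \<open>For fixed \<open>x\<close> the two graphs are the branches
  \<open>t = sqrt (A - y)\<close> and \<open>t = - sqrt (A - y)\<close>. They unite to one integral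
  over \<open>t\<close>, and \<open>t = exp z - a\<close> makes \<open>z\<close> the
  variable.\<close>

lemma graph_integral_fibre:
  assumes H [measurable]: "H \<in> borel_measurable borel" and x: "0 \<le> x"
  defines "E \<equiv> \<lambda>a. ennreal (exp (- Q * ln a)) * H (ln a)"
  defines "A \<equiv> R\<^sup>2 - C * x" and "a \<equiv> 2 * C - 1 - x / 4"
  shows "(\<integral>\<^sup>+ y. ennreal (R / sqrt (A - y)) * (E (a + 1 * sqrt (A - y)) + E (a + - 1 * sqrt (A - y))) * indicator {..<A} y \<partial>norm_sq_measure kI) =
    ennreal (2 * R) * (\<integral>\<^sup>+ z. (if 0 < dd x z then ennreal (norm_sq_density kI (dd x z)) else 0) * (ennreal (exp (z - Q * z)) * H z) \<partial>lborel)"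
proof -
  let ?f = "\<lambda>t. ennreal (norm_sq_density kI (A - t^2)) * E (a + t) * indicator {t. t\<^sup>2 < A} t"
  have Em [measurable]: "E \<in> borel_measurable borel" unfolding E_def by measurable
  have dd: "dd x z = A - (exp z - a)\<^sup>2" for z
    unfolding dd_def A_def a_def R2 by (simp add: power2_eq_square algebra_simps)
  have "(\<integral>\<^sup>+ y. ennreal (R / sqrt (A - y)) * (E (a + 1 * sqrt (A - y)) + E (a + - 1 * sqrt (A - y))) * indicator {..<A} y \<partial>norm_sq_measure kI) =
      (\<integral>\<^sup>+ y. ennreal R * (ennreal (1 / sqrt (A - y)) * (E (a + sqrt (A - y)) + E (a + - sqrt (A - y))) * indicator {..<A} y) \<partial>norm_sq_measure kI)"
  proof (rule nn_integral_cong)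
    fix y
    have "ennreal (R / sqrt (A - y)) = ennreal R * ennreal (1 / sqrt (A - y))"
      using ennreal_mult'[of R "1 / sqrt (A - y)"] R_pos by simp
    then show "ennreal (R / sqrt (A - y)) * (E (a + 1 * sqrt (A - y)) + E (a + - 1 * sqrt (A - y))) * indicator {..<A} y =
        ennreal R * (ennreal (1 / sqrt (A - y)) * (E (a + sqrt (A - y)) + E (a + - sqrt (A - y))) * indicator {..<A} y)"
      by (simp only: mult.assoc mult_1 mult_minus_left)
  qed
  also have "\<dots> = ennreal R * (\<integral>\<^sup>+ y. ennreal (1 / sqrt (A - y)) * (E (a + sqrt (A - y)) + E (a + - sqrt (A - y))) * indicator {..<A} y \<partial>norm_sq_measure kI)"
    by (rule nn_integral_cmult) measurable
  also have "\<dots> = ennreal R * (2 * (\<integral>\<^sup>+ t. ?f t \<partial>lborel))"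
  proof -
    have "kI \<noteq> 0" using kI_pos by linarith
    then show ?thesis by (subst nn_integral_norm_sq_branches[where G = "\<lambda>t. E (a + t)"]) measurable
  qed
  also have "\<dots> = ennreal (2 * R) * (\<integral>\<^sup>+ t. ?f t \<partial>lborel)"
    using R_pos by (simp add: ennreal_mult mult_ac)
  also have "(\<integral>\<^sup>+ t. ?f t \<partial>lborel) =
      (\<integral>\<^sup>+ t. ?f t * indicator ((\<lambda>z. exp z - a) ` UNIV) t \<partial>lborel)"
  proof (rule nn_integral_cong)
    fix t
    \<comment> \<open>Positivity of \<open>4 * C * (a + t) = (2 * C + t)^2 + (A - t^2)\<close> makes
      every admissible \<open>t\<close> some \<open>exp z - a\<close>.\<close>
    have "t \<in> (\<lambda>z. exp z - a) ` UNIV" if t: "t^2 < A"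
    proof -
      have "0 \<le> C * x" using C_pos x by simp
      then have "t^2 < R^2" using t by (simp add: A_def)
      then have "\<bar>t\<bar>\<^sup>2 < R^2" by simp
      then have "\<bar>t\<bar> < R" by (rule power2_less_imp_less) (use R_pos in simp)
      then have "0 < 2 * C + t" using R_less by linarith
      moreover have "4 * C * (a + t) = (2 * C + t)\<^sup>2 + (A - t^2)"
        unfolding A_def a_def R2 by (simp add: power2_eq_square algebra_simps)
      ultimately have "0 < 4 * C * (a + t)" using t by (simp add: add_pos_pos)
      then have "0 < a + t" using C_pos by (simp add: zero_less_mult_iff)
      then show ?thesis by (intro image_eqI[of _ _ "ln (a + t)"]) simp_all
    qed
    then show "?f t =
        ?f t * indicator ((\<lambda>z. exp z - a) ` UNIV) t"
      by (cases "t^2 < A") simp_all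
  qed
  also have "\<dots> = (\<integral>\<^sup>+ z. ennreal \<bar>exp z\<bar> * (ennreal (norm_sq_density kI (A - (exp z - a)\<^sup>2)) * E (a + (exp z - a)) * indicator {t. t\<^sup>2 < A} (exp z - a)) * indicator UNIV z \<partial>lborel)"
  proof (rule nn_integral_change_of_variables_1)
    have "range (\<lambda>z. exp z - a) = {- a<..}"
    proof
      show "{- a<..} \<subseteq> range (\<lambda>z. exp z - a)"
      proof
        fix t assume "t \<in> {- a<..}"
        then show "t \<in> range (\<lambda>z. exp z - a)" by (intro image_eqI[of _ _ "ln (t + a)"]) auto
      qed
    qed auto
    then show "range (\<lambda>z. exp z - a) \<in> sets borel" by simp
    show "((\<lambda>z. exp z - a) has_real_derivative exp z) (at z within UNIV)" for z
      by (rule derivative_eq_intros refl | simp)+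
    show "inj (\<lambda>z. exp z - a)" by (rule injI) simp
  qed measurable
  also have "\<dots> = (\<integral>\<^sup>+ z. (if 0 < dd x z then ennreal (norm_sq_density kI (dd x z)) else 0) * (ennreal (exp (z - Q * z)) * H z) \<partial>lborel)"
  proof (rule nn_integral_cong)
    fix z
    have "ennreal (exp (z - Q * z)) = ennreal \<bar>exp z\<bar> * ennreal (exp (- Q * z))"
      by (subst ennreal_mult[symmetric]) (simp_all add: exp_add[symmetric])
    then show "ennreal \<bar>exp z\<bar> * (ennreal (norm_sq_density kI (A - (exp z - a)\<^sup>2)) * E (a + (exp z - a)) * indicator {t. t\<^sup>2 < A} (exp z - a)) * indicator UNIV z =
      (if 0 < dd x z then ennreal (norm_sq_density kI (dd x z)) else 0) * (ennreal (exp (z - Q * z)) * H z)"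
      unfolding dd E_def by (simp add: indicator_def mult_ac)
  qed
  finally show ?thesis .
qed

lemma AE_norm_sq_measure_nonneg: "AE x in norm_sq_measure n. 0 \<le> x"
proof (cases "n = 0")
  case True
  have "AE x in distr (count_space {()}) borel (\<lambda>_. 0 :: real). 0 \<le> x"
    by (subst AE_distr_iff) auto
  then show ?thesis unfolding norm_sq_measure_def if_P[OF True] .
next
  case False
  then show ?thesis
    unfolding norm_sq_measure_def if_not_P[OF False] by (subst AE_density) (auto simp: indicator_def)
qed

text \<open>Polar coordinates in \<open>X\<close> and \<open>Y\<close>, then Fubini to bring the
  integration over \<open>z\<close> outside.\<close>

lemma nn_integral_sphere_fibre:
  assumes H [measurable]: "H \<in> borel_measurable borel"
  shows "(\<integral>\<^sup>+ p. H (snd p) \<partial>sphere_measure) = ennreal (2 * R) * (\<integral>\<^sup>+ z. fibre z * (ennreal (exp (z - Q * z)) * H z) \<partial>lborel)"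
proof -
  define E where "E = (\<lambda>a. ennreal (exp (- Q * ln a)) * H (ln a))"
  have Em [measurable]: "E \<in> borel_measurable borel" unfolding E_def by measurable
  let ?A = "\<lambda>x. R\<^sup>2 - C * x" and ?a = "\<lambda>x. 2 * C - 1 - x / 4"
  let ?G = "\<lambda>x y. ennreal (R / sqrt (?A x - y)) * (E (?a x + 1 * sqrt (?A x - y)) + E (?a x + - 1 * sqrt (?A x - y))) * indicator {..<?A x} y"
  let ?W = "\<lambda>x z. (if 0 < dd x z then ennreal (norm_sq_density kI (dd x z)) else 0) * (ennreal (exp (z - Q * z)) * H z)"
  interpret m: sigma_finite_measure "norm_sq_measure mI" by (rule sigma_finite_norm_sq_measure)
  interpret p: pair_sigma_finite "norm_sq_measure mI" lborel ..
  have Gm: "(\<lambda>(x, y). ?G x y) \<in> borel_measurable (borel \<Otimes>\<^sub>M borel)"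
  proof -
    have "(\<lambda>(x, y). ennreal (R / sqrt (?A x - y)) * (E (?a x + 1 * sqrt (?A x - y)) + E (?a x + - 1 * sqrt (?A x - y))) * (if y < ?A x then 1 else 0)) \<in> borel_measurable (borel \<Otimes>\<^sub>M borel)"
      by measurable
    then show ?thesis by (simp add: indicator_def of_bool_def)
  qed
  have "(\<integral>\<^sup>+ p. H (snd p) \<partial>sphere_measure) = (\<integral>\<^sup>+ w. ?G (restr I w \<bullet> restr I w) (restr (- I) w \<bullet> restr (- I) w) \<partial>lborel)"
    unfolding nn_integral_sphere_graph[OF H]
    by (rule nn_integral_cong) (simp add: lv_def sq_def disc_def indicator_def E_def)
  also have "\<dots> = (\<integral>\<^sup>+ x. \<integral>\<^sup>+ y. ?G x y \<partial>norm_sq_measure kI \<partial>norm_sq_measure mI)"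
    by (rule nn_integral_restr_norms[OF Gm])
  also have "\<dots> = (\<integral>\<^sup>+ x. ennreal (2 * R) * (\<integral>\<^sup>+ z. ?W x z \<partial>lborel) \<partial>norm_sq_measure mI)"
    by (rule nn_integral_cong_AE, rule AE_mp[OF AE_norm_sq_measure_nonneg], rule AE_I2, rule impI)
      (simp only: E_def graph_integral_fibre[OF H])
  also have "\<dots> = ennreal (2 * R) * (\<integral>\<^sup>+ x. \<integral>\<^sup>+ z. ?W x z \<partial>lborel \<partial>norm_sq_measure mI)"
    by (rule nn_integral_cmult) measurable
  also have "(\<integral>\<^sup>+ x. \<integral>\<^sup>+ z. ?W x z \<partial>lborel \<partial>norm_sq_measure mI) = (\<integral>\<^sup>+ z. \<integral>\<^sup>+ x. ?W x z \<partial>norm_sq_measure mI \<partial>lborel)"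
    by (rule p.Fubini'[symmetric]) measurable
  also have "\<dots> = (\<integral>\<^sup>+ z. fibre z * (ennreal (exp (z - Q * z)) * H z) \<partial>lborel)"
    unfolding fibre_def by (intro nn_integral_cong nn_integral_multc) measurable
  finally show ?thesis .
qed

lemma density_dd:
  assumes "\<bar>s\<bar> < r"
  shows "norm_sq_density kI (dd (8 * exp (z / 2) * (cosh (s / 2) - cosh (z / 2))) z) =
    norm_sq_density kI 2 * exp (z * (real kI / 2 - 1)) * (cosh r - cosh s) powr (real kI / 2 - 1)"
proof -
  have "cosh \<bar>s\<bar> < cosh r" using assms by (intro cosh_real_strict_mono) simp_all
  then have "(2 * exp z * (cosh r - cosh s)) powr (real kI / 2 - 1) =
      2 powr (real kI / 2 - 1) * exp z powr (real kI / 2 - 1) * (cosh r - cosh s) powr (real kI / 2 - 1)"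
    by (simp add: powr_mult)
  then show ?thesis unfolding dd_eq norm_sq_density_def by (simp add: exp_powr_real)
qed

text \<open>In dimension zero the point mass puts \<open>x = 0\<close>, which is the case
  \<open>s = z\<close> of \<open>dd_eq\<close>.\<close>

lemma fibre_0: assumes "mI = 0"
  shows "fibre z = ennreal (norm_sq_density kI 2 * exp (z * (real kI / 2 - 1)) * (cosh r - cosh z) powr (real kI / 2 - 1)) * indicator {z. \<bar>z\<bar> < r} z"
proof -
  have "fibre z = (if 0 < dd 0 z then ennreal (norm_sq_density kI (dd 0 z)) else 0)"
    unfolding fibre_def assms by (rule nn_integral_norm_sq_measure_0) measurable
  then show ?thesis using dd_pos_iff[of z z] density_dd[of z z] by (simp add: indicator_def)
qed

text \<open>The substitution of \<open>dd_eq\<close> maps \<open>s > |z|\<close> onto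
  \<open>x > 0\<close>, and the condition \<open>dd > 0\<close> becomes \<open>s < r\<close>. The
  arguments 2 and 8 of the densities are the coefficients in front of the two differences of
  cosines.\<close>

lemma fibre_pos: assumes m: "mI \<noteq> 0"
  shows "fibre z = (\<integral>\<^sup>+ s. ennreal (norm_sq_density kI 2 * norm_sq_density mI 8 * 4 * exp (z * (real kI / 2 - 1) + z / 2 + z / 2 * (real mI / 2 - 1))
    * sinh (s / 2) * (cosh r - cosh s) powr (real kI / 2 - 1) * (cosh (s / 2) - cosh (z / 2)) powr (real mI / 2 - 1)) * indicator {\<bar>z\<bar><..<r} s \<partial>lborel)"
proof -
  let ?g = "\<lambda>s. 8 * exp (z / 2) * (cosh (s / 2) - cosh (z / 2))"
  let ?F = "\<lambda>s. ennreal (norm_sq_density kI 2 * norm_sq_density mI 8 * 4 * exp (z * (real kI / 2 - 1) + z / 2 + z / 2 * (real mI / 2 - 1))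
    * sinh (s / 2) * (cosh r - cosh s) powr (real kI / 2 - 1) * (cosh (s / 2) - cosh (z / 2)) powr (real mI / 2 - 1))"
  let ?S = "{\<bar>z\<bar><..}"
  have pos: "0 < ?g s" if "s \<in> ?S" for s
  proof -
    have "cosh \<bar>z / 2\<bar> < cosh (s / 2)" using that by (intro cosh_real_strict_mono) auto
    then have "0 < cosh (s / 2) - cosh (z / 2)" by (simp only: cosh_real_abs diff_gt_0_iff_gt)
    then show ?thesis by (intro mult_pos_pos) simp_all
  qed
  have img: "?g ` ?S = {0<..}"
  proof
    show "?g ` ?S \<subseteq> {0<..}" using pos by blast
    show "{0<..} \<subseteq> ?g ` ?S"
    proof
      fix x :: real assume x: "x \<in> {0<..}"
      define y where "y = cosh (z / 2) + x / (8 * exp (z / 2))"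
      have y: "cosh (z / 2) < y" using x by (simp add: y_def)
      then have y1: "1 \<le> y" using cosh_real_ge_1[of "z / 2"] by linarith
      have "cosh \<bar>z / 2\<bar> < cosh (arcosh y)" unfolding cosh_real_abs using y y1 by simp
      then have "\<bar>z / 2\<bar> < arcosh y" using y1 by (subst (asm) cosh_real_nonneg_less_iff) simp_all
      moreover have "?g (2 * arcosh y) = x" using y1 by (simp add: y_def)
      ultimately show "x \<in> ?g ` ?S" by (intro image_eqI[of _ _ "2 * arcosh y"]) simp_all
    qed
  qed
  have "fibre z = (\<integral>\<^sup>+ x. ennreal (norm_sq_density mI x) * (if 0 < dd x z then ennreal (norm_sq_density kI (dd x z)) else 0) * indicator (?g ` ?S) x \<partial>lborel)"
    unfolding fibre_def norm_sq_measure_def img using m by (simp add: nn_integral_density mult_ac)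
  also have "\<dots> = (\<integral>\<^sup>+ s. ennreal \<bar>4 * exp (z / 2) * sinh (s / 2)\<bar> * (ennreal (norm_sq_density mI (?g s)) * (if 0 < dd (?g s) z then ennreal (norm_sq_density kI (dd (?g s) z)) else 0)) * indicator ?S s \<partial>lborel)"
  proof (rule nn_integral_change_of_variables_1)
    show "(?g has_real_derivative 4 * exp (z / 2) * sinh (s / 2)) (at s within ?S)" for s
      by (rule derivative_eq_intros refl | simp)+
    show "inj_on ?g ?S"
    proof (rule inj_onI)
      fix s t assume st: "s \<in> ?S" "t \<in> ?S" "?g s = ?g t"
      then have "cosh (s / 2) = cosh (t / 2)" by simp
      moreover have "0 \<le> s / 2" "0 \<le> t / 2" using st(1,2) by auto
      ultimately show "s = t" using arcosh_cosh_real[of "s / 2"] arcosh_cosh_real[of "t / 2"] by simp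
    qed
    show "?g ` ?S \<in> sets borel" unfolding img by simp
  qed measurable
  also have "\<dots> = (\<integral>\<^sup>+ s. ?F s * indicator {\<bar>z\<bar><..<r} s \<partial>lborel)"
  proof (rule nn_integral_cong)
    fix s
    show "ennreal \<bar>4 * exp (z / 2) * sinh (s / 2)\<bar> * (ennreal (norm_sq_density mI (?g s)) * (if 0 < dd (?g s) z then ennreal (norm_sq_density kI (dd (?g s) z)) else 0)) * indicator ?S s =
      ?F s * indicator {\<bar>z\<bar><..<r} s"
    proof (cases "\<bar>z\<bar> < s \<and> s < r")
      case True
      then have s: "0 < s" "\<bar>s\<bar> < r" by auto
      have gp: "0 < cosh (s / 2) - cosh (z / 2)" using pos[of s] True by (simp add: zero_less_mult_iff)
      have g: "norm_sq_density mI (?g s) = norm_sq_density mI 8 * exp (z / 2 * (real mI / 2 - 1)) * (cosh (s / 2) - cosh (z / 2)) powr (real mI / 2 - 1)"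
        using gp unfolding norm_sq_density_def by (simp add: powr_mult exp_powr_real)
      have "ennreal \<bar>4 * exp (z / 2) * sinh (s / 2)\<bar> * (ennreal (norm_sq_density mI (?g s)) * ennreal (norm_sq_density kI (dd (?g s) z))) =
          ennreal (4 * exp (z / 2) * sinh (s / 2) * (norm_sq_density mI (?g s) * norm_sq_density kI (dd (?g s) z)))"
        using s by (simp add: ennreal_mult norm_sq_density_nonneg)
      also have "\<dots> = ?F s"
        unfolding g density_dd[OF s(2)] exp_add by (rule arg_cong[of _ _ ennreal]) (simp only: mult_ac)
      finally show ?thesis using True dd_pos_iff[of z s] s by (simp add: indicator_def)
    next
      case False
      then show ?thesis using dd_pos_iff[of z s] by (auto simp: indicator_def)
    qed
  qed
  finally show ?thesis .
qed

end

lemma indicator_mult_cong: "(t \<in> S \<Longrightarrow> a = c * b) \<Longrightarrow> a * indicator S t = c * (b * indicator S t :: ennreal)"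
  by (cases "t \<in> S") (simp_all add: mult.assoc)

lemma ennreal_mult2: "0 \<le> a \<Longrightarrow> 0 \<le> b \<Longrightarrow> ennreal a * (ennreal b * ennreal c) = ennreal (a * (b * c))"
  by (simp add: ennreal_mult')

section \<open>The two nested integrals and the spherical mean\<close>

context damek_ricci_sphere begin

text \<open>For \<open>m > 0\<close> the factor \<open>sinh (t / 2)\<close> of
  \<open>d (cosh (t / 2))\<close> cancels the division by it and only \<open>1 / 2\<close> is left,
  hence the factor 2. For \<open>m = 0\<close> the inner transform is the identity.\<close>

lemma inner_integral:
  fixes f :: "real \<Rightarrow> real"
  assumes f: "continuous_on UNIV f" "\<And>x. 0 \<le> f x" and s: "0 < s"
  obtains p where "0 \<le> p" "of_real p = rl_state (1 / 2) mI (ek 0 mI (abel_inner (\<lambda>x. of_real (f x)))) s"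
    "mI = 0 \<Longrightarrow> p = inverse (sinh (s / 2)) * f s"
    "mI \<noteq> 0 \<Longrightarrow> (\<integral>\<^sup>+ t. ennreal ((cosh (s / 2) - cosh (t / 2)) powr (real mI / 2 - 1) * f t) * indicator {0<..<s} t \<partial>lborel) =
      ennreal (2 * (Gamma (real mI / 2) * 2 powr (real mI / 2) * p))"
proof (cases "mI = 0")
  case True
  show ?thesis
  proof (rule that)
    show "complex_of_real (inverse (sinh (s / 2)) * f s) = rl_state (1 / 2) mI (ek 0 mI (abel_inner (\<lambda>x. of_real (f x)))) s"
      unfolding True by (simp add: abel_inner_state[OF s])
  qed (use True f(2) s in auto)
next
  case False
  let ?h = "\<lambda>t. ennreal (1 / 2 * sinh (1 / 2 * t) * (cosh (1 / 2 * s) - cosh (1 / 2 * t)) powr (real mI / 2 - 1) * (inverse (sinh (t / 2)) * f t))"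
  let ?k = "\<lambda>t. ennreal ((cosh (s / 2) - cosh (t / 2)) powr (real mI / 2 - 1) * f t)"
  let ?g = "\<lambda>x. complex_of_real (f x)"
  have g: "continuous_on UNIV ?g" by (intro continuous_intros f)
  have m: "0 < mI" using False unfolding neq0_conv .
  have "of_real (inverse (sinh (t / 2)) * f t) = rl_state (1 / 2) 0 (abel_inner ?g) t" if "0 < t" for t
    using abel_inner_state[OF that, of ?g] by simp
  then obtain q where q: "0 \<le> q" "of_real q = rl_state (1 / 2) (0 + mI) (ek 0 mI (abel_inner ?g)) s"
    "(\<integral>\<^sup>+ t. ?h t * indicator {0<..<s} t \<partial>lborel) =
      ennreal (Gamma (real mI / 2) * 2 powr (real mI / 2) * q)"
    using nn_integral_rl[OF abel_inner_continuous[OF g] _ s m, of "1 / 2" "\<lambda>t. inverse (sinh (t / 2)) * f t" 0] f(2) by auto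
  have [measurable]: "f \<in> borel_measurable borel" using f(1) by (rule borel_measurable_continuous_onI)
  have "(\<integral>\<^sup>+ t. ?k t * indicator {0<..<s} t \<partial>lborel) =
      (\<integral>\<^sup>+ t. 2 * (?h t * indicator {0<..<s} t) \<partial>lborel)"
  proof (rule nn_integral_cong)
    fix t
    have "?k t =
        2 * ?h t" if "t \<in> {0<..<s}"
    proof -
      have nz: "sinh (t / 2) \<noteq> 0" using that by simp
      have "2 * (1 / 2 * X * b * (inverse X * y)) = b * y" if "X \<noteq> 0" for X b y :: real using that by simp
      note e = this[OF nz]
      have two: "2 * ennreal Y = ennreal (2 * Y)" for Y using ennreal_mult'[of 2 Y] by simp
      have h: "1 / 2 * x = x / 2" for x :: real by simp
      have "?k t =
          2 * ennreal (1 / 2 * sinh (t / 2) * (cosh (s / 2) - cosh (t / 2)) powr (real mI / 2 - 1) * (inverse (sinh (t / 2)) * f t))"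
        unfolding two e ..
      then show ?thesis unfolding h .
    qed
    then show "?k t * indicator {0<..<s} t =
        2 * (?h t * indicator {0<..<s} t)"
      by (rule indicator_mult_cong)
  qed
  also have "\<dots> = 2 * ennreal (Gamma (real mI / 2) * 2 powr (real mI / 2) * q)"
    unfolding q(3)[symmetric] by (rule nn_integral_cmult) measurable
  also have "\<dots> = ennreal (2 * (Gamma (real mI / 2) * 2 powr (real mI / 2) * q))"
    by (simp add: ennreal_mult')
  finally show ?thesis using q(1,2) False by (intro that[of q]) auto
qed

text \<open>Tonelli on \<open>|z| < s < r\<close> if \<open>m > 0\<close>: by evenness the integral
  over \<open>z\<close> is twice the inner transform's integral over \<open>0 < z < s\<close>, and
  the integral over \<open>s\<close> is the outer one, since
  \<open>sinh s / cosh (s / 2) = 2 * sinh (s / 2)\<close>. For \<open>m = 0\<close> a single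
  integral is left, with \<open>s = |z|\<close>.\<close>

lemma nn_integral_sphere_abel:
  fixes f :: "real \<Rightarrow> real"
  assumes f: "continuous_on UNIV f" "\<And>x. 0 \<le> f x" "\<And>x. f (- x) = f x"
  obtains q where "0 \<le> q" "of_real q = rl_state 1 (mI + kI) (ek mI kI (abel_outer mI (\<lambda>x. of_real (f x)))) r"
    "(\<integral>\<^sup>+ p. ennreal (exp (Q / 2 * snd p) * f (snd p)) \<partial>sphere_measure) =
      ennreal (R * pi powr (real (mI + kI) / 2) * 2 powr (2 * real mI + real kI) * q)"
proof -
  let ?g = "\<lambda>x. complex_of_real (f x)"
  have g: "continuous_on UNIV ?g" by (intro continuous_intros f)
  have fm [measurable]: "f \<in> borel_measurable borel" using f(1) by (rule borel_measurable_continuous_onI)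
  let ?e = "\<lambda>z. exp (z * (real kI / 2 - 1) + z / 2 + z / 2 * (real mI / 2 - 1))"
  let ?gk = "Gamma (real kI / 2) * 2 powr (real kI / 2)"
  let ?gm = "Gamma (real mI / 2) * 2 powr (real mI / 2)"
  let ?a = "\<lambda>s. (cosh r - cosh s) powr (real kI / 2 - 1)"
  let ?b = "\<lambda>s z. (cosh (s / 2) - cosh (z / 2)) powr (real mI / 2 - 1)"
  \<comment> \<open>A real part, which makes measurability in \<open>s\<close> immediate; for
    \<open>s > 0\<close> the values are real by \<open>inner_integral\<close>.\<close>
  define p where "p = (\<lambda>s. Re (rl_state (1 / 2) mI (ek 0 mI (abel_inner ?g)) s))"
  have pm [measurable]: "p \<in> borel_measurable borel"
  proof -
    have "continuous_on UNIV (ek 0 mI (abel_inner ?g))" by (intro ek_continuous abel_inner_continuous g)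
    then have [measurable]: "ek 0 mI (abel_inner ?g) \<in> borel_measurable borel" by (rule borel_measurable_continuous_onI)
    show ?thesis unfolding p_def rl_state_def by measurable
  qed
  have p: "0 \<le> p s" "of_real (p s) = rl_state (1 / 2) mI (ek 0 mI (abel_inner ?g)) s"
      "mI = 0 \<Longrightarrow> p s = inverse (sinh (s / 2)) * f s"
      "mI \<noteq> 0 \<Longrightarrow> (\<integral>\<^sup>+ t. ennreal (?b s t * f t) * indicator {0<..<s} t \<partial>lborel) = ennreal (2 * (?gm * p s))"
    if s: "0 < s" for s
  proof -
    obtain v where v: "0 \<le> v" "of_real v = rl_state (1 / 2) mI (ek 0 mI (abel_inner ?g)) s"
      "mI = 0 \<Longrightarrow> v = inverse (sinh (s / 2)) * f s"
      "mI \<noteq> 0 \<Longrightarrow> (\<integral>\<^sup>+ t. ennreal (?b s t * f t) * indicator {0<..<s} t \<partial>lborel) = ennreal (2 * (?gm * v))"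
      using inner_integral[OF f(1,2) s] by blast
    have "p s = v" unfolding p_def v(2)[symmetric] by simp
    then show "0 \<le> p s" "of_real (p s) = rl_state (1 / 2) mI (ek 0 mI (abel_inner ?g)) s"
      "mI = 0 \<Longrightarrow> p s = inverse (sinh (s / 2)) * f s"
      "mI \<noteq> 0 \<Longrightarrow> (\<integral>\<^sup>+ t. ennreal (?b s t * f t) * indicator {0<..<s} t \<partial>lborel) = ennreal (2 * (?gm * p s))"
      using v by simp_all
  qed
  have hs: "of_real (inverse (cosh (s / 2)) * p s) = rl_state 1 mI (abel_outer mI ?g) s" if "0 < s" for s
    unfolding abel_outer_state[OF that] p(2)[OF that, symmetric] by simp
  have hn: "0 \<le> inverse (cosh (s / 2)) * p s" if "0 < s" for s
    using p(1)[OF that] cosh_real_nonneg[of "s / 2"] by (intro mult_nonneg_nonneg) auto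
  obtain q where q: "0 \<le> q" "of_real q = rl_state 1 (mI + kI) (ek mI kI (abel_outer mI ?g)) r"
    "(\<integral>\<^sup>+ s. ennreal (1 * sinh (1 * s) * (cosh (1 * r) - cosh (1 * s)) powr (real kI / 2 - 1) * (inverse (cosh (s / 2)) * p s)) * indicator {0<..<r} s \<partial>lborel) =
      ennreal (?gk * q)"
    using nn_integral_rl[OF abel_outer_continuous[OF g] _ r_pos kI_pos, of 1 "\<lambda>s. inverse (cosh (s / 2)) * p s" mI] hs hn by auto
  have d: "sinh s * inverse (cosh (s / 2)) = 2 * sinh (s / 2)" for s :: real
    using sinh_double[of "s / 2"] by (simp add: field_simps)
  have q3: "(\<integral>\<^sup>+ s. ennreal (2 * sinh (s / 2) * ?a s * p s) * indicator {0<..<r} s \<partial>lborel) = ennreal (?gk * q)"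
    unfolding q(3)[symmetric] mult_1 d[symmetric] by (simp only: mult_ac)
  have Gk: "0 < Gamma (real kI / 2)" using kI_pos by (intro Gamma_real_pos) simp
  define d2 where "d2 = norm_sq_density kI 2"
  have d2: "0 \<le> d2" by (simp add: d2_def norm_sq_density_nonneg)
  have d2': "d2 * Gamma (real kI / 2) = pi powr (real kI / 2) * 2 powr (real kI / 2 - 1)"
    using Gk by (simp add: d2_def norm_sq_density_def)
  let ?H = "\<lambda>z. ennreal (exp (Q / 2 * z) * f z)"
  let ?T = "\<integral>\<^sup>+ z. fibre z * (ennreal (exp (z - Q * z)) * ?H z) \<partial>lborel"
  have "(\<integral>\<^sup>+ p. ?H (snd p) \<partial>sphere_measure) = ennreal (2 * R) * ?T"
    by (rule nn_integral_sphere_fibre) measurable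
  also have "\<dots> = ennreal (R * pi powr (real (mI + kI) / 2) * 2 powr (2 * real mI + real kI) * q)"
  proof (cases "mI = 0")
    case m: True
    have Q: "Q = real kI" by (simp add: Q_def m)
    have "fibre z * (ennreal (exp (z - Q * z)) * ?H z) = ennreal (d2 / 2 * (2 * ?a z * f z)) * indicator {z. \<bar>z\<bar> < r} z" for z
    proof -
      have "ennreal (d2 * exp (z * (real kI / 2 - 1)) * ?a z) * (ennreal (exp (z - Q * z)) * ?H z) =
          ennreal (d2 * exp (z * (real kI / 2 - 1)) * ?a z * (exp (z - Q * z) * (exp (Q / 2 * z) * f z)))"
        using d2 f(2) by (simp add: ennreal_mult)
      also have "d2 * exp (z * (real kI / 2 - 1)) * ?a z * (exp (z - Q * z) * (exp (Q / 2 * z) * f z)) =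
          exp (z * (real kI / 2 - 1) + (z - Q * z) + Q / 2 * z) * (d2 * ?a z * f z)"
        unfolding exp_add by (simp only: mult_ac)
      also have "z * (real kI / 2 - 1) + (z - Q * z) + Q / 2 * z = 0" unfolding Q by (simp add: field_simps)
      finally have "ennreal (d2 * exp (z * (real kI / 2 - 1)) * ?a z) * (ennreal (exp (z - Q * z)) * ?H z) = ennreal (d2 / 2 * (2 * ?a z * f z))" by (simp add: mult.assoc)
      then show ?thesis unfolding fibre_0[OF m] d2_def[symmetric] by (simp add: indicator_def)
    qed
    then have "?T = (\<integral>\<^sup>+ z. ennreal (d2 / 2 * (2 * ?a z * f z)) * indicator {z. \<bar>z\<bar> < r} z \<partial>lborel)"
      by simp
    also have "\<dots> = 2 * (\<integral>\<^sup>+ z. ennreal (d2 / 2 * (2 * ?a z * f z)) * indicator {0<..<r} z \<partial>lborel)"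
      by (rule nn_integral_symmetric_interval) (measurable, simp add: f(3))
    also have "(\<integral>\<^sup>+ z. ennreal (d2 / 2 * (2 * ?a z * f z)) * indicator {0<..<r} z \<partial>lborel) =
        (\<integral>\<^sup>+ s. ennreal (d2 / 2) * (ennreal (2 * sinh (s / 2) * ?a s * p s) * indicator {0<..<r} s) \<partial>lborel)"
    proof (rule nn_integral_cong)
      fix s
      have "ennreal (d2 / 2 * (2 * ?a s * f s)) = ennreal (d2 / 2) * ennreal (2 * sinh (s / 2) * ?a s * p s)" if "s \<in> {0<..<r}"
      proof -
        have "0 < s" using that by simp
        then have e: "2 * ?a s * f s = 2 * sinh (s / 2) * ?a s * p s" using p(3)[OF _ m, of s] by simp
        show ?thesis unfolding e using d2 by (intro ennreal_mult') simp
      qed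
      then show "ennreal (d2 / 2 * (2 * ?a s * f s)) * indicator {0<..<r} s = ennreal (d2 / 2) * (ennreal (2 * sinh (s / 2) * ?a s * p s) * indicator {0<..<r} s)"
        by (rule indicator_mult_cong)
    qed
    also have "\<dots> = ennreal (d2 / 2) * ennreal (?gk * q)"
      unfolding q3[symmetric] by (rule nn_integral_cmult) measurable
    finally have "ennreal (2 * R) * ?T =
        ennreal (2 * R) * (ennreal 2 * (ennreal (d2 / 2) * ennreal (?gk * q)))" by simp
    also have "\<dots> = ennreal (2 * R * (2 * (d2 / 2 * (?gk * q))))"
      using R_pos d2 by (subst ennreal_mult2, simp, simp, subst ennreal_mult'[symmetric]) simp_all
    also have "2 * R * (2 * (d2 / 2 * (?gk * q))) = R * (d2 * Gamma (real kI / 2)) * (2 * 2 powr (real kI / 2)) * q" by simp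
    also have "\<dots> = R * pi powr (real kI / 2) * (2 * 2 powr (real kI / 2 - 1) * 2 powr (real kI / 2)) * q" unfolding d2' by simp
    also have "2 * 2 powr (real kI / 2 - 1) * 2 powr (real kI / 2) = 2 powr real kI"
    proof -
      have "2 * 2 powr (real kI / 2 - 1) * 2 powr (real kI / 2) = 2 powr 1 * 2 powr (real kI / 2 - 1) * 2 powr (real kI / 2)" by simp
      then show ?thesis unfolding powr_add[symmetric] by simp
    qed
    finally show ?thesis by (simp add: m)
  next
    case m: False
    have m0: "0 < mI" using m unfolding neq0_conv .
    then have Gm: "0 < Gamma (real mI / 2)" by (intro Gamma_real_pos) simp
    define d8 where "d8 = norm_sq_density mI 8"
    have d8: "0 \<le> d8" by (simp add: d8_def norm_sq_density_nonneg)
    have d8': "d8 * Gamma (real mI / 2) = pi powr (real mI / 2) * 8 powr (real mI / 2 - 1)"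
      using Gm by (simp add: d8_def norm_sq_density_def)
    define K where "K = 2 * d2 * d8"
    have K: "0 \<le> K" using d2 d8 by (simp add: K_def)
    let ?F = "\<lambda>s. ennreal (K * (2 * sinh (s / 2) * ?a s))"
    let ?V = "\<lambda>z s. (if \<bar>z\<bar> < s \<and> s < r then ?F s * ennreal (?b s z * f z) else 0)"
    let ?U = "\<lambda>z s. d2 * d8 * 4 * ?e z * sinh (s / 2) * ?a s * ?b s z"
    have "fibre z * (ennreal (exp (z - Q * z)) * ?H z) = (\<integral>\<^sup>+ s. ?V z s \<partial>lborel)" for z
    proof -
      have "fibre z * (ennreal (exp (z - Q * z)) * ?H z) = (\<integral>\<^sup>+ s. ennreal (?U z s) * indicator {\<bar>z\<bar><..<r} s * (ennreal (exp (z - Q * z)) * ?H z) \<partial>lborel)"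
        unfolding fibre_pos[OF m] d2_def[symmetric] d8_def[symmetric] by (rule nn_integral_multc[symmetric]) measurable
      also have "\<dots> = (\<integral>\<^sup>+ s. ?V z s \<partial>lborel)"
      proof (rule nn_integral_cong)
        fix s
        show "ennreal (?U z s) * indicator {\<bar>z\<bar><..<r} s * (ennreal (exp (z - Q * z)) * ?H z) = ?V z s"
        proof (cases "\<bar>z\<bar> < s \<and> s < r")
          case True
          then have "0 \<le> s / 2" using abs_ge_zero[of z] by linarith
          then have s: "0 \<le> sinh (s / 2)" by simp
          have "ennreal (?U z s) * (ennreal (exp (z - Q * z)) * ?H z) =
              ennreal (?U z s * (exp (z - Q * z) * (exp (Q / 2 * z) * f z)))"
            using f(2) s d2 d8 by (intro ennreal_mult2 mult_nonneg_nonneg) simp_all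
          also have "?U z s * (exp (z - Q * z) * (exp (Q / 2 * z) * f z)) =
              exp (z * (real kI / 2 - 1) + z / 2 + z / 2 * (real mI / 2 - 1) + (z - Q * z) + Q / 2 * z) * (K * (2 * sinh (s / 2) * ?a s) * (?b s z * f z))"
          proof -
            have "d2 * d8 * 4 * X * S * A * B * (Y * (Z * f z)) = X * Y * Z * (K * (2 * S * A) * (B * f z))" for X Y Z S A B
              by (simp add: K_def)
            then show ?thesis unfolding exp_add[of _ "z - Q * z"] exp_add[of _ "Q / 2 * z"] by blast
          qed
          \<comment> \<open>The purpose of the weight \<open>exp (Q / 2 * z)\<close>: it cancels all
            powers of \<open>exp z\<close> that come from the norm densities, the substitutions and
            the surface density.\<close>
          also have "z * (real kI / 2 - 1) + z / 2 + z / 2 * (real mI / 2 - 1) + (z - Q * z) + Q / 2 * z = 0"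
            by (simp add: Q_def field_simps)
          also have "ennreal (exp 0 * (K * (2 * sinh (s / 2) * ?a s) * (?b s z * f z))) = ?F s * ennreal (?b s z * f z)"
            unfolding exp_zero mult_1 using K s by (intro ennreal_mult' mult_nonneg_nonneg) simp_all
          finally show ?thesis using True by simp
        next
          case False
          then show ?thesis by (auto simp: indicator_def)
        qed
      qed
      finally show ?thesis .
    qed
    then have "?T = (\<integral>\<^sup>+ z. \<integral>\<^sup>+ s. ?V z s \<partial>lborel \<partial>lborel)" by simp
    also have "\<dots> = (\<integral>\<^sup>+ s. \<integral>\<^sup>+ z. ?V z s \<partial>lborel \<partial>lborel)"
      by (rule lborel_pair.Fubini'[symmetric]) measurable
    also have "\<dots> = (\<integral>\<^sup>+ s. ennreal (K * (4 * ?gm)) * (ennreal (2 * sinh (s / 2) * ?a s * p s) * indicator {0<..<r} s) \<partial>lborel)"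
    proof (rule nn_integral_cong)
      fix s
      show "(\<integral>\<^sup>+ z. ?V z s \<partial>lborel) = ennreal (K * (4 * ?gm)) * (ennreal (2 * sinh (s / 2) * ?a s * p s) * indicator {0<..<r} s)"
      proof (cases "s \<in> {0<..<r}")
        case True
        then have s: "0 < s" "0 \<le> sinh (s / 2)" by simp_all
        have "(\<integral>\<^sup>+ z. ?V z s \<partial>lborel) = (\<integral>\<^sup>+ z. ?F s * (ennreal (?b s z * f z) * indicator {z. \<bar>z\<bar> < s} z) \<partial>lborel)"
          using True by (intro nn_integral_cong) (simp add: indicator_def)
        also have "\<dots> = ?F s * (\<integral>\<^sup>+ z. ennreal (?b s z * f z) * indicator {z. \<bar>z\<bar> < s} z \<partial>lborel)"
          by (rule nn_integral_cmult) measurable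
        also have "(\<integral>\<^sup>+ z. ennreal (?b s z * f z) * indicator {z. \<bar>z\<bar> < s} z \<partial>lborel) = 2 * (\<integral>\<^sup>+ z. ennreal (?b s z * f z) * indicator {0<..<s} z \<partial>lborel)"
          by (rule nn_integral_symmetric_interval) (measurable, simp add: f(3))
        also have "\<dots> = ennreal 2 * ennreal (2 * (?gm * p s))"
          unfolding p(4)[OF s(1) m] by simp
        also have "?F s * \<dots> = ennreal (K * (2 * sinh (s / 2) * ?a s) * (2 * (2 * (?gm * p s))))"
          using K s(2) by (intro ennreal_mult2 mult_nonneg_nonneg) simp_all
        also have "K * (2 * sinh (s / 2) * ?a s) * (2 * (2 * (?gm * p s))) =
            K * (4 * ?gm) * (2 * sinh (s / 2) * ?a s * p s)" by simp
        also have "ennreal \<dots> = ennreal (K * (4 * ?gm)) * ennreal (2 * sinh (s / 2) * ?a s * p s)"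
          using K Gm by (intro ennreal_mult' mult_nonneg_nonneg) simp_all
        finally show ?thesis using True by simp
      next
        case False
        then have "?V z s = 0" for z by auto
        then show ?thesis using False by simp
      qed
    qed
    also have "\<dots> = ennreal (K * (4 * ?gm)) * ennreal (?gk * q)"
      unfolding q3[symmetric] by (rule nn_integral_cmult) measurable
    finally have "ennreal (2 * R) * ?T =
        ennreal (2 * R) * (ennreal (K * (4 * ?gm)) * ennreal (?gk * q))" by simp
    also have "\<dots> = ennreal (2 * R * (K * (4 * ?gm) * (?gk * q)))"
      using R_pos K Gm by (intro ennreal_mult2 mult_nonneg_nonneg) simp_all
    also have "2 * R * (K * (4 * ?gm) * (?gk * q)) =
        R * (16 * (d8 * Gamma (real mI / 2)) * (d2 * Gamma (real kI / 2)) * 2 powr (real mI / 2) * 2 powr (real kI / 2)) * q" by (simp add: K_def)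
    also have "16 * (d8 * Gamma (real mI / 2)) * (d2 * Gamma (real kI / 2)) * 2 powr (real mI / 2) * 2 powr (real kI / 2) =
        pi powr (real (mI + kI) / 2) * 2 powr (2 * real mI + real kI)"
    proof -
      have "(8 :: real) powr (real mI / 2 - 1) = (2 powr 3) powr (real mI / 2 - 1)" by simp
      then have 8: "(8 :: real) powr (real mI / 2 - 1) = 2 powr (3 * (real mI / 2 - 1))" unfolding powr_powr .
      have 16: "(16 :: real) = 2 powr 4" by simp
      have "16 * (d8 * Gamma (real mI / 2)) * (d2 * Gamma (real kI / 2)) * 2 powr (real mI / 2) * 2 powr (real kI / 2) =
          (pi powr (real mI / 2) * pi powr (real kI / 2)) * (2 powr 4 * 2 powr (3 * (real mI / 2 - 1)) * 2 powr (real kI / 2 - 1) * 2 powr (real mI / 2) * 2 powr (real kI / 2))"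
        unfolding d2' d8' 8 16 by (simp only: mult_ac)
      also have "\<dots> = pi powr (real mI / 2 + real kI / 2) * 2 powr (4 + 3 * (real mI / 2 - 1) + (real kI / 2 - 1) + real mI / 2 + real kI / 2)"
        unfolding powr_add[symmetric] ..
      finally show ?thesis by (simp add: add_divide_distrib algebra_simps)
    qed
    finally show ?thesis by (simp only: mult.assoc)
  qed
  finally show ?thesis using q(1,2) that by blast
qed

text \<open>Reconciles the total area with the normalization of \<open>abel_op\<close>:
  \<open>Gamma N\<close> in the area cancels against the one in \<open>c2\<close>, and the remaining
  powers of 2 and \<open>pi\<close> are those found by the direct integration.\<close>

lemma sphere_area_constant:
  assumes "of_real (sinh (r / 2) ^ mI * sinh r ^ (kI - 1)) * L =
    of_real (c2 (mI + kI + 1) / 2 * 2 powr (real mI / 2)) * (of_real (2 powr (real kI / 2)) * (of_real q :: complex))"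
  shows "of_real (sphere_area mI kI r) * L = of_real (R * pi powr (real (mI + kI) / 2) * 2 powr (2 * real mI + real kI) * q)"
proof -
  define N where "N = real (mI + kI + 1) / 2"
  have G: "0 < Gamma N" by (rule Gamma_real_pos) (simp add: N_def)
  obtain l where l: "kI = Suc l" using kI_pos gr0_conv_Suc by auto
  have pN: "pi powr N = pi powr (real (mI + kI) / 2) * sqrt pi"
  proof -
    have "N = real (mI + kI) / 2 + 1 / 2" by (simp add: N_def add_divide_distrib)
    then show ?thesis by (simp add: powr_add powr_half_sqrt)
  qed
  have "sphere_area mI kI r = 2 ^ (mI + 1) * pi powr N / Gamma N * sinh r * (sinh (r / 2) ^ mI * sinh r ^ (kI - 1))"
    by (simp add: sphere_area_def N_def l)
  then have "of_real (sphere_area mI kI r) * L = of_real (2 ^ (mI + 1) * pi powr N / Gamma N * sinh r) * (of_real (sinh (r / 2) ^ mI * sinh r ^ (kI - 1)) * L)"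
    by (simp only: of_real_mult mult.assoc)
  also have "\<dots> = of_real (2 ^ (mI + 1) * pi powr N / Gamma N * sinh r * (c2 (mI + kI + 1) / 2 * 2 powr (real mI / 2) * (2 powr (real kI / 2) * q)))"
    unfolding assms by (simp only: of_real_mult mult.assoc)
  also have "2 ^ (mI + 1) * pi powr N / Gamma N * sinh r * (c2 (mI + kI + 1) / 2 * 2 powr (real mI / 2) * (2 powr (real kI / 2) * q)) =
      R * pi powr (real (mI + kI) / 2) * 2 powr (2 * real mI + real kI) * q"
  proof -
    have c: "c2 (mI + kI + 1) = 2 powr (real (mI + kI) / 2) * Gamma N / sqrt pi" by (simp add: c2_def N_def)
    have "2 ^ (mI + 1) * pi powr N / Gamma N * sinh r * (c2 (mI + kI + 1) / 2 * 2 powr (real mI / 2) * (2 powr (real kI / 2) * q)) =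
        sinh r * pi powr (real (mI + kI) / 2) * (2 ^ mI * 2 powr (real (mI + kI) / 2) * 2 powr (real mI / 2) * 2 powr (real kI / 2)) * q"
      unfolding c pN using G by simp
    also have "2 ^ mI * 2 powr (real (mI + kI) / 2) * 2 powr (real mI / 2) * 2 powr (real kI / 2) = 2 powr (real mI + real (mI + kI) / 2 + real mI / 2 + real kI / 2)"
      unfolding powr_add by (simp add: powr_realpow)
    also have "real mI + real (mI + kI) / 2 + real mI / 2 + real kI / 2 = 2 * real mI + real kI" by (simp add: field_simps)
    finally show ?thesis by (simp add: R_def)
  qed
  finally show ?thesis .
qed

lemma sphere_integral_nonneg:
  fixes f :: "real \<Rightarrow> real"
  assumes f: "continuous_on UNIV f" "\<And>x. 0 \<le> f x" "\<And>x. f (- x) = f x"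
  shows "has_bochner_integral sphere_measure (\<lambda>p. of_real (exp (Q / 2 * snd p)) * complex_of_real (f (snd p)))
    (of_real (sphere_area mI kI r) * abel_op mI kI (\<lambda>x. of_real (f x)) r)"
proof -
  let ?g = "\<lambda>x. complex_of_real (f x)"
  obtain q where q: "0 \<le> q" "of_real q = rl_state 1 (mI + kI) (ek mI kI (abel_outer mI ?g)) r"
    "(\<integral>\<^sup>+ p. ennreal (exp (Q / 2 * snd p) * f (snd p)) \<partial>sphere_measure) =
      ennreal (R * pi powr (real (mI + kI) / 2) * 2 powr (2 * real mI + real kI) * q)"
    using nn_integral_sphere_abel[OF f] .
  have "has_bochner_integral sphere_measure (\<lambda>p. exp (Q / 2 * snd p) * f (snd p)) (R * pi powr (real (mI + kI) / 2) * 2 powr (2 * real mI + real kI) * q)"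
  proof (rule has_bochner_integral_nn_integral[OF _ _ _ q(3)])
    have "continuous_on UNIV (\<lambda>p :: (real^'i) \<times> real. exp (Q / 2 * snd p) * f (snd p))"
      by (intro continuous_intros continuous_on_compose2[OF f(1)]) auto
    then show "(\<lambda>p. exp (Q / 2 * snd p) * f (snd p)) \<in> borel_measurable sphere_measure"
      by (simp add: sphere_measure_def borel_measurable_continuous_onI)
  qed (use f(2) q(1) R_pos in auto)
  from has_bochner_integral_of_real[OF this, where 'a = complex]
  have "has_bochner_integral sphere_measure (\<lambda>p. of_real (exp (Q / 2 * snd p)) * complex_of_real (f (snd p)))
      (of_real (R * pi powr (real (mI + kI) / 2) * 2 powr (2 * real mI + real kI) * q))"
    by (simp only: of_real_mult)
  moreover have "of_real (R * pi powr (real (mI + kI) / 2) * 2 powr (2 * real mI + real kI) * q) = of_real (sphere_area mI kI r) * abel_op mI kI ?g r"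
    by (rule sphere_area_constant[symmetric], unfold q(2), rule abel_op_state) (use kI_pos r_pos in auto)
  ultimately show ?thesis by simp
qed

text \<open>Linearity: the parts \<open>max f 0\<close> and \<open>max (- f) 0\<close> of an even
  real function are even and nonnegative, and real and imaginary parts lead to complex
  functions.\<close>

lemma sphere_integral:
  fixes g :: "real \<Rightarrow> complex"
  assumes g: "continuous_on UNIV g" "\<And>x. g (- x) = g x"
  shows "has_bochner_integral sphere_measure (\<lambda>p. of_real (exp (Q / 2 * snd p)) * g (snd p)) (of_real (sphere_area mI kI r) * abel_op mI kI g r)"
proof -
  define ok where "ok = (\<lambda>g :: real \<Rightarrow> complex. continuous_on UNIV g \<and>
    has_bochner_integral sphere_measure (\<lambda>p. of_real (exp (Q / 2 * snd p)) * g (snd p)) (of_real (sphere_area mI kI r) * abel_op mI kI g r))"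
  have ok_add: "ok (\<lambda>x. g x + h x)" if "ok g" "ok h" for g h
    using that unfolding ok_def
    by (auto intro: continuous_intros simp: abel_op_add distrib_left dest: has_bochner_integral_add)
  have ok_cmult: "ok (\<lambda>x. c * g x)" if "ok g" for g c
  proof -
    have "has_bochner_integral sphere_measure (\<lambda>p. c * (of_real (exp (Q / 2 * snd p)) * g (snd p))) (c * (of_real (sphere_area mI kI r) * abel_op mI kI g r))"
      using that unfolding ok_def by (intro has_bochner_integral_mult_right) auto
    then show ?thesis using that unfolding ok_def abel_op_cmult by (auto intro!: continuous_intros simp: mult_ac)
  qed
  have ok_real: "ok (\<lambda>x. of_real (f x))" if f: "continuous_on UNIV f" "\<And>x. f (- x) = f x" for f :: "real \<Rightarrow> real"
  proof -
    have nn: "ok (\<lambda>x. of_real (h x))" if "continuous_on UNIV h" "\<And>x. 0 \<le> h x" "\<And>x. h (- x) = h x" for h :: "real \<Rightarrow> real"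
      unfolding ok_def using sphere_integral_nonneg[of h] that by (auto intro: continuous_intros)
    have "ok (\<lambda>x. of_real (max (f x) 0))" "ok (\<lambda>x. of_real (max (- f x) 0))"
      by (rule nn; use f in \<open>auto intro: continuous_intros\<close>)+
    then have "ok (\<lambda>x. of_real (max (f x) 0) + (- 1) * of_real (max (- f x) 0))" by (intro ok_add ok_cmult)
    moreover have "complex_of_real (max (f x) 0) + (- 1) * of_real (max (- f x) 0) = of_real (f x)" for x
      by (auto simp: max_def)
    ultimately show ?thesis by simp
  qed
  have "ok (\<lambda>x. of_real (Re (g x)) + \<i> * of_real (Im (g x)))"
    using g by (intro ok_add ok_cmult ok_real) (auto intro: continuous_intros)
  moreover have "of_real (Re (g x)) + \<i> * of_real (Im (g x)) = g x" for x by (rule complex_eq[symmetric])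
  ultimately show ?thesis by (simp add: ok_def)
qed

lemma dual_abel_pos:
  assumes g: "continuous_on UNIV g" "\<And>x. g (- x) = g x"
  shows "dual_abel I br g r = abel_op mI kI g r"
proof -
  let ?F = "\<lambda>p. of_real (exp (Q / 2 * snd p)) * g (snd p)"
  have "- \<Sigma> \<in> null_sets sphere_measure"
    using is_surface_measure_sphere_measure closed_\<Sigma> unfolding is_surface_measure_def by (auto simp: null_sets_def)
  then have ae: "AE p in sphere_measure. p \<notin> - \<Sigma>" by (rule AE_not_in)
  have hb: "has_bochner_integral sphere_measure ?F (of_real (sphere_area mI kI r) * abel_op mI kI g r)"
    by (rule sphere_integral[OF g])
  have m: "?F \<in> borel_measurable sphere_measure" using hb by (rule borel_measurable_has_bochner_integral)
  have "\<Sigma> \<in> sets sphere_measure" using closed_\<Sigma> by (simp add: sphere_measure_def)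
  then have "(\<lambda>p. indicator \<Sigma> p :: real) \<in> borel_measurable sphere_measure" by simp
  from borel_measurable_scaleR[OF this m]
  have "(LINT p|sphere_measure. indicator \<Sigma> p *\<^sub>R ?F p) = (LINT p|sphere_measure. ?F p)"
    using m
  proof (rule integral_cong_AE)
    show "AE p in sphere_measure. indicator \<Sigma> p *\<^sub>R ?F p = ?F p"
      using ae by eventually_elim simp
  qed
  also have "\<dots> = of_real (sphere_area mI kI r) * abel_op mI kI g r" using hb by (rule has_bochner_integral_integral_eq)
  finally have i: "(LINT p:\<Sigma>|sphere_measure. ?F p) = of_real (sphere_area mI kI r) * abel_op mI kI g r"
    unfolding set_lebesgue_integral_def .
  have "0 < sphere_area mI kI r"
    unfolding sphere_area_def using r_pos by (intro mult_pos_pos divide_pos_pos Gamma_real_pos) auto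
  moreover have "dual_abel I br g r = (1 / sphere_area mI kI r) *\<^sub>R (of_real (sphere_area mI kI r) * abel_op mI kI g r)"
    unfolding dual_abel_def Let_def Q_def[symmetric] spherical_mean_def abs_of_pos[OF r_pos] surface_measure_eq
      if_not_P[OF less_imp_neq[OF r_pos, symmetric]] unfolding dr_sphere_eq i ..
  ultimately show ?thesis by (simp add: scaleR_conv_of_real)
qed

end

context damek_ricci begin

lemma ek_even: "(\<And>x. h (- x) = h x) \<Longrightarrow> ek j d h (- r) = ek j d h r"
  by (simp add: ek_def dilate_int_def)

lemma abel_op_even:
  assumes "\<And>x. g (- x) = g x"
  shows "abel_op m k g (- r) = abel_op m k g r"
proof -
  have "abel_inner g (- x) = abel_inner g x" for x by (simp add: abel_inner_def assms)
  then have "abel_outer m g (- x) = abel_outer m g x" for x by (simp add: abel_outer_def ek_even)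
  then show ?thesis by (simp add: abel_op_def ek_even)
qed

theorem dual_abel_eq:
  assumes g: "continuous_on UNIV g" "\<And>x. g (- x) = g x"
  shows "dual_abel I br g r = abel_op (card I) (card (- I)) g r"
proof -
  have k: "1 \<le> card (- I)" using center by (simp add: Suc_le_eq card_gt_0_iff)
  have even: "abel_op (card I) (card (- I)) g (- s) = abel_op (card I) (card (- I)) g s" for s
    by (rule abel_op_even) (use g in auto)
  have pos: "dual_abel I br g s = abel_op (card I) (card (- I)) g s" if "0 < s" for s
  proof -
    interpret damek_ricci_sphere I br s by unfold_locales (rule that)
    show ?thesis by (rule dual_abel_pos[OF g])
  qed
  consider "0 < r" | "r = 0" | "0 < - r" by linarith
  then show ?thesis
  proof cases
    case 2
    then show ?thesis using abel_op_0[OF k] by (simp add: dual_abel_def spherical_mean_def Let_def)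
  next
    case 3
    have "dual_abel I br g r = dual_abel I br g (- r)" by (simp add: dual_abel_def spherical_mean_def Let_def)
    then show ?thesis using pos[OF 3] even[of r] by simp
  qed (rule pos)
qed

end

section \<open>Radial functions\<close>

text \<open>With \<open>u = sqrt t\<close>, the derivative of \<open>h (sqrt t)\<close> is \<open>h' u / (2 * u)\<close>, which for even \<open>h\<close> is again an even smooth
  function of \<open>u\<close>, namely the following integral.\<close>

definition sqrt_deriv :: "(real \<Rightarrow> complex) \<Rightarrow> real \<Rightarrow> complex" where
  "sqrt_deriv h = dilate_int (\<lambda>\<theta>. cos \<theta> / 2) (nth_deriv 2 h)"

lemma fs_boundedE:
  assumes "fs_bounded E T" "compact K"
  obtains N' K' B where "compact K'" "0 \<le> B"
    "\<And>f c. f \<in> E \<Longrightarrow> deriv_bound N' K' c f \<Longrightarrow> deriv_bound N K (B * c) (T f)"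
proof -
  from assms(1)[unfolded fs_bounded_def, rule_format, OF assms(2), of N]
  obtain N' K' B where "compact K'" "0 \<le> B" "\<forall>f\<in>E. \<forall>c. deriv_bound N' K' c f \<longrightarrow> deriv_bound N K (B * c) (T f)"
    by (elim exE conjE)
  then show thesis using that by blast
qed

lemma nth_deriv_parity:
  assumes h: "smooth_on UNIV h" and e: "\<And>x. h (- x) = c * h x"
  shows "nth_deriv 1 h (- x) = - c * nth_deriv 1 h x"
proof -
  have d: "(h has_vector_derivative nth_deriv 1 h x) (at x)" for x
    using has_vector_derivative_iter[OF h, of x 0] by simp
  have "((\<lambda>x. h (- x)) has_vector_derivative - nth_deriv 1 h (- x)) (at x)"
    using vector_diff_chain_at[OF _ d, of "\<lambda>x. - x" "- 1" x] by (simp add: o_def has_vector_derivative_minus)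
  moreover have "((\<lambda>x. h (- x)) has_vector_derivative c * nth_deriv 1 h x) (at x)"
    unfolding e using has_vector_derivative_mult_right[OF d] .
  ultimately have "- nth_deriv 1 h (- x) = c * nth_deriv 1 h x" by (rule vector_derivative_unique_at)
  then show ?thesis by (metis minus_minus mult_minus_left)
qed

lemma nth_deriv_2_even: assumes "h \<in> even_smooth" shows "nth_deriv 2 h \<in> even_smooth" "nth_deriv 1 h 0 = 0"
proof -
  have h: "smooth_on UNIV h" "\<And>x. h (- x) = 1 * h x" using assms by (simp_all add: even_smooth_def)
  have 1: "nth_deriv 1 h (- x) = - 1 * nth_deriv 1 h x" for x by (rule nth_deriv_parity[OF h])
  have "nth_deriv 1 (nth_deriv 1 h) (- x) = - (- 1) * nth_deriv 1 (nth_deriv 1 h) x" for x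
    by (rule nth_deriv_parity[OF smooth_on_iter_deriv[OF h(1)] 1])
  then have "nth_deriv 2 h (- x) = nth_deriv 2 h x" for x
    unfolding numeral_2_eq_2 nth_deriv_Suc[of "Suc 0" h] by simp
  then show "nth_deriv 2 h \<in> even_smooth" by (simp add: even_smooth_def smooth_on_iter_deriv[OF h(1)])
  show "nth_deriv 1 h 0 = 0" using 1[of 0] by simp
qed

lemma sqrt_deriv_even_smooth: "h \<in> even_smooth \<Longrightarrow> sqrt_deriv h \<in> even_smooth"
  unfolding sqrt_deriv_def
proof (rule fs_opD(1)[OF fs_op_dilate_int nth_deriv_2_even(1)])
  show "\<bar>cos \<theta> / 2\<bar> \<le> 1" for \<theta> :: real using abs_cos_le_one[of \<theta>] by linarith
qed (auto intro!: continuous_intros)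

lemma fs_bounded_sqrt_deriv: "fs_bounded even_smooth sqrt_deriv"
  unfolding fs_bounded_def
proof (intro allI impI)
  fix N and K :: "real set" assume K: "compact K"
  have "fs_bounded smooth_fns (dilate_int (\<lambda>\<theta>. cos \<theta> / 2))"
  proof (rule fs_bounded_dilate_int)
    show "\<bar>cos \<theta> / 2\<bar> \<le> 1" for \<theta> :: real using abs_cos_le_one[of \<theta>] by linarith
  qed (intro continuous_intros, simp)
  then obtain N' K' B where b: "compact K'" "0 \<le> B"
    "\<And>f c. f \<in> smooth_fns \<Longrightarrow> deriv_bound N' K' c f \<Longrightarrow> deriv_bound N K (B * c) (dilate_int (\<lambda>\<theta>. cos \<theta> / 2) f)"
    by (rule fs_boundedE[OF _ K]) blast
  \<comment> \<open>\<open>N' + 2\<close>, as \<open>sqrt_deriv\<close> involves the second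
    derivative.\<close>
  have "deriv_bound N K (B * c) (sqrt_deriv h)" if h: "h \<in> even_smooth" "deriv_bound (N' + 2) K' c h" for h c
  proof -
    have "deriv_bound N' K' c (nth_deriv 2 h)"
      unfolding deriv_bound_real_iff
    proof (intro allI impI ballI)
      fix j x assume "j \<le> N'" "x \<in> K'"
      then have "norm (nth_deriv (j + 2) h x) \<le> c" by (intro h(2)[unfolded deriv_bound_real_iff, rule_format]) simp_all
      then show "norm (nth_deriv j (nth_deriv 2 h) x) \<le> c" unfolding replicate_add iter_deriv_append .
    qed
    then show ?thesis
      unfolding sqrt_deriv_def using h(1) by (intro b(3)) (simp_all add: even_smooth_def smooth_on_iter_deriv)
  qed
  then show "\<exists>N' K' B. compact K' \<and> 0 \<le> B \<and> (\<forall>f\<in>even_smooth. \<forall>c. deriv_bound N' K' c f \<longrightarrow> deriv_bound N K (B * c) (sqrt_deriv f))"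
    using b(1,2) by blast
qed

text \<open>The integrand is the derivative in \<open>\<theta>\<close> of
  \<open>h' (u * sin \<theta>) / (2 * u)\<close>, and \<open>h' 0 = 0\<close> for even
  \<open>h\<close>.\<close>

lemma sqrt_deriv_eq:
  assumes h: "h \<in> even_smooth" and u: "0 < u"
  shows "sqrt_deriv h u = of_real (1 / (2 * u)) * nth_deriv 1 h u"
proof -
  have s: "smooth_on UNIV h" using h by (simp add: even_smooth_def)
  have d: "(nth_deriv 1 h has_vector_derivative nth_deriv 2 h x) (at x)" for x
    using has_vector_derivative_iter[OF s, of x 1] by (simp add: numeral_2_eq_2)
  have "((\<lambda>\<theta>. of_real (1 / (2 * u)) * nth_deriv 1 h (u * sin \<theta>)) has_vector_derivative of_real (cos \<theta> / 2) * nth_deriv 2 h (u * sin \<theta>)) (at \<theta> within {0..pi / 2})" for \<theta>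
  proof -
    have "((\<lambda>\<theta>. u * sin \<theta>) has_vector_derivative u * cos \<theta>) (at \<theta>)"
      unfolding has_real_derivative_iff_has_vector_derivative[symmetric] by (auto intro!: derivative_eq_intros)
    from vector_diff_chain_at[OF this d]
    have "((\<lambda>\<theta>. nth_deriv 1 h (u * sin \<theta>)) has_vector_derivative (u * cos \<theta>) *\<^sub>R nth_deriv 2 h (u * sin \<theta>)) (at \<theta>)"
      by (simp add: o_def)
    from has_vector_derivative_mult_right[OF this, of "of_real (1 / (2 * u))"]
    have "((\<lambda>\<theta>. of_real (1 / (2 * u)) * nth_deriv 1 h (u * sin \<theta>)) has_vector_derivative of_real (1 / (2 * u)) * ((u * cos \<theta>) *\<^sub>R nth_deriv 2 h (u * sin \<theta>))) (at \<theta>)" .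
    moreover have "of_real (1 / (2 * u)) * ((u * cos \<theta>) *\<^sub>R nth_deriv 2 h (u * sin \<theta>)) = of_real (cos \<theta> / 2) * nth_deriv 2 h (u * sin \<theta>)"
      using u by (simp add: scaleR_conv_of_real)
    ultimately show ?thesis by (metis has_vector_derivative_at_within)
  qed
  from fundamental_theorem_of_calculus[OF _ this]
  have "((\<lambda>\<theta>. of_real (cos \<theta> / 2) * nth_deriv 2 h (u * sin \<theta>)) has_integral
      of_real (1 / (2 * u)) * nth_deriv 1 h (u * sin (pi / 2)) - of_real (1 / (2 * u)) * nth_deriv 1 h (u * sin 0)) {0..pi / 2}"
    by simp
  note i = integral_unique[OF this]
  have z: "nth_deriv 1 h (u * sin 0) = 0" using nth_deriv_2_even(2)[OF h] by simp
  show ?thesis unfolding sqrt_deriv_def dilate_int_def i z by simp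
qed

text \<open>At \<open>t = 0\<close> the chain rule fails, \<open>sqrt\<close> having infinite slope.
  Instead \<open>h (sqrt t)\<close> is recovered as an integral of the continuous function
  \<open>sqrt_deriv h (sqrt t)\<close>, which gives the one-sided derivative there too; one side is
  enough for arguments \<open>q p \<ge> 0\<close>.\<close>

lemma sqrt_has_derivative:
  assumes h: "h \<in> even_smooth" and t: "t \<in> {0..}"
  shows "((\<lambda>t. h (sqrt t)) has_derivative (\<lambda>v. v *\<^sub>R sqrt_deriv h (sqrt t))) (at t within {0..})"
proof -
  have s: "smooth_on UNIV h" using h by (simp add: even_smooth_def)
  have hc: "continuous_on UNIV h" by (rule smooth_on_continuous_on[OF s])
  have "continuous_on UNIV (sqrt_deriv h)"
    by (rule smooth_on_continuous_on) (use sqrt_deriv_even_smooth[OF h] in \<open>simp add: even_smooth_def\<close>)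
  then have gc: "continuous_on A (\<lambda>t. sqrt_deriv h (sqrt t))" for A
    by (rule continuous_on_compose2[OF _ continuous_on_real_sqrt[OF continuous_on_id] subset_UNIV])
  have d: "((\<lambda>t. h (sqrt t)) has_vector_derivative sqrt_deriv h (sqrt x)) (at x)" if "0 < x" for x
  proof -
    have 1: "(sqrt has_vector_derivative inverse (sqrt x) / 2) (at x)"
      unfolding has_real_derivative_iff_has_vector_derivative[symmetric] by (rule DERIV_real_sqrt[OF that])
    have 2: "(h has_vector_derivative nth_deriv 1 h (sqrt x)) (at (sqrt x))"
      using has_vector_derivative_iter[OF s, of "sqrt x" 0] by simp
    have "sqrt_deriv h (sqrt x) = (inverse (sqrt x) / 2) *\<^sub>R nth_deriv 1 h (sqrt x)"
      using sqrt_deriv_eq[OF h, of "sqrt x"] that by (simp add: scaleR_conv_of_real field_simps)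
    then show ?thesis using vector_diff_chain_at[OF 1 2] by (simp add: o_def)
  qed
  have eq: "h (sqrt x) = h 0 + integral {0..x} (\<lambda>t. sqrt_deriv h (sqrt t))" if "0 \<le> x" for x
  proof -
    have "((\<lambda>t. sqrt_deriv h (sqrt t)) has_integral h (sqrt x) - h (sqrt 0)) {0..x}"
    proof (rule fundamental_theorem_of_calculus_interior[OF that])
      show "continuous_on {0..x} (\<lambda>t. h (sqrt t))"
        by (rule continuous_on_compose2[OF hc continuous_on_real_sqrt[OF continuous_on_id] subset_UNIV])
    qed (use d in simp)
    then show ?thesis by (simp add: integral_unique)
  qed
  have "((\<lambda>x. h 0 + integral {0..x} (\<lambda>t. sqrt_deriv h (sqrt t))) has_vector_derivative 0 + sqrt_deriv h (sqrt t)) (at t within {0..t + 1})"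
    using t by (intro has_vector_derivative_add has_vector_derivative_const integral_has_vector_derivative gc) auto
  then have "((\<lambda>x. h (sqrt x)) has_vector_derivative sqrt_deriv h (sqrt t)) (at t within {0..t + 1})"
    using t eq by (intro has_vector_derivative_transform[of t "{0..t + 1}" "\<lambda>x. h (sqrt x)"]) auto
  moreover have "at t within {0..t + 1} = at t within {0..}"
    by (rule at_within_nhd[of _ "{..<t + 1}"]) auto
  ultimately show ?thesis by (simp add: has_vector_derivative_def)
qed

context
  fixes q :: "'a::euclidean_space \<Rightarrow> real"
  assumes q_smooth: "smooth_on UNIV q" and q_nonneg: "\<And>p. 0 \<le> q p"
begin

lemma sqrt_compose_has_derivative:
  assumes h: "h \<in> even_smooth"
  shows "((\<lambda>p. h (sqrt (q p))) has_derivative (\<lambda>v. of_real (frechet_derivative q (at p) v) * sqrt_deriv h (sqrt (q p)))) (at p)"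
proof -
  have "((\<lambda>p. h (sqrt (q p))) has_derivative (\<lambda>v. frechet_derivative q (at p) v *\<^sub>R sqrt_deriv h (sqrt (q p)))) (at p within UNIV)"
    by (rule has_derivative_in_compose2[OF sqrt_has_derivative[OF h]])
      (use q_nonneg smooth_on_has_derivative[OF q_smooth] in auto)
  then show ?thesis by (simp add: scaleR_conv_of_real)
qed

text \<open>Stable under differentiation because \<open>sqrt_deriv h\<close> is again even and
  smooth, while the derivative of \<open>q\<close> joins the smooth coefficient.\<close>

inductive radial_sum :: "('a \<Rightarrow> complex) \<Rightarrow> bool" where
  base: "smooth_on UNIV a \<Longrightarrow> h \<in> even_smooth \<Longrightarrow> radial_sum (\<lambda>p. a p * h (sqrt (q p)))"
| add: "radial_sum f \<Longrightarrow> radial_sum g \<Longrightarrow> radial_sum (\<lambda>p. f p + g p)"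

lemma radial_sum_derivative:
  "radial_sum f \<Longrightarrow> \<exists>D. (\<forall>p. (f has_derivative D p) (at p)) \<and> (\<forall>v. radial_sum (\<lambda>p. D p v))"
proof (induction rule: radial_sum.induct)
  case (base a h)
  have "((\<lambda>p. a p * h (sqrt (q p))) has_derivative
      (\<lambda>v. a p * (of_real (frechet_derivative q (at p) v) * sqrt_deriv h (sqrt (q p))) + frechet_derivative a (at p) v * h (sqrt (q p)))) (at p)" for p
    by (rule has_derivative_mult[OF smooth_on_has_derivative[OF base(1)] sqrt_compose_has_derivative[OF base(2)]]) simp
  moreover have "radial_sum (\<lambda>p. a p * (of_real (frechet_derivative q (at p) v) * sqrt_deriv h (sqrt (q p))) + frechet_derivative a (at p) v * h (sqrt (q p)))" for v
  proof (rule radial_sum.add)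
    have "smooth_on UNIV (\<lambda>p. a p * of_real (frechet_derivative q (at p) v))"
      by (intro smooth_on_mult base(1) smooth_on_of_real smooth_on_frechet q_smooth open_UNIV)
    from radial_sum.base[OF this sqrt_deriv_even_smooth[OF base(2)]]
    show "radial_sum (\<lambda>p. a p * (of_real (frechet_derivative q (at p) v) * sqrt_deriv h (sqrt (q p))))"
      by (simp only: mult.assoc)
  qed (intro radial_sum.base smooth_on_frechet base)
  ultimately show ?case
    by (intro exI[of _ "\<lambda>p v. a p * (of_real (frechet_derivative q (at p) v) * sqrt_deriv h (sqrt (q p))) + frechet_derivative a (at p) v * h (sqrt (q p))"]) simp
next
  case (add f g)
  then obtain D E where D: "\<And>p. (f has_derivative D p) (at p)" "\<And>v. radial_sum (\<lambda>p. D p v)"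
    and E: "\<And>p. (g has_derivative E p) (at p)" "\<And>v. radial_sum (\<lambda>p. E p v)" by blast
  show ?case
    by (intro exI[of _ "\<lambda>p v. D p v + E p v"] conjI allI has_derivative_add D(1) E(1) radial_sum.add D(2) E(2))
qed

lemma smooth_sqrt_compose:
  assumes h: "h \<in> even_smooth" shows "smooth_on UNIV (\<lambda>p. h (sqrt (q p)))"
proof (rule smooth_on_coinduct[where P = radial_sum])
  show "radial_sum (\<lambda>p. h (sqrt (q p)))"
    using radial_sum.base[OF smooth_on_const[OF open_UNIV, of 1] h] by simp
  fix f assume "radial_sum f"
  then obtain D where D: "\<And>p. (f has_derivative D p) (at p)" "\<And>v. radial_sum (\<lambda>p. D p v)"
    using radial_sum_derivative by blast
  show "(\<forall>x\<in>UNIV. f differentiable at x) \<and> (\<forall>v. \<exists>g. radial_sum g \<and> (\<forall>x\<in>UNIV. g x = frechet_derivative f (at x) v))"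
    by (rule derivative_stepI[OF D(1)]) (use D(2) in blast)
qed simp

lemma fs_bounded_sqrt_compose: "fs_bounded even_smooth (\<lambda>h p. h (sqrt (q p)))"
proof -
  \<comment> \<open>For nonempty \<open>K\<close> the bound \<open>c\<close> is nonnegative, as the
    estimates require; the empty set is added at the end.\<close>
  have "\<exists>N' K' B. compact K' \<and> 0 \<le> B \<and>
      (\<forall>h\<in>even_smooth. \<forall>c. deriv_bound N' K' c h \<longrightarrow> deriv_bound N K (B * c) (\<lambda>p. h (sqrt (q p))))"
    if K: "compact K" "K \<noteq> {}" for N K
  proof (induction N)
    have cK: "compact ((\<lambda>p. sqrt (q p)) ` K)"
      by (intro compact_continuous_image continuous_on_real_sqrt continuous_on_subset[OF smooth_on_continuous_on[OF q_smooth]] K) simp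
    case 0
    show ?case
      by (intro exI[of _ 0] exI[of _ "(\<lambda>p. sqrt (q p)) ` K"] exI[of _ 1]) (use cK in \<open>simp add: deriv_bound_0_iff\<close>)
  next
    have cK: "compact ((\<lambda>p. sqrt (q p)) ` K)"
      by (intro compact_continuous_image continuous_on_real_sqrt continuous_on_subset[OF smooth_on_continuous_on[OF q_smooth]] K) simp
    case (Suc N)
    then obtain N1 K1 B1 where 1: "compact K1" "0 \<le> B1"
      "\<And>h c. h \<in> even_smooth \<Longrightarrow> deriv_bound N1 K1 c h \<Longrightarrow> deriv_bound N K (B1 * c) (\<lambda>p. h (sqrt (q p)))" by blast
    obtain N2 K2 B2 where 2: "compact K2" "0 \<le> B2"
      "\<And>h c. h \<in> even_smooth \<Longrightarrow> deriv_bound N2 K2 c h \<Longrightarrow> deriv_bound N1 K1 (B2 * c) (sqrt_deriv h)"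
      by (rule fs_boundedE[OF fs_bounded_sqrt_deriv 1(1), of N1]) blast
    have "\<forall>v. \<exists>B\<ge>0. \<forall>f c. smooth_on UNIV f \<longrightarrow> deriv_bound N K c f \<longrightarrow> deriv_bound N K (B * c) (\<lambda>p. of_real (frechet_derivative q (at p) v) * f p)"
      by (intro allI deriv_bound_mult smooth_on_of_real smooth_on_frechet q_smooth K(1) open_UNIV)
    then obtain B3 where 3: "\<And>v. 0 \<le> B3 v"
      "\<And>v f c. smooth_on UNIV f \<Longrightarrow> deriv_bound N K c f \<Longrightarrow> deriv_bound N K (B3 v * c) (\<lambda>p. of_real (frechet_derivative q (at p) v) * f p)"
      by metis
    define B where "B = 1 + (\<Sum>v\<in>Basis. B3 v) * (B1 * B2)"
    have S0: "0 \<le> (\<Sum>v\<in>Basis. B3 v)" by (intro sum_nonneg 3(1))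
    have B: "1 \<le> B" using S0 1(2) 2(2) by (simp add: B_def)
    have "deriv_bound (Suc N) K (B * c) (\<lambda>p. h (sqrt (q p)))"
      if h: "h \<in> even_smooth" "deriv_bound N2 (K2 \<union> (\<lambda>p. sqrt (q p)) ` K) c h" for h c
      unfolding deriv_bound_Suc_iff
    proof (intro conjI ballI)
      have c: "0 \<le> c" using deriv_bound_nonneg[OF h(2)] K(2) by blast
      have cB: "c \<le> B * c" using mult_right_mono[OF B c] by simp
      show "norm (h (sqrt (q p))) \<le> B * c" if "p \<in> K" for p
        using deriv_bound_le[OF h(2), of "sqrt (q p)"] that cB by fastforce
      fix v :: 'a assume v: "v \<in> Basis"
      have "deriv_bound N2 K2 c h" by (rule deriv_bound_mono[OF h(2)]) auto
      from 3(2)[OF smooth_sqrt_compose[OF sqrt_deriv_even_smooth[OF h(1)]] 1(3)[OF sqrt_deriv_even_smooth[OF h(1)] 2(3)[OF h(1) this]], of v]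
      have b: "deriv_bound N K (B3 v * (B1 * (B2 * c))) (\<lambda>p. of_real (frechet_derivative q (at p) v) * sqrt_deriv h (sqrt (q p)))" .
      have "B3 v * ((B1 * B2) * c) \<le> (\<Sum>v\<in>Basis. B3 v) * ((B1 * B2) * c)"
        using c 1(2) 2(2) v 3(1) by (intro mult_right_mono member_le_sum) auto
      then have le: "B3 v * (B1 * (B2 * c)) \<le> B * c" using c by (simp add: B_def algebra_simps)
      have "(\<lambda>p. frechet_derivative (\<lambda>p. h (sqrt (q p))) (at p) v) = (\<lambda>p. of_real (frechet_derivative q (at p) v) * sqrt_deriv h (sqrt (q p)))"
        unfolding frechet_derivative_at[OF sqrt_compose_has_derivative[OF h(1)], symmetric] ..
      then show "deriv_bound N K (B * c) (\<lambda>p. frechet_derivative (\<lambda>p. h (sqrt (q p))) (at p) v)"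
        using deriv_bound_mono[OF b order_refl le subset_refl] by simp
    qed
    then show ?case
      using 2(1) cK B by (intro exI[of _ N2] exI[of _ "K2 \<union> (\<lambda>p. sqrt (q p)) ` K"] exI[of _ B]) auto
  qed
  moreover have "\<exists>N' K' B. compact K' \<and> 0 \<le> B \<and>
      (\<forall>h\<in>even_smooth. \<forall>c. deriv_bound N' K' c h \<longrightarrow> deriv_bound N {} (B * c) (\<lambda>p. h (sqrt (q p))))" for N
    by (intro exI[of _ 0] exI[of _ "{}"]) (auto simp: deriv_bound_empty)
  ultimately show ?thesis unfolding fs_bounded_def by metis
qed

end

lemma vertical_line_derivatives:
  fixes F :: "('a::euclidean_space) \<times> real \<Rightarrow> complex"
  assumes F: "smooth_on UNIV F"
  shows "smooth_on UNIV (\<lambda>z. F (0, z))" "nth_deriv j (\<lambda>z. F (0, z)) z = iter_deriv (replicate j (0, 1)) F (0, z)"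
proof -
  let ?G = "\<lambda>j z. iter_deriv (replicate j (0, 1)) F (0, z)"
  have "(?G j has_vector_derivative ?G (Suc j) z) (at z)" for j z
  proof -
    have "((\<lambda>z :: real. (0, z)) has_derivative (\<lambda>v. (0, v))) (at z)" by (auto intro!: derivative_eq_intros)
    moreover have d: "(iter_deriv (replicate j (0, 1)) F has_derivative frechet_derivative (iter_deriv (replicate j (0, 1)) F) (at (0, z))) (at (0, z))"
      by (rule smooth_on_has_derivative[OF smooth_on_iter_deriv[OF F]]) simp
    ultimately have 1: "(?G j has_derivative (\<lambda>v. frechet_derivative (iter_deriv (replicate j (0, 1)) F) (at (0, z)) (0, v))) (at z)"
      by (rule has_derivative_compose)
    have 2: "frechet_derivative (iter_deriv (replicate j (0, 1)) F) (at (0, z)) (0, v) = v *\<^sub>R ?G (Suc j) z" for v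
      using linear_scale[OF has_derivative_linear[OF d], of v "(0, 1)"] by simp
    show ?thesis using 1 unfolding has_vector_derivative_def 2 .
  qed
  then have "smooth_on UNIV (?G 0)" "iter_deriv (replicate j 1) (?G 0) z = ?G j z"
    by (intro smooth_on_seq[of UNIV ?G]; simp)+
  then show "smooth_on UNIV (\<lambda>z. F (0, z))" "nth_deriv j (\<lambda>z. F (0, z)) z = iter_deriv (replicate j (0, 1)) F (0, z)"
    by simp_all
qed

text \<open>\<open>(0, 1)\<close> is a basis vector, so derivatives along the axis are among the
  partial derivatives that the seminorms on \<open>{0} \<times> K\<close> control.\<close>

lemma fs_bounded_vertical: "fs_bounded smooth_fns (\<lambda>F z. F (0 :: 'a::euclidean_space, z :: real))"
  unfolding fs_bounded_def
proof (intro allI impI)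
  fix N and K :: "real set" assume K: "compact K"
  have *: "deriv_bound N K (1 * c) (\<lambda>z. F (0 :: 'a, z))" if "F \<in> smooth_fns" "deriv_bound N ({0} \<times> K) c F" for F c
  proof -
    have "(0, 1) \<in> (Basis :: ('a \<times> real) set)" by (simp add: Basis_prod_def)
    then have "norm (iter_deriv (replicate j (0, 1)) F (0, z)) \<le> c" if "j \<le> N" "z \<in> K" for j z
      using \<open>deriv_bound N ({0} \<times> K) c F\<close> that unfolding deriv_bound_def by (auto simp: set_replicate_conv_if)
    then show ?thesis
      unfolding deriv_bound_real_iff using that(1) by (simp add: vertical_line_derivatives(2))
  qed
  show "\<exists>N' K' B. compact K' \<and> 0 \<le> B \<and>
     (\<forall>F\<in>smooth_fns. \<forall>c. deriv_bound N' K' c F \<longrightarrow> deriv_bound N K (B * c) (\<lambda>z. F (0 :: 'a, z)))"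
    by (intro exI[of _ N] exI[of _ "{0} \<times> K"] exI[of _ 1] conjI ballI allI impI compact_Times compact_sing K zero_le_one) (rule *)
qed

section \<open>Radial functions on the group\<close>

context damek_ricci begin

lemma cc_smooth: "smooth_on UNIV cc"
proof -
  interpret damek_ricci_sphere I br 1 by unfold_locales simp
  have "smooth_on UNIV (\<lambda>p. (1 / 4) * (bb p ^ 2 + yc p \<bullet> yc p) * exp ((- 1) * snd p))"
    by (intro smooth_on_mult smooth_on_add smooth_on_power smooth_on_const smooth_on_inner smooth_on_restr bb_smooth
        smooth_on_compose_real[OF _ open_UNIV smooth_on_exp] smooth_on_bounded_linear bounded_linear_fst bounded_linear_snd open_UNIV) auto
  then show ?thesis by (simp add: cc_def[abs_def])
qed

lemma dist0_sqrt: "2 * arsinh (sqrt (cc p - 1)) = dist0 p"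
proof -
  have "cosh (2 * x) = 2 * (sinh x)\<^sup>2 + 1" for x :: real
    unfolding cosh_double by (simp add: cosh_square_eq)
  from this[of "dist0 p / 2"] have "cc p - 1 = (sinh (dist0 p / 2))\<^sup>2" using cosh_dist0(1)[of p] by simp
  then show ?thesis using cosh_dist0(2)[of p] by (simp add: arsinh_sinh_real)
qed

lemma dist0_eq_cc: "dist0 x = dist0 y \<longleftrightarrow> cc x = cc y"
proof
  assume "dist0 x = dist0 y"
  then have "2 * cc x - 1 = 2 * cc y - 1" unfolding cosh_dist0(1)[symmetric] by (rule arg_cong)
  then show "cc x = cc y" by simp
qed (simp add: dist0_def)

lemma radial_iff: "F \<in> radial_smooth I br \<longleftrightarrow> smooth_on UNIV F \<and> (\<forall>x y. cc x = cc y \<longrightarrow> F x = F y)"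
  unfolding radial_smooth_def mem_Collect_eq dr_dist_eq dist0_eq_cc ..

lemma radial_subspace: "fs_subspace (radial_smooth I br)"
  unfolding fs_subspace_def
proof (intro conjI ballI allI)
  fix f assume "f \<in> radial_smooth I br"
  then have f: "smooth_on UNIV f" "\<And>x y. cc x = cc y \<Longrightarrow> f x = f y" unfolding radial_iff by blast+
  show "smooth_on UNIV f" by (rule f(1))
  show "(\<lambda>x. c * f x) \<in> radial_smooth I br" for c
    unfolding radial_iff by (intro conjI smooth_on_mult smooth_on_const open_UNIV f(1) allI impI arg_cong[of _ _ "(*) c"] f(2))
  fix g assume "g \<in> radial_smooth I br"
  then have g: "smooth_on UNIV g" "\<And>x y. cc x = cc y \<Longrightarrow> g x = g y" unfolding radial_iff by blast+
  show "(\<lambda>x. f x + g x) \<in> radial_smooth I br"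
    unfolding radial_iff by (intro conjI smooth_on_add open_UNIV f(1) g(1) allI impI arg_cong2[of _ _ _ _ "(+)"] f(2) g(2))
qed

text \<open>The distance is not smooth at the identity, but
  \<open>g (dist0 p) = h (sqrt (cc p - 1))\<close> with \<open>h x = g (2 * arsinh x)\<close> even
  and \<open>cc\<close> smooth. The inverse restricts to the vertical axis, where
  \<open>dist0\<close> is \<open>|z|\<close>.\<close>

lemma fs_iso_radial: "fs_iso even_smooth (radial_smooth I br) (\<lambda>g p. g (dist0 p))"
proof -
  let ?E = "\<lambda>h p. h (sqrt (cc p - 1))" and ?R = "radial_smooth I br"
  have q: "smooth_on UNIV (\<lambda>p. cc p - 1)" "0 \<le> cc p - 1" for p
    using cc_ge_1[of p] by (intro smooth_on_diff smooth_on_const cc_smooth open_UNIV, linarith)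
  have E: "fs_op even_smooth ?R ?E"
    unfolding fs_op_def
  proof (intro conjI ballI allI)
    show "?E h \<in> ?R" if "h \<in> even_smooth" for h
      using smooth_sqrt_compose[OF q that] unfolding radial_iff by simp
  qed (simp_all add: fs_bounded_sqrt_compose[OF q])
  have "fs_op even_smooth ?R (\<lambda>g. ?E (\<lambda>x. g (1 / (1 / 2) * arsinh x)))"
    by (rule fs_op_comp[OF _ E]) (use fs_iso_sinh(2)[of "1 / 2"] in \<open>auto simp: fs_iso_def\<close>)
  then have P: "fs_op even_smooth ?R (\<lambda>g p. g (dist0 p))" by (simp add: dist0_sqrt)
  have V: "fs_op ?R even_smooth (\<lambda>F z. F (0, z))"
    unfolding fs_op_def
  proof (intro conjI ballI allI)
    show "(\<lambda>z. F (0, z)) \<in> even_smooth" if F: "F \<in> ?R" for F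
    proof -
      have "F (0, - z) = F (0, z)" for z
        using F unfolding radial_iff dist0_eq_cc[symmetric] by (metis dist0_vertical abs_minus_cancel)
      moreover have "smooth_on UNIV (\<lambda>z. F (0, z))"
        by (intro vertical_line_derivatives(1) fs_subspaceD(1)[OF radial_subspace F])
      ultimately show ?thesis by (simp add: even_smooth_def)
    qed
    show "fs_bounded ?R (\<lambda>F z. F (0, z))"
      by (rule fs_bounded_subset[OF fs_bounded_vertical]) (intro subsetI CollectI fs_subspaceD(1)[OF radial_subspace])
  qed simp_all
  have VP: "(\<lambda>z. g (dist0 (0, z))) = g" if "g \<in> even_smooth" for g
  proof
    show "g (dist0 (0, z)) = g z" for z
      using that by (cases "0 \<le> z") (auto simp: dist0_vertical even_smooth_def)
  qed
  have PV: "(\<lambda>p. F (0, dist0 p)) = F" if F: "F \<in> ?R" for F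
  proof
    have "dist0 (0, dist0 p) = dist0 p" for p using cosh_dist0(2)[of p] by (simp add: dist0_vertical)
    then show "F (0, dist0 p) = F p" for p
      using F unfolding radial_iff dist0_eq_cc[symmetric] by blast
  qed
  show ?thesis unfolding fs_iso_def by (intro conjI exI[of _ "\<lambda>F z. F (0, z)"] ballI P V VP PV)
qed

end

theorem theorem2p1:
  fixes I :: "'i::finite set"
    and br :: "real^'i \<Rightarrow> real^'i \<Rightarrow> real^'i"
    and m k n :: nat
  assumes "m = card I" and "even m"
    and "k = card (- I)" and "k \<ge> 1"
    and "n = m + k + 1"
    and "heisenberg_type I br"
  shows
    "topological_isomorphism
       (subtopology smooth_topology even_smooth)
       (subtopology smooth_topology (radial_smooth I br))
       (\<lambda>f x. dual_abel I br f (dr_dist I br x 0))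
   \<and> topological_isomorphism
       (subtopology smooth_topology even_smooth)
       (subtopology smooth_topology even_smooth)
       (dual_abel I br)
   \<and> (\<forall>f\<in>even_smooth. \<forall>r>0.
        dual_abel I br f r =
          of_real (c2 n / 2 * inverse (sinh (r / 2) ^ m) * inverse (sinh r ^ (k - 1))) *
          riemann_liouville 1 (of_nat k / 2)
            (\<lambda>s. of_real (inverse (cosh (s / 2))) *
              riemann_liouville (1 / 2) (of_nat m / 2)
                (\<lambda>t. of_real (inverse (sinh (t / 2))) * f t) s) r)
   \<and> (\<forall>f\<in>even_smooth. \<forall>r>0.
        let \<Phi> = riemann_liouville (1 / 2) (- of_nat m / 2)
                  (riemann_liouville 1 (- of_nat k / 2 + 1)
                    (\<lambda>s. of_real (sinh (s / 2) ^ m * sinh s ^ (k - 1)) * f s))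
        in \<Phi> differentiable (at r) \<and>
           the_inv_into even_smooth (dual_abel I br) f r =
             of_real (1 / c2 n) * vector_derivative \<Phi> (at r))
   \<and> c2 n = fact (n - 1) / (2 powr ((real n - 1) / 2) * Gamma ((real n + 1) / 2))
   \<and> (odd n \<longleftrightarrow> even k)
   \<and> (even k \<longrightarrow> (\<forall>f\<in>even_smooth. \<forall>r>0.
        let \<Phi> = (cosh_deriv (1 / 2) ^^ (m div 2)) ((cosh_deriv 1 ^^ (k div 2 - 1))
                  (\<lambda>s. of_real (sinh (s / 2) ^ m * sinh s ^ (k - 1)) * f s))
        in \<Phi> differentiable (at r) \<and>
           the_inv_into even_smooth (dual_abel I br) f r =
             of_real (1 / c2 n) * vector_derivative \<Phi> (at r)))
   \<and> (odd k \<longrightarrow> (\<forall>f\<in>even_smooth. \<forall>r>0.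
        let \<Phi> = (cosh_deriv (1 / 2) ^^ (m div 2)) ((cosh_deriv 1 ^^ ((k - 1) div 2))
                  (\<lambda>t. integral {0..t}
                    (\<lambda>s. of_real (sinh (s / 2) ^ m * sinh s ^ k / sqrt (cosh t - cosh s)) * f s)))
        in \<Phi> differentiable (at r) \<and>
           the_inv_into even_smooth (dual_abel I br) f r =
             of_real (1 / (c2 n * sqrt pi)) * vector_derivative \<Phi> (at r)))"
proof -
  interpret damek_ricci I br
  proof
    show "- I \<noteq> {}" using assms(3,4) by auto
  qed (rule assms(6))
  have k: "1 \<le> k" and n: "0 < n" using assms(4,5) by simp_all
  have cont: "continuous_on UNIV f" and ev: "f (- x) = f x" if "f \<in> even_smooth" for f :: "real \<Rightarrow> complex" and x
    using that smooth_on_continuous_on[of UNIV f] by (simp_all add: even_smooth_def)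
  have D: "dual_abel I br f = abel_op m k f" if "f \<in> even_smooth" for f
    using dual_abel_eq[OF cont[OF that] ev[OF that]] unfolding assms(1,3) by (intro ext)
  have iso: "fs_iso even_smooth even_smooth (dual_abel I br)"
    by (rule fs_iso_cong[OF fs_iso_abel_op even_smooth_subspace D])
  have bij: "bij_betw (dual_abel I br) even_smooth even_smooth" by (rule fs_iso_bij_betw[OF iso])
  let ?inv = "the_inv_into even_smooth (dual_abel I br)"
  \<comment> \<open>The inversion lemmas compute \<open>g\<close> from \<open>abel_op m k g\<close>;
    taking \<open>g = ?inv f\<close> turns them into formulas for the inverse at
    \<open>f\<close>.\<close>
  have inv: "continuous_on UNIV (?inv f)" "abel_op m k (?inv f) = f" if f: "f \<in> even_smooth" for f
  proof -
    have g: "?inv f \<in> even_smooth" using bij_betw_the_inv_into[OF bij] f by (rule bij_betwE[THEN bspec])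
    then show "continuous_on UNIV (?inv f)" by (rule cont)
    have "dual_abel I br (?inv f) = f" by (rule f_the_inv_into_f_bij_betw[OF bij]) (rule f)
    then show "abel_op m k (?inv f) = f" unfolding D[OF g] .
  qed
  have concl: "\<Phi> differentiable (at r) \<and> ?inv f r = of_real (1 / (c2 n * c)) * vector_derivative \<Phi> (at r)"
    if "f \<in> even_smooth" "0 < r" "c \<noteq> 0" "\<And>s. 0 < s \<Longrightarrow> \<Phi> s = abel_primitive n (\<lambda>x. of_real c * ?inv f x) s" for f r c \<Phi>
    by (rule abel_primitive_conclusion[OF inv(1)[OF that(1)] that(2) n that(3,4)])
  let ?w = "\<lambda>f s. complex_of_real (sinh (s / 2) ^ m * sinh s ^ (k - 1)) * f s"
  let ?o = "\<lambda>f. (cosh_deriv (1 / 2) ^^ (m div 2))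
    ((cosh_deriv 1 ^^ ((k - 1) div 2)) (\<lambda>t. integral {0..t} (\<lambda>s. complex_of_real (sinh (s / 2) ^ m * sinh s ^ k / sqrt (cosh t - cosh s)) * f s)))"
  show ?thesis
  proof (intro conjI impI ballI allI)
    have "fs_iso even_smooth (radial_smooth I br) (\<lambda>f x. dual_abel I br f (dr_dist I br x 0))"
      unfolding dr_dist_eq by (rule fs_iso_comp[OF iso fs_iso_radial])
    then show "topological_isomorphism (subtopology smooth_topology even_smooth) (subtopology smooth_topology (radial_smooth I br))
        (\<lambda>f x. dual_abel I br f (dr_dist I br x 0))"
      using even_smooth_subspace radial_subspace by (rule fs_iso_topological_isomorphism)
    show "topological_isomorphism (subtopology smooth_topology even_smooth) (subtopology smooth_topology even_smooth) (dual_abel I br)"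
      using iso even_smooth_subspace even_smooth_subspace by (rule fs_iso_topological_isomorphism)
    show "c2 n = fact (n - 1) / (2 powr ((real n - 1) / 2) * Gamma ((real n + 1) / 2))"
      by (rule c2_factorial[OF n])
    show "odd n \<longleftrightarrow> even k" using assms(2,5) by simp
  next
    fix f and r :: real assume f: "f \<in> even_smooth" and r: "0 < r"
    show "dual_abel I br f r =
          of_real (c2 n / 2 * inverse (sinh (r / 2) ^ m) * inverse (sinh r ^ (k - 1))) *
          riemann_liouville 1 (of_nat k / 2)
            (\<lambda>s. of_real (inverse (cosh (s / 2))) *
              riemann_liouville (1 / 2) (of_nat m / 2)
                (\<lambda>t. of_real (inverse (sinh (t / 2))) * f t) s) r"
      unfolding D[OF f] assms(5) by (rule abel_op_eq_riemann_liouville[OF cont[OF f] k r])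
    have "riemann_liouville (1 / 2) (- of_nat m / 2)
        (riemann_liouville 1 (- of_nat k / 2 + 1) (?w f)) s =
      abel_primitive n (\<lambda>x. of_real 1 * ?inv f x) s" if "0 < s" for s
      using abel_inverse_riemann_liouville[OF inv(1)[OF f] k that, of m] unfolding inv(2)[OF f] assms(5) of_real_1 mult_1 .
    from concl[OF f r one_neq_zero this]
    show "let \<Phi> = riemann_liouville (1 / 2) (- of_nat m / 2)
                  (riemann_liouville 1 (- of_nat k / 2 + 1)
                    (?w f))
        in \<Phi> differentiable (at r) \<and> ?inv f r = of_real (1 / c2 n) * vector_derivative \<Phi> (at r)"
      unfolding Let_def mult_1_right .
  next
    fix f and r :: real assume ke: "even k" and f: "f \<in> even_smooth" and r: "0 < r"
    have "(cosh_deriv (1 / 2) ^^ (m div 2)) ((cosh_deriv 1 ^^ (k div 2 - 1))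
        (?w f)) s =
      abel_primitive n (\<lambda>x. of_real 1 * ?inv f x) s" if "0 < s" for s
      using abel_inverse_even[OF inv(1)[OF f] assms(2) k ke that] unfolding inv(2)[OF f] assms(5) of_real_1 mult_1 .
    from concl[OF f r one_neq_zero this]
    show "let \<Phi> = (cosh_deriv (1 / 2) ^^ (m div 2)) ((cosh_deriv 1 ^^ (k div 2 - 1))
                  (?w f))
        in \<Phi> differentiable (at r) \<and> ?inv f r = of_real (1 / c2 n) * vector_derivative \<Phi> (at r)"
      unfolding Let_def mult_1_right .
  next
    fix f and r :: real assume ko: "odd k" and f: "f \<in> even_smooth" and r: "0 < r"
    have "?o f s =
      abel_primitive n (\<lambda>x. of_real (sqrt pi) * ?inv f x) s" if "0 < s" for s
      using abel_inverse_odd[OF inv(1)[OF f] assms(2) ko that] unfolding inv(2)[OF f] assms(5) .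
    moreover have "sqrt pi \<noteq> 0" by simp
    ultimately have "?o f differentiable (at r) \<and>
      ?inv f r = of_real (1 / (c2 n * sqrt pi)) * vector_derivative (?o f) (at r)"
      by (intro concl[OF f r])
    then show "let \<Phi> = ?o f
        in \<Phi> differentiable (at r) \<and>
           ?inv f r = of_real (1 / (c2 n * sqrt pi)) * vector_derivative \<Phi> (at r)"
      unfolding Let_def .
  qed
qed

end
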